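(* Let $n,r,k$ and $s$ be integers with $3\le r\le n$ and $0\le s\le\lfloor\frac{r-1}{2}\rfloor$. Assume that the closed subscheme $\mathbf{C}_k(s)$ of $\mathbf{F}_k(\mathrm{SD}_n^r)$ is equal to an irreducible component of $\mathbf{F}_k(\mathrm{SD}_n^r)$ taken with the induced reduced subscheme structure. Then $\mathbf{F}_k(\mathrm{SD}_n^r)$ is reduced generically on that component if and only if $r$ is odd and $s=\frac{r-1}{2}$.
   Context: $\mathbb{K}$ is an algebraically closed field of characteristic $\ne2$. $\mathcal{S}_n$ is the $\mathbb{K}$-vector space of symmetric $n\times n$ matrices over $\mathbb{K}$. $\mathrm{SD}_n^r\subseteq\mathbb{P}(\mathcal S_n)=\mathbb{P}^{\binom{n+1}{2}-1}$ is the closed subscheme cut out by the $r\times r$ minors of the generic symmetric $n\times n$ matrix. $\mathbf{F}_k(\mathrm{SD}_n^r)\subseteq\mathrm{Gr}(k+1,\mathcal{S}_n)$ is the Fano scheme of $k$-planes contained in $\mathrm{SD}_n^r$. A linear subspace $Q\subseteq\mathcal{S}_n$ is a nested $s$-compression space if there are linear subspaces $U\subseteq W\subseteq\mathbb{K}^n$ with $\dim U=s+1+n-r$, $\dim W=n-s$ and $uAw^t=0$ for all $u\in U$, $w\in W$, $A\in Q$ (vectors written as rows). $\mathbf{C}_k(s)\subseteq\mathbf{F}_k(\mathrm{SD}_n^r)$ is the closed locus of $(k+1)$-dimensional nested $s$-compression spaces, with the induced reduced subscheme structure (it is irreducible when non-empty).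
   Formalization: The integer k is required to be at least 1; for k = 0 the claim fails, e.g. n = r = 3, s = 0, where F_0 is the reduced irreducible cubic of singular symmetric matrices and equals C_0(0). *)

theory Defs
  imports
    "HOL-Library.Poly_Mapping"
    "HOL-Library.Uprod"
    "HOL-Algebra.QuotRing"
    "HOL-Analysis.Cartesian_Space"
    "Jordan_Normal_Form.Determinant"
begin

no_notation Matrix.vec_index (infixl "$" 100)

section \<open>Polynomials\<close>

text \<open>Exponent vectors are finitely supported functions to the naturals; the product on
  \<^type>\<open>poly_mapping\<close> is convolution, so this is the usual polynomial ring.\<close>

type_synonym ('v, 'a) mpoly = "('v \<Rightarrow>\<^sub>0 nat) \<Rightarrow>\<^sub>0 'a"

definition poly_const :: "'a::zero \<Rightarrow> ('v, 'a) mpoly" where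
  "poly_const c = Poly_Mapping.single 0 c"

definition poly_var :: "'v \<Rightarrow> ('v, 'a::comm_ring_1) mpoly" where
  "poly_var v = Poly_Mapping.single (Poly_Mapping.single v 1) 1"

text \<open>Substitution of \<open>x\<close> for the variables, with the coefficients mapped along \<open>h\<close>.\<close>

definition eval_poly ::
  "('a::zero \<Rightarrow> 'b::comm_ring_1) \<Rightarrow> ('v \<Rightarrow> 'b) \<Rightarrow> ('v, 'a) mpoly \<Rightarrow> 'b" where
  "eval_poly h x f =
     (\<Sum>m\<in>Poly_Mapping.keys f. h (Poly_Mapping.lookup f m) *
        (\<Prod>v\<in>Poly_Mapping.keys m. x v ^ Poly_Mapping.lookup m v))"

definition poly_ring :: "'v set \<Rightarrow> ('v, 'a::comm_ring_1) mpoly ring" where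
  "poly_ring V =
     \<lparr>carrier = {f. \<forall>m\<in>Poly_Mapping.keys f. Poly_Mapping.keys m \<subseteq> V},
      monoid.mult = (*), one = 1, ring.zero = 0, ring.add = (+)\<rparr>"

lemma poly_ring_simps:
  "f \<in> carrier (poly_ring V) \<longleftrightarrow>
     (\<forall>m\<in>Poly_Mapping.keys f. Poly_Mapping.keys m \<subseteq> V)"
  "f \<otimes>\<^bsub>poly_ring V\<^esub> g = f * g" "\<one>\<^bsub>poly_ring V\<^esub> = 1"
  "f \<oplus>\<^bsub>poly_ring V\<^esub> g = f + g" "\<zero>\<^bsub>poly_ring V\<^esub> = 0"
  by (simp_all add: poly_ring_def)

lemma cring_poly_ring: "cring (poly_ring V :: ('v, 'a::comm_ring_1) mpoly ring)"
proof -
  let ?R = "poly_ring V :: ('v, 'a) mpoly ring"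
  note ops = poly_ring_simps(2-5)
  have add: "f + g \<in> carrier ?R" if "f \<in> carrier ?R" "g \<in> carrier ?R" for f g
    using that Poly_Mapping.keys_add[of f g] unfolding poly_ring_simps(1) by blast
  have mult: "f * g \<in> carrier ?R" if fg: "f \<in> carrier ?R" "g \<in> carrier ?R" for f g
    unfolding poly_ring_simps(1)
  proof
    fix m assume "m \<in> Poly_Mapping.keys (f * g)"
    then obtain a b where ab: "m = a + b" "a \<in> Poly_Mapping.keys f" "b \<in> Poly_Mapping.keys g"
      using keys_mult[of f g] by blast
    then have "Poly_Mapping.keys a \<subseteq> V" "Poly_Mapping.keys b \<subseteq> V"
      using fg unfolding poly_ring_simps(1) by blast+
    then show "Poly_Mapping.keys m \<subseteq> V"
      unfolding ab(1) using Poly_Mapping.keys_add[of a b] by blast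
  qed
  have neg: "- f \<in> carrier ?R" if "f \<in> carrier ?R" for f
    using that unfolding poly_ring_simps(1) by (simp add: keys.rep_eq)
  have zero: "0 \<in> carrier ?R" and one: "1 \<in> carrier ?R"
    unfolding poly_ring_simps(1) by simp_all
  have "abelian_group ?R"
  proof (rule abelian_groupI, unfold ops)
    show "\<exists>y\<in>carrier ?R. y + x = 0" if "x \<in> carrier ?R" for x
      using neg[OF that] by (rule bexI[rotated]) simp
  qed (simp_all add: add zero add_ac)
  moreover have "comm_monoid ?R"
    by (rule comm_monoidI, unfold ops) (simp_all add: mult one mult_ac)
  ultimately show ?thesis
    by (rule cringI, unfold ops) (simp_all add: distrib_right)
qed

section \<open>Reducedness and localization\<close>

definition reduced_ring :: "('a, 'b) ring_scheme \<Rightarrow> bool" where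
  "reduced_ring R \<longleftrightarrow>
     (\<forall>x\<in>carrier R. \<forall>m::nat. x [^]\<^bsub>R\<^esub> m = \<zero>\<^bsub>R\<^esub> \<longrightarrow> x = \<zero>\<^bsub>R\<^esub>)"

definition frac_rel :: "('a, 'b) ring_scheme \<Rightarrow> 'a set \<Rightarrow> (('a \<times> 'a) \<times> ('a \<times> 'a)) set" where
  "frac_rel R S =
     {((a, s), (b, t)). a \<in> carrier R \<and> b \<in> carrier R \<and> s \<in> S \<and> t \<in> S \<and>
        (\<exists>u\<in>S. u \<otimes>\<^bsub>R\<^esub> (a \<otimes>\<^bsub>R\<^esub> t) = u \<otimes>\<^bsub>R\<^esub> (b \<otimes>\<^bsub>R\<^esub> s))}"

definition frac :: "('a, 'b) ring_scheme \<Rightarrow> 'a set \<Rightarrow> 'a \<Rightarrow> 'a \<Rightarrow> ('a \<times> 'a) set" where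
  "frac R S a s = frac_rel R S `` {(a, s)}"

definition localization :: "('a, 'b) ring_scheme \<Rightarrow> 'a set \<Rightarrow> ('a \<times> 'a) set ring" where
  "localization R S =
     \<lparr>carrier = (carrier R \<times> S) // frac_rel R S,
      monoid.mult = (\<lambda>X Y. \<Union>(a, s)\<in>X. \<Union>(b, t)\<in>Y. frac R S (a \<otimes>\<^bsub>R\<^esub> b) (s \<otimes>\<^bsub>R\<^esub> t)),
      one = frac R S \<one>\<^bsub>R\<^esub> \<one>\<^bsub>R\<^esub>,
      ring.zero = frac R S \<zero>\<^bsub>R\<^esub> \<one>\<^bsub>R\<^esub>,
      ring.add = (\<lambda>X Y. \<Union>(a, s)\<in>X. \<Union>(b, t)\<in>Y.
        frac R S (a \<otimes>\<^bsub>R\<^esub> t \<oplus>\<^bsub>R\<^esub> b \<otimes>\<^bsub>R\<^esub> s) (s \<otimes>\<^bsub>R\<^esub> t))\<rparr>"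

lemma UN_pairs_const:
  assumes "\<And>a s b t. (a, s) \<in> X \<Longrightarrow> (b, t) \<in> Y \<Longrightarrow> F a s b t = C"
    and "(a, s) \<in> X" and "(b, t) \<in> Y"
  shows "(\<Union>(a, s)\<in>X. \<Union>(b, t)\<in>Y. F a s b t) = C"
  using assms by blast

locale mult_subset = cring +
  fixes S
  assumes S_subset: "S \<subseteq> carrier R"
    and S_one: "\<one> \<in> S"
    and S_mult: "s \<in> S \<Longrightarrow> t \<in> S \<Longrightarrow> s \<otimes> t \<in> S"
begin

lemma S_carrier: "s \<in> S \<Longrightarrow> s \<in> carrier R"
  using S_subset by blast

lemma equiv_frac_rel: "equiv (carrier R \<times> S) (frac_rel R S)"
proof (rule equivI)
  show "frac_rel R S \<subseteq> (carrier R \<times> S) \<times> (carrier R \<times> S)"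
    by (auto simp: frac_rel_def)
  show "refl_on (carrier R \<times> S) (frac_rel R S)"
    using S_one by (auto simp: refl_on_def frac_rel_def)
  show "sym (frac_rel R S)"
    by (auto simp: sym_def frac_rel_def intro: sym)
  show "trans (frac_rel R S)"
  proof (rule transI, clarify)
    fix a s b t c v
    assume "((a, s), (b, t)) \<in> frac_rel R S" and "((b, t), (c, v)) \<in> frac_rel R S"
    then obtain x y where car: "a \<in> carrier R" "b \<in> carrier R" "c \<in> carrier R"
      and S: "s \<in> S" "t \<in> S" "v \<in> S" "x \<in> S" "y \<in> S"
      and x: "x \<otimes> (a \<otimes> t) = x \<otimes> (b \<otimes> s)" and y: "y \<otimes> (b \<otimes> v) = y \<otimes> (c \<otimes> t)"
      by (auto simp: frac_rel_def)
    note [simp] = car S S[THEN S_carrier]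
    have "(x \<otimes> y \<otimes> t) \<otimes> (a \<otimes> v) = (y \<otimes> v) \<otimes> (x \<otimes> (a \<otimes> t))"
      by (simp add: m_ac)
    also have "\<dots> = (x \<otimes> s) \<otimes> (y \<otimes> (b \<otimes> v))"
      unfolding x by (simp add: m_ac)
    also have "\<dots> = (x \<otimes> y \<otimes> t) \<otimes> (c \<otimes> s)"
      unfolding y by (simp add: m_ac)
    finally have "(x \<otimes> y \<otimes> t) \<otimes> (a \<otimes> v) = (x \<otimes> y \<otimes> t) \<otimes> (c \<otimes> s)" .
    moreover have "x \<otimes> y \<otimes> t \<in> S"
      by (intro S_mult) simp_all
    ultimately show "((a, s), (c, v)) \<in> frac_rel R S"
      by (auto simp: frac_rel_def)
  qed
qed

lemma frac_eq_iff:
  assumes "a \<in> carrier R" "b \<in> carrier R" "s \<in> S" "t \<in> S"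
  shows "frac R S a s = frac R S b t \<longleftrightarrow> (\<exists>u\<in>S. u \<otimes> (a \<otimes> t) = u \<otimes> (b \<otimes> s))"
  using eq_equiv_class_iff[OF equiv_frac_rel, of "(a, s)" "(b, t)"] assms
  by (auto simp: frac_def frac_rel_def)

lemma frac_eqI:
  assumes "a \<in> carrier R" "b \<in> carrier R" "s \<in> S" "t \<in> S" "a \<otimes> t = b \<otimes> s"
  shows "frac R S a s = frac R S b t"
proof -
  have "\<one> \<otimes> (a \<otimes> t) = \<one> \<otimes> (b \<otimes> s)"
    by (simp only: assms(5))
  then show ?thesis
    using frac_eq_iff[OF assms(1-4)] S_one by blast
qed

lemma carrier_localization:
  "carrier (localization R S) = {frac R S a s | a s. a \<in> carrier R \<and> s \<in> S}"
  by (auto simp: localization_def quotient_def frac_def)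

lemma frac_closed:
  "a \<in> carrier R \<Longrightarrow> s \<in> S \<Longrightarrow> frac R S a s \<in> carrier (localization R S)"
  by (auto simp: carrier_localization)

lemma localizationE:
  assumes "x \<in> carrier (localization R S)"
  obtains a s where "x = frac R S a s" "a \<in> carrier R" "s \<in> S"
  using assms by (auto simp: carrier_localization)

lemma mult_frac:
  assumes "a \<in> carrier R" "b \<in> carrier R" "s \<in> S" "t \<in> S"
  shows "frac R S a s \<otimes>\<^bsub>localization R S\<^esub> frac R S b t = frac R S (a \<otimes> b) (s \<otimes> t)"
proof -
  have "frac R S (a' \<otimes> b') (s' \<otimes> t') = frac R S (a \<otimes> b) (s \<otimes> t)"
    if "(a', s') \<in> frac R S a s" "(b', t') \<in> frac R S b t" for a' s' b' t'
  proof -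
    from that obtain x y where car: "a' \<in> carrier R" "b' \<in> carrier R"
      and S: "s' \<in> S" "t' \<in> S" "x \<in> S" "y \<in> S"
      and x: "x \<otimes> (a \<otimes> s') = x \<otimes> (a' \<otimes> s)" and y: "y \<otimes> (b \<otimes> t') = y \<otimes> (b' \<otimes> t)"
      by (auto simp: frac_def frac_rel_def)
    note [simp] = car S S[THEN S_carrier] assms assms(3-4)[THEN S_carrier]
    have "(x \<otimes> y) \<otimes> ((a' \<otimes> b') \<otimes> (s \<otimes> t)) = (x \<otimes> (a' \<otimes> s)) \<otimes> (y \<otimes> (b' \<otimes> t))"
      by (simp add: m_ac)
    also have "\<dots> = (x \<otimes> y) \<otimes> ((a \<otimes> b) \<otimes> (s' \<otimes> t'))"
      unfolding x[symmetric] y[symmetric] by (simp add: m_ac)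
    finally have "\<exists>u\<in>S. u \<otimes> ((a' \<otimes> b') \<otimes> (s \<otimes> t)) = u \<otimes> ((a \<otimes> b) \<otimes> (s' \<otimes> t'))"
      using S_mult[OF S(3,4)] by blast
    then show ?thesis
      by (subst frac_eq_iff) (simp_all add: S_mult)
  qed
  moreover have "(a, s) \<in> frac R S a s" "(b, t) \<in> frac R S b t"
    using assms S_one by (auto simp: frac_def frac_rel_def)
  ultimately show ?thesis
    unfolding localization_def monoid.simps ring.simps by (rule UN_pairs_const)
qed

lemma add_frac:
  assumes "a \<in> carrier R" "b \<in> carrier R" "s \<in> S" "t \<in> S"
  shows "frac R S a s \<oplus>\<^bsub>localization R S\<^esub> frac R S b t =
    frac R S (a \<otimes> t \<oplus> b \<otimes> s) (s \<otimes> t)"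
proof -
  have "frac R S (a' \<otimes> t' \<oplus> b' \<otimes> s') (s' \<otimes> t') = frac R S (a \<otimes> t \<oplus> b \<otimes> s) (s \<otimes> t)"
    if "(a', s') \<in> frac R S a s" "(b', t') \<in> frac R S b t" for a' s' b' t'
  proof -
    from that obtain x y where car: "a' \<in> carrier R" "b' \<in> carrier R"
      and S: "s' \<in> S" "t' \<in> S" "x \<in> S" "y \<in> S"
      and x: "x \<otimes> (a \<otimes> s') = x \<otimes> (a' \<otimes> s)" and y: "y \<otimes> (b \<otimes> t') = y \<otimes> (b' \<otimes> t)"
      by (auto simp: frac_def frac_rel_def)
    note [simp] = car S S[THEN S_carrier] assms assms(3-4)[THEN S_carrier]
    have "(x \<otimes> y) \<otimes> ((a' \<otimes> t' \<oplus> b' \<otimes> s') \<otimes> (s \<otimes> t)) =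
      (y \<otimes> t \<otimes> t') \<otimes> (x \<otimes> (a' \<otimes> s)) \<oplus> (x \<otimes> s \<otimes> s') \<otimes> (y \<otimes> (b' \<otimes> t))"
      by (simp add: m_ac l_distr r_distr)
    also have "\<dots> = (x \<otimes> y) \<otimes> ((a \<otimes> t \<oplus> b \<otimes> s) \<otimes> (s' \<otimes> t'))"
      unfolding x[symmetric] y[symmetric] by (simp add: m_ac l_distr r_distr)
    finally have "\<exists>u\<in>S. u \<otimes> ((a' \<otimes> t' \<oplus> b' \<otimes> s') \<otimes> (s \<otimes> t)) = u \<otimes> ((a \<otimes> t \<oplus> b \<otimes> s) \<otimes> (s' \<otimes> t'))"
      using S_mult[OF S(3,4)] by blast
    then show ?thesis
      by (subst frac_eq_iff) (simp_all add: S_mult)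
  qed
  moreover have "(a, s) \<in> frac R S a s" "(b, t) \<in> frac R S b t"
    using assms S_one by (auto simp: frac_def frac_rel_def)
  ultimately show ?thesis
    unfolding localization_def monoid.simps ring.simps by (rule UN_pairs_const)
qed

lemma cring_localization: "cring (localization R S)"
proof -
  let ?L = "localization R S"
  note [simp] = S_carrier S_one S_mult mult_frac add_frac frac_closed
  have one: "\<one>\<^bsub>?L\<^esub> = frac R S \<one> \<one>" and zero: "\<zero>\<^bsub>?L\<^esub> = frac R S \<zero> \<one>"
    by (simp_all add: localization_def)
  have "abelian_group ?L"
  proof (rule abelian_groupI)
    fix x y assume "x \<in> carrier ?L" "y \<in> carrier ?L"
    then show "x \<oplus>\<^bsub>?L\<^esub> y \<in> carrier ?L" "x \<oplus>\<^bsub>?L\<^esub> y = y \<oplus>\<^bsub>?L\<^esub> x"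
      by (elim localizationE, simp add: m_comm a_comm)+
  next
    show "\<zero>\<^bsub>?L\<^esub> \<in> carrier ?L"
      by (simp add: zero)
  next
    fix x y z assume "x \<in> carrier ?L" "y \<in> carrier ?L" "z \<in> carrier ?L"
    then show "x \<oplus>\<^bsub>?L\<^esub> y \<oplus>\<^bsub>?L\<^esub> z = x \<oplus>\<^bsub>?L\<^esub> (y \<oplus>\<^bsub>?L\<^esub> z)"
      by (elim localizationE) (simp add: m_ac a_ac l_distr r_distr)
  next
    fix x assume "x \<in> carrier ?L"
    then obtain a s where x: "x = frac R S a s" "a \<in> carrier R" "s \<in> S"
      by (rule localizationE)
    then show "\<zero>\<^bsub>?L\<^esub> \<oplus>\<^bsub>?L\<^esub> x = x"
      by (simp add: zero)
    have "\<ominus> a \<otimes> s \<oplus> a \<otimes> s = \<zero>"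
      using x by (simp add: l_minus l_neg)
    then have "frac R S (\<ominus> a) s \<oplus>\<^bsub>?L\<^esub> x = \<zero>\<^bsub>?L\<^esub>"
      using x by (simp add: zero) (rule frac_eqI, simp_all)
    then show "\<exists>y\<in>carrier ?L. y \<oplus>\<^bsub>?L\<^esub> x = \<zero>\<^bsub>?L\<^esub>"
      using x by (intro bexI[of _ "frac R S (\<ominus> a) s"]) simp_all
  qed
  moreover have "comm_monoid ?L"
  proof (rule comm_monoidI)
    fix x y assume "x \<in> carrier ?L" "y \<in> carrier ?L"
    then show "x \<otimes>\<^bsub>?L\<^esub> y \<in> carrier ?L" "x \<otimes>\<^bsub>?L\<^esub> y = y \<otimes>\<^bsub>?L\<^esub> x"
      by (elim localizationE, simp add: m_comm)+
  next
    show "\<one>\<^bsub>?L\<^esub> \<in> carrier ?L"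
      by (simp add: one)
  next
    fix x y z assume "x \<in> carrier ?L" "y \<in> carrier ?L" "z \<in> carrier ?L"
    then show "x \<otimes>\<^bsub>?L\<^esub> y \<otimes>\<^bsub>?L\<^esub> z = x \<otimes>\<^bsub>?L\<^esub> (y \<otimes>\<^bsub>?L\<^esub> z)"
      by (elim localizationE) (simp add: m_assoc)
  next
    fix x assume "x \<in> carrier ?L"
    then show "\<one>\<^bsub>?L\<^esub> \<otimes>\<^bsub>?L\<^esub> x = x"
      by (elim localizationE) (simp add: one)
  qed
  ultimately show ?thesis
  proof (rule cringI)
    fix x y z assume "x \<in> carrier ?L" "y \<in> carrier ?L" "z \<in> carrier ?L"
    then obtain a s b t c v where xyz: "x = frac R S a s" "y = frac R S b t" "z = frac R S c v"
      and [simp]: "a \<in> carrier R" "s \<in> S" "b \<in> carrier R" "t \<in> S" "c \<in> carrier R" "v \<in> S"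
      by (elim localizationE)
    have "((a \<otimes> t \<oplus> b \<otimes> s) \<otimes> c) \<otimes> (s \<otimes> v \<otimes> (t \<otimes> v)) =
      (a \<otimes> c \<otimes> (t \<otimes> v) \<oplus> b \<otimes> c \<otimes> (s \<otimes> v)) \<otimes> (s \<otimes> t \<otimes> v)"
      by (simp add: m_ac l_distr r_distr)
    then have "frac R S ((a \<otimes> t \<oplus> b \<otimes> s) \<otimes> c) (s \<otimes> t \<otimes> v) =
      frac R S (a \<otimes> c \<otimes> (t \<otimes> v) \<oplus> b \<otimes> c \<otimes> (s \<otimes> v)) (s \<otimes> v \<otimes> (t \<otimes> v))"
      by (intro frac_eqI) simp_all
    then show "(x \<oplus>\<^bsub>?L\<^esub> y) \<otimes>\<^bsub>?L\<^esub> z = x \<otimes>\<^bsub>?L\<^esub> z \<oplus>\<^bsub>?L\<^esub> y \<otimes>\<^bsub>?L\<^esub> z"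
      by (simp add: xyz)
  qed
qed

end

section \<open>Grassmannians, their closed subschemes, and Fano schemes\<close>

text \<open>Everything takes place in the coordinate space \<open>'k ^ 'c\<close>. For a set \<open>I\<close> of \<open>d\<close>
  coordinates, the standard chart of \<open>Gr(d, 'k ^ 'c)\<close> is the affine space with coordinates
  \<open>x (a, p)\<close>, \<open>a \<in> I\<close>, \<open>p \<notin> I\<close>: the point \<open>x\<close> is the row space of the matrix, with rows
  indexed by \<open>I\<close>, whose columns in \<open>I\<close> form the identity and whose remaining entries
  are \<open>x\<close>. These charts cover the Grassmannian.\<close>

definition grassmannian :: "nat \<Rightarrow> ('k::field ^ 'c::finite) set set" where
  "grassmannian d = {Q. vec.subspace Q \<and> vec.dim Q = d}"

definition chart_entry :: "'c set \<Rightarrow> ('c \<times> 'c \<Rightarrow> 'b::zero_neq_one) \<Rightarrow> 'c \<Rightarrow> 'c \<Rightarrow> 'b" where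
  "chart_entry I x a p = (if p \<in> I then (if p = a then 1 else 0) else x (a, p))"

definition chart_plane :: "'c set \<Rightarrow> ('c \<times> 'c \<Rightarrow> 'k) \<Rightarrow> ('k::field ^ 'c::finite) set" where
  "chart_plane I x = vec.span ((\<lambda>a. \<chi> p. chart_entry I x a p) ` I)"

definition chart_ring :: "'c set \<Rightarrow> ('c \<times> 'c, 'k::comm_ring_1) mpoly ring" where
  "chart_ring I = poly_ring (I \<times> (- I))"

text \<open>A closed subscheme of the Grassmannian is given by its ideals in the coordinate rings
  of the standard charts.\<close>

type_synonym ('c, 'k) subscheme = "'c set \<Rightarrow> ('c \<times> 'c, 'k) mpoly set"

text \<open>As the field will be algebraically closed, it suffices to record closed points.\<close>

definition scheme_points ::
  "nat \<Rightarrow> ('c::finite, 'k::field) subscheme \<Rightarrow> ('k ^ 'c) set set" where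
  "scheme_points d X =
     {Q \<in> grassmannian d. \<forall>I x. card I = d \<and> Q = chart_plane I x \<longrightarrow>
        (\<forall>f\<in>X I. eval_poly id x f = 0)}"

definition reduced_structure ::
  "('k::field ^ 'c::finite) set set \<Rightarrow> ('c, 'k) subscheme" where
  "reduced_structure Z I =
     {f \<in> carrier (chart_ring I). \<forall>x. chart_plane I x \<in> Z \<longrightarrow> eval_poly id x f = 0}"

definition zariski_closed :: "nat \<Rightarrow> ('k::field ^ 'c::finite) set set \<Rightarrow> bool" where
  "zariski_closed d Z \<longleftrightarrow> Z \<subseteq> grassmannian d \<and>
     (\<forall>I. card I = d \<longrightarrow> (\<exists>G \<subseteq> carrier (chart_ring I).
        \<forall>x. chart_plane I x \<in> Z \<longleftrightarrow> (\<forall>f\<in>G. eval_poly id x f = 0)))"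

definition irreducible_locus :: "nat \<Rightarrow> ('k::field ^ 'c::finite) set set \<Rightarrow> bool" where
  "irreducible_locus d Z \<longleftrightarrow> Z \<noteq> {} \<and>
     (\<forall>A B. zariski_closed d A \<and> zariski_closed d B \<and> Z \<subseteq> A \<union> B \<longrightarrow> Z \<subseteq> A \<or> Z \<subseteq> B)"

definition irreducible_component ::
  "nat \<Rightarrow> ('c::finite, 'k::field) subscheme \<Rightarrow> ('k ^ 'c) set set \<Rightarrow> bool" where
  "irreducible_component d X Z \<longleftrightarrow>
     Z \<subseteq> scheme_points d X \<and> irreducible_locus d Z \<and>
     (\<forall>Y. Z \<subseteq> Y \<and> Y \<subseteq> scheme_points d X \<and> irreducible_locus d Y \<longrightarrow> Y = Z)"

text \<open>The local ring of \<open>X\<close> at the generic point of \<open>Z\<close>, computed in the chart \<open>I\<close>: the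
  coordinate ring \<open>chart_ring I Quot X I\<close>, localized at the prime that is the image of the
  vanishing ideal of \<open>Z\<close>. It is meaningful when \<open>Z\<close> is irreducible, contained in \<open>X\<close> and
  meets the chart; up to isomorphism it does not depend on the chart.\<close>

definition generic_local_ring ::
  "('c::finite, 'k::field) subscheme \<Rightarrow> ('k ^ 'c) set set \<Rightarrow> 'c set \<Rightarrow>
   (('c \<times> 'c, 'k) mpoly set \<times> ('c \<times> 'c, 'k) mpoly set) set ring" where
  "generic_local_ring X Z I =
     (let A = chart_ring I Quot X I
      in localization A
           (carrier A - (\<lambda>f. X I +>\<^bsub>chart_ring I\<^esub> f) ` reduced_structure Z I))"

definition generically_reduced_on ::
  "('c::finite, 'k::field) subscheme \<Rightarrow> ('k ^ 'c) set set \<Rightarrow> bool" where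
  "generically_reduced_on X Z \<longleftrightarrow>
     (\<forall>I. (\<exists>x. chart_plane I x \<in> Z) \<longrightarrow> reduced_ring (generic_local_ring X Z I))"

text \<open>The Fano scheme of the projective scheme cut out by the forms \<open>G\<close>. On the chart \<open>I\<close> a
  form is restricted to the general point \<open>\<Sum>a\<in>I. t a * row a\<close> of the universal plane, and
  the coefficients of all monomials in the \<open>t a\<close> are set to zero.\<close>

definition restrict_to_plane ::
  "'c::finite set \<Rightarrow> ('c, 'k::field) mpoly \<Rightarrow> ('c, ('c \<times> 'c, 'k) mpoly) mpoly" where
  "restrict_to_plane I =
     eval_poly (\<lambda>c. poly_const (poly_const c))
       (\<lambda>p. \<Sum>a\<in>I. poly_var a * poly_const (chart_entry I poly_var a p))"

definition fano_scheme :: "('c::finite, 'k::field) mpoly set \<Rightarrow> ('c, 'k) subscheme" where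
  "fano_scheme G I =
     genideal (chart_ring I)
       {Poly_Mapping.lookup (restrict_to_plane I g) m | g m. g \<in> G}"

section \<open>Symmetric matrices\<close>

instance uprod :: (finite) finite
proof
  have "(UNIV :: 'a uprod set) = range (\<lambda>(a, b). Upair a b)"
  proof (intro equalityI subsetI)
    show "p \<in> range (\<lambda>(a, b). Upair a b)" for p :: "'a uprod"
      by (cases p) auto
  qed simp
  then show "finite (UNIV :: 'a uprod set)"
    by (metis finite finite_imageI)
qed

text \<open>The space of symmetric matrices is identified with \<open>'k ^ 'n uprod\<close>, unordered pairs
  \<open>{i, j}\<close> (possibly \<open>i = j\<close>) indexing the independent entries.\<close>

definition sym_matrix :: "'a ^ 'n uprod \<Rightarrow> 'a ^ 'n ^ 'n" where
  "sym_matrix z = (\<chi> i j. z $ Upair i j)"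

lemma bij_betw_sym_matrix:
  "bij_betw sym_matrix (UNIV :: ('a ^ 'n uprod) set) {A :: 'a ^ 'n ^ 'n. transpose A = A}"
proof (rule bij_betwI')
  fix z w :: "'a ^ 'n uprod"
  have "z = w" if "\<And>i j. z $ Upair i j = w $ Upair i j"
    unfolding Finite_Cartesian_Product.vec_eq_iff
  proof (rule allI)
    show "z $ p = w $ p" for p
      using that by (cases p) auto
  qed
  then show "(sym_matrix z = sym_matrix w) = (z = w)"
    by (auto simp: sym_matrix_def Finite_Cartesian_Product.vec_eq_iff)
  show "sym_matrix z \<in> {A. transpose A = A}"
    by (auto simp: sym_matrix_def transpose_def Finite_Cartesian_Product.vec_eq_iff
        intro!: arg_cong[of _ _ "($) z"])
next
  fix A :: "'a ^ 'n ^ 'n"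
  assume "A \<in> {A. transpose A = A}"
  then have sym: "A $ i $ j = A $ j $ i" for i j
    by (auto simp: transpose_def Finite_Cartesian_Product.vec_eq_iff)
  let ?rep = "\<lambda>p. SOME ij. p = Upair (fst ij) (snd ij)"
  let ?z = "\<chi> p. A $ fst (?rep p) $ snd (?rep p)"
  have "?z $ Upair i j = A $ i $ j" for i j
  proof -
    define ij where "ij = (SOME ij. Upair i j = Upair (fst ij) (snd ij))"
    have "Upair i j = Upair (fst ij) (snd ij)"
      unfolding ij_def by (rule someI[of _ "(i, j)"]) simp
    then have "A $ fst ij $ snd ij = A $ i $ j"
      using sym by auto
    then show ?thesis by (simp add: ij_def)
  qed
  then show "\<exists>z\<in>UNIV. A = sym_matrix z"
    by (intro bexI[of _ ?z]) (simp_all add: sym_matrix_def Finite_Cartesian_Product.vec_eq_iff)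
qed

text \<open>Selecting rows and columns by arbitrary injections rather than increasing ones changes
  the minors only by signs.\<close>

definition minors :: "nat \<Rightarrow> 'a::comm_ring_1 ^ 'n ^ 'n \<Rightarrow> 'a set" where
  "minors r A =
     {Determinant.det (Matrix.mat r r (\<lambda>(i, j). A $ \<rho> i $ \<sigma> j)) | \<rho> \<sigma>.
        inj_on \<rho> {..<r} \<and> inj_on \<sigma> {..<r}}"

definition generic_sym_matrix :: "('n uprod, 'k::comm_ring_1) mpoly ^ 'n ^ 'n" where
  "generic_sym_matrix = sym_matrix (\<chi> p. poly_var p)"

definition sd_equations :: "nat \<Rightarrow> ('n::finite uprod, 'k::comm_ring_1) mpoly set" where
  "sd_equations r = minors r generic_sym_matrix"

text \<open>\<open>sd_fano r\<close> gives the ideals in all charts of all Grassmannians; the Fano scheme of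
  \<open>k\<close>-planes consists of those in the charts of \<open>Gr(k + 1)\<close>.\<close>

definition sd_fano :: "nat \<Rightarrow> ('n::finite uprod, 'k::field) subscheme" where
  "sd_fano r = fano_scheme (sd_equations r)"

definition nested_compression_space ::
  "nat \<Rightarrow> nat \<Rightarrow> ('k::field ^ 'n::finite uprod) set \<Rightarrow> bool" where
  "nested_compression_space r s Q \<longleftrightarrow>
     vec.subspace Q \<and>
     (\<exists>U W :: ('k ^ 'n) set. vec.subspace U \<and> vec.subspace W \<and> U \<subseteq> W \<and>
        vec.dim U = s + 1 + CARD('n) - r \<and> vec.dim W = CARD('n) - s \<and>
        (\<forall>u\<in>U. \<forall>w\<in>W. \<forall>z\<in>Q. scalar_product u (sym_matrix z *v w) = 0))"

definition compression_locus ::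
  "nat \<Rightarrow> nat \<Rightarrow> nat \<Rightarrow> ('k::field ^ 'n::finite uprod) set set" where
  "compression_locus r k s =
     {Q \<in> scheme_points (k + 1) (sd_fano r). nested_compression_space r s Q}"

end

theory Submission
  imports Defs
begin

text \<open>
  Let \<open>P\<close> be the vanishing ideal of the component in a chart and \<open>b\<close> the ideal of the Fano scheme
  localized at \<open>P\<close>; generic reducedness means \<open>P = b\<close>. Matrices in the universal plane have vanishing
  \<open>r\<close>-minors modulo \<open>b\<close>, so their vectors of \<open>(r - 1)\<close>-cofactors are kernel vectors, and at the
  points of the compression locus these vectors lie in \<open>U\<close>.

  If \<open>2s + 1 < r\<close>, then \<open>U\<close> is a proper subspace of \<open>W\<close>. On the locus, a pencil in the plane maps
  kernel vectors of its members into the annihilator of \<open>W\<close>, of dimension \<open>s\<close>, so \<open>(s + 1)\<close>-minors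
  formed from the images vanish there. Adding to the plane a first-order perturbation that vanishes on
  \<open>U \<times> U\<close> but not on \<open>U \<times> W\<close> keeps the \<open>r\<close>-minors zero to first order and does not annihilate these
  minors: the Fano scheme has more tangent directions than the locus.

  If \<open>r = 2s + 1\<close>, then \<open>U = W\<close> is isotropic for all members of the plane. Kernel vectors of a pencil
  of two members yield a normalised frame of \<open>U\<close> over the coordinate ring on which the pencil is
  isotropic modulo \<open>b\<close>. The values \<open>D\<close> of the other members on the frame generate an ideal in \<open>P\<close>.
  Expanding a kernel vector of a third member in the frame, its remainder lies in the ideal of the \<open>D\<close>,
  so \<open>D\<close> evaluated on kernel vectors lies in \<open>P D + b\<close>. No quadric contains all
  kernel vectors, hence each \<open>D\<close> lies in \<open>P D + b\<close>, and Nakayama's lemma gives \<open>D \<in> b\<close>. Thus the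
  universal plane is, modulo \<open>b\<close>, a family of planes isotropic on the frame, and every function
  vanishing on the locus lies in \<open>b\<close>.
\<close>

section \<open>Polynomial evaluation\<close>

text \<open>The generic point must be handled without fields of fractions. Kernel vectors, frames
  and changes of chart are therefore built from cofactors with denominators cleared, and a statement
  in the local ring becomes one about multipliers outside \<open>P\<close>. Nondegeneracy is then
  one polynomial in a few members of the plane, and by irreducibility it suffices to test it at one
  plane. The test matrices are built from a bidiagonal block, so that their kernel vectors are
  explicit and the determinants become Vandermonde or triangular.

  The odd case uses a third member because the curve (1, t, t^2, ...) of kernel vectors of the test
  pencil lies on quadrics as soon as s >= 2. With the third member, t is replaced by c + y
  \<theta>_a with distinct \<theta>_a, the coordinates become products of different linear forms,
  and no quadric contains them all; characteristic other than 2 enters there. If k = 1 there is no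
  third member, but the plane is then the pencil itself, which is isotropic on its frame.

  That the locus gives a component is used to obtain, for each f in \<open>P\<close>, a power of f
  in \<open>b\<close>; this is why reducedness amounts to \<open>P = b\<close>.\<close>

definition mono :: "('v \<Rightarrow> 'b::comm_ring_1) \<Rightarrow> ('v \<Rightarrow>\<^sub>0 nat) \<Rightarrow> 'b" where
  "mono x m = (\<Prod>v\<in>Poly_Mapping.keys m. x v ^ Poly_Mapping.lookup m v)"

lemma mono_superset:
  assumes "finite V" "Poly_Mapping.keys m \<subseteq> V"
  shows "mono x m = (\<Prod>v\<in>V. x v ^ Poly_Mapping.lookup m v)"
  unfolding mono_def
  by (rule prod.mono_neutral_left) (use assms in \<open>auto simp: in_keys_iff\<close>)

lemma mono_zero [simp]: "mono x 0 = 1"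
  by (simp add: mono_def)

lemma mono_add: "mono x (m + m') = mono x m * mono x m'"
proof -
  let ?V = "Poly_Mapping.keys m \<union> Poly_Mapping.keys m'"
  have "Poly_Mapping.keys (m + m') \<subseteq> ?V" by (rule Poly_Mapping.keys_add)
  then show ?thesis
    by (simp add: mono_superset[of ?V] lookup_add power_add prod.distrib)
qed

lemma mono_single [simp]: "mono x (Poly_Mapping.single v k) = x v ^ k"
  by (simp add: mono_superset[of "{v}"])

lemma eval_poly_mono:
  "eval_poly h x f = (\<Sum>m\<in>Poly_Mapping.keys f. h (Poly_Mapping.lookup f m) * mono x m)"
  by (simp add: eval_poly_def mono_def)

lemma poly_mapping_sum_singles:
  fixes f :: "'a \<Rightarrow>\<^sub>0 'b::comm_monoid_add"
  shows "f = (\<Sum>m\<in>Poly_Mapping.keys f. Poly_Mapping.single m (Poly_Mapping.lookup f m))"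
proof (rule poly_mapping_eqI)
  fix k
  have "Poly_Mapping.lookup (\<Sum>m\<in>Poly_Mapping.keys f. Poly_Mapping.single m (Poly_Mapping.lookup f m)) k
      = (\<Sum>m\<in>Poly_Mapping.keys f. if m = k then Poly_Mapping.lookup f m else 0)"
    unfolding lookup_sum by (rule sum.cong) (auto simp: lookup_single when_def)
  then show "Poly_Mapping.lookup f k = Poly_Mapping.lookup
      (\<Sum>m\<in>Poly_Mapping.keys f. Poly_Mapping.single m (Poly_Mapping.lookup f m)) k"
    by (simp add: in_keys_iff)
qed

lemma single_eq_const_times_vars:
  fixes c :: "'a::comm_ring_1"
  shows "Poly_Mapping.single m c = poly_const c * mono poly_var m"
proof -
  have pw: "poly_var v ^ k = (Poly_Mapping.single (Poly_Mapping.single v k) 1 :: ('v, 'a) mpoly)" for v :: 'v and k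
    by (induction k) (simp_all add: poly_var_def mult_single single_add[symmetric])
  have pr: "(\<Prod>v\<in>V. poly_var v ^ Poly_Mapping.lookup m v) =
      (Poly_Mapping.single (\<Sum>v\<in>V. Poly_Mapping.single v (Poly_Mapping.lookup m v)) 1 :: ('v, 'a) mpoly)"
    if "finite V" for V and m :: "'v \<Rightarrow>\<^sub>0 nat"
    using that by (induction V rule: finite_induct) (simp_all add: pw mult_single)
  have "mono poly_var m = (Poly_Mapping.single m 1 :: (_, 'a) mpoly)"
    unfolding mono_def pr[OF finite_keys] by (simp add: poly_mapping_sum_singles[symmetric])
  then show ?thesis
    by (simp add: poly_const_def mult_single)
qed

lemma mpoly_expand:
  "f = (\<Sum>m\<in>Poly_Mapping.keys f. poly_const (Poly_Mapping.lookup f m) * mono poly_var m)"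
  by (subst poly_mapping_sum_singles) (simp add: single_eq_const_times_vars)

lemma comm_ring_hom_poly_const: "comm_ring_hom (poly_const :: 'a::comm_ring_1 \<Rightarrow> ('v, 'a) mpoly)"
  by unfold_locales (simp_all add: poly_const_def single_add mult_single)

interpretation poly_const: comm_ring_hom "poly_const :: 'a::comm_ring_1 \<Rightarrow> ('v, 'a) mpoly"
  by (rule comm_ring_hom_poly_const)

context comm_ring_hom
begin

lemma hom_mono: "hom (mono x m) = mono (\<lambda>v. hom (x v)) m"
  by (simp add: mono_def hom_distribs)

lemma eval_poly_superset:
  assumes "finite M" "Poly_Mapping.keys f \<subseteq> M"
  shows "eval_poly hom x f = (\<Sum>m\<in>M. hom (Poly_Mapping.lookup f m) * mono x m)"
  unfolding eval_poly_mono
  by (rule sum.mono_neutral_left) (use assms in \<open>auto simp: in_keys_iff\<close>)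

lemma eval_poly_single:
  "eval_poly hom x (Poly_Mapping.single m c) = hom c * mono x m"
  by (simp add: eval_poly_superset[of "{m}"])

lemma eval_poly_plus: "eval_poly hom x (f + g) = eval_poly hom x f + eval_poly hom x g"
proof -
  let ?M = "Poly_Mapping.keys f \<union> Poly_Mapping.keys g"
  have "Poly_Mapping.keys (f + g) \<subseteq> ?M" by (rule Poly_Mapping.keys_add)
  then show ?thesis
    by (simp add: eval_poly_superset[of ?M] lookup_add hom_add distrib_right sum.distrib)
qed

lemma eval_poly_zero: "eval_poly hom x 0 = 0"
  by (simp add: eval_poly_mono)

lemma eval_poly_sum: "eval_poly hom x (\<Sum>i\<in>A. F i) = (\<Sum>i\<in>A. eval_poly hom x (F i))"
  by (induction A rule: infinite_finite_induct) (simp_all add: eval_poly_zero eval_poly_plus)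

lemma eval_poly_times: "eval_poly hom x (f * g) = eval_poly hom x f * eval_poly hom x g"
proof -
  have "f * g = (\<Sum>m\<in>Poly_Mapping.keys f. Poly_Mapping.single m (Poly_Mapping.lookup f m)) *
      (\<Sum>m\<in>Poly_Mapping.keys g. Poly_Mapping.single m (Poly_Mapping.lookup g m))"
    by (simp add: poly_mapping_sum_singles[symmetric])
  also have "\<dots> = (\<Sum>m\<in>Poly_Mapping.keys f. \<Sum>m'\<in>Poly_Mapping.keys g.
      Poly_Mapping.single (m + m') (Poly_Mapping.lookup f m * Poly_Mapping.lookup g m'))"
    by (simp add: sum_product mult_single)
  finally have "eval_poly hom x (f * g) = (\<Sum>m\<in>Poly_Mapping.keys f. \<Sum>m'\<in>Poly_Mapping.keys g.
      (hom (Poly_Mapping.lookup f m) * mono x m) * (hom (Poly_Mapping.lookup g m') * mono x m'))"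
    by (simp add: eval_poly_sum eval_poly_single mono_add hom_mult mult_ac)
  also have "\<dots> = eval_poly hom x f * eval_poly hom x g"
    by (simp add: eval_poly_mono sum_product)
  finally show ?thesis .
qed

lemma eval_poly_const: "eval_poly hom x (poly_const c) = hom c"
  by (simp add: poly_const_def eval_poly_single)

lemma eval_poly_var: "eval_poly hom x (poly_var v) = x v"
  by (simp add: poly_var_def eval_poly_single)

lemma comm_ring_hom_eval_poly: "comm_ring_hom (eval_poly hom x)"
proof
  show "eval_poly hom x 1 = 1"
    using eval_poly_const[of x 1] by (simp add: poly_const_def)
qed (simp_all add: eval_poly_zero eval_poly_plus eval_poly_times)

end

lemma mpoly_hom_eq:
  assumes "comm_ring_hom H"
  shows "H f = eval_poly (\<lambda>c. H (poly_const c)) (\<lambda>v. H (poly_var v)) f"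
proof -
  interpret H: comm_ring_hom H by fact
  show ?thesis
    unfolding eval_poly_mono
    by (subst mpoly_expand[of f]) (simp add: H.hom_mono hom_distribs)
qed

text \<open>The universal property of the polynomial ring. Identities between composed substitutions
  are proved by comparing both sides on constants and variables only.\<close>

lemma mpoly_hom_cong:
  assumes "comm_ring_hom H" "comm_ring_hom H'"
    and "\<And>c. H (poly_const c) = H' (poly_const c)" "\<And>v. H (poly_var v) = H' (poly_var v)"
  shows "H f = H' f"
  by (simp add: mpoly_hom_eq[OF assms(1), of f] mpoly_hom_eq[OF assms(2), of f] assms(3,4))

lemma comm_ring_hom_comp:
  "comm_ring_hom H \<Longrightarrow> comm_ring_hom G \<Longrightarrow> comm_ring_hom (\<lambda>x. H (G x))"
proof -
  assume "comm_ring_hom H" "comm_ring_hom G"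
  then interpret H: comm_ring_hom H + G: comm_ring_hom G by auto
  show ?thesis by unfold_locales (simp_all add: hom_distribs)
qed

lemma comm_ring_hom_id: "comm_ring_hom (id :: 'a::comm_ring_1 \<Rightarrow> 'a)"
  by unfold_locales auto

abbreviation evl :: "('v \<Rightarrow> 'a::comm_ring_1) \<Rightarrow> ('v, 'a) mpoly \<Rightarrow> 'a" where
  "evl \<equiv> eval_poly id"

interpretation evl: comm_ring_hom "evl x"
  by (rule comm_ring_hom.comm_ring_hom_eval_poly[OF comm_ring_hom_id])

lemma evl_const [simp]: "evl x (poly_const c) = c"
  using comm_ring_hom.eval_poly_const[OF comm_ring_hom_id] by simp

lemma evl_var [simp]: "evl x (poly_var v) = x v"
  by (rule comm_ring_hom.eval_poly_var[OF comm_ring_hom_id])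

definition vars_in :: "'v set \<Rightarrow> ('v, 'a::zero) mpoly \<Rightarrow> bool" where
  "vars_in V f \<longleftrightarrow> (\<forall>m\<in>Poly_Mapping.keys f. Poly_Mapping.keys m \<subseteq> V)"

lemma vars_in_poly_ring: "f \<in> carrier (poly_ring V) \<longleftrightarrow> vars_in V f"
  by (simp add: poly_ring_simps vars_in_def)

lemma vars_in_mono: "V \<subseteq> W \<Longrightarrow> vars_in V f \<Longrightarrow> vars_in W f"
  by (auto simp: vars_in_def)

lemma vars_in_UNIV [simp]: "vars_in UNIV f"
  by (simp add: vars_in_def)

lemma vars_in_0 [simp]: "vars_in V 0"
  by (simp add: vars_in_def)

lemma vars_in_const [simp]: "vars_in V (poly_const c)"
  by (simp add: vars_in_def poly_const_def)

lemma vars_in_1 [simp]: "vars_in V (1 :: ('v, 'a::comm_ring_1) mpoly)"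
  by (simp add: vars_in_def)

lemma vars_in_var: "v \<in> V \<Longrightarrow> vars_in V (poly_var v)"
  by (auto simp: vars_in_def poly_var_def)

lemma vars_in_add:
  fixes f g :: "('v, 'a::comm_ring_1) mpoly"
  shows "vars_in V f \<Longrightarrow> vars_in V g \<Longrightarrow> vars_in V (f + g)"
  using ring.ring_simprules(1)[OF cring.axioms(1)[OF cring_poly_ring], of f V g]
  by (simp add: vars_in_poly_ring[symmetric] poly_ring_simps(4))

lemma vars_in_mult:
  fixes f g :: "('v, 'a::comm_ring_1) mpoly"
  shows "vars_in V f \<Longrightarrow> vars_in V g \<Longrightarrow> vars_in V (f * g)"
  using ring.ring_simprules(5)[OF cring.axioms(1)[OF cring_poly_ring], of f V g]
  by (simp add: vars_in_poly_ring[symmetric] poly_ring_simps(2))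

lemma vars_in_sum:
  fixes F :: "'i \<Rightarrow> ('v, 'a::comm_ring_1) mpoly"
  shows "(\<And>i. i \<in> A \<Longrightarrow> vars_in V (F i)) \<Longrightarrow> vars_in V (\<Sum>i\<in>A. F i)"
  by (induction A rule: infinite_finite_induct) (simp_all add: vars_in_add)

lemma vars_in_prod:
  fixes F :: "'i \<Rightarrow> ('v, 'a::comm_ring_1) mpoly"
  shows "(\<And>i. i \<in> A \<Longrightarrow> vars_in V (F i)) \<Longrightarrow> vars_in V (\<Prod>i\<in>A. F i)"
  by (induction A rule: infinite_finite_induct) (simp_all add: vars_in_mult)

lemma vars_in_power:
  fixes f :: "('v, 'a::comm_ring_1) mpoly"
  shows "vars_in V f \<Longrightarrow> vars_in V (f ^ k)"
  by (induction k) (simp_all add: vars_in_mult)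

lemma vars_in_eval_poly:
  fixes y :: "'w \<Rightarrow> ('v, 'a::comm_ring_1) mpoly"
  assumes "\<And>c. vars_in V (h c)" "\<And>v. vars_in V (y v)"
  shows "vars_in V (eval_poly h y f)"
  unfolding eval_poly_def
  by (intro vars_in_sum vars_in_mult vars_in_prod vars_in_power assms)

lemma evl_cong:
  assumes "vars_in V f" "\<And>v. v \<in> V \<Longrightarrow> x v = y v"
  shows "eval_poly h x f = eval_poly h y f"
  unfolding eval_poly_def
  by (intro sum.cong refl arg_cong2[of _ _ _ _ "(*)"] prod.cong arg_cong2[of _ _ _ _ "(^)"])
    (use assms in \<open>auto simp: vars_in_def\<close>)

lemma vars_in_empty:
  assumes "vars_in {} f"
  shows "f = poly_const (Poly_Mapping.lookup f 0)"
proof (rule poly_mapping_eqI)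
  fix m
  show "Poly_Mapping.lookup f m = Poly_Mapping.lookup (poly_const (Poly_Mapping.lookup f 0)) m"
    using assms by (cases "m = 0") (force simp: vars_in_def poly_const_def lookup_single in_keys_iff)+
qed

section \<open>Isolating one variable\<close>

text \<open>The coefficients keep the full polynomial type; that they avoid \<open>v\<close> is a
  separate fact. This permits induction on the set of variables inside one type.\<close>

definition split_var :: "'v \<Rightarrow> ('v, 'a::comm_ring_1) mpoly \<Rightarrow> ('v, 'a) mpoly poly" where
  "split_var v = eval_poly (\<lambda>c. [:poly_const c:]) (\<lambda>u. if u = v then [:0, 1:] else [:poly_var u:])"

lemma hom_pCons_const: "comm_ring_hom (\<lambda>c. [:poly_const c:] :: ('v, 'a::comm_ring_1) mpoly poly)"
  by unfold_locales (simp_all add: hom_distribs one_pCons)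

interpretation split_var: comm_ring_hom "split_var v"
  unfolding split_var_def
  by (rule comm_ring_hom.comm_ring_hom_eval_poly[OF hom_pCons_const])

lemma split_var_const: "split_var v (poly_const c) = [:poly_const c:]"
  unfolding split_var_def by (rule comm_ring_hom.eval_poly_const[OF hom_pCons_const])

lemma split_var_var: "split_var v (poly_var u) = (if u = v then [:0, 1:] else [:poly_var u:])"
  unfolding split_var_def by (rule comm_ring_hom.eval_poly_var[OF hom_pCons_const])

lemma comm_ring_hom_poly: "comm_ring_hom (\<lambda>p. poly p (a :: 'a::comm_ring_1))"
  by unfold_locales auto

lemma poly_split_var: "poly (split_var v f) (poly_var v) = f"
proof (rule mpoly_hom_cong[of "\<lambda>f. poly (split_var v f) (poly_var v)" "\<lambda>f. f" f])
  show "comm_ring_hom (\<lambda>f. poly (split_var v f) (poly_var v))"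
    by (rule comm_ring_hom_comp[OF comm_ring_hom_poly split_var.comm_ring_hom_axioms])
  show "comm_ring_hom (\<lambda>f::('a, 'b) mpoly. f)"
    using comm_ring_hom_id by (simp add: id_def)
qed (simp_all add: split_var_const split_var_var)

lemma vars_in_split_var:
  assumes "vars_in (insert v V) f"
  shows "vars_in V (coeff (split_var v f) i)"
proof -
  define C where "C p \<longleftrightarrow> (\<forall>i. vars_in V (coeff p i))" for p :: "('a, 'b) mpoly poly"
  have [intro]: "C (p + q)" "C (p * q)" if "C p" "C q" for p q
    using that unfolding C_def by (auto simp: coeff_mult intro!: vars_in_add vars_in_sum vars_in_mult)
  have [simp]: "C 0" by (simp add: C_def)
  have C0: "C [:c:]" if "vars_in V c" for c
    using that by (simp add: C_def coeff_pCons split: nat.split)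
  have C1: "C 1" using C0[of 1] by (simp add: one_pCons)
  have Cs: "C (\<Sum>i\<in>A. F i)" if "\<And>i. i \<in> A \<Longrightarrow> C (F i)" for F and A :: "'z set"
    using that by (induction A rule: infinite_finite_induct) auto
  have Cp: "C (\<Prod>i\<in>A. F i)" if "\<And>i. i \<in> A \<Longrightarrow> C (F i)" for F and A :: "'z set"
    using that by (induction A rule: infinite_finite_induct) (auto simp: C1)
  have Cpow: "C (p ^ k)" if "C p" for p k
    using that by (induction k) (auto simp: C1)
  have Cx: "C (if u = v then [:0, 1:] else [:poly_var u:])" if "u \<in> insert v V" for u
    using that C0[OF vars_in_var, of u] by (cases "u = v") (auto simp: C_def coeff_pCons vars_in_var split: nat.split)
  have "C (split_var v f)"
    unfolding split_var_def eval_poly_def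
    by (intro Cs Cp Cpow Cx C0 vars_in_const; (rule \<open>\<lbrakk>C _; C _\<rbrakk> \<Longrightarrow> C (_ * _)\<close>)?; 
        intro Cs Cp Cpow Cx C0 vars_in_const) (use assms in \<open>auto simp: vars_in_def\<close>)
  then show ?thesis by (simp add: C_def)
qed

lemma comm_ring_hom_map_poly:
  assumes "comm_ring_hom h"
  shows "comm_ring_hom (map_poly h)"
proof -
  interpret comm_ring_hom h by fact
  show ?thesis
    by unfold_locales
      (auto intro!: poly_eqI simp: coeff_map_poly coeff_mult hom_distribs map_poly_pCons one_pCons)
qed

lemma evl_update_split_var:
  "evl (x(v := \<xi>)) f = poly (map_poly (evl x) (split_var v f)) \<xi>"
proof (rule mpoly_hom_cong[of "evl (x(v := \<xi>))" "\<lambda>f. poly (map_poly (evl x) (split_var v f)) \<xi>" f])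
  interpret mp: comm_ring_hom "map_poly (evl x)"
    by (rule comm_ring_hom_map_poly[OF evl.comm_ring_hom_axioms])
  show "comm_ring_hom (\<lambda>f. poly (map_poly (evl x) (split_var v f)) \<xi>)"
    by (intro comm_ring_hom_comp[OF comm_ring_hom_poly] 
        comm_ring_hom_comp[OF mp.comm_ring_hom_axioms split_var.comm_ring_hom_axioms])
qed (simp_all add: evl.comm_ring_hom_axioms split_var_const split_var_var map_poly_pCons)

lemma alg_closed_infinite: "infinite (UNIV :: 'a::alg_closed_field set)"
proof
  assume fin: "finite (UNIV :: 'a set)"
  define p where "p = (\<Prod>a\<in>(UNIV::'a set). [:-a, 1:]) + 1"
  have ev: "poly p a = 1" for a
    unfolding p_def using fin by (simp add: poly_prod prod_zero_iff)
  have "degree (\<Prod>a\<in>(UNIV::'a set). [:-a, 1:]) = (\<Sum>a\<in>(UNIV::'a set). 1)"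
    by (subst degree_prod_eq_sum_degree) auto
  then have "degree (\<Prod>a\<in>(UNIV::'a set). [:-a, 1:]) > 0"
    using fin by (simp add: card_gt_0_iff)
  then have "degree p > 0" unfolding p_def by (subst degree_add_eq_left) auto
  then obtain a where "poly p a = 0" using alg_closed_imp_poly_has_root by blast
  then show False using ev by simp
qed

lemma poly_all_zero:
  fixes p :: "'a::field poly"
  assumes "infinite (UNIV :: 'a set)" "\<And>a. poly p a = 0"
  shows "p = 0"
  using poly_roots_finite[of p] assms by fastforce

text \<open>With one variable isolated, a univariate polynomial has infinitely many roots at every
  choice of the others, so its coefficients vanish at all points and the induction applies to
  them.\<close>

lemma mpoly_all_zero_vars:
  fixes f :: "('v, 'a::field) mpoly"
  assumes inf: "infinite (UNIV :: 'a set)"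
  shows "finite V \<Longrightarrow> vars_in V f \<Longrightarrow> (\<And>x. evl x f = 0) \<Longrightarrow> f = 0"
proof (induction V arbitrary: f rule: finite_induct)
  case empty
  then have "f = poly_const (Poly_Mapping.lookup f 0)" by (intro vars_in_empty)
  then show ?case using empty(2) by (metis evl_const poly_const.hom_zero)
next
  case (insert v V)
  have "map_poly (evl x) (split_var v f) = 0" for x
    by (rule poly_all_zero[OF inf]) (simp add: evl_update_split_var[symmetric] insert.prems)
  then have "coeff (map_poly (evl x) (split_var v f)) i = 0" for x i by simp
  then have "evl x (coeff (split_var v f) i) = 0" for x i
    by (simp add: coeff_map_poly)
  then have "coeff (split_var v f) i = 0" for i
    by (intro insert.IH vars_in_split_var insert.prems)
  then have "split_var v f = 0" by (intro poly_eqI) simp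
  then show ?case by (metis poly_split_var poly_0)
qed

lemma mpoly_all_zero:
  fixes f :: "('v, 'a::field) mpoly"
  assumes "infinite (UNIV :: 'a set)" "\<And>x. evl x f = 0"
  shows "f = 0"
proof (rule mpoly_all_zero_vars[OF assms(1), of "\<Union>m\<in>Poly_Mapping.keys f. Poly_Mapping.keys m"])
qed (auto simp: vars_in_def assms)

lemma mpoly_eqI:
  fixes f g :: "('v, 'a::field) mpoly"
  assumes "infinite (UNIV :: 'a set)" "\<And>x. evl x f = evl x g"
  shows "f = g"
  using mpoly_all_zero[of "f - g"] assms by (simp add: hom_distribs)

section \<open>Ideals\<close>

text \<open>Ideals of a ring that is a whole type, so that no carrier conditions arise; ideals of
  \<open>chart_ring I\<close> are moved here by \<open>pull\<close>.\<close>

definition is_ideal :: "'b::comm_ring_1 set \<Rightarrow> bool" where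
  "is_ideal J \<longleftrightarrow> 0 \<in> J \<and> (\<forall>a\<in>J. \<forall>b\<in>J. a + b \<in> J) \<and> (\<forall>a\<in>J. \<forall>c. c * a \<in> J)"

definition is_prime :: "'b::comm_ring_1 set \<Rightarrow> bool" where
  "is_prime P \<longleftrightarrow> is_ideal P \<and> 1 \<notin> P \<and> (\<forall>a b. a * b \<in> P \<longrightarrow> a \<in> P \<or> b \<in> P)"

lemma ideal_zero: "is_ideal J \<Longrightarrow> 0 \<in> J"
  by (simp add: is_ideal_def)

lemma ideal_add: "is_ideal J \<Longrightarrow> a \<in> J \<Longrightarrow> b \<in> J \<Longrightarrow> a + b \<in> J"
  by (simp add: is_ideal_def)

lemma ideal_mult: "is_ideal J \<Longrightarrow> a \<in> J \<Longrightarrow> c * a \<in> J"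
  by (simp add: is_ideal_def)

lemma ideal_mult_right: "is_ideal J \<Longrightarrow> a \<in> J \<Longrightarrow> a * c \<in> J"
  using ideal_mult[of J a c] by (simp add: mult.commute)

lemma ideal_uminus: "is_ideal J \<Longrightarrow> a \<in> J \<Longrightarrow> - a \<in> J"
  using ideal_mult[of J a "-1"] by simp

lemma ideal_diff: "is_ideal J \<Longrightarrow> a \<in> J \<Longrightarrow> b \<in> J \<Longrightarrow> a - b \<in> J"
  using ideal_add[of J a "- b"] ideal_uminus[of J b] by simp

lemma ideal_sum: "is_ideal J \<Longrightarrow> (\<And>i. i \<in> A \<Longrightarrow> F i \<in> J) \<Longrightarrow> (\<Sum>i\<in>A. F i) \<in> J"
  by (induction A rule: infinite_finite_induct) (simp_all add: ideal_zero ideal_add)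

lemma ideal_diff_iff: "is_ideal J \<Longrightarrow> a - b \<in> J \<Longrightarrow> a \<in> J \<longleftrightarrow> b \<in> J"
  using ideal_add[of J "a - b" b] ideal_diff[of J a "a - b"] by auto

lemma ideal_diff_mult:
  assumes "is_ideal J" "a - a' \<in> J" "b - b' \<in> J"
  shows "a * b - a' * b' \<in> J"
proof -
  have "a * b - a' * b' = (a - a') * b + a' * (b - b')" by (simp add: algebra_simps)
  then show ?thesis
    using assms by (simp add: ideal_add ideal_mult ideal_mult_right)
qed

lemma ideal_diff_sum:
  assumes "is_ideal J" "\<And>i. i \<in> A \<Longrightarrow> F i - G i \<in> J"
  shows "(\<Sum>i\<in>A. F i) - (\<Sum>i\<in>A. G i) \<in> J"
  using ideal_sum[OF assms(1), of A "\<lambda>i. F i - G i"] assms(2) by (simp add: sum_subtractf)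

lemma ideal_diff_prod:
  assumes "is_ideal J" "\<And>i. i \<in> A \<Longrightarrow> F i - G i \<in> J"
  shows "(\<Prod>i\<in>A. F i) - (\<Prod>i\<in>A. G i) \<in> J"
  using assms(2)
  by (induction A rule: infinite_finite_induct) (simp_all add: ideal_zero[OF assms(1)] ideal_diff_mult[OF assms(1)])

lemma ideal_diff_power:
  assumes "is_ideal J" "a - b \<in> J"
  shows "a ^ k - b ^ k \<in> J"
  using assms(2)
  by (induction k) (simp_all add: ideal_zero[OF assms(1)] ideal_diff_mult[OF assms(1)])

lemma prime_ideal: "is_prime P \<Longrightarrow> is_ideal P"
  by (simp add: is_prime_def)

lemma prime_one: "is_prime P \<Longrightarrow> 1 \<notin> P"
  by (simp add: is_prime_def)

lemma prime_mult_iff: "is_prime P \<Longrightarrow> a * b \<in> P \<longleftrightarrow> a \<in> P \<or> b \<in> P"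
proof
  assume "is_prime P" "a * b \<in> P"
  then show "a \<in> P \<or> b \<in> P" unfolding is_prime_def by blast
next
  assume "is_prime P" "a \<in> P \<or> b \<in> P"
  then show "a * b \<in> P"
    using ideal_mult[of P b a] ideal_mult_right[of P a b] by (auto simp: prime_ideal)
qed

lemma prime_prod_iff: "is_prime P \<Longrightarrow> finite A \<Longrightarrow> (\<Prod>i\<in>A. F i) \<in> P \<longleftrightarrow> (\<exists>i\<in>A. F i \<in> P)"
proof -
  assume P: "is_prime P" and "finite A"
  show ?thesis
    using \<open>finite A\<close> P by (induction A rule: finite_induct) (auto simp: prime_mult_iff prime_one)
qed

lemma prime_power: "is_prime P \<Longrightarrow> a ^ k \<in> P \<Longrightarrow> a \<in> P"
  by (induction k) (auto simp: prime_mult_iff prime_one)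

lemma ideal_hull:
  assumes "is_ideal J"
  shows "is_ideal {j + c * a | j c. j \<in> J}" (is "is_ideal ?K")
  unfolding is_ideal_def
proof (intro conjI ballI allI)
  show "0 \<in> ?K" using ideal_zero[OF assms] by (auto intro!: exI[of _ 0])
next
  fix x y assume "x \<in> ?K" "y \<in> ?K"
  then obtain j c j' c' where "x = j + c * a" "y = j' + c' * a" "j \<in> J" "j' \<in> J" by auto
  then have "x + y = (j + j') + (c + c') * a" "j + j' \<in> J"
    using ideal_add[OF assms] by (simp_all add: algebra_simps)
  then show "x + y \<in> ?K" by blast
next
  fix x d assume "x \<in> ?K"
  then obtain j c where "x = j + c * a" "j \<in> J" by auto
  then have "d * x = d * j + (d * c) * a" "d * j \<in> J"
    using ideal_mult[OF assms, of j d] by (auto simp: algebra_simps)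
  then show "d * x \<in> ?K" by blast
qed

text \<open>Krull's argument: an ideal maximal among those containing \<open>J\<close> and missing
  \<open>M\<close> is prime, because adjoining either factor of a product in the ideal would meet
  \<open>M\<close>, and multiplying the two witnesses would put an element of \<open>M\<close> into
  the ideal.\<close>

lemma exists_prime_avoiding:
  assumes J: "is_ideal J" and one: "1 \<in> M"
    and mult: "\<And>a b. a \<in> M \<Longrightarrow> b \<in> M \<Longrightarrow> a * b \<in> M" and disj: "J \<inter> M = {}"
  shows "\<exists>P. is_prime P \<and> J \<subseteq> P \<and> P \<inter> M = {}"
proof -
  define \<A> where "\<A> = {K. is_ideal K \<and> J \<subseteq> K \<and> K \<inter> M = {}}"
  have "\<exists>P\<in>\<A>. \<forall>X\<in>\<A>. P \<subseteq> X \<longrightarrow> X = P"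
  proof (rule subset_Zorn_nonempty)
    show "\<A> \<noteq> {}" using J disj by (auto simp: \<A>_def)
    fix \<C> assume C: "\<C> \<noteq> {}" "subset.chain \<A> \<C>"
    then have sub: "K \<in> \<C> \<Longrightarrow> K \<in> \<A>" for K by (auto simp: subset.chain_def)
    have tot: "K \<subseteq> L \<or> L \<subseteq> K" if "K \<in> \<C>" "L \<in> \<C>" for K L
      using C(2) that by (auto simp: subset.chain_def)
    have "is_ideal (\<Union>\<C>)"
      unfolding is_ideal_def
    proof (intro conjI ballI allI)
      show "0 \<in> \<Union>\<C>" using C(1) sub ideal_zero by (auto simp: \<A>_def)
    next
      fix a b assume "a \<in> \<Union>\<C>" "b \<in> \<Union>\<C>"
      then obtain K L where KL: "a \<in> K" "b \<in> L" "K \<in> \<C>" "L \<in> \<C>" by auto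
      from tot[OF KL(3,4)] obtain N where "N \<in> \<C>" "a \<in> N" "b \<in> N" using KL by auto
      then have "a + b \<in> N" using ideal_add sub by (auto simp: \<A>_def)
      then show "a + b \<in> \<Union>\<C>" using \<open>N \<in> \<C>\<close> by blast
    next
      fix a c assume "a \<in> \<Union>\<C>"
      then obtain N where "N \<in> \<C>" "a \<in> N" by auto
      then have "c * a \<in> N" using ideal_mult sub by (auto simp: \<A>_def)
      then show "c * a \<in> \<Union>\<C>" using \<open>N \<in> \<C>\<close> by blast
    qed
    then show "\<Union>\<C> \<in> \<A>" using sub C(1) by (auto simp: \<A>_def)
  qed
  then obtain P where P: "is_ideal P" "J \<subseteq> P" "P \<inter> M = {}"
    and max: "\<And>X. is_ideal X \<Longrightarrow> J \<subseteq> X \<Longrightarrow> X \<inter> M = {} \<Longrightarrow> P \<subseteq> X \<Longrightarrow> X = P"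
    by (auto simp: \<A>_def)
  have meets: "\<exists>j\<in>P. \<exists>c. j + c * a \<in> M" if "a \<notin> P" for a
  proof (rule ccontr)
    assume no: "\<not> ?thesis"
    let ?K = "{j + c * a | j c. j \<in> P}"
    have "P \<subseteq> ?K"
    proof
      fix j assume "j \<in> P"
      moreover have "j = j + 0 * a" by simp
      ultimately show "j \<in> ?K" by blast
    qed
    moreover have "?K \<inter> M = {}" using no by auto
    ultimately have "?K = P" using P(2) by (intro max ideal_hull P(1)) auto
    moreover have "a \<in> ?K" using ideal_zero[OF P(1)] by (intro CollectI exI[of _ 0] exI[of _ 1]) simp
    ultimately show False using that by simp
  qed
  have "a \<in> P \<or> b \<in> P" if ab: "a * b \<in> P" for a b
  proof (rule ccontr)
    assume "\<not> ?thesis"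
    then obtain j c j' c' where *: "j \<in> P" "j' \<in> P" "j + c * a \<in> M" "j' + c' * b \<in> M"
      using meets by blast
    have "(j + c * a) * (j' + c' * b) = (j' + c' * b) * j + (c * a) * j' + (c * c') * (a * b)"
      by (simp add: algebra_simps)
    also have "\<dots> \<in> P" by (intro ideal_add[OF P(1)] ideal_mult[OF P(1)] * ab)
    finally show False using mult[OF *(3,4)] P(3) by auto
  qed
  then have "is_prime P" using P one by (auto simp: is_prime_def)
  then show ?thesis using P by blast
qed

section \<open>A Nullstellensatz for prime ideals\<close>

definition coeffs_in :: "'v set \<Rightarrow> ('v, 'a::comm_ring_1) mpoly poly \<Rightarrow> bool" where
  "coeffs_in V q \<longleftrightarrow> (\<forall>i. vars_in V (coeff q i))"

lemma coeffs_in_add: "coeffs_in V p \<Longrightarrow> coeffs_in V q \<Longrightarrow> coeffs_in V (p + q)"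
  by (simp add: coeffs_in_def vars_in_add)

lemma vars_in_uminus: "vars_in V f \<Longrightarrow> vars_in V (- f :: ('v, 'a::comm_ring_1) mpoly)"
  by (simp add: vars_in_def)

lemma vars_in_diff: "vars_in V f \<Longrightarrow> vars_in V g \<Longrightarrow> vars_in V (f - g :: ('v, 'a::comm_ring_1) mpoly)"
  using vars_in_add[of V f "- g"] vars_in_uminus[of V g] by simp

lemma coeffs_in_diff: "coeffs_in V p \<Longrightarrow> coeffs_in V q \<Longrightarrow> coeffs_in V (p - q)"
  by (simp add: coeffs_in_def vars_in_diff)

lemma coeffs_in_mult: "coeffs_in V p \<Longrightarrow> coeffs_in V q \<Longrightarrow> coeffs_in V (p * q)"
  by (auto simp: coeffs_in_def coeff_mult intro!: vars_in_sum vars_in_mult)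

lemma coeffs_in_smult: "vars_in V c \<Longrightarrow> coeffs_in V q \<Longrightarrow> coeffs_in V (smult c q)"
  by (auto simp: coeffs_in_def intro!: vars_in_mult)

lemma coeffs_in_split_var: "vars_in (insert v V) f \<Longrightarrow> coeffs_in V (split_var v f)"
  by (simp add: coeffs_in_def vars_in_split_var)

lemma vars_in_poly:
  assumes "coeffs_in V q" "vars_in (insert v V) y"
  shows "vars_in (insert v V) (poly q y)"
  unfolding poly_altdef
  by (intro vars_in_sum vars_in_mult vars_in_power assms(2) vars_in_mono[OF subset_insertI])
    (use assms(1) in \<open>simp add: coeffs_in_def\<close>)

text \<open>Division by a polynomial that is not monic works after multiplication by a power of its
  leading coefficient. The bound on the degree of the quotient \<open>t\<close> is what lets the
  Euclidean step in \<open>extend_zero\<close> contradict minimality.\<close>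

lemma pseudo_division:
  fixes p q :: "('v, 'a::comm_ring_1) mpoly poly"
  assumes p: "coeffs_in V p" "degree p > 0" and q: "coeffs_in V q"
  shows "\<exists>N t r. smult (lead_coeff p ^ N) q = t * p + r \<and> coeffs_in V t \<and> coeffs_in V r \<and>
    degree r < degree p \<and> degree t \<le> degree q - degree p \<and> (degree q < degree p \<longrightarrow> t = 0)"
  using q
proof (induction "degree q" arbitrary: q rule: less_induct)
  case less
  show ?case
  proof (cases "degree q < degree p")
    case True
    then show ?thesis using less.prems
      by (intro exI[of _ "0::nat"] exI[of _ "0 :: ('v, 'a) mpoly poly"] exI[of _ q] conjI impI)
        (simp_all add: coeffs_in_def)
  next
    case False
    define k where "k = degree q - degree p"
    define m where "m = monom (lead_coeff q) k"
    define q' where "q' = smult (lead_coeff p) q - m * p"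
    have m: "coeffs_in V m" using less.prems by (auto simp: m_def coeffs_in_def)
    have aV: "vars_in V (lead_coeff p)" using p(1) by (simp add: coeffs_in_def)
    have q': "coeffs_in V q'"
      unfolding q'_def by (rule coeffs_in_diff[OF coeffs_in_smult[OF aV less.prems] coeffs_in_mult[OF m p(1)]])
    have "coeff q' i = 0" if "i \<ge> degree q" for i
    proof (cases "i = degree q")
      case True
      have "i - k = degree p" "k \<le> i" using False True by (auto simp: k_def)
      then have "coeff (m * p) i = lead_coeff q * lead_coeff p"
        unfolding m_def coeff_monom_mult by simp
      then show ?thesis unfolding q'_def using True by simp
    next
      case F: False
      then have "degree q < i" "degree p < i - k" using that False by (auto simp: k_def)
      then have "coeff q i = 0" "coeff p (i - k) = 0" by (simp_all add: coeff_eq_0)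
      then show ?thesis unfolding q'_def m_def by (simp add: coeff_monom_mult)
    qed
    then have deg: "degree q' < degree q"
      using False p(2) by (intro degree_lessI) auto
    obtain N t r where *: "smult (lead_coeff p ^ N) q' = t * p + r" "coeffs_in V t" "coeffs_in V r"
      "degree r < degree p" "degree t \<le> degree q' - degree p"
      using less.hyps[OF deg q'] by (elim exE conjE)
    have "smult (lead_coeff p ^ Suc N) q = (t + smult (lead_coeff p ^ N) m) * p + r"
    proof -
      have "q' + m * p = smult (lead_coeff p) q" by (simp add: q'_def)
      then have "smult (lead_coeff p ^ Suc N) q = smult (lead_coeff p ^ N) (q' + m * p)"
        by (simp only: smult_smult power_Suc2)
      also have "\<dots> = t * p + r + smult (lead_coeff p ^ N) (m * p)" 
        by (simp only: smult_add_right *(1))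
      also have "\<dots> = (t + smult (lead_coeff p ^ N) m) * p + r"
        by (simp only: distrib_right mult_smult_left add.assoc add.commute[of r])
      finally show ?thesis .
    qed
    moreover have "coeffs_in V (t + smult (lead_coeff p ^ N) m)"
      by (rule coeffs_in_add[OF *(2) coeffs_in_smult[OF vars_in_power[OF aV] m]])
    moreover have "degree (t + smult (lead_coeff p ^ N) m) \<le> degree q - degree p"
    proof (rule degree_add_le)
      show "degree t \<le> degree q - degree p" using *(5) deg by simp
      show "degree (smult (lead_coeff p ^ N) m) \<le> degree q - degree p"
        using order_trans[OF degree_smult_le degree_monom_le] unfolding m_def k_def .
    qed
    ultimately show ?thesis using *(3,4) False by blast
  qed
qed

text \<open>Leading terms with coefficient in \<open>P\<close> are deleted until one survives; each
  deletion changes the value at \<open>y\<close> by an element of \<open>P\<close>. Degrees modulo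
  \<open>P\<close> can then be treated as ordinary degrees.\<close>

lemma drop_leading_terms:
  fixes q :: "('v, 'a::comm_ring_1) mpoly poly"
  assumes P: "is_ideal P" and q: "coeffs_in V q" "coeff q i \<notin> P"
  shows "\<exists>q'. coeffs_in V q' \<and> degree q' \<le> degree q \<and> lead_coeff q' \<notin> P \<and> poly q' y - poly q y \<in> P"
  using q
proof (induction "degree q" arbitrary: q rule: less_induct)
  case less
  show ?case
  proof (cases "lead_coeff q \<in> P")
    case False
    then show ?thesis using less.prems ideal_zero[OF P] by (intro exI[of _ q]) simp
  next
    case True
    define q' where "q' = q - monom (lead_coeff q) (degree q)"
    have i: "i \<noteq> degree q" using True less.prems by auto
    then have ci: "coeff q' i = coeff q i" by (simp add: q'_def)
    have cz: "coeff q' j = 0" if "j \<ge> degree q" for j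
      using that by (cases "j = degree q") (auto simp: q'_def coeff_eq_0)
    have "coeff q i \<noteq> 0" using less.prems(2) ideal_zero[OF P] by auto
    then have "i < degree q" using i le_degree[of q i] by simp
    then have deg: "degree q' < degree q"
      using cz by (intro degree_lessI) auto
    have "coeffs_in V q'"
      using less.prems by (auto simp: q'_def coeffs_in_def intro!: vars_in_diff)
    from less.hyps[OF deg this] obtain q'' where **: "coeffs_in V q''" "degree q'' \<le> degree q'"
      "lead_coeff q'' \<notin> P" "poly q'' y - poly q' y \<in> P"
      using ci less.prems(2) by auto
    have "poly q'' y - poly q y = (poly q'' y - poly q' y) - lead_coeff q * y ^ degree q"
      by (simp add: q'_def poly_monom)
    also have "\<dots> \<in> P" by (rule ideal_diff[OF P **(4) ideal_mult_right[OF P True]])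
    finally show ?thesis using ** deg by (intro exI[of _ q'']) simp
  qed
qed

lemma poly_in_ideal: "is_ideal P \<Longrightarrow> (\<And>i. coeff q i \<in> P) \<Longrightarrow> poly q y \<in> P"
  unfolding poly_altdef by (intro ideal_sum ideal_mult_right)

text \<open>Inductive step of the Nullstellensatz. Modulo \<open>P\<close> the variable
  \<open>v\<close> is either transcendental or algebraic over the variables in \<open>V\<close>. In
  the first case a coefficient of \<open>f\<close> outside \<open>P\<close> serves as
  \<open>u\<close>; in the second, \<open>u\<close> must keep the leading coefficient of a minimal
  relation alive and force \<open>f\<close> to be nonzero at the root.\<close>

lemma extend_zero:
  fixes P :: "('v, 'a::alg_closed_field) mpoly set"
  assumes P: "is_prime P" and v: "v \<notin> V" and f: "vars_in (insert v V) f" "f \<notin> P"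
  shows "\<exists>u. vars_in V u \<and> u \<notin> P \<and> (\<forall>x. (\<forall>g\<in>P. vars_in V g \<longrightarrow> evl x g = 0) \<and> evl x u \<noteq> 0 \<longrightarrow>
    (\<exists>\<xi>. (\<forall>g\<in>P. vars_in (insert v V) g \<longrightarrow> evl (x(v := \<xi>)) g = 0) \<and> evl (x(v := \<xi>)) f \<noteq> 0))"
proof -
  note I = prime_ideal[OF P]
  let ?X = "poly_var v :: ('v, 'a) mpoly"
  have vX: "vars_in (insert v V) ?X" by (rule vars_in_var) simp
  \<comment> \<open>The relations that \<open>v\<close> satisfies modulo \<open>P\<close> over the
    variables in \<open>V\<close>.\<close>
  define A where "A q \<longleftrightarrow> coeffs_in V q \<and> poly q ?X \<in> P" for q
  have A_split: "A (split_var v g)" if "g \<in> P" "vars_in (insert v V) g" for g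
    using that by (simp add: A_def coeffs_in_split_var poly_split_var)
  have ev: "evl (x(v := \<xi>)) g = poly (map_poly (evl x) (split_var v g)) \<xi>" for x \<xi> g
    by (rule evl_update_split_var)
  obtain i0 where i0: "coeff (split_var v f) i0 \<notin> P"
    using poly_in_ideal[OF I, of "split_var v f" ?X] f(2) by (auto simp: poly_split_var)
  show ?thesis
  proof (cases "\<forall>q. A q \<longrightarrow> (\<forall>i. coeff q i \<in> P)")
    case True
    show ?thesis
    proof (rule exI[of _ "coeff (split_var v f) i0"], intro conjI allI impI)
      show "vars_in V (coeff (split_var v f) i0)" by (rule vars_in_split_var[OF f(1)])
      show "coeff (split_var v f) i0 \<notin> P" by (rule i0)
      fix x assume x: "(\<forall>g\<in>P. vars_in V g \<longrightarrow> evl x g = 0) \<and> evl x (coeff (split_var v f) i0) \<noteq> 0"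
      then have "map_poly (evl x) (split_var v f) \<noteq> 0"
        by (auto simp: coeff_map_poly dest!: arg_cong[of _ _ "\<lambda>p. coeff p i0"])
      then obtain \<xi> where \<xi>: "poly (map_poly (evl x) (split_var v f)) \<xi> \<noteq> 0"
        using poly_all_zero[OF alg_closed_infinite] by blast
      have "evl (x(v := \<xi>)) g = 0" if g: "g \<in> P" "vars_in (insert v V) g" for g
      proof -
        have "evl x (coeff (split_var v g) i) = 0" for i
          using x True A_split[OF g] vars_in_split_var[OF g(2)] by blast
        then have "map_poly (evl x) (split_var v g) = 0" by (intro poly_eqI) (simp add: coeff_map_poly)
        then show ?thesis by (simp add: ev)
      qed
      then show "\<exists>\<xi>. (\<forall>g\<in>P. vars_in (insert v V) g \<longrightarrow> evl (x(v := \<xi>)) g = 0) \<and> evl (x(v := \<xi>)) f \<noteq> 0"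
        using \<xi> by (intro exI[of _ \<xi>]) (simp add: ev)
    qed
  next
    case False
    define B where "B q \<longleftrightarrow> A q \<and> lead_coeff q \<notin> P" for q
    have A_drop: "\<exists>q'. B q' \<and> degree q' \<le> degree q" if asm: "A q" "coeff q i \<notin> P" for q i
    proof -
      obtain q' where q': "coeffs_in V q'" "degree q' \<le> degree q" "lead_coeff q' \<notin> P" 
        "poly q' ?X - poly q ?X \<in> P"
        using drop_leading_terms[OF I _ asm(2), of V ?X] asm(1) unfolding A_def by blast
      then have "poly q' ?X \<in> P" using asm(1) ideal_diff_iff[OF I] unfolding A_def by blast
      then show ?thesis using q' unfolding A_def B_def by blast
    qed
    obtain p where p: "B p" and p_min: "\<And>q. B q \<Longrightarrow> degree p \<le> degree q"
    proof -
      obtain q i where "A q" "coeff q i \<notin> P" using False by blast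
      then obtain q' where "B q'" using A_drop by blast
      then show ?thesis using ex_has_least_nat[of B q' degree] that by blast
    qed
    have small: "coeff q i \<in> P" if asm: "A q" "degree q < degree p" for q i
    proof (rule ccontr)
      assume "coeff q i \<notin> P"
      then obtain q' where "B q'" "degree q' \<le> degree q" using A_drop[OF asm(1)] by blast
      then show False using p_min[of q'] asm(2) by simp
    qed
    have pd: "degree p > 0"
    proof (rule ccontr)
      assume "\<not> ?thesis"
      then obtain c where "p = [:c:]" using degree_eq_zeroE[of p] by auto
      then show False using p by (auto simp: A_def B_def)
    qed
    let ?a = "lead_coeff p"
    have pV: "coeffs_in V p" "poly p ?X \<in> P" "?a \<notin> P" using p by (auto simp: A_def B_def)
    have aV: "vars_in V ?a" using pV(1) by (simp add: coeffs_in_def)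
    have rem: "\<exists>N t r. smult (?a ^ N) q = t * p + r \<and> coeffs_in V t \<and> coeffs_in V r \<and> degree r < degree p \<and>
       ?a ^ N * poly q ?X - poly r ?X \<in> P" if asm: "coeffs_in V q" for q
    proof -
      obtain N t r where *: "smult (?a ^ N) q = t * p + r" "coeffs_in V t" "coeffs_in V r" "degree r < degree p"
        using pseudo_division[OF pV(1) pd asm] by (elim exE conjE)
      have "?a ^ N * poly q ?X = poly (smult (?a ^ N) q) ?X" by simp
      also have "\<dots> = poly t ?X * poly p ?X + poly r ?X" unfolding *(1) by simp
      finally have "?a ^ N * poly q ?X - poly r ?X = poly t ?X * poly p ?X" by simp
      then have "?a ^ N * poly q ?X - poly r ?X \<in> P" using ideal_mult[OF I pV(2)] by simp
      with * show ?thesis by blast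
    qed
    \<comment> \<open>Polynomials in \<open>v\<close> that are multiples of \<open>f\<close> modulo
      \<open>P\<close>. A member of least degree turns out to be free of \<open>v\<close>: it shows
      \<open>f\<close> to be invertible modulo \<open>P\<close> up to a factor from the variables in
      \<open>V\<close>.\<close>
    define D where "D q \<longleftrightarrow> coeffs_in V q \<and> lead_coeff q \<notin> P \<and> 
      (\<exists>w. vars_in (insert v V) w \<and> poly q ?X - w * f \<in> P)" for q
    have D_drop: "\<exists>q'. D q' \<and> degree q' \<le> degree q" 
      if asm: "coeffs_in V q" "coeff q i \<notin> P" "vars_in (insert v V) w" "poly q ?X - w * f \<in> P" for q i w
    proof -
      obtain q' where q': "coeffs_in V q'" "degree q' \<le> degree q" "lead_coeff q' \<notin> P" 
        "poly q' ?X - poly q ?X \<in> P"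
        using drop_leading_terms[OF I asm(1,2), of ?X] by blast
      have "poly q' ?X - w * f \<in> P" using ideal_add[OF I q'(4) asm(4)] by simp
      then show ?thesis using q' asm(3) unfolding D_def by blast
    qed
    have "\<exists>q. D q \<and> degree q < degree p"
    proof -
      obtain N t r where *: "coeffs_in V r" "degree r < degree p" 
        "?a ^ N * poly (split_var v f) ?X - poly r ?X \<in> P"
        using rem[OF coeffs_in_split_var[OF f(1)]] by blast
      then have **: "?a ^ N * f - poly r ?X \<in> P" by (simp add: poly_split_var)
      have "?a ^ N * f \<notin> P" using pV(3) f(2) prime_power[OF P] by (auto simp: prime_mult_iff[OF P])
      then have "poly r ?X \<notin> P" using ** ideal_diff_iff[OF I] by blast
      then obtain i where i: "coeff r i \<notin> P" using poly_in_ideal[OF I] by blast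
      have "poly r ?X - ?a ^ N * f \<in> P" using ideal_uminus[OF I **] by simp
      then obtain q' where "D q'" "degree q' \<le> degree r"
        using D_drop[OF *(1) i] aV vars_in_mono[of V "insert v V" "?a ^ N"] vars_in_power by blast
      then show ?thesis using *(2) by (intro exI[of _ q']) simp
    qed
    then obtain q0 where q0: "D q0" "degree q0 < degree p" by blast
    obtain q where q: "D q" and q_min: "\<And>q'. D q' \<Longrightarrow> degree q \<le> degree q'"
      using ex_has_least_nat[of D q0 degree, OF q0(1)] by blast
    have qp: "degree q < degree p" using q_min[OF q0(1)] q0(2) by simp
    obtain w where qV: "coeffs_in V q" "lead_coeff q \<notin> P" and w: "vars_in (insert v V) w" "poly q ?X - w * f \<in> P"
      using q by (auto simp: D_def)
    \<comment> \<open>Divide the minimal relation \<open>p\<close> by \<open>q\<close>. The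
      remainder is again a multiple of \<open>f\<close>, so by minimality its coefficients lie in
      \<open>P\<close>; hence \<open>t * q\<close> vanishes modulo \<open>P\<close>, and as the
      degree of \<open>q\<close> is too small for a relation, \<open>t\<close> is one. Its degree is
      below that of \<open>p\<close> too, which forces the leading coefficient of \<open>p\<close>
      into \<open>P\<close>.\<close>
    have "degree q = 0"
    proof (rule ccontr)
      assume "degree q \<noteq> 0"
      then have "degree q > 0" by simp
      from pseudo_division[OF qV(1) this pV(1)] obtain N t r where *: "smult (lead_coeff q ^ N) p = t * q + r" "coeffs_in V t" "coeffs_in V r"
        "degree r < degree q" "degree t \<le> degree p - degree q"
        by (elim exE conjE)
      have td: "degree t < degree p" using *(5) \<open>degree q \<noteq> 0\<close> qp by simp
      have e: "lead_coeff q ^ N * poly p ?X = poly t ?X * poly q ?X + poly r ?X"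
        using arg_cong[OF *(1), of "\<lambda>z. poly z ?X"] by simp
      have rP: "coeff r i \<in> P" for i
      proof (rule ccontr)
        assume c: "coeff r i \<notin> P"
        have "poly r ?X - (- (poly t ?X * w)) * f = lead_coeff q ^ N * poly p ?X - poly t ?X * (poly q ?X - w * f)"
          unfolding e by (simp add: algebra_simps)
        also have "\<dots> \<in> P" by (rule ideal_diff[OF I ideal_mult[OF I pV(2)] ideal_mult[OF I w(2)]])
        finally have "poly r ?X - (- (poly t ?X * w)) * f \<in> P" .
        from D_drop[OF *(3) c vars_in_uminus[OF vars_in_mult[OF vars_in_poly[OF *(2) vX] w(1)]] this]
        obtain q' where "D q'" "degree q' \<le> degree r" by blast
        then show False using q_min[of q'] *(4) by simp
      qed
      have "poly t ?X * poly q ?X = lead_coeff q ^ N * poly p ?X - poly r ?X" using e by simp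
      also have "\<dots> \<in> P" by (rule ideal_diff[OF I ideal_mult[OF I pV(2)] poly_in_ideal[OF I rP]])
      finally have "poly t ?X \<in> P \<or> poly q ?X \<in> P" by (simp add: prime_mult_iff[OF P])
      moreover have "poly q ?X \<notin> P"
      proof
        assume "poly q ?X \<in> P"
        then have "A q" using qV(1) by (simp add: A_def)
        then show False using small[OF _ qp] qV(2) by blast
      qed
      ultimately have "A t" using *(2) by (simp add: A_def)
      then have tP: "coeff t i \<in> P" for i by (rule small[OF _ td])
      have "coeff (t * q + r) (degree p) \<in> P"
        unfolding coeff_add coeff_mult by (intro ideal_add[OF I] ideal_sum[OF I] ideal_mult_right[OF I] tP rP)
      then have "lead_coeff q ^ N * ?a \<in> P" unfolding *(1)[symmetric] coeff_smult .
      then have "lead_coeff q ^ N \<in> P \<or> ?a \<in> P" by (rule prime_mult_iff[OF P, THEN iffD1])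
      then have "lead_coeff q ^ N \<in> P" using pV(3) by (simp only: simp_thms)
      from prime_power[OF P this] show False using qV(2) by simp
    qed
    then obtain c where c: "q = [:c:]" by (rule degree_eq_zeroE)
    have cV: "vars_in V c" "c \<notin> P" "c - w * f \<in> P" 
      using qV w(2) spec[of _ 0, OF qV(1)[unfolded coeffs_in_def]] by (simp_all add: c)
    show ?thesis
    \<comment> \<open>If \<open>?a\<close> is nonzero at \<open>x\<close>, the degree of
      \<open>p\<close> is kept and there is a root; every relation reduces to zero modulo
      \<open>p\<close>, so the root gives a zero of \<open>P\<close>. If \<open>c\<close> is
      nonzero, so is \<open>f\<close>, because \<open>c - w * f\<close> lies in
      \<open>P\<close>.\<close>
    proof (rule exI[of _ "?a * c"], intro conjI allI impI)
      show "vars_in V (?a * c)" using aV cV by (intro vars_in_mult)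
      show "?a * c \<notin> P" using pV(3) cV by (simp add: prime_mult_iff[OF P])
      fix x assume "(\<forall>g\<in>P. vars_in V g \<longrightarrow> evl x g = 0) \<and> evl x (?a * c) \<noteq> 0"
      then have x: "\<And>g. g \<in> P \<Longrightarrow> vars_in V g \<Longrightarrow> evl x g = 0" and ax: "evl x ?a \<noteq> 0" "evl x c \<noteq> 0"
        by (auto simp: hom_distribs)
      have "degree (map_poly (evl x) p) = degree p" 
        by (rule map_poly_degree_eq) (rule ax(1))
      then obtain \<xi> where \<xi>: "poly (map_poly (evl x) p) \<xi> = 0"
        using pd alg_closed_imp_poly_has_root by metis
      have zero: "evl (x(v := \<xi>)) g = 0" if g: "g \<in> P" "vars_in (insert v V) g" for g
      proof -
        have sV: "coeffs_in V (split_var v g)" by (rule coeffs_in_split_var[OF g(2)])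
        obtain N t r where *: "smult (?a ^ N) (split_var v g) = t * p + r" "coeffs_in V t" "coeffs_in V r" "degree r < degree p"
          "?a ^ N * poly (split_var v g) ?X - poly r ?X \<in> P"
          using rem[OF sV] by blast
        have "?a ^ N * poly (split_var v g) ?X \<in> P" using g(1) by (auto simp: poly_split_var intro: ideal_mult[OF I])
        then have "A r" using *(3,5) ideal_diff_iff[OF I] by (auto simp: A_def)
        then have "coeff r i \<in> P" "vars_in V (coeff r i)" for i
          using small *(4) *(3) by (auto simp: coeffs_in_def)
        then have r0: "map_poly (evl x) r = 0" using x by (intro poly_eqI) (simp add: coeff_map_poly)
        interpret mp: comm_ring_hom "map_poly (evl x)"
          by (rule comm_ring_hom_map_poly[OF evl.comm_ring_hom_axioms])
        have "map_poly (evl x) ([:?a ^ N:] * split_var v g) = map_poly (evl x) t * map_poly (evl x) p"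
          using *(1) by (simp add: mp.hom_add mp.hom_mult r0)
        then have "poly (map_poly (evl x) ([:?a ^ N:] * split_var v g)) \<xi> = 0" by (simp add: \<xi>)
        then have "evl x ?a ^ N * poly (map_poly (evl x) (split_var v g)) \<xi> = 0"
          unfolding mp.hom_mult by (simp add: map_poly_pCons hom_distribs)
        then show ?thesis using ax(1) by (simp add: ev)
      qed
      have "evl (x(v := \<xi>)) (c - w * f) = 0"
        by (rule zero[OF cV(3) vars_in_diff[OF vars_in_mono[OF subset_insertI cV(1)] vars_in_mult[OF w(1) f(1)]]])
      moreover have "evl (x(v := \<xi>)) c = evl x c"
        by (rule evl_cong[OF cV(1)]) (use v in auto)
      ultimately have "evl (x(v := \<xi>)) f \<noteq> 0" using ax(2) by (auto simp: hom_distribs)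
      then show "\<exists>\<xi>. (\<forall>g\<in>P. vars_in (insert v V) g \<longrightarrow> evl (x(v := \<xi>)) g = 0) \<and> evl (x(v := \<xi>)) f \<noteq> 0"
        using zero by blast
    qed
  qed
qed

lemma nullstellensatz_vars:
  fixes P :: "('v, 'a::alg_closed_field) mpoly set"
  assumes P: "is_prime P"
  shows "finite V \<Longrightarrow> vars_in V u \<Longrightarrow> u \<notin> P \<Longrightarrow> \<exists>x. (\<forall>g\<in>P. vars_in V g \<longrightarrow> evl x g = 0) \<and> evl x u \<noteq> 0"
proof (induction V arbitrary: u rule: finite_induct)
  case empty
  have "evl (\<lambda>_. 0) g = 0" if "g \<in> P" "vars_in {} g" for g
  proof (rule ccontr)
    define c where "c = Poly_Mapping.lookup g 0"
    have g: "g = poly_const c" using vars_in_empty[OF that(2)] by (simp add: c_def)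
    assume "evl (\<lambda>_. 0) g \<noteq> 0"
    then have "c \<noteq> 0" by (simp add: g)
    then have "poly_const (inverse c) * g = 1" by (simp add: g poly_const.hom_mult[symmetric])
    then show False using ideal_mult[OF prime_ideal[OF P] that(1)] P unfolding is_prime_def by metis
  qed
  moreover have "evl (\<lambda>_. 0) u \<noteq> 0"
    using vars_in_empty[OF empty(1)] empty(2) ideal_zero[OF prime_ideal[OF P]] by (metis evl_const poly_const.hom_zero)
  ultimately show ?case by blast
next
  case (insert v V)
  then show ?case using extend_zero[OF P insert.hyps(2) insert.prems] insert.IH by blast
qed

lemma nullstellensatz:
  fixes P :: "('v::finite, 'a::alg_closed_field) mpoly set"
  assumes "is_prime P" "u \<notin> P"
  shows "\<exists>x. (\<forall>g\<in>P. evl x g = 0) \<and> evl x u \<noteq> 0"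
  using nullstellensatz_vars[OF assms(1), of UNIV u] assms(2) by simp

section \<open>Determinants of families\<close>

text \<open>Written for functions of two natural numbers so that minors arise by composing with
  arbitrary index maps, injective or not, and no dimensions have to be carried along.\<close>

definition dt :: "nat \<Rightarrow> (nat \<Rightarrow> nat \<Rightarrow> 'a::comm_ring_1) \<Rightarrow> 'a" where
  "dt r f = Determinant.det (Matrix.mat r r (\<lambda>(i, j). f i j))"

definition cf :: "nat \<Rightarrow> (nat \<Rightarrow> nat \<Rightarrow> 'a::comm_ring_1) \<Rightarrow> nat \<Rightarrow> nat \<Rightarrow> 'a" where
  "cf r f i j = cofactor (Matrix.mat r r (\<lambda>(i, j). f i j)) i j"

lemma mat_cong_dt:
  "(\<And>i j. i < r \<Longrightarrow> j < r \<Longrightarrow> f i j = g i j) \<Longrightarrow>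
    Matrix.mat r r (\<lambda>(i, j). f i j) = Matrix.mat r r (\<lambda>(i, j). g i j)"
  by (rule eq_matI) auto

lemma dt_cong: "(\<And>i j. i < r \<Longrightarrow> j < r \<Longrightarrow> f i j = g i j) \<Longrightarrow> dt r f = dt r g"
  unfolding dt_def using mat_cong_dt[of r f g] by presburger

lemma cf_cong_row:
  assumes "i < r" "j < r" "\<And>k l. k < r \<Longrightarrow> l < r \<Longrightarrow> k \<noteq> i \<Longrightarrow> f k l = g k l"
  shows "cf r f i j = cf r g i j"
proof -
  have "mat_delete (Matrix.mat r r (\<lambda>(i, j). f i j)) i j = mat_delete (Matrix.mat r r (\<lambda>(i, j). g i j)) i j"
    by (rule eq_matI) (use assms in \<open>auto simp: mat_delete_def\<close>)
  then show ?thesis by (simp add: cf_def cofactor_def)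
qed

lemma dt_row: "i < r \<Longrightarrow> dt r f = (\<Sum>j<r. f i j * cf r f i j)"
  unfolding dt_def cf_def by (subst laplace_expansion_row[of _ r i]) auto

lemma dt_row_update: "i < r \<Longrightarrow> dt r (f(i := v)) = (\<Sum>j<r. v j * cf r f i j)"
  by (subst dt_row[of i]) (auto intro!: sum.cong arg_cong2[of _ _ _ _ "(*)"] cf_cong_row)

lemma dt_identical_rows:
  assumes "i < r" "k < r" "i \<noteq> k" "\<And>j. j < r \<Longrightarrow> f i j = f k j"
  shows "dt r f = 0"
  unfolding dt_def
  by (rule Determinant.det_identical_rows[of _ r i k]) (use assms in \<open>auto simp: Matrix.row_def\<close>)

lemma adj_row:
  assumes "i < r" "k < r"
  shows "(\<Sum>j<r. f k j * cf r f i j) = (if k = i then dt r f else 0)"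
proof -
  have "(\<Sum>j<r. f k j * cf r f i j) = dt r (f(i := f k))" by (simp add: dt_row_update assms)
  also have "\<dots> = (if k = i then dt r f else 0)"
    using assms by (auto intro: dt_identical_rows[of i r k])
  finally show ?thesis .
qed

lemma adj_col:
  assumes "j < r" "l < r"
  shows "(\<Sum>i<r. f i l * cf r f i j) = (if l = j then dt r f else 0)"
proof -
  let ?A = "Matrix.mat r r (\<lambda>(i, j). f i j)"
  have A: "?A \<in> carrier_mat r r" by simp
  have "(adj_mat ?A * ?A) $$ (j, l) = (\<Sum>i<r. f i l * cf r f i j)"
    using assms by (simp add: scalar_prod_def adj_mat_def cf_def mult.commute atLeast0LessThan)
  moreover have "(adj_mat ?A * ?A) $$ (j, l) = (if l = j then dt r f else 0)"
    unfolding adj_mat(3)[OF A] using assms by (auto simp: dt_def)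
  ultimately show ?thesis by simp
qed

lemma dt_transpose: "dt r (\<lambda>i j. f j i) = dt r f"
proof -
  have "Matrix.mat r r (\<lambda>(i, j). f j i) = Matrix.transpose_mat (Matrix.mat r r (\<lambda>(i, j). f i j))"
    by (rule eq_matI) auto
  then show ?thesis unfolding dt_def by (simp add: Determinant.det_transpose[of _ r])
qed

lemma dt_hom:
  assumes "comm_ring_hom h"
  shows "h (dt r f) = dt r (\<lambda>i j. h (f i j))"
proof -
  interpret comm_ring_hom h by fact
  have "map_mat h (Matrix.mat r r (\<lambda>(i, j). f i j)) = Matrix.mat r r (\<lambda>(i, j). h (f i j))"
    by (rule eq_matI) auto
  then show ?thesis unfolding dt_def by (simp flip: hom_det)
qed

lemma cf_0_0: "cf (Suc m) f 0 0 = dt m (\<lambda>i j. f (Suc i) (Suc j))"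
proof -
  have "mat_delete (Matrix.mat (Suc m) (Suc m) (\<lambda>(i, j). f i j)) 0 0 = Matrix.mat m m (\<lambda>(i, j). f (Suc i) (Suc j))"
    by (rule eq_matI) (auto simp: mat_delete_def)
  then show ?thesis by (simp add: cf_def cofactor_def dt_def)
qed

lemma cf_last: "cf (Suc m) f m m = dt m f"
proof -
  have "mat_delete (Matrix.mat (Suc m) (Suc m) (\<lambda>(i, j). f i j)) m m = Matrix.mat m m (\<lambda>(i, j). f i j)"
    by (rule eq_matI) (auto simp: mat_delete_def)
  then show ?thesis by (simp add: cf_def cofactor_def dt_def)
qed

lemma cf_hom:
  assumes "comm_ring_hom h" "i < r" "j < r"
  shows "h (cf r f i j) = cf r (\<lambda>i j. h (f i j)) i j"
proof -
  interpret comm_ring_hom h by fact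
  let ?e = "\<lambda>l. if l = j then 1 else 0"
  have cfe: "cf r g i j = dt r (g(i := ?e))" for g :: "nat \<Rightarrow> nat \<Rightarrow> 'z::comm_ring_1"
  proof -
    have "(\<Sum>l<r. ?e l * cf r g i l) = (\<Sum>l<r. if l = j then cf r g i l else 0)"
      by (rule sum.cong) auto
    then show ?thesis using assms by (simp add: dt_row_update)
  qed
  show ?thesis unfolding cfe dt_hom[OF assms(1)] by (rule dt_cong) auto
qed

lemma dt_ideal_cong:
  assumes J: "is_ideal J" "\<And>i j. i < r \<Longrightarrow> j < r \<Longrightarrow> f i j - g i j \<in> J"
  shows "dt r f - dt r g \<in> J"
  unfolding dt_def Determinant.det_def
  using J(2)
  by (auto intro!: ideal_diff_sum[OF J(1)] ideal_diff_mult[OF J(1)] ideal_diff_prod[OF J(1)]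
      simp: ideal_zero[OF J(1)] permutes_in_image)

lemma dt_zero_iff:
  fixes f :: "nat \<Rightarrow> nat \<Rightarrow> 'a::idom"
  shows "dt r f = 0 \<longleftrightarrow> (\<exists>v. (\<exists>j<r. v j \<noteq> 0) \<and> (\<forall>i<r. (\<Sum>j<r. f i j * v j) = 0))"
proof -
  let ?A = "Matrix.mat r r (\<lambda>(i, j). f i j)"
  have "dt r f = 0 \<longleftrightarrow> (\<exists>v. v \<in> carrier_vec r \<and> v \<noteq> 0\<^sub>v r \<and> ?A *\<^sub>v v = 0\<^sub>v r)"
    unfolding dt_def by (rule det_0_iff_vec_prod_zero) simp
  also have "\<dots> \<longleftrightarrow> (\<exists>v. (\<exists>j<r. v j \<noteq> 0) \<and> (\<forall>i<r. (\<Sum>j<r. f i j * v j) = 0))"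
  proof (intro iffI; elim exE conjE)
    fix v assume v: "v \<in> carrier_vec r" "v \<noteq> 0\<^sub>v r" "?A *\<^sub>v v = 0\<^sub>v r"
    show "\<exists>v. (\<exists>j<r. v j \<noteq> 0) \<and> (\<forall>i<r. (\<Sum>j<r. f i j * v j) = 0)"
    proof (intro exI[of _ "\<lambda>j. Matrix.vec_index v j"] conjI allI impI)
      show "\<exists>j<r. Matrix.vec_index v j \<noteq> 0" using v(1,2) by (metis carrier_vecD eq_vecI index_zero_vec)
      fix i assume i: "i < r"
      have "Matrix.vec_index (?A *\<^sub>v v) i = 0" using v(3) i by simp
      then show "(\<Sum>j<r. f i j * Matrix.vec_index v j) = 0"
        using i v(1) by (simp add: scalar_prod_def atLeast0LessThan)
    qed
  next
    fix v j assume v: "j < r" "v j \<noteq> 0" "\<forall>i<r. (\<Sum>j<r. f i j * v j) = 0"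
    show "\<exists>v. v \<in> carrier_vec r \<and> v \<noteq> 0\<^sub>v r \<and> ?A *\<^sub>v v = 0\<^sub>v r"
    proof (intro exI[of _ "Matrix.vec r v"] conjI)
      show "Matrix.vec r v \<noteq> 0\<^sub>v r" using v(1,2) by (metis index_vec index_zero_vec(1))
      show "?A *\<^sub>v Matrix.vec r v = 0\<^sub>v r"
        by (rule eq_vecI) (use v(3) in \<open>auto simp: scalar_prod_def atLeast0LessThan\<close>)
    qed simp
  qed
  finally show ?thesis .
qed

text \<open>Multiplication by the adjugate. Combined with saturation it solves linear systems modulo
  an ideal whenever the determinant lies outside the prime.\<close>

lemma cramer_ideal:
  assumes J: "is_ideal J" and v: "\<And>i. i < r \<Longrightarrow> (\<Sum>j<r. f i j * v j) \<in> J" and l: "l < r"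
  shows "dt r f * v l \<in> J"
proof -
  have "(\<Sum>i<r. cf r f i l * (\<Sum>j<r. f i j * v j)) = (\<Sum>j<r. v j * (\<Sum>i<r. f i j * cf r f i l))"
    unfolding sum_distrib_left by (subst sum.swap) (simp add: mult_ac)
  also have "\<dots> = (\<Sum>j<r. if j = l then v j * dt r f else 0)"
    by (rule sum.cong) (use l in \<open>auto simp: adj_col\<close>)
  also have "\<dots> = dt r f * v l" using l by (simp add: mult.commute)
  finally show ?thesis
    using ideal_sum[OF J, of "{..<r}" "\<lambda>i. cf r f i l * (\<Sum>j<r. f i j * v j)"] v ideal_mult[OF J] by auto
qed

text \<open>If every bordering of a nonsingular minor by a new row from the family vanished, the cofactors
  of the new row would be a functional vanishing on the family.\<close>

lemma exists_nonsingular_selection: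
  fixes \<phi> :: "'q \<Rightarrow> nat \<Rightarrow> 'a::field"
  assumes sep: "\<And>D. (\<And>q. q \<in> Q \<Longrightarrow> (\<Sum>j<r. D j * \<phi> q j) = 0) \<Longrightarrow> (\<forall>j<r. D j = 0)"
  shows "\<exists>q. (\<forall>i<r. q i \<in> Q) \<and> dt r (\<lambda>i j. \<phi> (q i) j) \<noteq> 0"
proof -
  have "\<exists>q. (\<forall>i<m. q i \<in> Q) \<and> dt m (\<lambda>i j. \<phi> (q i) j) \<noteq> 0" if "m \<le> r" for m
    using that
  proof (induction m)
    case 0
    then show ?case by (simp add: dt_def)
  next
    case (Suc m)
    then obtain q where q: "\<forall>i<m. q i \<in> Q" "dt m (\<lambda>i j. \<phi> (q i) j) \<noteq> 0" by auto
    define D where "D j = (if j \<le> m then cf (Suc m) (\<lambda>i. \<phi> (q i)) m j else 0)" for j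
    have "D m \<noteq> 0" using q(2) by (simp add: D_def cf_last)
    then have nz: "\<not> (\<forall>j<r. D j = 0)" using Suc.prems by (auto intro!: exI[of _ m])
    have "\<exists>p\<in>Q. (\<Sum>j<r. D j * \<phi> p j) \<noteq> 0"
    proof (rule ccontr)
      assume "\<not> ?thesis"
      then have "\<forall>j<r. D j = 0" by (intro sep) simp
      then show False using nz by (rule notE[rotated])
    qed
    then obtain p where p: "p \<in> Q" "(\<Sum>j<r. D j * \<phi> p j) \<noteq> 0" by (elim bexE)
    have "(\<Sum>j<r. D j * \<phi> p j) = (\<Sum>j<Suc m. \<phi> p j * cf (Suc m) (\<lambda>i. \<phi> (q i)) m j)"
      using Suc.prems by (intro sum.mono_neutral_cong_right) (auto simp: D_def)
    also have "\<dots> = dt (Suc m) ((\<lambda>i. \<phi> (q i))(m := \<phi> p))" by (simp add: dt_row_update)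
    also have "(\<lambda>i. \<phi> (q i))(m := \<phi> p) = (\<lambda>i j. \<phi> ((q(m := p)) i) j)" by auto
    finally have "dt (Suc m) (\<lambda>i j. \<phi> ((q(m := p)) i) j) \<noteq> 0" using p(2) by simp
    moreover have "\<forall>i<Suc m. (q(m := p)) i \<in> Q" using q(1) p(1) by (auto simp: less_Suc_eq)
    ultimately show ?case by blast
  qed
  then show ?thesis by blast
qed

section \<open>Linear algebra\<close>

text \<open>A complement of the kernel inside \<open>S\<close> maps injectively and has the same
  image. The relative form is needed because matrices are restricted to the subspace
  \<open>W\<close>.\<close>

lemma rank_nullity:
  fixes f :: "'k::field ^ 'n::finite \<Rightarrow> 'k ^ 'm::finite"
  assumes f: "Vector_Spaces.linear (*s) (*s) f" and S: "vec.subspace S"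
  shows "vec.dim S = vec.dim (f ` S) + vec.dim {x \<in> S. f x = 0}"
proof -
  interpret f: Vector_Spaces.linear "(*s)" "(*s)" f by (rule f)
  let ?K = "{x \<in> S. f x = 0}"
  have K: "vec.subspace ?K"
    using S by (auto simp: vec.subspace_def f.zero f.add f.scale)
  obtain B0 where B0: "B0 \<subseteq> ?K" "vec.independent B0" "?K \<subseteq> vec.span B0" "card B0 = vec.dim ?K"
    using vec.basis_exists by blast
  obtain B where B: "B0 \<subseteq> B" "B \<subseteq> S" "vec.independent B" "S \<subseteq> vec.span B"
    using vec.maximal_independent_subset_extend[of B0 S] B0 by blast
  have finB: "finite B" using B(3) by (rule vec.finiteI_independent)
  let ?C = "vec.span (B - B0)"
  have spK: "vec.span B0 = ?K" using B0 K by (meson vec.span_minimal subset_antisym)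
  have CS: "?C \<subseteq> S" using B(2) S by (meson Diff_subset vec.span_minimal order_trans)
  have "inj_on f ?C"
  proof (subst f.inj_on_iff_eq_0)
    show "vec.subspace ?C" by (rule vec.subspace_span)
    show "\<forall>x\<in>?C. f x = 0 \<longrightarrow> x = 0"
    proof (intro ballI impI)
      fix x assume x: "x \<in> ?C" "f x = 0"
      then have "x \<in> vec.span B0" using spK CS by auto
      then obtain u where u: "x = (\<Sum>b\<in>B0. u b *s b)"
        using vec.span_finite[OF finite_subset[OF B(1) finB]] by auto
      obtain v where v: "x = (\<Sum>b\<in>B - B0. v b *s b)"
        using x(1) vec.span_finite[OF finite_Diff[OF finB, of B0]] by auto
      let ?w = "\<lambda>b. if b \<in> B0 then u b else - v b"
      have "(\<Sum>b\<in>B. ?w b *s b) = (\<Sum>b\<in>B - B0. ?w b *s b) + (\<Sum>b\<in>B0. ?w b *s b)"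
        by (rule sum.subset_diff[OF B(1) finB])
      also have "(\<Sum>b\<in>B0. ?w b *s b) = x" unfolding u by (rule sum.cong) auto
      also have "(\<Sum>b\<in>B - B0. ?w b *s b) = - x"
        unfolding v sum_negf[symmetric] by (rule sum.cong) (auto simp: vec.scale_minus_left)
      finally have "(\<Sum>b\<in>B. ?w b *s b) = 0" by simp
      from vec.independentD[OF B(3) finB subset_refl this] have "u b = 0" if "b \<in> B0" for b
        using that B(1) by (metis subsetD)
      then show "x = 0" by (simp add: u)
    qed
  qed
  then have d1: "vec.dim (f ` ?C) = vec.dim ?C" using vec.dim_image_eq[OF f, of "vec.span (B - B0)"]
    by (simp only: vec.span_span)
  have "f ` S = f ` ?C"
  proof
    show "f ` ?C \<subseteq> f ` S" using CS by auto
    have "S \<subseteq> vec.span (B0 \<union> (B - B0))" using B by (simp add: Un_absorb1)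
    show "f ` S \<subseteq> f ` ?C"
    proof
      fix y assume "y \<in> f ` S"
      then obtain x where x: "x \<in> S" "y = f x" by auto
      have "x \<in> vec.span (B0 \<union> (B - B0))" using x B by (auto simp: Un_absorb1)
      then obtain a b where ab: "x = a + b" "a \<in> vec.span B0" "b \<in> ?C"
        unfolding vec.span_Un by blast
      then show "y \<in> f ` ?C" using x spK by (auto simp: f.add)
    qed
  qed
  moreover have "vec.dim ?C = card B - card B0"
    using vec.independent_mono[OF B(3), of "B - B0"] B(1) finB
    by (simp add: vec.dim_eq_card_independent card_Diff_subset finite_subset)
  moreover have "vec.dim S = card B" using vec.basis_card_eq_dim[OF B(2,4,3)] by simp
  moreover have "card B0 \<le> card B" using B(1) finB by (rule card_mono[rotated])
  ultimately show ?thesis using d1 B0(4) by simp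
qed

definition ann :: "('k::field ^ 'n::finite) set \<Rightarrow> ('k ^ 'n) set" where
  "ann Y = {v. \<forall>y\<in>Y. scalar_product y v = 0}"

lemma scalar_product_add_right: "scalar_product x (y + z) = scalar_product x y + scalar_product x z"
  by (simp add: scalar_product_def distrib_left sum.distrib)

lemma scalar_product_diff_right: "scalar_product x (y - z) = scalar_product x y - scalar_product x (z :: 'k::field ^ 'n::finite)"
  by (simp add: scalar_product_def right_diff_distrib sum_subtractf)

lemma scalar_product_scale_right: "scalar_product x (c *s y) = c * scalar_product x (y :: 'k::field ^ 'n::finite)"
  by (simp add: scalar_product_def sum_distrib_left mult_ac)

lemma scalar_product_commute: "scalar_product x y = scalar_product (y :: 'k::field ^ 'n::finite) x"
  by (simp add: scalar_product_def mult.commute)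

lemma scalar_product_zero_right [simp]: "scalar_product x 0 = (0 :: 'k::field)"
  by (simp add: scalar_product_def)

lemma subspace_ann: "vec.subspace (ann Y)"
  by (auto simp: vec.subspace_def ann_def scalar_product_add_right scalar_product_scale_right)

lemma dim_supported:
  "vec.dim {v :: 'k::field ^ 'n::finite. \<forall>i. i \<notin> I \<longrightarrow> v $ i = 0} = card I"
proof (rule vec.dim_unique[of "(\<lambda>i. axis i 1) ` I"])
  show "(\<lambda>i. axis i (1::'k)) ` I \<subseteq> {v. \<forall>i. i \<notin> I \<longrightarrow> v $ i = 0}" by (auto simp: axis_def)
  show "{v :: 'k ^ 'n. \<forall>i. i \<notin> I \<longrightarrow> v $ i = 0} \<subseteq> vec.span ((\<lambda>i. axis i 1) ` I)"
  proof
    fix v :: "'k ^ 'n" assume v: "v \<in> {v. \<forall>i. i \<notin> I \<longrightarrow> v $ i = 0}"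
    have "v = (\<Sum>i\<in>I. v $ i *s axis i 1)"
      unfolding Finite_Cartesian_Product.vec_eq_iff
    proof
      fix j
      have "(\<Sum>i\<in>I. v $ i *s axis i 1) $ j = (\<Sum>i\<in>I. if i = j then v $ i else 0)"
        unfolding sum_component by (rule sum.cong) (auto simp: axis_def)
      then show "v $ j = (\<Sum>i\<in>I. v $ i *s axis i 1) $ j" using v by (auto simp: axis_def)
    qed
    also have "\<dots> \<in> vec.span ((\<lambda>i. axis i 1) ` I)"
      by (intro vec.span_sum vec.span_scale vec.span_base) auto
    finally show "v \<in> vec.span ((\<lambda>i. axis i 1) ` I)" .
  qed
  show "vec.independent ((\<lambda>i. axis i (1::'k)) ` I)"
    by (rule vec.independent_mono[OF vec.independent_Basis]) (auto simp: cart_basis_def)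
  show "card ((\<lambda>i. axis i (1::'k)) ` I) = card I"
    by (rule card_image) (simp add: inj_on_def axis_eq_axis)
qed

text \<open>Pairing with a basis that extends one of \<open>Y\<close> is an automorphism of the
  whole space; it carries \<open>ann Y\<close> to the vectors supported on the indices of the added
  basis elements.\<close>

lemma dim_ann:
  fixes Y :: "('k::field ^ 'n::finite) set"
  assumes Y: "vec.subspace Y"
  shows "vec.dim (ann Y) = CARD('n) - vec.dim Y"
proof -
  obtain B0 where B0: "B0 \<subseteq> Y" "vec.independent B0" "Y \<subseteq> vec.span B0" "card B0 = vec.dim Y"
    by (rule vec.basis_exists[of Y])
  obtain B where B: "B0 \<subseteq> B" "vec.independent B" "UNIV \<subseteq> vec.span B"
    by (rule vec.maximal_independent_subset_extend[OF subset_UNIV B0(2)])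
  have finB: "finite B" using B(2) by (rule vec.finiteI_independent)
  have "card B = CARD('n)"
    using vec.basis_card_eq_dim[of B UNIV] B by (simp add: vec.dim_UNIV card_cart_basis)
  then obtain b :: "'n \<Rightarrow> 'k ^ 'n" where b: "bij_betw b UNIV B"
    using finite_same_card_bij[of "UNIV :: 'n set" B] finB by auto
  define I where "I = {i. b i \<in> B0}"
  have bI: "b ` I = B0" using b B(1) by (auto simp: I_def bij_betw_def)
  have cI: "card I = vec.dim Y" using card_image[of b I] b bI B0(4) by (auto simp: bij_betw_def inj_on_def)
  define f where "f v = (\<chi> i. scalar_product (b i) v)" for v
  have lf: "Vector_Spaces.linear (*s) (*s) f"
    by (unfold_locales) (auto simp: f_def Finite_Cartesian_Product.vec_eq_iff scalar_product_add_right scalar_product_scale_right)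
  have zero: "v = 0" if "\<And>i. scalar_product (b i) v = 0" for v
  proof -
    have "scalar_product x v = 0" if "x \<in> vec.span B" for x
      using that
    proof (induction rule: vec.span_induct_alt)
      case base then show ?case by (simp add: scalar_product_def)
    next
      case (step c x y)
      have "scalar_product x v = 0" using step(1) b \<open>\<And>i. scalar_product (b i) v = 0\<close> by (auto simp: bij_betw_def)
      then show ?case using step(2)
        by (simp add: scalar_product_commute[of _ v] scalar_product_add_right scalar_product_scale_right)
    qed
    then have "scalar_product (axis i 1) v = 0" for i using B(3) by auto
    then show ?thesis
      by (auto simp: Finite_Cartesian_Product.vec_eq_iff scalar_product_def axis_def if_distrib[of "\<lambda>x. x * _"] cong: if_cong)
  qed
  have inj: "inj f"
  proof (rule injI)
    fix x y assume e: "f x = f y"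
    have "scalar_product (b i) (x - y) = 0" for i
      using e by (simp add: f_def Finite_Cartesian_Product.vec_eq_iff scalar_product_diff_right)
    from zero[OF this] show "x = y" by simp
  qed
  have surj: "surj f" using vec.linear_inj_imp_surj[OF lf inj] .
  have annY: "ann Y = {v. \<forall>i\<in>I. scalar_product (b i) v = 0}"
  proof (intro equalityI subsetI)
    fix v assume "v \<in> ann Y" then show "v \<in> {v. \<forall>i\<in>I. scalar_product (b i) v = 0}"
      using B0(1) bI by (auto simp: ann_def)
  next
    fix v assume v: "v \<in> {v. \<forall>i\<in>I. scalar_product (b i) v = 0}"
    have "scalar_product x v = 0" if "x \<in> vec.span B0" for x
      using that
    proof (induction rule: vec.span_induct_alt)
      case base then show ?case by (simp add: scalar_product_def)
    next
      case (step c x y)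
      then show ?case using v bI
        by (auto simp: scalar_product_commute[of _ v] scalar_product_add_right scalar_product_scale_right)
    qed
    then show "v \<in> ann Y" using B0(3) by (auto simp: ann_def)
  qed
  have "f ` ann Y = {v. \<forall>i. i \<notin> - I \<longrightarrow> v $ i = 0}"
  proof (intro equalityI subsetI)
    fix y assume "y \<in> f ` ann Y" then show "y \<in> {v. \<forall>i. i \<notin> - I \<longrightarrow> v $ i = 0}"
      by (auto simp: annY f_def)
  next
    fix y :: "'k ^ 'n" assume y: "y \<in> {v. \<forall>i. i \<notin> - I \<longrightarrow> v $ i = 0}"
    obtain x where "y = f x" using surj by auto
    then show "y \<in> f ` ann Y" using y by (auto simp: annY f_def)
  qed
  then have "vec.dim (f ` ann Y) = card (- I)" by (simp only: dim_supported)
  moreover have "vec.dim (f ` ann Y) = vec.dim (ann Y)"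
    using vec.dim_image_eq[OF lf, of "ann Y"] inj by (auto simp: inj_on_def)
  ultimately show ?thesis by (simp add: cI Compl_eq_Diff_UNIV card_Diff_subset)
qed

lemma dependent_family:
  fixes w :: "nat \<Rightarrow> 'k::field ^ 'n::finite"
  assumes "\<And>j. j < m \<Longrightarrow> w j \<in> Y" "vec.dim Y < m"
  shows "\<exists>c. (\<exists>j<m. c j \<noteq> 0) \<and> (\<Sum>j<m. c j *s w j) = 0"
proof (cases "inj_on w {..<m}")
  case False
  then obtain i j where ij: "i < m" "j < m" "i \<noteq> j" "w i = w j" by (auto simp: inj_on_def)
  define c :: "nat \<Rightarrow> 'k" where "c l = (if l = i then 1 else if l = j then -1 else 0)" for l
  have "(\<Sum>l<m. c l *s w l) = (\<Sum>l\<in>{i,j}. c l *s w l)"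
    by (rule sum.mono_neutral_right) (use ij in \<open>auto simp: c_def\<close>)
  also have "\<dots> = 0" using ij by (simp add: c_def vec.scale_minus_left)
  finally show ?thesis using ij by (intro exI[of _ c]) (auto simp: c_def)
next
  case True
  have "vec.dependent (w ` {..<m})"
  proof (rule ccontr)
    assume "\<not> ?thesis"
    then have "card (w ` {..<m}) \<le> vec.dim Y"
      using assms(1) by (intro vec.independent_card_le_dim) auto
    then show False using assms(2) True by (simp add: card_image)
  qed
  then obtain u where u: "\<exists>v\<in>w ` {..<m}. u v \<noteq> 0" "(\<Sum>v\<in>w ` {..<m}. u v *s v) = 0"
    unfolding vec.dependent_finite[OF finite_imageI[OF finite_lessThan]] by (elim exE conjE)
  have "(\<Sum>j<m. u (w j) *s w j) = (\<Sum>v\<in>w ` {..<m}. u v *s v)" by (simp only: sum.reindex[OF True] o_def)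
  then show ?thesis using u by (intro exI[of _ "\<lambda>j. u (w j)"]) auto
qed

lemma dt_family_zero:
  fixes w :: "nat \<Rightarrow> 'k::field ^ 'n::finite"
  assumes "\<And>j. j < m \<Longrightarrow> w j \<in> Y" "vec.dim Y < m"
  shows "dt m (\<lambda>i j. w j $ \<rho> i) = 0"
proof -
  obtain c where c: "\<exists>j<m. c j \<noteq> 0" "(\<Sum>j<m. c j *s w j) = 0"
  proof -
    have "\<exists>c. (\<exists>j<m. c j \<noteq> 0) \<and> (\<Sum>j<m. c j *s w j) = 0"
      by (rule dependent_family[of m w Y]) (use assms in auto)
    then obtain c where "(\<exists>j<m. c j \<noteq> 0) \<and> (\<Sum>j<m. c j *s w j) = 0" by (rule exE)
    then show thesis by (intro that[of c]) simp_all
  qed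
  have "(\<Sum>j<m. w j $ \<rho> i * c j) = 0" for i
    using arg_cong[OF c(2), of "\<lambda>v. v $ \<rho> i"] by (simp add: mult.commute)
  then show ?thesis unfolding dt_zero_iff using c(1) by (intro exI[of _ c]) simp
qed

section \<open>Reducedness of a localized quotient\<close>

text \<open>A fraction vanishes exactly if some element outside \<open>\<cc>\<close> multiplies its
  numerator into \<open>\<aa>\<close>, so reducedness of the local ring becomes a statement about
  elements of \<open>R\<close> alone. The case \<open>m = 0\<close> is vacuous:
  \<open>\<aa> \<subseteq> \<cc>\<close> keeps \<open>h\<close> out of \<open>\<aa>\<close>.\<close>

lemma (in cring) reduced_localization_iff:
  assumes a: "ideal \<aa> R" and c: "primeideal \<cc> R" and sub: "\<aa> \<subseteq> \<cc>"
  shows "reduced_ring (localization (R Quot \<aa>) (carrier (R Quot \<aa>) - (\<lambda>f. \<aa> +>\<^bsub>R\<^esub> f) ` \<cc>)) \<longleftrightarrow>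
    (\<forall>f\<in>carrier R. \<forall>h\<in>carrier R - \<cc>. \<forall>m::nat. h \<otimes> f [^] m \<in> \<aa> \<longrightarrow> (\<exists>h'\<in>carrier R - \<cc>. h' \<otimes> f \<in> \<aa>))"
proof -
  interpret a: ideal \<aa> R by fact
  interpret c: primeideal \<cc> R by fact
  let ?A = "R Quot \<aa>" and ?p = "\<lambda>f. \<aa> +> f"
  let ?S = "carrier ?A - ?p ` \<cc>"
  have carA: "carrier ?A = ?p ` carrier R"
    by (simp add: FactRing_def A_RCOSETS_def' UNION_singleton_eq_range)
  have zeroA: "\<zero>\<^bsub>?A\<^esub> = \<aa>" by (simp add: FactRing_def)
  interpret A: cring ?A by (rule a.quotient_is_cring[OF is_cring])
  interpret p: ring_hom_cring R ?A ?p
    by (rule a.rcos_ring_hom_cring[OF is_cring])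
  have zero: "?p f = \<zero>\<^bsub>?A\<^esub> \<longleftrightarrow> f \<in> \<aa>" if "f \<in> carrier R" for f
  proof
    assume "?p f = \<zero>\<^bsub>?A\<^esub>"
    then have "?p f = \<aa>" by (simp only: zeroA)
    then show "f \<in> \<aa>" using a.a_rcos_self[OF that] by simp
  next
    assume "f \<in> \<aa>"
    then show "?p f = \<zero>\<^bsub>?A\<^esub>" unfolding zeroA by (rule a.a_rcos_const)
  qed
  have S: "?p h \<in> ?S \<longleftrightarrow> h \<notin> \<cc>" if "h \<in> carrier R" for h
  proof -
    \<comment> \<open>Two representatives of a coset differ by an element of \<open>\<aa>\<close>,
      hence of \<open>\<cc>\<close>; so the complement of the image of \<open>\<cc>\<close> is the
      image of the complement.\<close>
    have "h \<in> \<cc>" if "c \<in> \<cc>" "?p h = ?p c" for c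
    proof -
      have cc: "c \<in> carrier R" using that c.Icarr by blast
      have "?p (h \<ominus> c) = \<zero>\<^bsub>?A\<^esub>"
        using that(2) cc \<open>h \<in> carrier R\<close> by (simp add: a_minus_def A.r_neg)
      then have "h \<ominus> c \<in> \<cc>" using zero cc \<open>h \<in> carrier R\<close> sub by auto
      then have "(h \<ominus> c) \<oplus> c \<in> \<cc>" using that(1) by (rule c.a_closed)
      then show ?thesis using cc \<open>h \<in> carrier R\<close> by (simp add: a_minus_def a_assoc l_neg)
    qed
    then show ?thesis using that by (auto simp: carA)
  qed
  have SE: "\<exists>h\<in>carrier R - \<cc>. X = ?p h" if "X \<in> ?S" for X
    using that by (auto simp: carA)
  define S where "S = ?S"
  have S1: "?p h \<in> S \<longleftrightarrow> h \<notin> \<cc>" if "h \<in> carrier R" for h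
    unfolding S_def by (rule S[OF that])
  have S2: "\<exists>h\<in>carrier R - \<cc>. X = ?p h" if "X \<in> S" for X
    using that unfolding S_def by (rule SE)
  have S3: "S \<subseteq> carrier ?A" unfolding S_def by (rule Diff_subset)
  have one_c: "\<one> \<notin> \<cc>"
  proof
    assume "\<one> \<in> \<cc>"
    then have "\<cc> = carrier R" by (rule c.one_imp_carrier)
    then show False using c.I_notcarr by simp
  qed
  interpret L: mult_subset ?A S
  proof (intro mult_subset.intro mult_subset_axioms.intro)
    show "cring ?A" by (rule A.is_cring)
    show "S \<subseteq> carrier ?A" by (rule S3)
    show "\<one>\<^bsub>?A\<^esub> \<in> S" using S1[OF one_closed] one_c p.hom_one by simp
    fix s t assume st: "s \<in> S" "t \<in> S"
    obtain h where h: "h \<in> carrier R - \<cc>" "s = ?p h" using S2[OF st(1)] by (rule bexE)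
    obtain k where k: "k \<in> carrier R - \<cc>" "t = ?p k" using S2[OF st(2)] by (rule bexE)
    have hk: "h \<in> carrier R" "k \<in> carrier R" "h \<notin> \<cc>" "k \<notin> \<cc>" using h k by simp_all
    have "h \<otimes> k \<notin> \<cc>" using c.I_prime[OF hk(1,2)] hk(3,4) by iprover
    then have "?p (h \<otimes> k) \<in> S" using S1[OF m_closed[OF hk(1,2)]] by simp
    then show "s \<otimes>\<^bsub>?A\<^esub> t \<in> S" unfolding h(2) k(2) by (simp only: p.hom_mult[OF hk(1,2)])
  qed
  let ?L = "localization ?A S"
  interpret L': cring ?L by (rule L.cring_localization)
  have pow: "frac ?A S x s [^]\<^bsub>?L\<^esub> m = frac ?A S (x [^]\<^bsub>?A\<^esub> m) (s [^]\<^bsub>?A\<^esub> m) \<and> s [^]\<^bsub>?A\<^esub> m \<in> S"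
    if x: "x \<in> carrier ?A" and s: "s \<in> S" for x s and m :: nat
  proof (induction m)
    case 0
    then show ?case using L.S_one by (simp add: localization_def)
  next
    case (Suc m)
    have "x [^]\<^bsub>?A\<^esub> m \<in> carrier ?A" by (rule A.nat_pow_closed[OF x])
    then have "frac ?A S (x [^]\<^bsub>?A\<^esub> m) (s [^]\<^bsub>?A\<^esub> m) \<otimes>\<^bsub>?L\<^esub> frac ?A S x s =
        frac ?A S (x [^]\<^bsub>?A\<^esub> m \<otimes>\<^bsub>?A\<^esub> x) (s [^]\<^bsub>?A\<^esub> m \<otimes>\<^bsub>?A\<^esub> s)"
      using Suc x s by (intro L.mult_frac) simp_all
    moreover have "s [^]\<^bsub>?A\<^esub> m \<otimes>\<^bsub>?A\<^esub> s \<in> S" using Suc s by (intro L.S_mult) simp_all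
    ultimately show ?case using Suc by (simp only: nat_pow_Suc monoid.nat_pow_Suc L'.nat_pow_Suc A.nat_pow_Suc)
  qed
  have fz: "frac ?A S x s = \<zero>\<^bsub>?L\<^esub> \<longleftrightarrow> (\<exists>u\<in>S. u \<otimes>\<^bsub>?A\<^esub> x = \<zero>\<^bsub>?A\<^esub>)"
    if x: "x \<in> carrier ?A" and s: "s \<in> S" for x s
  proof -
    have z: "\<zero>\<^bsub>?L\<^esub> = frac ?A S \<zero>\<^bsub>?A\<^esub> \<one>\<^bsub>?A\<^esub>" by (simp add: localization_def)
    have "u \<otimes>\<^bsub>?A\<^esub> (x \<otimes>\<^bsub>?A\<^esub> \<one>\<^bsub>?A\<^esub>) = u \<otimes>\<^bsub>?A\<^esub> (\<zero>\<^bsub>?A\<^esub> \<otimes>\<^bsub>?A\<^esub> s) \<longleftrightarrow> u \<otimes>\<^bsub>?A\<^esub> x = \<zero>\<^bsub>?A\<^esub>" if "u \<in> S" for u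
      using x L.S_carrier[OF s] L.S_carrier[OF that] by (simp only: A.r_one A.l_null A.r_null)
    then show ?thesis unfolding z L.frac_eq_iff[OF x A.zero_closed s L.S_one] by (simp cong: bex_cong)
  qed
  have key: "frac ?A S (?p f [^]\<^bsub>?A\<^esub> m) s = \<zero>\<^bsub>?L\<^esub> \<longleftrightarrow> (\<exists>h\<in>carrier R - \<cc>. h \<otimes> f [^] m \<in> \<aa>)"
    if f: "f \<in> carrier R" and s: "s \<in> S" for f s and m :: nat
  proof -
    have fm: "f [^] m \<in> carrier R" by (rule nat_pow_closed[OF f])
    have pn: "?p (f [^] m) = ?p f [^]\<^bsub>?A\<^esub> m"
      by (induction m) (simp_all add: f p.hom_mult[OF nat_pow_closed[OF f] f])
    have e: "?p h \<otimes>\<^bsub>?A\<^esub> (?p f [^]\<^bsub>?A\<^esub> m) = \<zero>\<^bsub>?A\<^esub> \<longleftrightarrow> h \<otimes> f [^] m \<in> \<aa>" if h: "h \<in> carrier R" for h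
    proof -
      have "?p h \<otimes>\<^bsub>?A\<^esub> (?p f [^]\<^bsub>?A\<^esub> m) = ?p (h \<otimes> f [^] m)"
        by (simp only: p.hom_mult[OF h fm] pn)
      then show ?thesis using zero[OF m_closed[OF h fm]] by (simp only:)
    qed
    have "(\<exists>u\<in>S. u \<otimes>\<^bsub>?A\<^esub> (?p f [^]\<^bsub>?A\<^esub> m) = \<zero>\<^bsub>?A\<^esub>) \<longleftrightarrow> (\<exists>h\<in>carrier R - \<cc>. h \<otimes> f [^] m \<in> \<aa>)"
    proof
      assume "\<exists>u\<in>S. u \<otimes>\<^bsub>?A\<^esub> (?p f [^]\<^bsub>?A\<^esub> m) = \<zero>\<^bsub>?A\<^esub>"
      then obtain u where u: "u \<in> S" "u \<otimes>\<^bsub>?A\<^esub> (?p f [^]\<^bsub>?A\<^esub> m) = \<zero>\<^bsub>?A\<^esub>" by (rule bexE)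
      obtain h where h: "h \<in> carrier R - \<cc>" "u = ?p h" using S2[OF u(1)] by (rule bexE)
      have hR: "h \<in> carrier R" using h(1) by simp
      have "h \<otimes> f [^] m \<in> \<aa>" using u(2) unfolding h(2) e[OF hR] .
      then show "\<exists>h\<in>carrier R - \<cc>. h \<otimes> f [^] m \<in> \<aa>" using h(1) by (rule bexI)
    next
      assume "\<exists>h\<in>carrier R - \<cc>. h \<otimes> f [^] m \<in> \<aa>"
      then obtain h where h: "h \<in> carrier R - \<cc>" "h \<otimes> f [^] m \<in> \<aa>" by (rule bexE)
      have hR: "h \<in> carrier R" "h \<notin> \<cc>" using h(1) by simp_all
      have "?p h \<otimes>\<^bsub>?A\<^esub> (?p f [^]\<^bsub>?A\<^esub> m) = \<zero>\<^bsub>?A\<^esub>" unfolding e[OF hR(1)] by (rule h(2))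
      moreover have "?p h \<in> S" using S1[OF hR(1)] hR(2) by simp
      ultimately show "\<exists>u\<in>S. u \<otimes>\<^bsub>?A\<^esub> (?p f [^]\<^bsub>?A\<^esub> m) = \<zero>\<^bsub>?A\<^esub>" by (rule bexI)
    qed
    then show ?thesis
      using fz[OF A.nat_pow_closed[OF p.hom_closed[OF f]] s] by (simp only:)
  qed
  have key1: "frac ?A S (?p f) s = \<zero>\<^bsub>?L\<^esub> \<longleftrightarrow> (\<exists>h\<in>carrier R - \<cc>. h \<otimes> f \<in> \<aa>)"
    if f: "f \<in> carrier R" and s: "s \<in> S" for f s
  proof -
    have "?p f [^]\<^bsub>?A\<^esub> Suc 0 = ?p f" "f [^] Suc 0 = f"
      by (simp_all add: f p.hom_closed[OF f])
    then show ?thesis using key[OF f s, of "Suc 0"] by (simp only:)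
  qed
  have "reduced_ring ?L \<longleftrightarrow> (\<forall>f\<in>carrier R. \<forall>h\<in>carrier R - \<cc>. \<forall>m::nat. h \<otimes> f [^] m \<in> \<aa> \<longrightarrow>
      (\<exists>h'\<in>carrier R - \<cc>. h' \<otimes> f \<in> \<aa>))"
  proof
    assume red: "reduced_ring ?L"
    show "\<forall>f\<in>carrier R. \<forall>h\<in>carrier R - \<cc>. \<forall>m::nat. h \<otimes> f [^] m \<in> \<aa> \<longrightarrow> (\<exists>h'\<in>carrier R - \<cc>. h' \<otimes> f \<in> \<aa>)"
    proof (intro ballI allI impI)
      fix f h and m :: nat assume *: "f \<in> carrier R" "h \<in> carrier R - \<cc>" "h \<otimes> f [^] m \<in> \<aa>"
      have pf: "?p f \<in> carrier ?A" by (rule p.hom_closed[OF *(1)])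
      have pw: "frac ?A S (?p f) \<one>\<^bsub>?A\<^esub> [^]\<^bsub>?L\<^esub> m = frac ?A S (?p f [^]\<^bsub>?A\<^esub> m) (\<one>\<^bsub>?A\<^esub> [^]\<^bsub>?A\<^esub> m)"
        "\<one>\<^bsub>?A\<^esub> [^]\<^bsub>?A\<^esub> m \<in> S" using pow[OF pf L.S_one, of m] by simp_all
      have "frac ?A S (?p f) \<one>\<^bsub>?A\<^esub> [^]\<^bsub>?L\<^esub> m = \<zero>\<^bsub>?L\<^esub>"
        unfolding pw(1) key[OF *(1) pw(2)] using *(3,2) by (rule bexI)
      then have "frac ?A S (?p f) \<one>\<^bsub>?A\<^esub> = \<zero>\<^bsub>?L\<^esub>"
        using red[unfolded reduced_ring_def, rule_format, OF L.frac_closed[OF pf L.S_one]] by iprover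
      then show "\<exists>h'\<in>carrier R - \<cc>. h' \<otimes> f \<in> \<aa>" unfolding key1[OF *(1) L.S_one] .
    qed
  next
    assume R: "\<forall>f\<in>carrier R. \<forall>h\<in>carrier R - \<cc>. \<forall>m::nat. h \<otimes> f [^] m \<in> \<aa> \<longrightarrow> (\<exists>h'\<in>carrier R - \<cc>. h' \<otimes> f \<in> \<aa>)"
    show "reduced_ring ?L"
      unfolding reduced_ring_def
    proof (intro ballI allI impI)
      fix x and m :: nat assume x: "x \<in> carrier ?L" "x [^]\<^bsub>?L\<^esub> m = \<zero>\<^bsub>?L\<^esub>"
      obtain X s where Xs: "x = frac ?A S X s" "X \<in> carrier ?A" "s \<in> S" using x(1) by (rule L.localizationE)
      obtain f where f: "X = ?p f" "f \<in> carrier R" using Xs(2) unfolding carA by (rule imageE)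
      have pf: "?p f \<in> carrier ?A" by (rule p.hom_closed[OF f(2)])
      have pw: "frac ?A S (?p f) s [^]\<^bsub>?L\<^esub> m = frac ?A S (?p f [^]\<^bsub>?A\<^esub> m) (s [^]\<^bsub>?A\<^esub> m)"
        "s [^]\<^bsub>?A\<^esub> m \<in> S" using pow[OF pf Xs(3), of m] by simp_all
      have "\<exists>h\<in>carrier R - \<cc>. h \<otimes> f [^] m \<in> \<aa>"
        using x(2) unfolding Xs(1) f(1) pw(1) key[OF f(2) pw(2)] .
      then obtain h where h: "h \<in> carrier R - \<cc>" "h \<otimes> f [^] m \<in> \<aa>" by (rule bexE)
      then have "\<exists>h'\<in>carrier R - \<cc>. h' \<otimes> f \<in> \<aa>" by (rule R[rule_format, OF f(2)])
      then show "x = \<zero>\<^bsub>?L\<^esub>" unfolding Xs(1) f(1) key1[OF f(2) Xs(3)[unfolded f(1)]] .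
    qed
  qed
  then show ?thesis unfolding S_def .
qed

section \<open>Determinants indexed by a finite type\<close>

text \<open>One fixed numbering of the type. Besides defining \<open>tdet\<close> it numbers the
  coordinates in \<open>kv\<close>, in the frames and in the special matrices, so that these can be
  written with explicit indices.\<close>

definition enum_type :: "nat \<Rightarrow> 'c::finite" where
  "enum_type = (SOME e. bij_betw e {..<CARD('c)} UNIV)"

lemma bij_enum_type: "bij_betw (enum_type :: nat \<Rightarrow> 'c::finite) {..<CARD('c)} UNIV"
proof -
  have "\<exists>e :: nat \<Rightarrow> 'c. bij_betw e {..<CARD('c)} UNIV"
    using finite_same_card_bij[of "{..<CARD('c)}" "UNIV :: 'c set"] by auto
  then show ?thesis unfolding enum_type_def by (rule someI_ex)
qed

definition type_index :: "'c::finite \<Rightarrow> nat" where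
  "type_index = inv_into {..<CARD('c)} enum_type"

lemma type_index_less: "type_index (p :: 'c::finite) < CARD('c)"
  using bij_betw_apply[OF bij_betw_inv_into[OF bij_enum_type], of p] by (simp add: type_index_def)

lemma enum_type_index [simp]: "enum_type (type_index p) = p"
  unfolding type_index_def using bij_enum_type by (intro f_inv_into_f) (auto simp: bij_betw_def)

lemma type_index_enum: "i < CARD('c) \<Longrightarrow> type_index (enum_type i :: 'c::finite) = i"
  unfolding type_index_def using bij_enum_type[where 'c='c] by (intro inv_into_f_f) (auto simp: bij_betw_def)

lemma sum_enum_type: "(\<Sum>i<CARD('c). F (enum_type i :: 'c::finite)) = (\<Sum>p\<in>UNIV. F p)"
  by (rule sum.reindex_bij_betw[OF bij_enum_type])

definition tdet :: "('c::finite \<Rightarrow> 'c \<Rightarrow> 'b::comm_ring_1) \<Rightarrow> 'b" where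
  "tdet f = dt CARD('c) (\<lambda>i j. f (enum_type i) (enum_type j))"

definition tcof :: "('c::finite \<Rightarrow> 'c \<Rightarrow> 'b::comm_ring_1) \<Rightarrow> 'c \<Rightarrow> 'c \<Rightarrow> 'b" where
  "tcof f p q = cf CARD('c) (\<lambda>i j. f (enum_type i) (enum_type j)) (type_index p) (type_index q)"

lemma tadj_col:
  fixes f :: "'c::finite \<Rightarrow> 'c \<Rightarrow> 'b::comm_ring_1"
  shows "(\<Sum>q\<in>UNIV. f q l * tcof f q j) = (if l = j then tdet f else 0)"
proof -
  have "(\<Sum>q\<in>UNIV. f q l * tcof f q j) = (\<Sum>i<CARD('c). f (enum_type i) l * tcof f (enum_type i) j)"
    by (rule sum_enum_type[symmetric])
  also have "\<dots> = (\<Sum>i<CARD('c). f (enum_type i) (enum_type (type_index l)) *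
      cf CARD('c) (\<lambda>i j. f (enum_type i) (enum_type j)) i (type_index j))"
    by (rule sum.cong) (auto simp: tcof_def type_index_enum)
  also have "\<dots> = (if type_index l = type_index j then tdet f else 0)"
    unfolding tdet_def by (rule adj_col) (auto simp: type_index_less)
  finally show ?thesis by (metis enum_type_index)
qed

lemma tdet_zeroI:
  fixes f :: "'c::finite \<Rightarrow> 'c \<Rightarrow> 'b::field"
  assumes "tdet f = 0"
  shows "\<exists>v. (\<exists>q. v q \<noteq> 0) \<and> (\<forall>p. (\<Sum>q\<in>UNIV. f p q * v q) = 0)"
proof -
  from assms obtain v where "\<exists>j<CARD('c). v j \<noteq> 0"
    and v: "\<And>i. i < CARD('c) \<Longrightarrow> (\<Sum>j<CARD('c). f (enum_type i) (enum_type j) * v j) = 0"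
    unfolding tdet_def dt_zero_iff by auto
  then obtain j where j: "j < CARD('c)" "v j \<noteq> 0" by blast
  have "(\<Sum>q\<in>UNIV. f p q * v (type_index q)) = 0" for p
  proof -
    have "(\<Sum>q\<in>UNIV. f p q * v (type_index q)) = (\<Sum>j<CARD('c). f p (enum_type j) * v (type_index (enum_type j :: 'c)))"
      by (rule sum_enum_type[symmetric])
    also have "\<dots> = (\<Sum>j<CARD('c). f (enum_type (type_index p)) (enum_type j) * v j)"
      by (rule sum.cong) (auto simp: type_index_enum)
    finally show ?thesis using v[OF type_index_less[of p]] by simp
  qed
  moreover have "v (type_index (enum_type j :: 'c)) \<noteq> 0" using j by (simp add: type_index_enum)
  ultimately show ?thesis by (intro exI[of _ "\<lambda>q. v (type_index q)"]) blast
qed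

lemma cf_as_dt:
  assumes "i < r" "j < r"
  shows "cf r f i j = dt r (f(i := \<lambda>l. if l = j then 1 else 0))"
proof -
  have "(\<Sum>l<r. (if l = j then 1 else 0) * cf r f i l) = (\<Sum>l<r. if l = j then cf r f i l else 0)"
    by (rule sum.cong) auto
  then show ?thesis using assms by (simp add: dt_row_update)
qed

lemma cf_ideal_cong:
  assumes J: "is_ideal J" "\<And>i j. i < r \<Longrightarrow> j < r \<Longrightarrow> f i j - g i j \<in> J" and "i < r" "j < r"
  shows "cf r f i j - cf r g i j \<in> J"
  unfolding cf_as_dt[OF assms(3,4)]
  by (rule dt_ideal_cong[OF J(1)]) (use J in \<open>auto simp: ideal_zero\<close>)

lemma tdet_hom: "comm_ring_hom h \<Longrightarrow> h (tdet f) = tdet (\<lambda>p q. h (f p q))"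
  by (simp add: tdet_def dt_hom)

lemma tcof_hom: "comm_ring_hom h \<Longrightarrow> h (tcof f p q) = tcof (\<lambda>p q. h (f p q)) p q"
  by (simp add: tcof_def cf_hom type_index_less)

lemma tdet_ideal_cong: "is_ideal J \<Longrightarrow> (\<And>p q. f p q - g p q \<in> J) \<Longrightarrow> tdet f - tdet g \<in> J"
  unfolding tdet_def by (rule dt_ideal_cong) auto

lemma tcof_ideal_cong: "is_ideal J \<Longrightarrow> (\<And>p q. f p q - g p q \<in> J) \<Longrightarrow> tcof f p q - tcof g p q \<in> J"
  unfolding tcof_def by (rule cf_ideal_cong) (auto simp: type_index_less)

section \<open>Charts of the Grassmannian\<close>

definition rowv :: "'c set \<Rightarrow> ('c \<times> 'c \<Rightarrow> 'k) \<Rightarrow> 'c \<Rightarrow> 'k::field ^ 'c::finite" where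
  "rowv I x a = (\<chi> p. chart_entry I x a p)"

lemma chart_plane_rowv: "chart_plane I x = vec.span (rowv I x ` I)"
  by (simp add: chart_plane_def rowv_def[abs_def])

lemma rowv_nth: "rowv I x a $ p = chart_entry I x a p"
  by (simp add: rowv_def)

lemma rowv_comb_nth:
  assumes "a \<in> I"
  shows "(\<Sum>b\<in>I. t b *s rowv I x b) $ a = t a"
proof -
  have "(\<Sum>b\<in>I. t b *s rowv I x b) $ a = (\<Sum>b\<in>I. if b = a then t b else 0)"
    unfolding sum_component by (rule sum.cong) (use assms in \<open>auto simp: rowv_nth chart_entry_def\<close>)
  then show ?thesis using assms by simp
qed

lemma inj_on_rowv: "inj_on (rowv I x :: _ \<Rightarrow> 'k::field ^ 'c::finite) I"
proof (rule inj_onI)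
  fix a b assume "a \<in> I" "b \<in> I" "(rowv I x a :: 'k ^ 'c) = rowv I x b"
  then have "(rowv I x a :: 'k ^ 'c) $ a = rowv I x b $ a" by simp
  then show "a = b" using \<open>a \<in> I\<close> by (auto simp: rowv_nth chart_entry_def split: if_splits)
qed

lemma chart_plane_iff: "z \<in> chart_plane I x \<longleftrightarrow> z = (\<Sum>a\<in>I. z $ a *s rowv I x a)"
proof
  assume "z \<in> chart_plane I x"
  then obtain u where "z = (\<Sum>v\<in>rowv I x ` I. u v *s v)"
    unfolding chart_plane_rowv vec.span_finite[OF finite_imageI[OF finite]] by auto
  then have z: "z = (\<Sum>a\<in>I. u (rowv I x a) *s rowv I x a)" by (simp add: sum.reindex[OF inj_on_rowv])
  then have "z $ a = u (rowv I x a)" if "a \<in> I" for a using rowv_comb_nth[OF that] by metis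
  then show "z = (\<Sum>a\<in>I. z $ a *s rowv I x a)" by (subst z) (rule sum.cong, auto)
next
  assume z: "z = (\<Sum>a\<in>I. z $ a *s rowv I x a)"
  show "z \<in> chart_plane I x" unfolding chart_plane_rowv
    by (subst z) (intro vec.span_sum vec.span_scale vec.span_base imageI)
qed

lemma rowv_in_chart_plane: "a \<in> I \<Longrightarrow> rowv I x a \<in> chart_plane I x"
  unfolding chart_plane_rowv by (intro vec.span_base imageI)

lemma comb_in_chart_plane: "(\<Sum>a\<in>I. t a *s rowv I x a) \<in> chart_plane I x"
  unfolding chart_plane_rowv by (intro vec.span_sum vec.span_scale vec.span_base imageI)

lemma subspace_chart_plane: "vec.subspace (chart_plane I x)"
  by (simp add: chart_plane_rowv)

lemma chart_plane_zero:
  assumes "z \<in> chart_plane I x" "\<And>a. a \<in> I \<Longrightarrow> z $ a = 0"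
  shows "z = 0"
proof -
  have "z = (\<Sum>a\<in>I. z $ a *s rowv I x a)" using assms(1) by (simp only: chart_plane_iff)
  also have "\<dots> = 0" using assms(2) by simp
  finally show ?thesis .
qed

lemma dim_chart_plane: "vec.dim (chart_plane I x :: ('k::field ^ 'c::finite) set) = card I"
proof -
  have "vec.independent (rowv I x ` I :: ('k ^ 'c) set)"
    unfolding vec.independent_explicit_finite_subsets
  proof (intro allI impI ballI)
    fix A and u :: "'k ^ 'c \<Rightarrow> 'k" and v assume A: "A \<subseteq> rowv I x ` I" "finite A" "(\<Sum>v\<in>A. u v *s v) = 0" "v \<in> A"
    then obtain a where a: "a \<in> I" "v = rowv I x a" by auto
    let ?t = "\<lambda>b. if rowv I x b \<in> A then u (rowv I x b) else 0"
    have "(\<Sum>b\<in>I. ?t b *s rowv I x b) = (\<Sum>w\<in>rowv I x ` I. (if w \<in> A then u w else 0) *s w)"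
      by (simp add: sum.reindex[OF inj_on_rowv])
    also have "\<dots> = (\<Sum>w\<in>A. u w *s w)"
      by (rule sum.mono_neutral_cong_right) (use A in auto)
    finally have "(\<Sum>b\<in>I. ?t b *s rowv I x b) = 0" by (simp only: A(3))
    then have "?t a = 0" using rowv_comb_nth[OF a(1), of ?t x] by (simp only: zero_index)
    then show "u v = 0" using a(2) A(4) by simp
  qed
  then show ?thesis
    by (simp add: chart_plane_rowv vec.dim_eq_card_independent card_image[OF inj_on_rowv])
qed

lemma chart_plane_in_grassmannian: "card I = d \<Longrightarrow> chart_plane I x \<in> grassmannian d"
  by (simp add: grassmannian_def dim_chart_plane subspace_chart_plane)

lemma chart_plane_inj:
  assumes "chart_plane I x = chart_plane I y" "a \<in> I" "p \<notin> I"
  shows "x (a, p) = (y (a, p) :: 'k::field)"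
proof -
  have "rowv I x a - rowv I y a \<in> chart_plane I y"
    using assms rowv_in_chart_plane by (metis subspace_chart_plane vec.subspace_diff)
  then have "rowv I x a - rowv I y a = 0"
    by (rule chart_plane_zero) (simp add: rowv_nth chart_entry_def)
  then have "rowv I x a $ p = rowv I y a $ p" by simp
  then show ?thesis using assms(3) by (simp add: rowv_nth chart_entry_def)
qed

lemma chart_plane_cong: "(\<And>a p. a \<in> I \<Longrightarrow> p \<notin> I \<Longrightarrow> x (a, p) = y (a, p)) \<Longrightarrow> chart_plane I x = chart_plane I y"
  unfolding chart_plane_rowv
  by (intro arg_cong[of _ _ vec.span] image_cong refl)
    (simp add: rowv_def chart_entry_def Finite_Cartesian_Product.vec_eq_iff)

text \<open>The coordinates of the chart form a minimal set of coordinates separating the points of the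
  subspace.\<close>

lemma exists_chart:
  fixes Q :: "('k::field ^ 'c::finite) set"
  assumes Q: "vec.subspace Q"
  shows "\<exists>I x. card I = vec.dim Q \<and> Q = chart_plane I x"
proof -
  define sep where "sep I \<longleftrightarrow> (\<forall>z\<in>Q. (\<forall>a\<in>I. z $ a = 0) \<longrightarrow> z = 0)" for I
  have "sep UNIV" by (auto simp: sep_def Finite_Cartesian_Product.vec_eq_iff)
  then obtain I where I: "sep I" and min: "\<And>J. sep J \<Longrightarrow> card I \<le> card J"
    using ex_has_least_nat[of sep UNIV card] by blast
  have "\<forall>a\<in>I. \<exists>q. q \<in> Q \<and> q $ a = 1 \<and> (\<forall>b\<in>I - {a}. q $ b = 0)"
  proof
    fix a assume a: "a \<in> I"
    have "\<not> sep (I - {a})" using min[of "I - {a}"] card_Diff1_less[OF finite a] by linarith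
    then obtain z where z: "z \<in> Q" "\<forall>b\<in>I - {a}. z $ b = 0" "z \<noteq> 0" by (auto simp: sep_def)
    then have "z $ a \<noteq> 0" using I by (auto simp: sep_def)
    then show "\<exists>q. q \<in> Q \<and> q $ a = 1 \<and> (\<forall>b\<in>I - {a}. q $ b = 0)" using z Q
      by (intro exI[of _ "inverse (z $ a) *s z"]) (simp add: vec.subspace_scale)
  qed
  from bchoice[OF this] obtain q where
    q0: "\<forall>a\<in>I. q a \<in> Q \<and> q a $ a = 1 \<and> (\<forall>b\<in>I - {a}. q a $ b = 0)" by (rule exE)
  then have q: "\<And>a. a \<in> I \<Longrightarrow> q a \<in> Q" "\<And>a. a \<in> I \<Longrightarrow> q a $ a = 1"
    "\<And>a b. a \<in> I \<Longrightarrow> b \<in> I \<Longrightarrow> b \<noteq> a \<Longrightarrow> q a $ b = 0" by simp_all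
  define x where "x = (\<lambda>(a, p). q a $ p)"
  have row: "rowv I x a = q a" if "a \<in> I" for a
    using q that by (auto simp: rowv_nth chart_entry_def x_def Finite_Cartesian_Product.vec_eq_iff)
  have "Q = chart_plane I x"
  proof
    show "chart_plane I x \<subseteq> Q" unfolding chart_plane_rowv
      by (rule vec.span_minimal[OF _ Q]) (simp add: image_subset_iff row q(1))
    show "Q \<subseteq> chart_plane I x"
    proof
      fix z assume z: "z \<in> Q"
      have "(\<Sum>a\<in>I. z $ a *s rowv I x a) \<in> Q"
        by (rule vec.subspace_sum[OF Q], rule vec.subspace_scale[OF Q]) (simp add: row q(1))
      then have "z - (\<Sum>a\<in>I. z $ a *s rowv I x a) \<in> Q"
        by (rule vec.subspace_diff[OF Q z])
      moreover have "(z - (\<Sum>a\<in>I. z $ a *s rowv I x a)) $ b = 0" if "b \<in> I" for b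
        by (simp only: vector_minus_component rowv_comb_nth[OF that]) simp
      ultimately have "z - (\<Sum>a\<in>I. z $ a *s rowv I x a) = 0" using I unfolding sep_def by blast
      then have "z = (\<Sum>a\<in>I. z $ a *s rowv I x a)" by (rule eq_iff_diff_eq_0[THEN iffD2])
      then show "z \<in> chart_plane I x" by (rule chart_plane_iff[THEN iffD2])
    qed
  qed
  moreover from this have "card I = vec.dim Q" using dim_chart_plane[of I x] by simp
  ultimately show ?thesis by blast
qed

text \<open>For a matrix with rows indexed by \<open>I\<close>, completed by unit rows to a square matrix, the
  chart coordinates of its row space are read off the inverse matrix.\<close>

definition complete_rows :: "'c set \<Rightarrow> ('c \<Rightarrow> 'c \<Rightarrow> 'b::comm_ring_1) \<Rightarrow> 'c \<Rightarrow> 'c \<Rightarrow> 'b" where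
  "complete_rows I M p q = (if p \<in> I then M p q else if p = q then 1 else 0)"

text \<open>With the columns in \<open>I\<close> first, the completed matrix has the block form (M1,
  M2; 0, 1), and the upper right block of its inverse is -M1^(-1) M2. This explains the minus
  sign.\<close>

lemma span_rows_chart:
  fixes M :: "'c::finite \<Rightarrow> 'c \<Rightarrow> 'k::field" and I :: "'c set"
  defines "G \<equiv> complete_rows I M"
  assumes d: "tdet G \<noteq> 0"
  shows "vec.span ((\<lambda>a. \<chi> p. M a p) ` I) = chart_plane I (\<lambda>(a, p). - tcof G p a / tdet G)"
proof -
  let ?y = "\<lambda>(a, p). - tcof G p a / tdet G"
  let ?r = "\<lambda>a. \<chi> p. M a p"
  have row: "rowv I ?y a = (\<Sum>b\<in>I. (tcof G b a / tdet G) *s ?r b)" if a: "a \<in> I" for a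
    unfolding Finite_Cartesian_Product.vec_eq_iff
  proof
    fix p
    have "(if p = a then tdet G else 0) = (\<Sum>q\<in>UNIV. G q p * tcof G q a)"
      by (rule tadj_col[symmetric])
    also have "\<dots> = (\<Sum>q\<in>I. G q p * tcof G q a) + (\<Sum>q\<in>-I. G q p * tcof G q a)"
      by (subst sum.union_disjoint[symmetric]) (auto simp: Un_absorb)
    also have "(\<Sum>q\<in>-I. G q p * tcof G q a) = (\<Sum>q\<in>-I. if q = p then tcof G p a else 0)"
      by (rule sum.cong) (auto simp: G_def complete_rows_def)
    also have "(\<Sum>q\<in>I. G q p * tcof G q a) = (\<Sum>q\<in>I. tcof G q a * M q p)"
      by (rule sum.cong) (auto simp: G_def complete_rows_def)
    finally have *: "(\<Sum>q\<in>I. tcof G q a * M q p) =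
        (if p = a then tdet G else 0) - (if p \<in> I then 0 else tcof G p a)"
      by simp
    have "(\<Sum>b\<in>I. (tcof G b a / tdet G) *s ?r b) $ p = (\<Sum>q\<in>I. tcof G q a * M q p) / tdet G"
      by (simp add: sum_component sum_divide_distrib)
    then show "rowv I ?y a $ p = (\<Sum>b\<in>I. (tcof G b a / tdet G) *s ?r b) $ p"
      unfolding * using d a by (auto simp: rowv_nth chart_entry_def)
  qed
  have sub: "chart_plane I ?y \<subseteq> vec.span (?r ` I)"
    unfolding chart_plane_rowv
  proof (rule vec.span_minimal[OF image_subsetI vec.subspace_span])
    fix a assume "a \<in> I"
    then show "rowv I ?y a \<in> vec.span (?r ` I)"
      unfolding row[OF \<open>a \<in> I\<close>] by (intro vec.span_sum vec.span_scale vec.span_base imageI)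
  qed
  have "vec.dim (vec.span (?r ` I)) \<le> card I"
    unfolding vec.dim_span
    by (rule order_trans[OF vec.dim_le_card[OF vec.span_superset finite_imageI[OF finite]] card_image_le[OF finite]])
  then have "vec.dim (vec.span (?r ` I)) \<le> vec.dim (chart_plane I ?y)" by (simp only: dim_chart_plane)
  then show ?thesis
    using vec.subspace_dim_equal[OF subspace_chart_plane vec.subspace_span sub] by simp
qed

text \<open>A kernel vector of the completed matrix is supported on \<open>I\<close> and orthogonal
  to all rows of \<open>M\<close>, hence to the rows of the chart; these are unit vectors on
  \<open>I\<close>, so the vector is zero.\<close>

lemma span_rows_tdet:
  fixes M :: "'c::finite \<Rightarrow> 'c \<Rightarrow> 'k::field"
  assumes "vec.span ((\<lambda>a. \<chi> p. M a p) ` I) = chart_plane I x"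
  shows "tdet (complete_rows I M) \<noteq> 0"
proof
  assume "tdet (complete_rows I M) = 0"
  then obtain v where v: "\<exists>q. v q \<noteq> 0" "\<And>p. (\<Sum>q\<in>UNIV. complete_rows I M p q * v q) = 0"
    by (blast dest: tdet_zeroI)
  have v0: "v p = 0" if "p \<notin> I" for p
    using v(2)[of p] that by (simp add: complete_rows_def if_distrib[of "\<lambda>x. x * _"] cong: if_cong)
  have "scalar_product (\<chi> q. v q) z = 0" if "z \<in> vec.span ((\<lambda>a. \<chi> p. M a p) ` I)" for z
    using that
  proof (induction rule: vec.span_induct_alt)
    case base then show ?case by simp
  next
    case (step c z y)
    then obtain a where a: "a \<in> I" "z = (\<chi> p. M a p)" by auto
    have "scalar_product (\<chi> q. v q) z = 0"
      using v(2)[of a] a by (simp add: complete_rows_def scalar_product_def mult.commute)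
    then show ?case using step(2) by (simp add: scalar_product_add_right scalar_product_scale_right)
  qed
  then have s: "scalar_product (\<chi> q. v q) (rowv I x a) = 0" if "a \<in> I" for a
    using rowv_in_chart_plane[OF that] assms by auto
  have "v a = 0" if a: "a \<in> I" for a
  proof -
    have "scalar_product (\<chi> q. v q) (rowv I x a) = (\<Sum>q\<in>UNIV. if q = a then v a else 0)"
      unfolding scalar_product_def
      by (rule sum.cong) (use v0 a in \<open>auto simp: rowv_nth chart_entry_def\<close>)
    then show ?thesis using s[OF a] by simp
  qed
  then show False using v(1) v0 by blast
qed

section \<open>Functions of one chart evaluated on row spaces, with denominators cleared\<close>

definition total_deg :: "('v, 'k::zero) mpoly \<Rightarrow> nat" where
  "total_deg f = (\<Sum>m\<in>Poly_Mapping.keys f. \<Sum>v\<in>Poly_Mapping.keys m. Poly_Mapping.lookup m v)"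

text \<open>The value of \<open>f\<close> at the row space of \<open>M\<close> in the chart
  \<open>I\<close>, multiplied by a power of the determinant so that it makes sense over any ring.
  One extra factor makes it vanish when the row space lies outside the chart.
  \<open>total_deg\<close> need not be sharp: it only has to bound the degree of every
  monomial.\<close>

definition chart_hom ::
  "'c set \<Rightarrow> ('k::zero \<Rightarrow> 'b::comm_ring_1) \<Rightarrow> ('c::finite \<times> 'c, 'k) mpoly \<Rightarrow> ('c \<Rightarrow> 'c \<Rightarrow> 'b) \<Rightarrow> 'b" where
  "chart_hom I h f M = tdet (complete_rows I M) *
     (\<Sum>m\<in>Poly_Mapping.keys f. h (Poly_Mapping.lookup f m) *
        tdet (complete_rows I M) ^ (total_deg f - (\<Sum>v\<in>Poly_Mapping.keys m. Poly_Mapping.lookup m v)) *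
        mono (\<lambda>(a, p). - tcof (complete_rows I M) p a) m)"

lemma chart_hom_field:
  fixes f :: "('c::finite \<times> 'c, 'k::field) mpoly"
  assumes "tdet (complete_rows I M) \<noteq> 0"
  shows "chart_hom I id f M = tdet (complete_rows I M) ^ Suc (total_deg f) *
    evl (\<lambda>(a, p). - tcof (complete_rows I M) p a / tdet (complete_rows I M)) f"
proof -
  let ?d = "tdet (complete_rows I M)"
  let ?y = "\<lambda>(a, p). - tcof (complete_rows I M) p a"
  have "?d ^ (total_deg f - (\<Sum>v\<in>Poly_Mapping.keys m. Poly_Mapping.lookup m v)) * mono ?y m =
      ?d ^ total_deg f * mono (\<lambda>v. ?y v / ?d) m" if m: "m \<in> Poly_Mapping.keys f" for m
  proof -
    let ?k = "\<Sum>v\<in>Poly_Mapping.keys m. Poly_Mapping.lookup m v"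
    have "?k \<le> total_deg f" unfolding total_deg_def by (rule member_le_sum[OF m]) auto
    then have "?d ^ total_deg f = ?d ^ (total_deg f - ?k) * ?d ^ ?k" by (simp flip: power_add)
    moreover have "mono ?y m = ?d ^ ?k * mono (\<lambda>v. ?y v / ?d) m"
      using assms unfolding mono_def power_sum prod.distrib[symmetric]
      by (intro prod.cong refl) (simp add: power_divide)
    ultimately show ?thesis by simp
  qed
  then have "(\<Sum>m\<in>Poly_Mapping.keys f. Poly_Mapping.lookup f m *
      ?d ^ (total_deg f - (\<Sum>v\<in>Poly_Mapping.keys m. Poly_Mapping.lookup m v)) * mono ?y m) =
      ?d ^ total_deg f * evl (\<lambda>v. ?y v / ?d) f"
    unfolding eval_poly_mono sum_distrib_left by (intro sum.cong) (auto simp: mult_ac)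
  moreover have "(\<lambda>v. ?y v / ?d) = (\<lambda>(a, p). - tcof (complete_rows I M) p a / ?d)" by auto
  ultimately show ?thesis by (simp add: chart_hom_def)
qed

lemma chart_hom_hom:
  assumes "comm_ring_hom \<phi>"
  shows "\<phi> (chart_hom I h f M) = chart_hom I (\<lambda>c. \<phi> (h c)) f (\<lambda>a p. \<phi> (M a p))"
proof -
  interpret comm_ring_hom \<phi> by fact
  have G: "(\<lambda>p q. \<phi> (complete_rows I M p q)) = complete_rows I (\<lambda>a p. \<phi> (M a p))"
    by (auto simp: complete_rows_def fun_eq_iff)
  have y: "(\<lambda>v. \<phi> (case v of (a, p) \<Rightarrow> - tcof (complete_rows I M) p a)) =
      (\<lambda>(a, p). - tcof (complete_rows I (\<lambda>a p. \<phi> (M a p))) p a)"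
    by (auto simp: fun_eq_iff hom_uminus tcof_hom[OF assms] G)
  show ?thesis
    unfolding chart_hom_def by (simp add: hom_distribs hom_mono tdet_hom[OF assms] G y)
qed

lemma chart_hom_ideal_cong:
  assumes J: "is_ideal J" and M: "\<And>a p. a \<in> I \<Longrightarrow> M a p - M' a p \<in> J"
  shows "chart_hom I h f M - chart_hom I h f M' \<in> J"
proof -
  have G: "complete_rows I M p q - complete_rows I M' p q \<in> J" for p q
    using M ideal_zero[OF J] by (simp add: complete_rows_def)
  have t: "(case v of (a, p) \<Rightarrow> - tcof (complete_rows I M) p a) -
      (case v of (a, p) \<Rightarrow> - tcof (complete_rows I M') p a) \<in> J" for v
    using ideal_uminus[OF J tcof_ideal_cong[of J "complete_rows I M" "complete_rows I M'" "snd v" "fst v", OF J G]]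
    by (cases v) simp
  show ?thesis
    unfolding chart_hom_def mono_def
    by (intro ideal_diff_mult[OF J] ideal_diff_sum[OF J] ideal_diff_power[OF J] ideal_diff_prod[OF J]
        tdet_ideal_cong[OF J] G t) (simp add: ideal_zero[OF J])
qed

section \<open>Zariski topology and generic points\<close>

definition chart_mask :: "'c set \<Rightarrow> ('c \<times> 'c \<Rightarrow> 'b::zero) \<Rightarrow> 'c \<times> 'c \<Rightarrow> 'b" where
  "chart_mask I x v = (if v \<in> I \<times> - I then x v else 0)"

text \<open>The type has a variable for every pair of coordinates; this is the retraction onto the
  chart ring that kills the surplus ones. Through it, ideals of the chart ring are handled as ideals
  of the whole polynomial type.\<close>

definition ret :: "'c set \<Rightarrow> ('c \<times> 'c, 'k::comm_ring_1) mpoly \<Rightarrow> ('c \<times> 'c, 'k) mpoly" where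
  "ret I = eval_poly poly_const (chart_mask I poly_var)"

interpretation ret: comm_ring_hom "ret I"
  unfolding ret_def by (rule poly_const.comm_ring_hom_eval_poly)

lemma ret_const [simp]: "ret I (poly_const c) = poly_const c"
  unfolding ret_def by (rule poly_const.eval_poly_const)

lemma ret_var: "ret I (poly_var v) = chart_mask I poly_var v"
  unfolding ret_def by (rule poly_const.eval_poly_var)

lemma vars_in_ret: "vars_in (I \<times> - I) (ret I f)"
  unfolding ret_def
  by (rule vars_in_eval_poly) (simp_all add: chart_mask_def vars_in_var)

lemma ret_id:
  assumes "vars_in (I \<times> - I) f"
  shows "ret I f = f"
proof -
  have "ret I f = eval_poly poly_const poly_var f"
    unfolding ret_def by (rule evl_cong[OF assms]) (simp add: chart_mask_def)
  also have "\<dots> = f"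
    by (rule mpoly_hom_cong[OF poly_const.comm_ring_hom_eval_poly comm_ring_hom_id[unfolded id_def]])
      (simp_all add: poly_const.eval_poly_const poly_const.eval_poly_var)
  finally show ?thesis .
qed

lemma ret_ret [simp]: "ret I (ret I f) = ret I f"
  by (rule ret_id[OF vars_in_ret])

lemma evl_ret: "evl x (ret I f) = evl (chart_mask I x) f"
proof (rule mpoly_hom_cong[OF comm_ring_hom_comp[OF evl.comm_ring_hom_axioms ret.comm_ring_hom_axioms] evl.comm_ring_hom_axioms])
  show "evl x (ret I (poly_var v)) = evl (chart_mask I x) (poly_var v)" for v
    by (simp add: ret_var chart_mask_def)
qed simp

lemma chart_mask_mask [simp]: "chart_mask I (chart_mask I x) = chart_mask I x"
  by (auto simp: chart_mask_def fun_eq_iff)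

lemma chart_plane_mask [simp]: "chart_plane I (chart_mask I x) = chart_plane I x"
  by (rule chart_plane_cong) (simp add: chart_mask_def)

lemma chart_entry_mask: "a \<in> I \<Longrightarrow> chart_entry I (chart_mask I x) a p = chart_entry I x a p"
  by (simp add: chart_entry_def chart_mask_def)

lemma carrier_chart_ring: "f \<in> carrier (chart_ring I) \<longleftrightarrow> vars_in (I \<times> - I) f"
  by (simp add: chart_ring_def vars_in_poly_ring)

lemma chart_ring_ops:
  "f \<otimes>\<^bsub>chart_ring I\<^esub> g = f * g" "\<one>\<^bsub>chart_ring I\<^esub> = 1"
  "f \<oplus>\<^bsub>chart_ring I\<^esub> g = f + g" "\<zero>\<^bsub>chart_ring I\<^esub> = 0"
  by (simp_all add: chart_ring_def poly_ring_simps)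

lemma cring_chart_ring: "cring (chart_ring I :: ('c \<times> 'c, 'k::comm_ring_1) mpoly ring)"
  by (simp add: chart_ring_def cring_poly_ring)

lemma chart_ring_pow: "f [^]\<^bsub>chart_ring I\<^esub> (m::nat) = f ^ m"
  by (induction m) (simp_all add: nat_pow_def chart_ring_ops mult.commute)

lemma evl_chart_unique:
  fixes f :: "('c::finite \<times> 'c, 'k::field) mpoly"
  assumes "vars_in (I \<times> - I) f" "chart_plane I x = chart_plane I y"
  shows "evl x f = evl y f"
  by (rule evl_cong[OF assms(1)]) (auto intro: chart_plane_inj[OF assms(2)])

lemma span_rows_reindex:
  assumes "bij_betw \<beta> I J"
  shows "vec.span ((\<lambda>a. \<chi> p. chart_entry J x (\<beta> a) p) ` I) = chart_plane J x"
proof -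
  have "(\<lambda>a. \<chi> p. chart_entry J x (\<beta> a) p) ` I = rowv J x ` J"
    using assms by (auto simp: rowv_def[abs_def] bij_betw_def)
  then show ?thesis by (simp only: chart_plane_rowv)
qed

text \<open>The set contains all planes outside the chart \<open>I\<close>. In another chart
  \<open>J\<close> it is cut out by one equation, \<open>f\<close> evaluated by
  \<open>chart_hom\<close> on the universal rows of \<open>J\<close>; the extra determinant factor
  there takes care of the planes outside \<open>I\<close>.\<close>

lemma zariski_closed_chart:
  fixes f :: "('c::finite \<times> 'c, 'k::field) mpoly"
  assumes I: "card I = d" and f: "vars_in (I \<times> - I) f"
  shows "zariski_closed d {Q \<in> grassmannian d. \<forall>x. Q = chart_plane I x \<longrightarrow> evl x f = 0}"
    (is "zariski_closed d ?A")
  unfolding zariski_closed_def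
proof (intro conjI allI impI)
  fix J :: "'c set" assume J: "card J = d"
  \<comment> \<open>The rows of the chart \<open>J\<close> are renumbered by \<open>I\<close>, the
    index set that \<open>chart_hom\<close> expects.\<close>
  then obtain \<beta> where \<beta>: "bij_betw \<beta> I J"
    using finite_same_card_bij[of I J] I by auto
  define M where "M y a p = chart_entry J y (\<beta> a) p" for y :: "'c \<times> 'c \<Rightarrow> 'k" and a p
  define F where "F = chart_hom I poly_const f (\<lambda>a p. chart_entry J poly_var (\<beta> a) p)"
  have evF: "evl y F = chart_hom I id f (M y)" for y
  proof -
    have "evl y (chart_entry J poly_var (\<beta> a) p) = M y a p" for a p
      by (simp add: M_def chart_entry_def)
    moreover have "(\<lambda>c. evl y (poly_const c)) = id" by (simp add: fun_eq_iff)
    ultimately show ?thesis unfolding F_def chart_hom_hom[OF evl.comm_ring_hom_axioms] by (simp only:)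
  qed
  have "chart_plane J x \<in> ?A \<longleftrightarrow> evl x (ret J F) = 0" for x :: "'c \<times> 'c \<Rightarrow> 'k"
  proof -
    let ?y = "chart_mask J x"
    have sp: "vec.span ((\<lambda>a. \<chi> p. M ?y a p) ` I) = chart_plane J x"
      unfolding M_def using span_rows_reindex[OF \<beta>, of ?y] by simp
    have Gr: "chart_plane J x \<in> grassmannian d" using J by (rule chart_plane_in_grassmannian)
    show ?thesis
    proof (cases "tdet (complete_rows I (M ?y)) = 0")
      case True
      have nex: "chart_plane J x \<noteq> chart_plane I z" for z
      proof
        assume "chart_plane J x = chart_plane I z"
        then have "vec.span ((\<lambda>a. \<chi> p. M ?y a p) ` I) = chart_plane I z" by (simp only: sp)
        then show False using span_rows_tdet True by blast
      qed
      have "evl x (ret J F) = 0" unfolding evl_ret evF chart_hom_def True by (rule mult_zero_left)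
      moreover have "chart_plane J x \<in> ?A" using Gr nex by simp
      ultimately show ?thesis by simp
    next
      case False
      let ?z = "\<lambda>(a, p). - tcof (complete_rows I (M ?y)) p a / tdet (complete_rows I (M ?y))"
      have z: "chart_plane J x = chart_plane I ?z"
        unfolding sp[symmetric] by (rule span_rows_chart[OF False])
      have "evl x (ret J F) = 0 \<longleftrightarrow> evl ?z f = 0"
        unfolding evl_ret evF chart_hom_field[OF False] mult_eq_0_iff power_eq_0_iff using False by blast
      moreover have "chart_plane J x \<in> ?A \<longleftrightarrow> evl ?z f = 0"
      proof
        assume "chart_plane J x \<in> ?A"
        then show "evl ?z f = 0" using z by blast
      next
        assume ez: "evl ?z f = 0"
        have "evl w f = 0" if "chart_plane J x = chart_plane I w" for w
          using evl_chart_unique[OF f, of w ?z] that z ez by (simp only:)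
        then show "chart_plane J x \<in> ?A" using Gr by simp
      qed
      ultimately show ?thesis by (simp only:)
    qed
  qed
  then show "\<exists>G\<subseteq>carrier (chart_ring J). \<forall>x. chart_plane J x \<in> ?A \<longleftrightarrow> (\<forall>f\<in>G. evl x f = 0)"
    by (intro exI[of _ "{ret J F}"]) (simp add: carrier_chart_ring vars_in_ret)
qed auto

text \<open>Preimage under \<open>ret\<close> of the vanishing ideal of \<open>Z\<close>: an ideal
  of the polynomial type that contains the variables foreign to the chart.\<close>

definition van :: "('k::field ^ 'c::finite) set set \<Rightarrow> 'c set \<Rightarrow> ('c \<times> 'c, 'k) mpoly set" where
  "van Z I = {f. \<forall>x. chart_plane I x \<in> Z \<longrightarrow> evl x (ret I f) = 0}"

definition pull :: "'c set \<Rightarrow> ('c \<times> 'c, 'k) mpoly set \<Rightarrow> ('c \<times> 'c, 'k::comm_ring_1) mpoly set" where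
  "pull I J = {f. ret I f \<in> J}"

lemma van_iff_reduced: "f \<in> van Z I \<longleftrightarrow> ret I f \<in> reduced_structure Z I"
  by (auto simp: van_def reduced_structure_def carrier_chart_ring vars_in_ret)

lemma van_iff: "f \<in> van Z I \<longleftrightarrow> (\<forall>x. chart_plane I x \<in> Z \<longrightarrow> evl (chart_mask I x) f = 0)"
  by (simp add: van_def evl_ret)

lemma van_ret [simp]: "ret I f \<in> van Z I \<longleftrightarrow> f \<in> van Z I"
  by (simp add: van_def)

lemma ideal_van: "is_ideal (van Z I)"
  by (simp add: is_ideal_def van_iff hom_distribs)

lemma is_ideal_pull:
  assumes "ideal J (chart_ring I)"
  shows "is_ideal (pull I J)"
proof -
  interpret J: ideal J "chart_ring I" by fact
  show ?thesis
    unfolding is_ideal_def pull_def mem_Collect_eq ret.hom_add ret.hom_mult ret.hom_zero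
  proof (intro conjI ballI allI)
    show "0 \<in> J"
      using additive_subgroup.zero_closed[OF J.is_additive_subgroup] by (simp add: chart_ring_ops)
    show "ret I a + ret I b \<in> J" if "a \<in> {f. ret I f \<in> J}" "b \<in> {f. ret I f \<in> J}" for a b
      using additive_subgroup.a_closed[OF J.is_additive_subgroup, of "ret I a" "ret I b"] that by (simp add: chart_ring_ops)
    show "ret I c * ret I a \<in> J" if "a \<in> {f. ret I f \<in> J}" for a c
      using J.I_l_closed[of "ret I a" "ret I c"] that
      by (simp add: chart_ring_ops carrier_chart_ring vars_in_ret)
  qed
qed

lemma irreducible_locusD:
  "irreducible_locus d Z \<Longrightarrow> zariski_closed d A \<Longrightarrow> zariski_closed d B \<Longrightarrow> Z \<subseteq> A \<union> B \<Longrightarrow> Z \<subseteq> A \<or> Z \<subseteq> B"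
  by (simp add: irreducible_locus_def)

text \<open>If a product vanishes on \<open>Z\<close> in the chart, the closed sets of its two
  factors from \<open>zariski_closed_chart\<close> cover \<open>Z\<close>, since both contain every
  plane outside the chart.\<close>

lemma prime_van:
  fixes Z :: "('k::field ^ 'c::finite) set set"
  assumes Z: "irreducible_locus d Z" "Z \<subseteq> grassmannian d" and I: "card I = d" "chart_plane I x0 \<in> Z"
  shows "is_prime (van Z I)"
  unfolding is_prime_def
proof (intro conjI allI impI)
  show "is_ideal (van Z I)" by (rule ideal_van)
  show "1 \<notin> van Z I" using I(2) by (auto simp: van_iff)
  fix f g :: "('c \<times> 'c, 'k) mpoly" assume fg: "f * g \<in> van Z I"
  define A where "A h = {Q \<in> grassmannian d. \<forall>x. Q = chart_plane I x \<longrightarrow> evl x (ret I h) = 0}" for h :: "('c \<times> 'c, 'k) mpoly"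
  have cl: "zariski_closed d (A h)" for h
    unfolding A_def by (rule zariski_closed_chart[OF I(1) vars_in_ret])
  have sub: "h \<in> van Z I" if "Z \<subseteq> A h" for h
    unfolding van_def
  proof (intro CollectI allI impI)
    fix x assume "chart_plane I x \<in> Z"
    then have "chart_plane I x \<in> A h" using that by (rule subsetD[rotated])
    then show "evl x (ret I h) = 0" unfolding A_def by simp
  qed
  have "Z \<subseteq> A f \<union> A g"
  proof
    fix Q assume Q: "Q \<in> Z"
    show "Q \<in> A f \<union> A g"
    proof (cases "\<exists>x. Q = chart_plane I x")
      case False
      then have "Q \<in> A f" using subsetD[OF Z(2) Q] unfolding A_def by simp
      then show ?thesis by simp
    next
      case True
      then obtain x where x: "Q = chart_plane I x" by (rule exE)
      have "evl x (ret I f) * evl x (ret I g) = 0"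
        using fg Q unfolding x van_def by (simp add: ret.hom_mult evl.hom_mult)
      then have "evl x (ret I f) = 0 \<or> evl x (ret I g) = 0" by simp
      moreover have "Q \<in> A h" if "evl x (ret I h) = 0" for h
        unfolding A_def
      proof (intro CollectI conjI allI impI)
        show "Q \<in> grassmannian d" using subsetD[OF Z(2) Q] .
        fix y assume "Q = chart_plane I y"
        then have "chart_plane I y = chart_plane I x" using x by simp
        from evl_chart_unique[OF vars_in_ret this] show "evl y (ret I h) = 0" using that by simp
      qed
      ultimately show ?thesis by (elim disjE) simp_all
    qed
  qed
  then have "Z \<subseteq> A f \<or> Z \<subseteq> A g" by (rule irreducible_locusD[OF Z(1) cl cl])
  then show "f \<in> van Z I \<or> g \<in> van Z I" using sub by (elim disjE) simp_all
qed

lemma closed_contains_irreducible: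
  fixes Z :: "('k::field ^ 'c::finite) set set"
  assumes Z: "irreducible_locus d Z" "Z \<subseteq> grassmannian d" and I: "card I = d" "chart_plane I x0 \<in> Z"
    and A: "zariski_closed d A" "\<And>x. chart_plane I x \<in> Z \<Longrightarrow> chart_plane I x \<in> A"
  shows "Z \<subseteq> A"
proof -
  \<comment> \<open>The equation 1 = 0 has no solutions, so this is the complement of the
    chart.\<close>
  let ?B = "{Q \<in> grassmannian d. \<forall>x. Q = chart_plane I x \<longrightarrow> evl x 1 = 0}"
  have B: "zariski_closed d ?B" by (rule zariski_closed_chart[OF I(1)]) simp
  have "Z \<subseteq> A \<union> ?B"
  proof
    fix Q assume Q: "Q \<in> Z"
    show "Q \<in> A \<union> ?B"
    proof (cases "\<exists>x. Q = chart_plane I x")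
      case True
      then show ?thesis using A(2) Q by (elim exE) simp
    next
      case False
      then show ?thesis using subsetD[OF Z(2) Q] by simp
    qed
  qed
  then have "Z \<subseteq> A \<or> Z \<subseteq> ?B" by (rule irreducible_locusD[OF Z(1) A(1) B])
  moreover have "\<not> Z \<subseteq> ?B"
  proof
    assume "Z \<subseteq> ?B"
    then have "chart_plane I x0 \<in> ?B" using I(2) by (rule subsetD)
    then have "chart_plane I x0 = chart_plane I x0 \<longrightarrow> evl x0 (1 :: ('c \<times> 'c, 'k) mpoly) = 0"
      unfolding mem_Collect_eq by (elim conjE) (drule spec[of _ x0], assumption)
    then show False by (simp add: evl.hom_one)
  qed
  ultimately show ?thesis by (elim disjE) simp_all
qed

text \<open>If no multiple \<open>h * f ^ m\<close> with \<open>h\<close> generically nonzero on \<open>Z\<close> lay in the ideal of \<open>X\<close>,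
  some prime between the ideal of \<open>X\<close> and that of \<open>Z\<close> would not contain \<open>f\<close>; its zero locus would
  be an irreducible subset of \<open>X\<close> strictly larger than the component \<open>Z\<close>.\<close>

lemma component_nilpotent:
  fixes Z :: "('k::alg_closed_field ^ 'c::finite) set set"
  assumes comp: "irreducible_component d X Z" and I: "card I = d" "chart_plane I x0 \<in> Z"
    and X: "ideal (X I) (chart_ring I)"
    and pts: "\<And>x. (\<And>f. f \<in> X I \<Longrightarrow> evl x f = 0) \<Longrightarrow> chart_plane I x \<in> scheme_points d X"
    and f: "f \<in> van Z I"
  shows "\<exists>h m. h \<notin> van Z I \<and> h * f ^ m \<in> pull I (X I)"
proof (rule ccontr)
  assume no: "\<not> ?thesis"
  have Z: "irreducible_locus d Z" "Z \<subseteq> scheme_points d X" 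
    and max: "\<And>Y. Z \<subseteq> Y \<Longrightarrow> Y \<subseteq> scheme_points d X \<Longrightarrow> irreducible_locus d Y \<Longrightarrow> Y = Z"
    using comp unfolding irreducible_component_def by auto
  have Zg: "Z \<subseteq> grassmannian d" using Z(2) by (auto simp: scheme_points_def)
  have prime: "is_prime (van Z I)" by (rule prime_van[OF Z(1) Zg I])
  \<comment> \<open>A prime that misses \<open>M\<close> avoids \<open>f\<close> and, by the
    elements with exponent 0, lies inside \<open>van Z I\<close>.\<close>
  define M where "M = {h * f ^ m | h m. h \<notin> van Z I}"
  have MI: "h * f ^ m \<in> M" if "h \<notin> van Z I" for h m using that unfolding M_def by blast
  have "\<exists>P. is_prime P \<and> pull I (X I) \<subseteq> P \<and> P \<inter> M = {}"
  proof (rule exists_prime_avoiding)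
    show "is_ideal (pull I (X I))" by (rule is_ideal_pull[OF X])
    show "1 \<in> M" using MI[of 1 0] prime_one[OF prime] by simp
    show "pull I (X I) \<inter> M = {}" using no unfolding M_def by blast
    fix a b assume "a \<in> M" "b \<in> M"
    then obtain h m h' m' where *: "a = h * f ^ m" "b = h' * f ^ m'" "h \<notin> van Z I" "h' \<notin> van Z I"
      unfolding M_def by blast
    have "a * b = (h * h') * f ^ (m + m')" by (simp add: * power_add mult_ac)
    moreover have "h * h' \<notin> van Z I" using * prime_mult_iff[OF prime] by simp
    ultimately show "a * b \<in> M" using MI by simp
  qed
  then obtain P where P: "is_prime P" "pull I (X I) \<subseteq> P" "P \<inter> M = {}" by (elim exE conjE)
  have Pvan: "g \<in> van Z I" if "g \<in> P" for g
  proof (rule ccontr)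
    assume "g \<notin> van Z I"
    then have "g \<in> M" using MI[of g 0] by simp
    then show False using that P(3) by blast
  qed
  have "f \<in> M" using MI[of 1 1] prime_one[OF prime] by simp
  then have "f \<notin> P" using P(3) by blast
  then obtain y where y: "\<And>g. g \<in> P \<Longrightarrow> evl y g = 0" "evl y f \<noteq> 0"
    using nullstellensatz[OF P(1)] by blast
  define V where "V = {x. \<forall>g\<in>P. evl x g = 0}"
  have V_mask: "chart_mask I x = x" if x: "x \<in> V" for x
  proof
    fix v
    show "chart_mask I x v = x v"
    proof (cases "v \<in> I \<times> - I")
      case True then show ?thesis by (simp add: chart_mask_def)
    next
      case False
      then have "ret I (poly_var v :: ('c \<times> 'c, 'k) mpoly) = 0" by (simp add: ret_var chart_mask_def)
      then have "poly_var v \<in> pull I (X I)"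
        using ideal_zero[OF is_ideal_pull[OF X]] by (simp add: pull_def)
      then have "evl x (poly_var v) = 0" using P(2) x unfolding V_def by blast
      then show ?thesis using False by (simp add: chart_mask_def)
    qed
  qed
  have V_pts: "chart_plane I x \<in> scheme_points d X" if x: "x \<in> V" for x
  proof (rule pts)
    fix g assume g: "g \<in> X I"
    then have "g \<in> carrier (chart_ring I)" using ideal.Icarr[OF X] by blast
    then have "ret I g = g" by (simp add: carrier_chart_ring ret_id)
    then have "g \<in> P" using g P(2) by (auto simp: pull_def)
    then show "evl x g = 0" using x by (auto simp: V_def)
  qed
  \<comment> \<open>The closure in the Grassmannian of the zero set of \<open>P\<close>, intersected
    with the points of \<open>X\<close>. It is irreducible because \<open>P\<close> is prime and has
    a zero off any given polynomial outside it.\<close>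
  define Y where "Y = {Q \<in> scheme_points d X. \<forall>A. zariski_closed d A \<and> (\<forall>x\<in>V. chart_plane I x \<in> A) \<longrightarrow> Q \<in> A}"
  have V_Y: "chart_plane I x \<in> Y" if "x \<in> V" for x
    using that V_pts by (auto simp: Y_def)
  have "Z \<subseteq> Y"
  proof -
    have "Z \<subseteq> A" if A: "zariski_closed d A" "\<forall>x\<in>V. chart_plane I x \<in> A" for A
    proof (rule closed_contains_irreducible[OF Z(1) Zg I A(1)])
      fix x assume x: "chart_plane I x \<in> Z"
      have "evl (chart_mask I x) g = 0" if "g \<in> P" for g
        using Pvan[OF that] x unfolding van_iff by simp
      then have "chart_mask I x \<in> V" by (simp add: V_def)
      with A(2) have "chart_plane I (chart_mask I x) \<in> A" by (rule bspec)
      then show "chart_plane I x \<in> A" by simp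
    qed
    then show ?thesis using Z(2) unfolding Y_def by (intro subsetI CollectI conjI allI impI) (simp_all add: subset_iff)
  qed
  moreover have "Y \<subseteq> scheme_points d X" by (auto simp: Y_def)
  moreover have "irreducible_locus d Y"
    unfolding irreducible_locus_def
  proof (intro conjI allI impI)
    show "Y \<noteq> {}" using subsetD[OF \<open>Z \<subseteq> Y\<close> I(2)] by (rule ex_in_conv[THEN iffD1, OF exI])
    fix A B assume AB: "zariski_closed d A \<and> zariski_closed d B \<and> Y \<subseteq> A \<union> B"
    have cl: "Y \<subseteq> C" if "zariski_closed d C" "\<forall>x\<in>V. chart_plane I x \<in> C" for C
    proof
      fix Q assume "Q \<in> Y"
      then show "Q \<in> C" using that unfolding Y_def by simp
    qed
    have eqs: "\<exists>G. \<forall>x. chart_plane I x \<in> C \<longleftrightarrow> (\<forall>g\<in>G. evl x g = 0)" if "zariski_closed d C" for C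
    proof -
      have "\<exists>G\<subseteq>carrier (chart_ring I). \<forall>x. chart_plane I x \<in> C \<longleftrightarrow> (\<forall>f\<in>G. evl x f = 0)"
        using that I(1) unfolding zariski_closed_def by simp
      then show ?thesis by (elim exE conjE) (rule exI)
    qed
    show "Y \<subseteq> A \<or> Y \<subseteq> B"
    proof (rule ccontr)
      assume "\<not> ?thesis"
      then have nY: "\<not> Y \<subseteq> A" "\<not> Y \<subseteq> B" by simp_all
      have zA: "zariski_closed d A" and zB: "zariski_closed d B" using AB by simp_all
      have "\<not> (\<forall>x\<in>V. chart_plane I x \<in> A)" using cl[OF zA] nY(1) by (rule contrapos_nn[rotated])
      then obtain a where a: "a \<in> V" "chart_plane I a \<notin> A" by (auto simp del: Collect_mem_eq)
      have "\<not> (\<forall>x\<in>V. chart_plane I x \<in> B)" using cl[OF zB] nY(2) by (rule contrapos_nn[rotated])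
      then obtain b where b: "b \<in> V" "chart_plane I b \<notin> B" by auto
      note ab = a b
      obtain G where G: "\<forall>x. chart_plane I x \<in> A \<longleftrightarrow> (\<forall>g\<in>G. evl x g = 0)" using eqs[OF zA] by (rule exE)
      obtain H where H: "\<forall>x. chart_plane I x \<in> B \<longleftrightarrow> (\<forall>g\<in>H. evl x g = 0)" using eqs[OF zB] by (rule exE)
      have "\<exists>g\<in>G. evl a g \<noteq> 0" using spec[OF G, of a] ab(2) by simp
      then obtain g where g: "g \<in> G" "evl a g \<noteq> 0" by (rule bexE)
      have "\<exists>h\<in>H. evl b h \<noteq> 0" using spec[OF H, of b] ab(4) by simp
      then obtain h where h: "h \<in> H" "evl b h \<noteq> 0" by (rule bexE)
      have "g \<notin> P" using g(2) ab(1) unfolding V_def by auto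
      moreover have "h \<notin> P" using h(2) ab(3) unfolding V_def by auto
      ultimately have "g * h \<notin> P" using prime_mult_iff[OF P(1)] by simp
      then obtain z where z: "\<And>g. g \<in> P \<Longrightarrow> evl z g = 0" "evl z (g * h) \<noteq> 0"
        using nullstellensatz[OF P(1)] by blast
      have "z \<in> V" using z(1) by (simp add: V_def)
      from V_Y[OF this] have "chart_plane I z \<in> A \<union> B" using AB by (elim conjE) (rule subsetD)
      then have "evl z g = 0 \<or> evl z h = 0" using spec[OF G, of z] spec[OF H, of z] g(1) h(1) by auto
      then show False using z(2) by (simp add: evl.hom_mult)
    qed
  qed
  ultimately have YZ: "Y = Z" by (rule max)
  have yV: "y \<in> V" using y(1) by (simp add: V_def)
  then have "chart_plane I y \<in> Z" using V_Y YZ by simp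
  then have "evl (chart_mask I y) f = 0" using f by (simp add: van_iff)
  then show False using y(2) V_mask[OF yV] by simp
qed

text \<open>\<open>reduced_localization_iff\<close> with chart-ring elements replaced by arbitrary
  polynomials: \<open>ret\<close> sends these into the chart ring without changing membership in
  \<open>van\<close> or \<open>pull\<close>.\<close>

lemma generic_reduced_iff:
  fixes Z :: "('k::field ^ 'c::finite) set set"
  assumes prime: "is_prime (van Z I)" and X: "ideal (X I) (chart_ring I)" 
    and sub: "\<And>f x. f \<in> X I \<Longrightarrow> chart_plane I x \<in> Z \<Longrightarrow> evl x f = 0"
  shows "reduced_ring (generic_local_ring X Z I) \<longleftrightarrow>
    (\<forall>f h m. h \<notin> van Z I \<and> h * f ^ m \<in> pull I (X I) \<longrightarrow> (\<exists>h'. h' \<notin> van Z I \<and> h' * f \<in> pull I (X I)))"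
proof -
  let ?R = "chart_ring I :: ('c \<times> 'c, 'k) mpoly ring" and ?c = "reduced_structure Z I"
  interpret R: cring ?R by (rule cring_chart_ring)
  interpret X: ideal "X I" ?R by fact
  have c_iff: "f \<in> ?c \<longleftrightarrow> vars_in (I \<times> - I) f \<and> f \<in> van Z I" for f
    using van_iff_reduced[of f Z I] ret_id[of I f] by (auto simp: reduced_structure_def carrier_chart_ring)
  have subc: "X I \<subseteq> ?c" using sub X.Icarr by (auto simp: reduced_structure_def)
  have pc: "primeideal ?c ?R"
  proof (rule primeidealI)
    show "ideal ?c ?R"
    proof (rule idealI)
      show "ring ?R" by (rule R.ring_axioms)
      show "subgroup ?c (add_monoid ?R)"
      proof (rule R.add.subgroupI)
        show "?c \<subseteq> carrier ?R" by (auto simp: reduced_structure_def)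
        show "?c \<noteq> {}" using c_iff[of 0] ideal_zero[OF ideal_van] by auto
        fix a assume a: "a \<in> ?c"
        then have "a \<in> carrier ?R" "- a \<in> carrier ?R" by (auto simp: c_iff carrier_chart_ring vars_in_uminus)
        moreover have "a \<oplus>\<^bsub>?R\<^esub> - a = \<zero>\<^bsub>?R\<^esub>" by (simp add: chart_ring_ops)
        ultimately have "\<ominus>\<^bsub>?R\<^esub> a = - a" by (metis R.minus_equality R.a_comm)
        then show "\<ominus>\<^bsub>?R\<^esub> a \<in> ?c" using a by (simp add: c_iff vars_in_uminus ideal_uminus[OF ideal_van])
        fix b assume "b \<in> ?c"
        then show "a \<oplus>\<^bsub>?R\<^esub> b \<in> ?c" using a
          by (simp add: c_iff chart_ring_ops vars_in_add ideal_add[OF ideal_van])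
      qed
      fix a x assume "a \<in> ?c" "x \<in> carrier ?R"
      then show "x \<otimes>\<^bsub>?R\<^esub> a \<in> ?c" "a \<otimes>\<^bsub>?R\<^esub> x \<in> ?c"
        by (simp_all add: c_iff carrier_chart_ring chart_ring_ops vars_in_mult ideal_mult[OF ideal_van] ideal_mult_right[OF ideal_van])
    qed
    show "cring ?R" by (rule R.is_cring)
    show "carrier ?R \<noteq> ?c"
      using c_iff[of 1] prime_one[OF prime] R.one_closed by (auto simp: chart_ring_ops)
    fix a b assume "a \<in> carrier ?R" "b \<in> carrier ?R" "a \<otimes>\<^bsub>?R\<^esub> b \<in> ?c"
    then show "a \<in> ?c \<or> b \<in> ?c"
      using prime_mult_iff[OF prime, of a b] by (auto simp: c_iff carrier_chart_ring chart_ring_ops)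
  qed
  have "reduced_ring (generic_local_ring X Z I) \<longleftrightarrow> (\<forall>f\<in>carrier ?R. \<forall>h\<in>carrier ?R - ?c. \<forall>m::nat.
      h \<otimes>\<^bsub>?R\<^esub> f [^]\<^bsub>?R\<^esub> m \<in> X I \<longrightarrow> (\<exists>h'\<in>carrier ?R - ?c. h' \<otimes>\<^bsub>?R\<^esub> f \<in> X I))"
    unfolding generic_local_ring_def Let_def
    by (rule R.reduced_localization_iff[OF X.ideal_axioms pc subc])
  also have "\<dots> \<longleftrightarrow> (\<forall>f h m. h \<notin> van Z I \<and> h * f ^ m \<in> pull I (X I) \<longrightarrow> (\<exists>h'. h' \<notin> van Z I \<and> h' * f \<in> pull I (X I)))"
    (is "?L \<longleftrightarrow> ?Rr")
  proof
    assume L: ?L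
    show ?Rr
    proof (intro allI impI; elim conjE)
      fix f h :: "('c \<times> 'c, 'k) mpoly" and m assume h: "h \<notin> van Z I" "h * f ^ m \<in> pull I (X I)"
      have car: "ret I f \<in> carrier ?R" "ret I h \<in> carrier ?R - ?c"
        using h(1) by (simp_all add: c_iff carrier_chart_ring vars_in_ret)
      have "ret I h \<otimes>\<^bsub>?R\<^esub> ret I f [^]\<^bsub>?R\<^esub> m \<in> X I"
        using h(2) by (simp add: chart_ring_ops chart_ring_pow pull_def ret.hom_mult ret.hom_power)
      then have "\<exists>h'\<in>carrier ?R - ?c. h' \<otimes>\<^bsub>?R\<^esub> ret I f \<in> X I" using L[rule_format, OF car] by blast
      then obtain h' where h': "h' \<in> carrier ?R - ?c" "h' \<otimes>\<^bsub>?R\<^esub> ret I f \<in> X I" by (rule bexE)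
      then have "vars_in (I \<times> - I) h'" "h' \<notin> van Z I" by (simp_all add: c_iff carrier_chart_ring)
      then show "\<exists>h'. h' \<notin> van Z I \<and> h' * f \<in> pull I (X I)"
        using h'(2) by (intro exI[of _ h']) (simp add: pull_def ret.hom_mult ret_id chart_ring_ops)
    qed
  next
    assume R: ?Rr
    show ?L
    proof (intro ballI allI impI)
      fix f h and m :: nat
      assume *: "f \<in> carrier ?R" "h \<in> carrier ?R - ?c" "h \<otimes>\<^bsub>?R\<^esub> f [^]\<^bsub>?R\<^esub> m \<in> X I"
      then have v: "vars_in (I \<times> - I) f" "vars_in (I \<times> - I) h" "h \<notin> van Z I" by (simp_all add: c_iff carrier_chart_ring)
      have "h * f ^ m \<in> pull I (X I)"
        using *(3) by (simp add: chart_ring_ops chart_ring_pow pull_def ret.hom_mult ret.hom_power ret_id v)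
      then obtain h' where h': "h' \<notin> van Z I" "h' * f \<in> pull I (X I)" using R v(3) by blast
      show "\<exists>h'\<in>carrier ?R - ?c. h' \<otimes>\<^bsub>?R\<^esub> f \<in> X I"
        by (rule bexI[of _ "ret I h'"])
          (use h' v in \<open>simp_all add: c_iff carrier_chart_ring vars_in_ret chart_ring_ops pull_def ret.hom_mult ret_id\<close>)
    qed
  qed
  finally show ?thesis .
qed

section \<open>Symmetric matrices annihilating a pair of subspaces\<close>

definition mv :: "('n::finite \<Rightarrow> 'n \<Rightarrow> 'k::comm_ring_1) \<Rightarrow> 'k ^ 'n \<Rightarrow> 'k ^ 'n" where
  "mv A w = (\<chi> i. \<Sum>j\<in>UNIV. A i j * w $ j)"

definition bf :: "('n::finite \<Rightarrow> 'n \<Rightarrow> 'k::comm_ring_1) \<Rightarrow> 'k ^ 'n \<Rightarrow> 'k ^ 'n \<Rightarrow> 'k" where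
  "bf A u w = (\<Sum>i\<in>UNIV. \<Sum>j\<in>UNIV. u $ i * A i j * w $ j)"

lemma bf_mv: "bf A u w = scalar_product u (mv A w)"
  by (simp add: bf_def mv_def scalar_product_def sum_distrib_left mult.assoc)

lemma linear_mv: "Vector_Spaces.linear (*s) (*s) (mv (A :: 'n::finite \<Rightarrow> 'n \<Rightarrow> 'k::field))"
  by unfold_locales
    (simp_all add: mv_def Finite_Cartesian_Product.vec_eq_iff distrib_left sum.distrib sum_distrib_left mult_ac)

lemma mv_diff: "mv A (v - w) = mv A v - mv (A :: 'n::finite \<Rightarrow> 'n \<Rightarrow> 'k::field) w"
  by (simp add: mv_def Finite_Cartesian_Product.vec_eq_iff right_diff_distrib sum_subtractf)

lemma mv_zero [simp]: "mv A 0 = 0"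
  by (simp add: mv_def Finite_Cartesian_Product.vec_eq_iff)

lemma bf_commute:
  assumes "\<And>i j. A i j = A j i"
  shows "bf A u w = bf A w u"
  unfolding bf_def
  by (subst sum.swap, intro sum.cong refl, subst assms) (simp only: mult_ac)

lemma bf_add_left: "bf A (u + v) w = bf A u w + bf A v w"
  by (simp add: bf_def distrib_right sum.distrib)

lemma bf_add_right: "bf A u (v + w) = bf A u v + bf A u w"
  by (simp add: bf_def distrib_left sum.distrib)

lemma bf_scale_left: "bf A (c *s u) w = c * bf (A :: 'n::finite \<Rightarrow> 'n \<Rightarrow> 'k::field) u w"
  by (simp add: bf_def sum_distrib_left mult.assoc)

lemma bf_scale_right: "bf A u (c *s w) = c * bf (A :: 'n::finite \<Rightarrow> 'n \<Rightarrow> 'k::field) u w"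
  by (simp add: bf_def sum_distrib_left mult_ac)

lemma bf_zero [simp]: "bf A 0 w = 0" "bf A u 0 = 0"
  by (simp_all add: bf_def)

lemma bf_sum_left: "bf A (\<Sum>i\<in>S. u i) w = (\<Sum>i\<in>S. bf A (u i) w)"
  by (induction S rule: infinite_finite_induct) (simp_all add: bf_add_left)

lemma bf_sum_right: "bf A u (\<Sum>i\<in>S. w i) = (\<Sum>i\<in>S. bf A u (w i))"
  by (induction S rule: infinite_finite_induct) (simp_all add: bf_add_right)

text \<open>The image of \<open>W\<close> lies in the annihilator of \<open>U\<close>, and passing
  from \<open>W\<close> to the whole space adds at most the codimension of \<open>W\<close> to the
  rank, as the kernel can only grow.\<close>

lemma dim_range_le:
  fixes A :: "'n::finite \<Rightarrow> 'n \<Rightarrow> 'k::field"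
  assumes U: "vec.subspace U" and W: "vec.subspace W"
    and z: "\<And>u w. u \<in> U \<Longrightarrow> w \<in> W \<Longrightarrow> bf A u w = 0"
  shows "vec.dim (mv A ` W) \<le> CARD('n) - vec.dim U"
    "vec.dim (range (mv A)) \<le> CARD('n) - vec.dim W + vec.dim (mv A ` W)"
proof -
  have "mv A ` W \<subseteq> ann U" using z by (auto simp: ann_def bf_mv)
  then have "vec.dim (mv A ` W) \<le> vec.dim (ann U)" by (rule vec.dim_subset)
  then show "vec.dim (mv A ` W) \<le> CARD('n) - vec.dim U" by (simp only: dim_ann[OF U])
  have 1: "vec.dim (UNIV :: ('k ^ 'n) set) = vec.dim (range (mv A)) + vec.dim {x \<in> UNIV. mv A x = 0}"
    by (rule rank_nullity[OF linear_mv]) simp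
  have 2: "vec.dim W = vec.dim (mv A ` W) + vec.dim {x \<in> W. mv A x = 0}"
    by (rule rank_nullity[OF linear_mv W])
  have 3: "vec.dim {x \<in> W. mv A x = 0} \<le> vec.dim {x \<in> UNIV. mv A x = 0}"
    by (rule vec.dim_subset) auto
  have 4: "vec.dim (UNIV :: ('k ^ 'n) set) = CARD('n)" by (simp add: card_cart_basis vec.dim_UNIV)
  show "vec.dim (range (mv A)) \<le> CARD('n) - vec.dim W + vec.dim (mv A ` W)"
    using 1 2 3 4 by linarith
qed

lemma column_eq_mv: "(\<chi> i. A i l) = mv A (axis l (1 :: 'k::field))"
proof -
  have "(\<Sum>j\<in>UNIV. A i j * axis l (1::'k) $ j) = (\<Sum>j\<in>UNIV. if j = l then A i j else 0)" for i
    by (rule sum.cong) (auto simp: axis_def)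
  then show ?thesis by (simp add: mv_def)
qed

lemma minors_zero:
  fixes A :: "'n::finite \<Rightarrow> 'n \<Rightarrow> 'k::field"
  assumes "vec.dim (range (mv A)) < r"
  shows "dt r (\<lambda>i j. A (\<rho> i) (\<sigma> j)) = 0"
proof -
  have "dt r (\<lambda>i j. (\<chi> i. A i (\<sigma> j)) $ \<rho> i) = 0"
    by (rule dt_family_zero[OF _ assms]) (simp add: column_eq_mv)
  then show ?thesis by simp
qed

text \<open>For a nested \<open>s\<close>-compression space the two codimensions are r - s - 1 and
  s, so the rank is at most r - 1.\<close>

lemma compression_minors_zero:
  fixes A :: "'n::finite \<Rightarrow> 'n \<Rightarrow> 'k::field"
  assumes "vec.subspace U" "vec.subspace W" "\<And>u w. u \<in> U \<Longrightarrow> w \<in> W \<Longrightarrow> bf A u w = 0"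
    and "(CARD('n) - vec.dim U) + (CARD('n) - vec.dim W) < r"
  shows "dt r (\<lambda>i j. A (\<rho> i) (\<sigma> j)) = 0"
  by (rule minors_zero) (use dim_range_le[OF assms(1-3)] assms(4) in linarith)

text \<open>If the rank is as large as the annihilation condition allows, then \<open>U\<close> is the full preimage
  of the annihilator of \<open>W\<close>; in particular it contains the kernel.\<close>

lemma preimage_ann:
  fixes A :: "'n::finite \<Rightarrow> 'n \<Rightarrow> 'k::field"
  assumes U: "vec.subspace U" and W: "vec.subspace W" and sym: "\<And>i j. A i j = A j i"
    and z: "\<And>u w. u \<in> U \<Longrightarrow> w \<in> W \<Longrightarrow> bf A u w = 0"
    and m: "(CARD('n) - vec.dim U) + (CARD('n) - vec.dim W) = m"
    and nz: "dt m (\<lambda>i j. A (\<rho> i) (\<sigma> j)) \<noteq> 0"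
    and v: "\<And>w. w \<in> W \<Longrightarrow> bf A w v = 0"
  shows "v \<in> U"
proof -
  interpret A: Vector_Spaces.linear "(*s)" "(*s)" "mv A" by (rule linear_mv)
  have "\<not> vec.dim (range (mv A)) < m" using minors_zero nz by blast
  then have d: "CARD('n) - vec.dim U \<le> vec.dim (mv A ` W)"
    using dim_range_le(2)[OF U W z] m by linarith
  have sub: "vec.subspace (mv A ` W)" by (rule A.subspace_image[OF W])
  have "vec.dim (ann (mv A ` W)) \<le> vec.dim U"
    unfolding dim_ann[OF sub] using d by linarith
  moreover have "U \<subseteq> ann (mv A ` W)"
    using z by (auto simp: ann_def bf_mv scalar_product_commute)
  ultimately have "U = ann (mv A ` W)" using vec.subspace_dim_equal[OF U subspace_ann] by blast
  moreover have "v \<in> ann (mv A ` W)"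
    using v bf_commute[of A _ v, OF sym] by (auto simp: ann_def bf_mv scalar_product_commute)
  ultimately show ?thesis by simp
qed

section \<open>Cofactor vectors\<close>

text \<open>The cofactors along row \<open>i\<close> of a minor, each placed at the coordinate of
  its column. Contributions of a repeated column are added, so that \<open>\<rho>\<close> and
  \<open>\<sigma>\<close> may be arbitrary maps.\<close>

definition cofv :: "nat \<Rightarrow> (nat \<Rightarrow> 'n) \<Rightarrow> (nat \<Rightarrow> 'n) \<Rightarrow> nat \<Rightarrow> ('n \<Rightarrow> 'n \<Rightarrow> 'b::comm_ring_1) \<Rightarrow> 'n \<Rightarrow> 'b" where
  "cofv r \<rho> \<sigma> i A l = (\<Sum>j<r. if \<sigma> j = l then cf r (\<lambda>i j. A (\<rho> i) (\<sigma> j)) i j else 0)"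

lemma sum_cofv:
  fixes v :: "'n::finite \<Rightarrow> 'b::comm_ring_1"
  shows "(\<Sum>l\<in>UNIV. v l * cofv r \<rho> \<sigma> i A l) = (\<Sum>j<r. v (\<sigma> j) * cf r (\<lambda>i j. A (\<rho> i) (\<sigma> j)) i j)"
proof -
  let ?c = "cf r (\<lambda>i j. A (\<rho> i) (\<sigma> j)) i"
  have "(\<Sum>l\<in>UNIV. v l * cofv r \<rho> \<sigma> i A l) = (\<Sum>l\<in>UNIV. \<Sum>j<r. if l = \<sigma> j then v l * ?c j else 0)"
    unfolding cofv_def sum_distrib_left by (intro sum.cong refl) auto
  also have "\<dots> = (\<Sum>j<r. \<Sum>l\<in>UNIV. if l = \<sigma> j then v l * ?c j else 0)" by (rule sum.swap)
  finally show ?thesis by simp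
qed

text \<open>Expansion along row \<open>i\<close> after that row has been replaced by row
  \<open>k\<close>. If all \<open>r\<close>-minors vanish, the cofactor vector is therefore in the
  kernel of \<open>A\<close>.\<close>

lemma row_cofv:
  fixes A :: "'n::finite \<Rightarrow> 'n \<Rightarrow> 'b::comm_ring_1"
  assumes "i < r"
  shows "(\<Sum>l\<in>UNIV. A k l * cofv r \<rho> \<sigma> i A l) = dt r (\<lambda>a b. A ((\<rho>(i := k)) a) (\<sigma> b))"
proof -
  have "(\<lambda>a b. A ((\<rho>(i := k)) a) (\<sigma> b)) = (\<lambda>a b. A (\<rho> a) (\<sigma> b))(i := \<lambda>b. A k (\<sigma> b))" by auto
  then show ?thesis unfolding sum_cofv by (simp add: dt_row_update[OF assms])
qed

lemma cofv_hom:
  assumes "comm_ring_hom h" "i < r"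
  shows "h (cofv r \<rho> \<sigma> i A l) = cofv r \<rho> \<sigma> i (\<lambda>a b. h (A a b)) l"
proof -
  interpret comm_ring_hom h by fact
  show ?thesis
    unfolding cofv_def hom_sum
    by (rule sum.cong) (use assms in \<open>auto simp: cf_hom[OF assms(1)]\<close>)
qed

lemma cf_transpose: "cf r (\<lambda>i j. f j i) j i = cf r f i j"
proof -
  have "Matrix.mat r r (\<lambda>(i, j). f j i) = Matrix.transpose_mat (Matrix.mat r r (\<lambda>(i, j). f i j))"
    by (rule eq_matI) auto
  moreover have "mat_delete (Matrix.transpose_mat B) j i = Matrix.transpose_mat (mat_delete B i j)" for B :: "'a mat"
    unfolding mat_delete_def by (rule eq_matI) auto
  moreover have "mat_delete (Matrix.mat r r (\<lambda>(i, j). f i j)) i j \<in> carrier_mat (r - 1) (r - 1)"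
    by (simp add: mat_delete_def)
  ultimately show ?thesis
    by (simp add: cf_def cofactor_def Determinant.det_transpose add.commute)
qed

lemma cf_minor:
  "cf r f i j = (-1) ^ (i + j) * dt (r - 1) (\<lambda>a b. f (if a < i then a else Suc a) (if b < j then b else Suc b))"
proof -
  have "mat_delete (Matrix.mat r r (\<lambda>(i, j). f i j)) i j =
      Matrix.mat (r - 1) (r - 1) (\<lambda>(a, b). f (if a < i then a else Suc a) (if b < j then b else Suc b))"
    unfolding mat_delete_def by (rule eq_matI) auto
  then show ?thesis by (simp add: cf_def cofactor_def dt_def)
qed

text \<open>If the vector is nonzero, some minor of size r - 1 is nonzero, the rank is as large as
  possible, and \<open>preimage_ann\<close> puts the kernel into \<open>U\<close>.\<close>

lemma cofv_in:
  fixes A :: "'n::finite \<Rightarrow> 'n \<Rightarrow> 'k::field"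
  assumes U: "vec.subspace U" and W: "vec.subspace W" and sym: "\<And>i j. A i j = A j i"
    and z: "\<And>u w. u \<in> U \<Longrightarrow> w \<in> W \<Longrightarrow> bf A u w = 0"
    and m: "Suc ((CARD('n) - vec.dim U) + (CARD('n) - vec.dim W)) = r" and i: "i < r"
  shows "(\<chi> l. cofv r \<rho> \<sigma> i A l) \<in> U"
proof (cases "\<exists>j<r. cf r (\<lambda>i j. A (\<rho> i) (\<sigma> j)) i j \<noteq> 0")
  case False
  then have "(\<chi> l. cofv r \<rho> \<sigma> i A l) = 0"
    by (auto simp: Finite_Cartesian_Product.vec_eq_iff cofv_def intro!: sum.neutral)
  then show ?thesis using vec.subspace_0[OF U] by simp
next
  case True
  then obtain j where j: "cf r (\<lambda>i j. A (\<rho> i) (\<sigma> j)) i j \<noteq> 0" by blast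
  have nz: "dt (r - 1) (\<lambda>a b. A ((\<lambda>a. \<rho> (if a < i then a else Suc a)) a) ((\<lambda>b. \<sigma> (if b < j then b else Suc b)) b)) \<noteq> 0"
    using j unfolding cf_minor by simp
  have "mv A (\<chi> l. cofv r \<rho> \<sigma> i A l) = 0"
    unfolding Finite_Cartesian_Product.vec_eq_iff
  proof
    fix k
    show "mv A (\<chi> l. cofv r \<rho> \<sigma> i A l) $ k = 0 $ k"
      using compression_minors_zero[OF U W z, of r "\<rho>(i := k)" \<sigma>] m
      by (simp add: mv_def row_cofv[OF i])
  qed
  then have "bf A w (\<chi> l. cofv r \<rho> \<sigma> i A l) = 0" for w by (simp add: bf_mv)
  moreover have "(CARD('n) - vec.dim U) + (CARD('n) - vec.dim W) = r - 1" using m by linarith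
  ultimately show ?thesis
    using preimage_ann[OF U W sym z, of "r - 1" "\<lambda>a. \<rho> (if a < i then a else Suc a)"
        "\<lambda>b. \<sigma> (if b < j then b else Suc b)" "\<chi> l. cofv r \<rho> \<sigma> i A l"] nz by simp
qed

section \<open>First derivatives of minors\<close>

lemma comm_ring_hom_coeff_0: "comm_ring_hom (\<lambda>p :: 'b::comm_ring_1 poly. coeff p 0)"
  by unfold_locales (auto simp: coeff_mult)

lemma dt_deriv:
  fixes N M :: "nat \<Rightarrow> nat \<Rightarrow> 'k::comm_ring_1"
  shows "coeff (dt r (\<lambda>i j. [:N i j, M i j:])) 1 = (\<Sum>i<r. \<Sum>j<r. M i j * cf r N i j)"
proof -
  \<comment> \<open>Rows are perturbed one at a time: only the first \<open>k\<close> rows carry the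
    linear term, and each further row contributes one summand of the derivative.\<close>
  define F where "F k i j = (if i < k then [:N i j, M i j:] else [:N i j:])" for k i j :: nat
  have main: "coeff (dt r (F k)) 1 = (\<Sum>i<k. \<Sum>j<r. M i j * cf r N i j)" if "k \<le> r" for k
    using that
  proof (induction k)
    case 0
    have "comm_ring_hom (\<lambda>c. [:c:] :: 'k poly)" by unfold_locales (auto simp: one_pCons)
    then have "dt r (\<lambda>i j. [:N i j:]) = [:dt r N:]" by (rule dt_hom[symmetric])
    moreover have "F 0 = (\<lambda>i j. [:N i j:])" by (simp add: F_def fun_eq_iff)
    ultimately show ?case by simp
  next
    case (Suc k)
    then have k: "k < r" by simp
    have "dt r (F (Suc k)) = (\<Sum>j<r. F (Suc k) k j * cf r (F (Suc k)) k j)" by (rule dt_row[OF k])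
    also have "\<dots> = (\<Sum>j<r. F k k j * cf r (F k) k j + [:0, M k j:] * cf r (F k) k j)"
    proof (rule sum.cong)
      fix j assume j: "j \<in> {..<r}"
      have "cf r (F (Suc k)) k j = cf r (F k) k j"
        by (rule cf_cong_row) (use k j in \<open>auto simp: F_def\<close>)
      moreover have "F (Suc k) k j = F k k j + [:0, M k j:]" by (simp add: F_def)
      ultimately show "F (Suc k) k j * cf r (F (Suc k)) k j = F k k j * cf r (F k) k j + [:0, M k j:] * cf r (F k) k j"
        by (simp add: distrib_right)
    qed simp
    also have "\<dots> = dt r (F k) + (\<Sum>j<r. [:0, M k j:] * cf r (F k) k j)"
      by (simp only: sum.distrib dt_row[OF k, symmetric])
    finally have "coeff (dt r (F (Suc k))) 1 = coeff (dt r (F k)) 1 + (\<Sum>j<r. M k j * coeff (cf r (F k) k j) 0)"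
      by (simp add: coeff_sum)
    also have "(\<Sum>j<r. M k j * coeff (cf r (F k) k j) 0) = (\<Sum>j<r. M k j * cf r N k j)"
    proof (rule sum.cong)
      fix j assume j: "j \<in> {..<r}"
      have "coeff (cf r (F k) k j) 0 = cf r (\<lambda>i j. coeff (F k i j) 0) k j"
        using cf_hom[OF comm_ring_hom_coeff_0 k, of j "F k"] j by simp
      also have "(\<lambda>i j. coeff (F k i j) 0) = N" by (auto simp: F_def fun_eq_iff)
      finally show "M k j * coeff (cf r (F k) k j) 0 = M k j * cf r N k j" by simp
    qed simp
    finally show ?case using Suc by simp
  qed
  have "dt r (F r) = dt r (\<lambda>i j. [:N i j, M i j:])" by (rule dt_cong) (simp add: F_def)
  from this[symmetric] show ?thesis using main[OF order_refl] by (simp only:)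
qed

text \<open>The cofactor matrix of a singular minor has all its rows and columns in \<open>U\<close>, so it pairs to zero
  with every form vanishing on \<open>U\<close>.\<close>

lemma minor_deriv_zero:
  fixes A M :: "'n::finite \<Rightarrow> 'n \<Rightarrow> 'k::field"
  assumes U: "vec.subspace U" and W: "vec.subspace W" and sym: "\<And>i j. A i j = A j i"
    and z: "\<And>u w. u \<in> U \<Longrightarrow> w \<in> W \<Longrightarrow> bf A u w = 0"
    and m: "Suc ((CARD('n) - vec.dim U) + (CARD('n) - vec.dim W)) = r"
    and M: "\<And>u w. u \<in> U \<Longrightarrow> w \<in> U \<Longrightarrow> bf M u w = 0"
  shows "coeff (dt r (\<lambda>i j. [:A (\<rho> i) (\<sigma> j), M (\<rho> i) (\<sigma> j):])) 1 = 0"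
proof -
  have "Vector_Spaces.linear (*s) (*s) (\<lambda>x :: 'k ^ 'n. x)" by (rule vec.linear_ident)
  \<comment> \<open>A projection onto \<open>U\<close>. As the rows of the cofactor matrix lie in
    \<open>U\<close>, it may be inserted in the right-hand argument; regrouping by columns then puts
    the left-hand argument into \<open>U\<close> as well.\<close>
  then obtain g where g: "range g \<subseteq> U" "Vector_Spaces.linear (*s) (*s) g" "\<And>v. v \<in> U \<Longrightarrow> g v = v"
    using vec.linear_exists_left_inverse_on[of "\<lambda>x. x" U] U by (auto simp: inj_on_def)
  interpret g: Vector_Spaces.linear "(*s)" "(*s)" g by (rule g(2))
  let ?c = "cf r (\<lambda>i j. A (\<rho> i) (\<sigma> j))"
  let ?C = "\<lambda>i. (\<chi> l. cofv r \<rho> \<sigma> i A l)" and ?D = "\<lambda>j. (\<chi> l. cofv r \<sigma> \<rho> j A l)"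
  have C1: "?C i \<in> U" if "i < r" for i by (rule cofv_in[OF U W sym z m that])
  have C2: "?D i \<in> U" if "i < r" for i by (rule cofv_in[OF U W sym z m that])
  have expand: "(\<chi> l. cofv r \<rho>' \<sigma>' i A l) = (\<Sum>j<r. cf r (\<lambda>i j. A (\<rho>' i) (\<sigma>' j)) i j *s axis (\<sigma>' j) 1)"
    for \<rho>' \<sigma>' i
  proof -
    have "(\<Sum>j<r. cf r (\<lambda>i j. A (\<rho>' i) (\<sigma>' j)) i j *s axis (\<sigma>' j) 1) $ l = cofv r \<rho>' \<sigma>' i A l" for l
      unfolding sum_component cofv_def by (rule sum.cong) (auto simp: axis_def)
    then show ?thesis by (simp add: Finite_Cartesian_Product.vec_eq_iff)
  qed
  have cT: "cf r (\<lambda>i j. A (\<sigma> i) (\<rho> j)) j i = ?c i j" for i j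
    using cf_transpose[of r "\<lambda>i j. A (\<rho> i) (\<sigma> j)" j i] by (simp add: sym)
  have "(\<Sum>j<r. M (\<rho> i) (\<sigma> j) * ?c i j) = bf M (axis (\<rho> i) 1) (?C i)" for i
  proof -
    have "bf M (axis (\<rho> i) 1) (?C i) = (\<Sum>k\<in>UNIV. if k = \<rho> i then \<Sum>l\<in>UNIV. M k l * cofv r \<rho> \<sigma> i A l else 0)"
      unfolding bf_def by (rule sum.cong) (auto simp: axis_def)
    also have "\<dots> = (\<Sum>j<r. M (\<rho> i) (\<sigma> j) * ?c i j)" by (simp add: sum_cofv)
    finally show ?thesis by simp
  qed
  then have "coeff (dt r (\<lambda>i j. [:A (\<rho> i) (\<sigma> j), M (\<rho> i) (\<sigma> j):])) 1 = (\<Sum>i<r. bf M (axis (\<rho> i) 1) (?C i))"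
    unfolding dt_deriv by simp
  also have "\<dots> = (\<Sum>i<r. bf M (axis (\<rho> i) 1) (\<Sum>j<r. ?c i j *s g (axis (\<sigma> j) 1)))"
  proof (rule sum.cong)
    fix i assume "i \<in> {..<r}"
    then have "?C i = g (?C i)" using C1 g(3) by simp
    also have "\<dots> = (\<Sum>j<r. ?c i j *s g (axis (\<sigma> j) 1))" unfolding expand by (simp add: g.sum g.scale)
    finally show "bf M (axis (\<rho> i) 1) (?C i) = bf M (axis (\<rho> i) 1) (\<Sum>j<r. ?c i j *s g (axis (\<sigma> j) 1))" by simp
  qed simp
  also have "\<dots> = (\<Sum>i<r. \<Sum>j<r. bf M (?c i j *s axis (\<rho> i) 1) (g (axis (\<sigma> j) 1)))"
    by (simp add: bf_sum_right bf_scale_right bf_scale_left)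
  also have "\<dots> = (\<Sum>j<r. bf M (\<Sum>i<r. ?c i j *s axis (\<rho> i) 1) (g (axis (\<sigma> j) 1)))"
    by (subst sum.swap) (simp add: bf_sum_left)
  also have "\<dots> = (\<Sum>j<r. bf M (?D j) (g (axis (\<sigma> j) 1)))"
    unfolding expand by (simp add: cT)
  also have "\<dots> = 0"
    by (rule sum.neutral) (use C2 g(1) M in auto)
  finally show ?thesis .
qed

section \<open>Equations of the Fano scheme\<close>

text \<open>Kept over an arbitrary ring so that one definition serves the universal plane
  (\<open>poly_var\<close> for \<open>X\<close>), actual planes, and first-order deformations of
  planes.\<close>

definition pmat :: "'n uprod set \<Rightarrow> ('n uprod \<times> 'n uprod \<Rightarrow> 'b) \<Rightarrow> ('n uprod \<Rightarrow> 'b) \<Rightarrow> 'n \<Rightarrow> 'n \<Rightarrow> 'b::comm_ring_1" where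
  "pmat I X t i j = (\<Sum>a\<in>I. t a * chart_entry I X a (Upair i j))"

lemma pmat_sym: "pmat I X t i j = pmat I X t j i"
proof -
  have "Upair i j = Upair j i" by simp
  then show ?thesis unfolding pmat_def by (simp only:)
qed

lemma pmat_hom:
  assumes "comm_ring_hom h"
  shows "h (pmat I X t i j) = pmat I (\<lambda>v. h (X v)) (\<lambda>a. h (t a)) i j"
proof -
  interpret comm_ring_hom h by fact
  show ?thesis unfolding pmat_def hom_sum
    by (rule sum.cong) (auto simp: hom_distribs chart_entry_def)
qed

lemma pmat_comb: "pmat I x t i j = (\<Sum>a\<in>I. t a *s rowv I x a) $ Upair i j"
  by (simp add: pmat_def sum_component rowv_nth)

lemma in_chart_plane_pmat:
  assumes "z \<in> chart_plane I x"
  shows "z $ Upair i j = pmat I x (\<lambda>a. z $ a) i j"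
  unfolding pmat_comb using assms chart_plane_iff[of z I x] by metis

lemma pmat_add: "pmat I X (\<lambda>a. t a + c * u a) i j = pmat I X t i j + c * pmat I X u i j"
  by (simp add: pmat_def distrib_right sum.distrib sum_distrib_left mult.assoc)

lemma pmat_mask: "pmat I (chart_mask I X) t = pmat I X t"
  by (auto simp: pmat_def fun_eq_iff chart_entry_mask)

lemma comm_ring_hom_restrict:
  "comm_ring_hom (restrict_to_plane I :: ('c::finite, 'k::field) mpoly \<Rightarrow> _)"
  unfolding restrict_to_plane_def
  by (intro comm_ring_hom.comm_ring_hom_eval_poly comm_ring_hom_comp[OF comm_ring_hom_poly_const comm_ring_hom_poly_const])

lemma eval_restrict:
  fixes H :: "('c::finite \<times> 'c, 'k::field) mpoly \<Rightarrow> 'b::comm_ring_1"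
  assumes H: "comm_ring_hom H"
  shows "eval_poly H t (restrict_to_plane I g) =
    eval_poly (\<lambda>c. H (poly_const c)) (\<lambda>p. \<Sum>a\<in>I. t a * H (chart_entry I poly_var a p)) g"
proof -
  interpret H: comm_ring_hom H by fact
  have Hc: "comm_ring_hom (\<lambda>c. H (poly_const c))" by (rule comm_ring_hom_comp[OF H comm_ring_hom_poly_const])
  have cc: "comm_ring_hom (\<lambda>c. poly_const (poly_const c) :: ('c, ('c \<times> 'c, 'k) mpoly) mpoly)"
    by (rule comm_ring_hom_comp[OF comm_ring_hom_poly_const comm_ring_hom_poly_const])
  interpret E: comm_ring_hom "eval_poly H t" by (rule H.comm_ring_hom_eval_poly)
  show ?thesis
  proof (rule mpoly_hom_cong[OF comm_ring_hom_comp[OF E.comm_ring_hom_axioms comm_ring_hom_restrict]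
        comm_ring_hom.comm_ring_hom_eval_poly[OF Hc]])
    show "eval_poly H t (restrict_to_plane I (poly_const c)) =
        eval_poly (\<lambda>c. H (poly_const c)) (\<lambda>p. \<Sum>a\<in>I. t a * H (chart_entry I poly_var a p)) (poly_const c)" for c
      by (simp add: restrict_to_plane_def comm_ring_hom.eval_poly_const[OF cc]
          comm_ring_hom.eval_poly_const[OF Hc] H.eval_poly_const)
    show "eval_poly H t (restrict_to_plane I (poly_var v)) =
        eval_poly (\<lambda>c. H (poly_const c)) (\<lambda>p. \<Sum>a\<in>I. t a * H (chart_entry I poly_var a p)) (poly_var v)" for v
      by (simp add: restrict_to_plane_def comm_ring_hom.eval_poly_var[OF cc]
          comm_ring_hom.eval_poly_var[OF Hc] E.hom_sum E.hom_mult H.eval_poly_const H.eval_poly_var)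
  qed
qed

lemma sd_equations_eq:
  "sd_equations r = {dt r (\<lambda>i j. poly_var (Upair (\<rho> i) (\<sigma> j))) | \<rho> \<sigma>. inj_on \<rho> {..<r} \<and> inj_on \<sigma> {..<r}}"
  by (simp add: sd_equations_def minors_def generic_sym_matrix_def sym_matrix_def dt_def)

lemma eval_minor_restrict:
  fixes H :: "('n::finite uprod \<times> 'n uprod, 'k::field) mpoly \<Rightarrow> 'b::comm_ring_1"
  assumes H: "comm_ring_hom H"
  shows "eval_poly H t (restrict_to_plane I (dt r (\<lambda>i j. poly_var (Upair (\<rho> i) (\<sigma> j))))) =
    dt r (\<lambda>i j. pmat I (\<lambda>v. H (poly_var v)) t (\<rho> i) (\<sigma> j))"
proof -
  interpret H: comm_ring_hom H by fact
  have Hc: "comm_ring_hom (\<lambda>c. H (poly_const c))" by (rule comm_ring_hom_comp[OF H comm_ring_hom_poly_const])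
  have "H (chart_entry I poly_var a p) = chart_entry I (\<lambda>v. H (poly_var v)) a p" for a p
    by (simp add: chart_entry_def)
  then show ?thesis
    unfolding eval_restrict[OF H] dt_hom[OF comm_ring_hom.comm_ring_hom_eval_poly[OF Hc]]
      comm_ring_hom.eval_poly_var[OF Hc] pmat_def by simp
qed

definition fano_gens :: "nat \<Rightarrow> 'n::finite uprod set \<Rightarrow> ('n uprod \<times> 'n uprod, 'k::field) mpoly set" where
  "fano_gens r I = {Poly_Mapping.lookup (restrict_to_plane I g) m | g m. g \<in> sd_equations r}"

lemma sd_fano_gens: "sd_fano r I = genideal (chart_ring I) (fano_gens r I)"
  by (simp add: sd_fano_def fano_scheme_def fano_gens_def)

lemma lookup_map_coeffs:
  fixes h :: "'a::comm_ring_1 \<Rightarrow> 'b::comm_ring_1"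
  assumes h: "comm_ring_hom h"
  shows "Poly_Mapping.lookup (eval_poly (\<lambda>c. poly_const (h c)) poly_var f) m = h (Poly_Mapping.lookup f m)"
proof -
  interpret h: comm_ring_hom h by fact
  have "eval_poly (\<lambda>c. poly_const (h c)) poly_var f =
      (\<Sum>m\<in>Poly_Mapping.keys f. Poly_Mapping.single m (h (Poly_Mapping.lookup f m)))"
    by (simp add: eval_poly_mono single_eq_const_times_vars)
  also have "Poly_Mapping.lookup \<dots> m = (\<Sum>m'\<in>Poly_Mapping.keys f. if m' = m then h (Poly_Mapping.lookup f m') else 0)"
    unfolding lookup_sum by (rule sum.cong) (auto simp: lookup_single when_def)
  also have "\<dots> = h (Poly_Mapping.lookup f m)" by (simp add: in_keys_iff)
  finally show ?thesis .
qed

lemma fano_gens_ret: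
  fixes f :: "('n::finite uprod \<times> 'n uprod, 'k::field) mpoly"
  assumes "f \<in> fano_gens r I"
  shows "ret I f = f"
proof -
  obtain g m where f: "f = Poly_Mapping.lookup (restrict_to_plane I g) m" using assms by (auto simp: fano_gens_def)
  let ?h = "\<lambda>c :: ('n uprod \<times> 'n uprod, 'k) mpoly. poly_const (ret I c) :: ('n uprod, ('n uprod \<times> 'n uprod, 'k) mpoly) mpoly"
  have h: "comm_ring_hom ?h" by (rule comm_ring_hom_comp[OF comm_ring_hom_poly_const ret.comm_ring_hom_axioms])
  have cc: "comm_ring_hom (\<lambda>c. poly_const (poly_const c) :: ('n uprod, ('n uprod \<times> 'n uprod, 'k) mpoly) mpoly)"
    by (rule comm_ring_hom_comp[OF comm_ring_hom_poly_const comm_ring_hom_poly_const])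
  interpret E: comm_ring_hom "eval_poly ?h poly_var" by (rule comm_ring_hom.comm_ring_hom_eval_poly[OF h])
  have re: "ret I (chart_entry I poly_var a p) = (chart_entry I poly_var a p :: ('n uprod \<times> 'n uprod, 'k) mpoly)"
    if "a \<in> I" for a p
    using that by (simp add: chart_entry_def ret_var chart_mask_def)
  have "eval_poly ?h poly_var (restrict_to_plane I g) = restrict_to_plane I g"
  proof (rule mpoly_hom_cong[OF comm_ring_hom_comp[OF E.comm_ring_hom_axioms comm_ring_hom_restrict] comm_ring_hom_restrict])
    show "eval_poly ?h poly_var (restrict_to_plane I (poly_const c)) = restrict_to_plane I (poly_const c)" for c
      by (simp add: restrict_to_plane_def comm_ring_hom.eval_poly_const[OF cc] comm_ring_hom.eval_poly_const[OF h])
    show "eval_poly ?h poly_var (restrict_to_plane I (poly_var v)) = restrict_to_plane I (poly_var v)" for v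
      by (simp add: restrict_to_plane_def comm_ring_hom.eval_poly_var[OF cc] E.hom_sum E.hom_mult
          comm_ring_hom.eval_poly_const[OF h] comm_ring_hom.eval_poly_var[OF h] re)
  qed
  then show ?thesis using lookup_map_coeffs[OF ret.comm_ring_hom_axioms, of I "restrict_to_plane I g" m]
    by (simp add: f)
qed

lemma fano_gens_carrier:
  "fano_gens r I \<subseteq> carrier (chart_ring I :: ('n::finite uprod \<times> 'n uprod, 'k::field) mpoly ring)"
proof
  fix f :: "('n uprod \<times> 'n uprod, 'k) mpoly" assume "f \<in> fano_gens r I"
  then have "ret I f = f" by (rule fano_gens_ret)
  then show "f \<in> carrier (chart_ring I)" unfolding carrier_chart_ring using vars_in_ret[of I f] by simp
qed

lemma ideal_sd_fano: "ideal (sd_fano r I) (chart_ring I)"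
  unfolding sd_fano_gens
  by (rule ring.genideal_ideal[OF cring.axioms(1)[OF cring_chart_ring] fano_gens_carrier])

lemma fano_gens_in: "fano_gens r I \<subseteq> sd_fano r I"
  unfolding sd_fano_gens
  by (rule ring.genideal_self[OF cring.axioms(1)[OF cring_chart_ring] fano_gens_carrier])

text \<open>The Fano ideal is generated inside the chart ring. Intersecting \<open>J\<close> with
  the carrier turns an ideal of the polynomial type into one of the chart ring, to which minimality
  applies.\<close>

lemma sd_fano_subset:
  fixes J :: "('n::finite uprod \<times> 'n uprod, 'k::field) mpoly set"
  assumes J: "is_ideal J" "fano_gens r I \<subseteq> J"
  shows "sd_fano r I \<subseteq> J"
proof -
  let ?R = "chart_ring I :: ('n uprod \<times> 'n uprod, 'k) mpoly ring"
  interpret R: cring ?R by (rule cring_chart_ring)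
  have "ideal (J \<inter> carrier ?R) ?R"
  proof (rule idealI)
    show "ring ?R" by (rule R.ring_axioms)
    show "subgroup (J \<inter> carrier ?R) (add_monoid ?R)"
    proof (rule R.add.subgroupI)
      show "J \<inter> carrier ?R \<subseteq> carrier ?R" by simp
      have "0 \<in> J \<inter> carrier ?R" using ideal_zero[OF J(1)] by (simp add: carrier_chart_ring)
      then show "J \<inter> carrier ?R \<noteq> {}" by (rule ex_in_conv[THEN iffD1, OF exI])
      fix a assume a: "a \<in> J \<inter> carrier ?R"
      then have car: "a \<in> carrier ?R" "- a \<in> carrier ?R" by (simp_all add: carrier_chart_ring vars_in_uminus)
      have "- a \<oplus>\<^bsub>?R\<^esub> a = \<zero>\<^bsub>?R\<^esub>" by (simp add: chart_ring_ops)
      from R.minus_equality[OF this car] have "\<ominus>\<^bsub>?R\<^esub> a = - a" .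
      then show "\<ominus>\<^bsub>?R\<^esub> a \<in> J \<inter> carrier ?R" using a car(2) by (simp add: ideal_uminus[OF J(1)])
      fix b assume "b \<in> J \<inter> carrier ?R"
      then show "a \<oplus>\<^bsub>?R\<^esub> b \<in> J \<inter> carrier ?R" using a
        by (simp add: carrier_chart_ring chart_ring_ops vars_in_add ideal_add[OF J(1)])
    qed
    fix a x assume "a \<in> J \<inter> carrier ?R" "x \<in> carrier ?R"
    then show "x \<otimes>\<^bsub>?R\<^esub> a \<in> J \<inter> carrier ?R" "a \<otimes>\<^bsub>?R\<^esub> x \<in> J \<inter> carrier ?R"
      by (simp_all add: carrier_chart_ring chart_ring_ops vars_in_mult ideal_mult[OF J(1)] ideal_mult_right[OF J(1)])
  qed
  moreover have "fano_gens r I \<subseteq> J \<inter> carrier ?R" using J(2) fano_gens_carrier by blast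
  ultimately have "sd_fano r I \<subseteq> J \<inter> carrier ?R" unfolding sd_fano_gens by (rule R.genideal_minimal)
  then show ?thesis by blast
qed

abbreviation fano_pull :: "nat \<Rightarrow> 'n::finite uprod set \<Rightarrow> ('n uprod \<times> 'n uprod, 'k::field) mpoly set" where
  "fano_pull r I \<equiv> pull I (sd_fano r I)"

lemma ideal_fano_pull: "is_ideal (fano_pull r I)"
  by (rule is_ideal_pull[OF ideal_sd_fano])

lemma dt_not_inj_rows:
  assumes "\<not> inj_on \<rho> {..<r}"
  shows "dt r (\<lambda>i j. A (\<rho> i) (\<sigma> j)) = 0"
proof -
  obtain i k where "i < r" "k < r" "i \<noteq> k" "\<rho> i = \<rho> k" using assms by (auto simp: inj_on_def)
  then show ?thesis by (intro dt_identical_rows[of i r k]) auto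
qed

lemma dt_not_inj_cols:
  assumes "\<not> inj_on \<sigma> {..<r}"
  shows "dt r (\<lambda>i j. A (\<rho> i) (\<sigma> j)) = 0"
  using dt_not_inj_rows[OF assms, of "\<lambda>i j. A j i" \<rho>] dt_transpose[of r "\<lambda>i j. A (\<rho> i) (\<sigma> j)"] by simp

text \<open>Substituting constants for the parameters of the universal plane gives a linear
  combination of the coefficients that generate the Fano ideal.\<close>

lemma minor_in_fano_pull:
  fixes t :: "'n::finite uprod \<Rightarrow> 'k::field"
  shows "dt r (\<lambda>i j. pmat I poly_var (\<lambda>a. poly_const (t a)) (\<rho> i) (\<sigma> j)) \<in> fano_pull r I"
proof (cases "inj_on \<rho> {..<r} \<and> inj_on \<sigma> {..<r}")
  case False
  then have "\<not> inj_on \<rho> {..<r} \<or> \<not> inj_on \<sigma> {..<r}" by blast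
  then have "dt r (\<lambda>i j. pmat I poly_var (\<lambda>a. poly_const (t a)) (\<rho> i) (\<sigma> j)) = (0 :: ('n uprod \<times> 'n uprod, 'k) mpoly)"
    by (elim disjE) (erule dt_not_inj_rows, erule dt_not_inj_cols)
  then show ?thesis using ideal_zero[OF ideal_fano_pull] by simp
next
  case True
  let ?g = "dt r (\<lambda>i j. poly_var (Upair (\<rho> i) (\<sigma> j))) :: ('n uprod, 'k) mpoly"
  let ?f = "restrict_to_plane I ?g"
  have g: "?g \<in> sd_equations r" using True unfolding sd_equations_eq by blast
  have gens: "Poly_Mapping.lookup ?f m \<in> fano_pull r I" for m
  proof -
    have "Poly_Mapping.lookup ?f m \<in> fano_gens r I" using g unfolding fano_gens_def by blast
    then show ?thesis using fano_gens_in fano_gens_ret unfolding pull_def by fastforce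
  qed
  have "dt r (\<lambda>i j. pmat I poly_var (\<lambda>a. poly_const (t a)) (\<rho> i) (\<sigma> j)) = eval_poly id (\<lambda>a. poly_const (t a)) ?f"
    using eval_minor_restrict[OF comm_ring_hom_id, of "\<lambda>a. poly_const (t a)" I r \<rho> \<sigma>] by simp
  also have "\<dots> \<in> fano_pull r I"
    unfolding eval_poly_mono by (intro ideal_sum[OF ideal_fano_pull] ideal_mult_right[OF ideal_fano_pull]) (simp add: gens)
  finally show ?thesis .
qed

text \<open>Over an infinite field a form in the parameters is zero once it vanishes at all
  constants, so conditions on the generators can be checked on members with constant coefficients.
  With values in univariate polynomials this serves both points (\<open>i = 0\<close>) and tangent
  vectors (\<open>i = 1\<close> as well).\<close>

lemma fano_gens_coeff_zero:
  fixes H :: "('n::finite uprod \<times> 'n uprod, 'k::field) mpoly \<Rightarrow> 'k poly"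
  assumes inf: "infinite (UNIV :: 'k set)" and H: "comm_ring_hom H"
    and z: "\<And>t \<rho> \<sigma>. coeff (dt r (\<lambda>i j. pmat I (\<lambda>v. H (poly_var v)) (\<lambda>a. [:t a:]) (\<rho> i) (\<sigma> j))) i = 0"
    and f: "f \<in> fano_gens r I"
  shows "coeff (H f) i = 0"
proof -
  obtain \<rho> \<sigma> m where f: "f = Poly_Mapping.lookup (restrict_to_plane I (dt r (\<lambda>i j. poly_var (Upair (\<rho> i) (\<sigma> j))))) m"
    using f unfolding fano_gens_def sd_equations_eq by blast
  let ?f = "restrict_to_plane I (dt r (\<lambda>i j. poly_var (Upair (\<rho> i) (\<sigma> j))) :: ('n uprod, 'k) mpoly)"
  \<comment> \<open>The form in the parameters whose coefficients are the \<open>i\<close>-th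
    coefficients of the images under \<open>H\<close>.\<close>
  define F where "F = (\<Sum>m\<in>Poly_Mapping.keys ?f. Poly_Mapping.single m (coeff (H (Poly_Mapping.lookup ?f m)) i))"
  have lF: "Poly_Mapping.lookup F m = coeff (H (Poly_Mapping.lookup ?f m)) i" for m
  proof -
    interpret H: comm_ring_hom H by fact
    have "Poly_Mapping.lookup F m = (\<Sum>m'\<in>Poly_Mapping.keys ?f. if m' = m then coeff (H (Poly_Mapping.lookup ?f m')) i else 0)"
      unfolding F_def lookup_sum by (rule sum.cong) (auto simp: lookup_single when_def)
    then show ?thesis by (simp add: in_keys_iff)
  qed
  have hp: "comm_ring_hom (\<lambda>c. [:c:] :: 'k poly)" by unfold_locales (auto simp: one_pCons)
  have "evl t F = 0" for t
  proof -
    have "evl t F = (\<Sum>m\<in>Poly_Mapping.keys ?f. coeff (H (Poly_Mapping.lookup ?f m)) i * mono t m)"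
      unfolding F_def evl.hom_sum by (simp add: comm_ring_hom.eval_poly_single[OF comm_ring_hom_id])
    also have "\<dots> = coeff (\<Sum>m\<in>Poly_Mapping.keys ?f. H (Poly_Mapping.lookup ?f m) * [:mono t m:]) i"
      by (simp add: coeff_sum mult.commute)
    also have "\<dots> = coeff (eval_poly H (\<lambda>a. [:t a:]) ?f) i"
      by (simp only: eval_poly_mono comm_ring_hom.hom_mono[OF hp])
    also have "\<dots> = 0" unfolding eval_minor_restrict[OF H] by (rule z)
    finally show ?thesis .
  qed
  then have "F = 0" by (intro mpoly_all_zero[OF inf])
  then show ?thesis using lF[of m] by (simp add: f)
qed

section \<open>Closed points of the Fano scheme\<close>

definition minors_vanish :: "nat \<Rightarrow> ('k::field ^ 'n::finite uprod) set \<Rightarrow> bool" where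
  "minors_vanish r Q \<longleftrightarrow> (\<forall>z\<in>Q. \<forall>\<rho> \<sigma>. dt r (\<lambda>i j. z $ Upair (\<rho> i) (\<sigma> j)) = 0)"

lemma fano_zero_iff:
  fixes x :: "'n::finite uprod \<times> 'n uprod \<Rightarrow> 'k::field"
  assumes inf: "infinite (UNIV :: 'k set)"
  shows "(\<forall>f\<in>sd_fano r I. evl x f = 0) \<longleftrightarrow> minors_vanish r (chart_plane I x)"
proof
  assume L: "\<forall>f\<in>sd_fano r I. evl x f = 0"
  show "minors_vanish r (chart_plane I x)"
    unfolding minors_vanish_def
  proof (intro ballI allI)
    fix z \<rho> \<sigma> assume z: "z \<in> chart_plane I x"
    let ?m = "dt r (\<lambda>i j. pmat I poly_var (\<lambda>a. poly_const (z $ a)) (\<rho> i) (\<sigma> j))"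
    have "ret I ?m \<in> sd_fano r I" using minor_in_fano_pull[of r I "\<lambda>a. z $ a" \<rho> \<sigma>] by (simp add: pull_def)
    then have "evl (chart_mask I x) ?m = 0" using L evl_ret[of x I ?m] by simp
    then have "dt r (\<lambda>i j. pmat I (chart_mask I x) (\<lambda>a. z $ a) (\<rho> i) (\<sigma> j)) = 0"
      by (simp add: dt_hom[OF evl.comm_ring_hom_axioms] pmat_hom[OF evl.comm_ring_hom_axioms])
    then show "dt r (\<lambda>i j. z $ Upair (\<rho> i) (\<sigma> j)) = 0"
      by (simp add: pmat_mask in_chart_plane_pmat[OF z])
  qed
next
  assume R: "minors_vanish r (chart_plane I x)"
  have hp: "comm_ring_hom (\<lambda>c. [:c:] :: 'k poly)" by unfold_locales (auto simp: one_pCons)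
  have H: "comm_ring_hom (\<lambda>f. [:evl x f:])" by (rule comm_ring_hom_comp[OF hp evl.comm_ring_hom_axioms])
  have "coeff [:evl x f:] 0 = 0" if "f \<in> fano_gens r I" for f
  proof (rule fano_gens_coeff_zero[OF inf H _ that])
    fix t \<rho> \<sigma>
    have "dt r (\<lambda>i j. pmat I (\<lambda>v. [:evl x (poly_var v):]) (\<lambda>a. [:t a:]) (\<rho> i) (\<sigma> j)) =
        [:dt r (\<lambda>i j. pmat I x t (\<rho> i) (\<sigma> j)):]"
      by (simp add: dt_hom[OF hp] pmat_hom[OF hp])
    also have "dt r (\<lambda>i j. pmat I x t (\<rho> i) (\<sigma> j)) = 0"
      unfolding pmat_comb using R comb_in_chart_plane unfolding minors_vanish_def by blast
    finally show "coeff (dt r (\<lambda>i j. pmat I (\<lambda>v. [:evl x (poly_var v):]) (\<lambda>a. [:t a:]) (\<rho> i) (\<sigma> j))) 0 = 0"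
      by (simp only: pCons_0_0 coeff_0)
  qed
  then have "fano_gens r I \<subseteq> {f. evl x f = 0}" by auto
  moreover have "is_ideal {f. evl x f = 0}" by (simp add: is_ideal_def hom_distribs)
  ultimately have "sd_fano r I \<subseteq> {f. evl x f = 0}" by (intro sd_fano_subset)
  then show "\<forall>f\<in>sd_fano r I. evl x f = 0" by auto
qed

lemma scheme_points_sd_fano:
  assumes inf: "infinite (UNIV :: 'k::field set)"
  shows "scheme_points d (sd_fano r) = {Q :: ('k ^ 'n::finite uprod) set. Q \<in> grassmannian d \<and> minors_vanish r Q}"
proof (intro equalityI subsetI)
  fix Q :: "('k ^ 'n uprod) set" assume Q: "Q \<in> scheme_points d (sd_fano r)"
  then have G: "Q \<in> grassmannian d" by (simp add: scheme_points_def)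
  then obtain I x where I: "card I = d" "Q = chart_plane I x"
    using exists_chart[of Q] unfolding grassmannian_def by auto
  then have "\<forall>f\<in>sd_fano r I. evl x f = 0" using Q unfolding scheme_points_def by blast
  then have "minors_vanish r Q" unfolding I(2) by (rule fano_zero_iff[OF inf, THEN iffD1])
  then show "Q \<in> {Q. Q \<in> grassmannian d \<and> minors_vanish r Q}" using G by simp
next
  fix Q :: "('k ^ 'n uprod) set" assume "Q \<in> {Q. Q \<in> grassmannian d \<and> minors_vanish r Q}"
  then have Q: "Q \<in> grassmannian d" "minors_vanish r Q" by simp_all
  show "Q \<in> scheme_points d (sd_fano r)"
    unfolding scheme_points_def
  proof (intro CollectI conjI allI impI Q(1))
    fix I x assume "card I = d \<and> Q = chart_plane I x"
    then have "minors_vanish r (chart_plane I x)" using Q(2) by simp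
    then show "\<forall>f\<in>sd_fano r I. evl x f = 0" by (rule fano_zero_iff[OF inf, THEN iffD2])
  qed
qed

section \<open>Generic conditions\<close>

lemma van_cong: "reduced_structure C = reduced_structure Z \<Longrightarrow> van C I = van Z I"
  using van_iff_reduced[of _ C I] van_iff_reduced[of _ Z I] by auto

text \<open>A polynomial condition on tuples of matrices in a plane cuts out a closed set of planes, so it holds
  generically in every chart meeting \<open>Z\<close> as soon as it holds at one plane.\<close>

lemma generic_condition:
  fixes Z C :: "('k::field ^ 'n::finite uprod) set set" and \<gamma> :: "(nat \<Rightarrow> 'n \<Rightarrow> 'n \<Rightarrow> 'k) \<Rightarrow> 'k"
  assumes Z: "irreducible_locus d Z" "Z \<subseteq> grassmannian d" and C: "reduced_structure C = reduced_structure Z"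
    and poly: "\<And>I \<tau>. \<exists>G. \<forall>x. evl x G = \<gamma> (\<lambda>m. pmat I x (\<tau> m))"
    and Q: "Q \<in> C" "Q \<in> grassmannian d" and z: "\<And>m. z m \<in> Q"
    and nz: "\<gamma> (\<lambda>m i j. z m $ Upair i j) \<noteq> 0"
    and I: "card I = d" "chart_plane I x0 \<in> Z"
  shows "\<exists>\<tau>. \<forall>G. (\<forall>x. evl x G = \<gamma> (\<lambda>m. pmat I x (\<tau> m))) \<longrightarrow> G \<notin> van Z I"
proof (rule ccontr)
  assume "\<not> ?thesis"
  then have all: "\<exists>G. (\<forall>x. evl x G = \<gamma> (\<lambda>m. pmat I x (\<tau> m))) \<and> G \<in> van Z I" for \<tau> by simp
  \<comment> \<open>Quantifying over tuples of members, and not over coefficients with respect to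
    one chart, makes this set independent of the chart.\<close>
  define B where "B = {Q \<in> grassmannian d. \<forall>z. (\<forall>m. z m \<in> Q) \<longrightarrow> \<gamma> (\<lambda>m i j. z m $ Upair i j) = 0}"
  have in_B: "chart_plane J x \<in> B \<longleftrightarrow> (\<forall>\<tau>. \<gamma> (\<lambda>m. pmat J x (\<tau> m)) = 0)" if J: "card J = d" for J x
  proof
    assume L: "chart_plane J x \<in> B"
    show "\<forall>\<tau>. \<gamma> (\<lambda>m. pmat J x (\<tau> m)) = 0"
    proof
      fix \<tau> :: "nat \<Rightarrow> 'n uprod \<Rightarrow> 'k"
      let ?z = "\<lambda>m. \<Sum>a\<in>J. \<tau> m a *s rowv J x a"
      have b: "\<forall>z. (\<forall>m. z m \<in> chart_plane J x) \<longrightarrow> \<gamma> (\<lambda>m i j. z m $ Upair i j) = 0"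
        using L unfolding B_def by simp
      have "\<gamma> (\<lambda>m i j. ?z m $ Upair i j) = 0" by (rule b[rule_format]) (rule comb_in_chart_plane)
      moreover have "(\<lambda>m i j. ?z m $ Upair i j) = (\<lambda>m. pmat J x (\<tau> m))"
        by (intro ext) (simp only: pmat_comb)
      ultimately show "\<gamma> (\<lambda>m. pmat J x (\<tau> m)) = 0" by simp
    qed
  next
    assume R: "\<forall>\<tau>. \<gamma> (\<lambda>m. pmat J x (\<tau> m)) = 0"
    show "chart_plane J x \<in> B"
      unfolding B_def
    proof (intro CollectI conjI allI impI)
      show "chart_plane J x \<in> grassmannian d" by (rule chart_plane_in_grassmannian[OF J])
      fix z :: "nat \<Rightarrow> 'k ^ 'n uprod" assume "\<forall>m. z m \<in> chart_plane J x"
      then have "(\<lambda>m i j. z m $ Upair i j) = (\<lambda>m. pmat J x (\<lambda>a. z m $ a))"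
        using in_chart_plane_pmat by (intro ext) blast
      then show "\<gamma> (\<lambda>m i j. z m $ Upair i j) = 0" using R by simp
    qed
  qed
  have evm: "evl (chart_mask J x) G = \<gamma> (\<lambda>m. pmat J x (\<tau> m))"
    if "\<forall>x. evl x G = \<gamma> (\<lambda>m. pmat J x (\<tau> m))" for J x G \<tau>
    using that by (simp add: pmat_mask)
  have "zariski_closed d B"
    unfolding zariski_closed_def
  proof (intro conjI allI impI)
    show "B \<subseteq> grassmannian d" by (auto simp: B_def)
    fix J :: "'n uprod set" assume J: "card J = d"
    define \<G> where "\<G> = {ret J G | G \<tau>. \<forall>x. evl x G = \<gamma> (\<lambda>m. pmat J x (\<tau> m))}"
    show "\<exists>G\<subseteq>carrier (chart_ring J). \<forall>x. chart_plane J x \<in> B \<longleftrightarrow> (\<forall>f\<in>G. evl x f = 0)"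
    proof (intro exI[of _ \<G>] conjI allI)
      show "\<G> \<subseteq> carrier (chart_ring J)" by (auto simp: \<G>_def carrier_chart_ring vars_in_ret)
      fix x
      have "(\<forall>f\<in>\<G>. evl x f = 0) \<longleftrightarrow> (\<forall>\<tau>. \<gamma> (\<lambda>m. pmat J x (\<tau> m)) = 0)"
      proof
        assume L: "\<forall>f\<in>\<G>. evl x f = 0"
        show "\<forall>\<tau>. \<gamma> (\<lambda>m. pmat J x (\<tau> m)) = 0"
        proof
          fix \<tau>
          obtain G where G: "\<forall>x. evl x G = \<gamma> (\<lambda>m. pmat J x (\<tau> m))" using poly[of J \<tau>] by (rule exE)
          then have "ret J G \<in> \<G>" unfolding \<G>_def by blast
          with L have "evl x (ret J G) = 0" by (rule bspec)
          then show "\<gamma> (\<lambda>m. pmat J x (\<tau> m)) = 0" unfolding evl_ret evm[OF G] .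
        qed
      next
        assume R: "\<forall>\<tau>. \<gamma> (\<lambda>m. pmat J x (\<tau> m)) = 0"
        show "\<forall>f\<in>\<G>. evl x f = 0"
        proof
          fix f assume "f \<in> \<G>"
          then obtain G \<tau> where G: "f = ret J G" "\<forall>x. evl x G = \<gamma> (\<lambda>m. pmat J x (\<tau> m))"
            unfolding \<G>_def by blast
          show "evl x f = 0" unfolding G(1) evl_ret evm[OF G(2)] using R by simp
        qed
      qed
      then show "chart_plane J x \<in> B \<longleftrightarrow> (\<forall>f\<in>\<G>. evl x f = 0)" using in_B[OF J] by simp
    qed
  qed
  then have ZB: "Z \<subseteq> B"
  proof (rule closed_contains_irreducible[OF Z I])
    fix x assume x: "chart_plane I x \<in> Z"
    have "\<gamma> (\<lambda>m. pmat I x (\<tau> m)) = 0" for \<tau>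
    proof -
      obtain G where G: "\<forall>x. evl x G = \<gamma> (\<lambda>m. pmat I x (\<tau> m))" "G \<in> van Z I" using all[of \<tau>] by (elim exE conjE)
      then have "evl (chart_mask I x) G = 0" using x by (simp add: van_iff)
      then show ?thesis unfolding evm[OF G(1)] .
    qed
    then show "chart_plane I x \<in> B" using in_B[OF I(1)] by simp
  qed
  obtain J x where J: "card J = d" "Q = chart_plane J x"
    using exists_chart[of Q] Q(2) unfolding grassmannian_def by auto
  obtain G where G: "\<forall>x. evl x G = \<gamma> (\<lambda>m. pmat J x (\<lambda>a. z m $ a))"
    using poly[of J "\<lambda>m a. z m $ a"] by (rule exE)
  have "G \<in> van Z J"
    unfolding van_iff
  proof (intro allI impI)
    fix y assume "chart_plane J y \<in> Z"
    then have "chart_plane J y \<in> B" using ZB by (rule subsetD[rotated])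
    then show "evl (chart_mask J y) G = 0" unfolding evm[OF G] in_B[OF J(1)] by (rule spec)
  qed
  \<comment> \<open>\<open>C\<close> and \<open>Z\<close> are comparable only through their
    vanishing ideals; this suffices to bring the equation from \<open>Z\<close> to the plane
    \<open>Q\<close>.\<close>
  then have "G \<in> van C J" using van_cong[OF C] by simp
  then have "evl (chart_mask J x) G = 0" using Q(1) J(2) by (simp add: van_iff)
  then have "\<gamma> (\<lambda>m. pmat J x (\<lambda>a. z m $ a)) = 0" unfolding evm[OF G] .
  moreover have "(\<lambda>m i j. z m $ Upair i j) = (\<lambda>m. pmat J x (\<lambda>a. z m $ a))"
    using z in_chart_plane_pmat unfolding J(2) by (intro ext) blast
  ultimately show False using nz by simp
qed

section \<open>Planes with prescribed members\<close>

definition fst_up :: "'n uprod \<Rightarrow> 'n" where "fst_up q = fst (SOME ij. q = Upair (fst ij) (snd ij))"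
definition snd_up :: "'n uprod \<Rightarrow> 'n" where "snd_up q = snd (SOME ij. q = Upair (fst ij) (snd ij))"

lemma Upair_fst_snd: "Upair (fst_up q) (snd_up q) = q"
proof -
  have "\<exists>ij. q = Upair (fst ij) (snd ij)" by (cases q) auto
  from someI_ex[OF this] show ?thesis unfolding fst_up_def snd_up_def by simp
qed

definition symvec :: "('n::finite \<Rightarrow> 'n \<Rightarrow> 'k) \<Rightarrow> 'k ^ 'n uprod" where
  "symvec A = (\<chi> q. A (fst_up q) (snd_up q))"

lemma symvec_nth:
  assumes "\<And>i j. A i j = A j i"
  shows "symvec A $ Upair i j = A i j"
proof -
  have "Upair (fst_up (Upair i j)) (snd_up (Upair i j)) = Upair i j" by (rule Upair_fst_snd)
  then show ?thesis using assms by (auto simp: symvec_def)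
qed

lemma uprod_vec_eqI: "(\<And>i j. z $ Upair i j = w $ Upair i j) \<Longrightarrow> z = w"
  unfolding Finite_Cartesian_Product.vec_eq_iff using Upair_fst_snd by metis

lemma scalar_product_sym_matrix:
  "scalar_product u (sym_matrix z *v w) = bf (\<lambda>i j. z $ Upair i j) u w"
  by (simp add: bf_def scalar_product_def sym_matrix_def matrix_vector_mult_def sum_distrib_left mult.assoc)

lemma adapted_basis:
  fixes U W :: "('k::field ^ 'n::finite) set" and I J :: "'n set"
  assumes U: "vec.subspace U" and W: "vec.subspace W" and UW: "U \<subseteq> W"
    and I: "I \<subseteq> J" "card I = vec.dim U" "card J = vec.dim W"
  shows "\<exists>p. (\<forall>i\<in>I. p i \<in> U) \<and> (\<forall>i\<in>J. p i \<in> W) \<and> vec.span (range p) = UNIV"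
proof -
  obtain B1 where B1: "B1 \<subseteq> U" "vec.independent B1" "U \<subseteq> vec.span B1" "card B1 = vec.dim U"
    by (rule vec.basis_exists)
  obtain B2 where B2: "B1 \<subseteq> B2" "B2 \<subseteq> W" "vec.independent B2" "W \<subseteq> vec.span B2"
    by (rule vec.maximal_independent_subset_extend[OF order_trans[OF B1(1) UW] B1(2)])
  obtain B where B: "B2 \<subseteq> B" "vec.independent B" "UNIV \<subseteq> vec.span B"
    by (rule vec.maximal_independent_subset_extend[OF subset_UNIV B2(3)])
  have fin: "finite B" using B(2) by (rule vec.finiteI_independent)
  have fin2: "finite B2" using B(1) fin by (rule finite_subset)
  have fin1: "finite B1" using B2(1) fin2 by (rule finite_subset)
  have c2: "card B2 = vec.dim W" using vec.basis_card_eq_dim[OF B2(2,4,3)] .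
  have c: "card B = CARD('n)" using vec.basis_card_eq_dim[OF subset_UNIV B(3,2)] by (simp add: vec.dim_UNIV card_cart_basis)
  obtain f1 where f1: "bij_betw f1 I B1" using finite_same_card_bij[of I B1] I(2) B1(4) fin1 by auto
  have "card (J - I) = card (B2 - B1)"
    using I B1(4) c2 card_Diff_subset[of I J] card_Diff_subset[OF fin1 B2(1)] by simp
  then obtain f2 where f2: "bij_betw f2 (J - I) (B2 - B1)" using finite_same_card_bij[of "J - I" "B2 - B1"] fin2 by auto
  have "card (- J) = card (B - B2)"
    using I c c2 card_Diff_subset[OF fin2 B(1)] by (simp add: Compl_eq_Diff_UNIV card_Diff_subset)
  then obtain f3 where f3: "bij_betw f3 (- J) (B - B2)" using finite_same_card_bij[of "- J" "B - B2"] fin by auto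
  define p where "p i = (if i \<in> I then f1 i else if i \<in> J then f2 i else f3 i)" for i
  have im1: "f1 ` I = B1" and im2: "f2 ` (J - I) = B2 - B1" and im3: "f3 ` (- J) = B - B2"
    using f1 f2 f3 by (simp_all add: bij_betw_def)
  have "B \<subseteq> range p"
  proof
    fix b assume b: "b \<in> B"
    consider "b \<in> B1" | "b \<in> B2 - B1" | "b \<in> B - B2" using b by blast
    then show "b \<in> range p"
    proof cases
      case 1
      then obtain i where "i \<in> I" "b = f1 i" using im1 by blast
      then show ?thesis by (intro range_eqI[of _ _ i]) (simp add: p_def)
    next
      case 2
      then obtain i where "i \<in> J - I" "b = f2 i" using im2 by blast
      then show ?thesis by (intro range_eqI[of _ _ i]) (simp add: p_def)
    next
      case 3
      then obtain i where "i \<in> - J" "b = f3 i" using im3 by blast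
      then show ?thesis using I(1) by (intro range_eqI[of _ _ i]) (auto simp: p_def)
    qed
  qed
  then have "vec.span (range p) = UNIV" using B(3) vec.span_mono[of B "range p"] by blast
  moreover have "\<forall>i\<in>I. p i \<in> U" using im1 B1(1) by (auto simp: p_def)
  moreover have "p i \<in> W" if i: "i \<in> J" for i
  proof (cases "i \<in> I")
    case True
    then have "p i \<in> B1" using im1 by (auto simp: p_def)
    then show ?thesis using B1(1) UW by blast
  next
    case False
    then have "p i \<in> f2 ` (J - I)" using i by (simp add: p_def)
    then show ?thesis using im2 B2(2) by blast
  qed
  ultimately show ?thesis by blast
qed

lemma bf_span_zero:
  fixes A :: "'n::finite \<Rightarrow> 'n \<Rightarrow> 'k::field"
  assumes z: "\<And>u v. u \<in> S \<Longrightarrow> v \<in> S \<Longrightarrow> bf A u v = 0" and u: "u \<in> vec.span S" and v: "v \<in> vec.span S"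
  shows "bf A u v = 0"
proof -
  have 1: "bf A u w = 0" if w: "w \<in> S" for w
    using u
  proof (induction rule: vec.span_induct_alt)
    case base then show ?case by simp
  next
    case (step c x y)
    then show ?case using z w by (simp add: bf_add_left bf_scale_left)
  qed
  show ?thesis using v
  proof (induction rule: vec.span_induct_alt)
    case base then show ?case by simp
  next
    case (step c x y)
    then show ?case using 1 by (simp add: bf_add_right bf_scale_right)
  qed
qed

definition coord_compression :: "'n set \<Rightarrow> 'n set \<Rightarrow> ('k::field ^ 'n::finite uprod) set" where
  "coord_compression I J = {z. \<forall>i\<in>I. \<forall>j\<in>J. z $ Upair i j = 0}"

lemma subspace_coord_compression: "vec.subspace (coord_compression I J)"
  by (auto simp: vec.subspace_def coord_compression_def)

lemma coord_compression_bf: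
  fixes z :: "'k::field ^ 'n::finite uprod"
  assumes "z \<in> coord_compression I J" "\<And>i. i \<notin> I \<Longrightarrow> u $ i = 0" "\<And>i. i \<notin> J \<Longrightarrow> w $ i = 0"
  shows "bf (\<lambda>i j. z $ Upair i j) u w = 0"
  unfolding bf_def
proof (intro sum.neutral ballI)
  fix i j
  show "u $ i * z $ Upair i j * w $ j = 0"
    using assms by (cases "i \<in> I"; cases "j \<in> J") (auto simp: coord_compression_def)
qed

text \<open>Congruence by a basis adapted to \<open>U \<subseteq> W\<close> moves any nested compression space into the coordinate one.\<close>

lemma dim_coord_compression:
  fixes Q :: "('k::field ^ 'n::finite uprod) set"
  assumes "nested_compression_space r s Q" and I: "I \<subseteq> J" "card I = s + 1 + CARD('n) - r" "card J = CARD('n) - s"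
  shows "vec.dim Q \<le> vec.dim (coord_compression I J :: ('k ^ 'n uprod) set)"
proof -
  obtain U W :: "('k ^ 'n) set" where UW: "vec.subspace U" "vec.subspace W" "U \<subseteq> W"
    "vec.dim U = s + 1 + CARD('n) - r" "vec.dim W = CARD('n) - s"
    and z: "\<forall>u\<in>U. \<forall>w\<in>W. \<forall>z\<in>Q. scalar_product u (sym_matrix z *v w) = 0"
    using assms(1) unfolding nested_compression_space_def by (elim conjE exE) (rule that)
  obtain p where p: "\<forall>i\<in>I. p i \<in> U" "\<forall>i\<in>J. p i \<in> W" "vec.span (range p) = UNIV"
    using adapted_basis[OF UW(1-3) I(1)] I UW by auto
  define T :: "'k ^ 'n uprod \<Rightarrow> 'k ^ 'n uprod" where
    "T z = symvec (\<lambda>i j. bf (\<lambda>i j. z $ Upair i j) (p i) (p j))" for z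
  have smsym: "z $ Upair i j = z $ Upair j i" for z :: "'k ^ 'n uprod" and i j
    by (rule arg_cong[of _ _ "($) z"]) simp
  have T: "T z $ Upair i j = bf (\<lambda>i j. z $ Upair i j) (p i) (p j)" for z i j
    unfolding T_def by (rule symvec_nth, rule bf_commute, rule smsym)
  have "T (z + w) = T z + T w" for z w
    by (rule uprod_vec_eqI) (simp only: vector_add_component T bf_def distrib_left distrib_right sum.distrib)
  moreover have "T (c *s z) = c *s T z" for c z
    by (rule uprod_vec_eqI) (simp add: T bf_def sum_distrib_left mult_ac)
  ultimately have lin: "Vector_Spaces.linear (*s) (*s) T" by unfold_locales simp_all
  have inj: "inj_on T (vec.span Q)"
  proof (rule inj_onI)
    fix z w assume e: "T z = T w"
    let ?A = "\<lambda>i j. z $ Upair i j - w $ Upair i j"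
    have "bf ?A (p i) (p j) = bf (\<lambda>i j. z $ Upair i j) (p i) (p j) - bf (\<lambda>i j. w $ Upair i j) (p i) (p j)" for i j
      by (simp only: bf_def left_diff_distrib right_diff_distrib sum_subtractf)
    then have bp: "bf ?A (p i) (p j) = 0" for i j unfolding T[symmetric] e by simp
    have b0: "bf ?A u v = 0" for u v
    proof (rule bf_span_zero[of "range p"])
      fix a b assume "a \<in> range p" "b \<in> range p"
      then show "bf ?A a b = 0" using bp by blast
    qed (simp_all only: p(3) UNIV_I)
    show "z = w"
    proof (rule uprod_vec_eqI)
      fix i j
      have "bf ?A (axis i 1) (axis j 1) = (\<Sum>a\<in>UNIV. if a = i then \<Sum>b\<in>UNIV. if b = j then ?A a b else 0 else 0)"
        unfolding bf_def
      proof (rule sum.cong[OF refl])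
        fix a
        show "(\<Sum>b\<in>UNIV. axis i 1 $ a * ?A a b * axis j 1 $ b) =
            (if a = i then \<Sum>b\<in>UNIV. if b = j then ?A a b else 0 else 0)"
        proof (cases "a = i")
          case True
          then show ?thesis by (simp add: axis_def if_distrib[of "(*) _"] cong: if_cong)
        next
          case False
          then show ?thesis by (simp add: axis_def)
        qed
      qed
      then show "z $ Upair i j = w $ Upair i j" using b0[of "axis i 1" "axis j 1"] by simp
    qed
  qed
  have "T ` Q \<subseteq> coord_compression I J"
  proof
    fix y assume "y \<in> T ` Q"
    then obtain z' where z': "z' \<in> Q" "y = T z'" by blast
    then have "bf (\<lambda>i j. z' $ Upair i j) (p i) (p j) = 0" if "i \<in> I" "j \<in> J" for i j
      using z p(1,2) that unfolding scalar_product_sym_matrix by blast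
    then show "y \<in> coord_compression I J" using z'(2) by (simp add: coord_compression_def T)
  qed
  then have "vec.dim (T ` Q) \<le> vec.dim (coord_compression I J :: ('k ^ 'n uprod) set)" by (rule vec.dim_subset)
  then show ?thesis using vec.dim_image_eq[OF lin inj] by simp
qed

lemma exists_subspace_between:
  fixes S E :: "('k::field ^ 'c::finite) set"
  assumes E: "vec.subspace E" and S: "S \<subseteq> E" "vec.dim S \<le> d" "d \<le> vec.dim E"
  shows "\<exists>Q. vec.subspace Q \<and> S \<subseteq> Q \<and> Q \<subseteq> E \<and> vec.dim Q = d"
proof -
  obtain B0 where B0: "B0 \<subseteq> S" "vec.independent B0" "S \<subseteq> vec.span B0" "card B0 = vec.dim S"
    by (rule vec.basis_exists)
  obtain B where B: "B0 \<subseteq> B" "B \<subseteq> E" "vec.independent B" "E \<subseteq> vec.span B"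
    by (rule vec.maximal_independent_subset_extend[OF order_trans[OF B0(1) S(1)] B0(2)])
  have fin: "finite B" using B(3) by (rule vec.finiteI_independent)
  have "card B = vec.dim E" using vec.basis_card_eq_dim[OF B(2,4,3)] .
  then obtain B1 where B1: "B0 \<subseteq> B1" "B1 \<subseteq> B" "card B1 = d"
    using exists_subset_between[of B0 d B] B0(4) S(2,3) B(1) fin by auto
  have "vec.independent B1" using vec.independent_mono[OF B(3) B1(2)] .
  then have "vec.dim (vec.span B1) = d" using B1(3) by (simp add: vec.dim_eq_card_independent)
  moreover have "S \<subseteq> vec.span B1" using B0(3) vec.span_mono[OF B1(1)] by (rule order_trans)
  moreover have "vec.span B1 \<subseteq> E" by (rule vec.span_minimal[OF order_trans[OF B1(2) B(2)] E])
  ultimately show ?thesis using vec.subspace_span by blast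
qed

text \<open>A nonempty locus forces the coordinate compression space to have dimension at least k +
  1, so a small family of chosen matrices in it extends to a plane of the locus. The generic
  conditions are tested at such a plane.\<close>

lemma exists_special_plane:
  fixes S :: "('k::field ^ 'n::finite uprod) set"
  assumes inf: "infinite (UNIV :: 'k set)" and r: "2 * s + 1 \<le> r" "r \<le> CARD('n)"
    and ne: "compression_locus r k s \<noteq> ({} :: ('k ^ 'n uprod) set set)"
    and I: "I \<subseteq> J" "card I = s + 1 + CARD('n) - r" "card J = CARD('n) - s"
    and S: "S \<subseteq> coord_compression I J" "vec.dim S \<le> k + 1"
  shows "\<exists>Q. Q \<in> compression_locus r k s \<and> Q \<in> grassmannian (k + 1) \<and> S \<subseteq> Q"
proof -
  obtain Q0 :: "('k ^ 'n uprod) set" where Q0: "Q0 \<in> scheme_points (k + 1) (sd_fano r)" "nested_compression_space r s Q0"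
    using ne unfolding compression_locus_def by blast
  have "vec.dim Q0 = k + 1" using Q0(1) by (simp add: scheme_points_def grassmannian_def)
  then have "k + 1 \<le> vec.dim (coord_compression I J :: ('k ^ 'n uprod) set)"
    using dim_coord_compression[OF Q0(2) I] by simp
  from exists_subspace_between[OF subspace_coord_compression S this]
  obtain Q where Q: "vec.subspace Q" "S \<subseteq> Q" "Q \<subseteq> coord_compression I J" "vec.dim Q = k + 1"
    by (elim exE conjE)
  have G: "Q \<in> grassmannian (k + 1)" using Q by (simp add: grassmannian_def)
  let ?U = "\<lambda>I. {v :: 'k ^ 'n. \<forall>i. i \<notin> I \<longrightarrow> v $ i = 0}"
  have sub: "vec.subspace (?U I)" for I by (auto simp: vec.subspace_def)
  have zero: "bf (\<lambda>i j. z $ Upair i j) u w = 0" if "z \<in> Q" "u \<in> ?U I" "w \<in> ?U J" for z u w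
  proof (rule coord_compression_bf[of z I J])
    show "z \<in> coord_compression I J" using that(1) Q(3) by (rule subsetD[rotated])
  qed (use that(2,3) in simp_all)
  have "nested_compression_space r s Q"
    unfolding nested_compression_space_def scalar_product_sym_matrix
  proof (rule conjI[OF Q(1)], rule exI[of _ "?U I"], rule exI[of _ "?U J"], intro conjI ballI)
    show "?U I \<subseteq> ?U J" using I(1) by auto
    show "vec.dim (?U I) = s + 1 + CARD('n) - r" unfolding dim_supported by (fact I(2))
    show "vec.dim (?U J) = CARD('n) - s" unfolding dim_supported by (fact I(3))
    show "vec.subspace (?U I)" "vec.subspace (?U J)" by (rule sub)+
    show "bf (\<lambda>i j. z $ Upair i j) u w = 0" if "u \<in> ?U I" "w \<in> ?U J" "z \<in> Q" for u w z
      by (rule zero[OF that(3,1,2)])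
  qed
  moreover have "minors_vanish r Q"
    unfolding minors_vanish_def
  proof (intro ballI allI)
    fix z \<rho> \<sigma> assume z: "z \<in> Q"
    show "dt r (\<lambda>i j. z $ Upair (\<rho> i) (\<sigma> j)) = 0"
    proof (rule compression_minors_zero[OF sub[of I] sub[of J], of "\<lambda>i j. z $ Upair i j"])
      show "bf (\<lambda>i j. z $ Upair i j) u w = 0" if "u \<in> ?U I" "w \<in> ?U J" for u w by (rule zero[OF z that])
      show "CARD('n) - vec.dim (?U I) + (CARD('n) - vec.dim (?U J)) < r"
        unfolding dim_supported I(2,3) using r by linarith
    qed
  qed
  ultimately have "Q \<in> compression_locus r k s"
    using G by (simp add: compression_locus_def scheme_points_sd_fano[OF inf])
  then show ?thesis using G Q(2) by blast
qed

section \<open>Kernel vectors of matrices of corank one and special matrices\<close>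

definition mvf :: "('n::finite \<Rightarrow> 'n \<Rightarrow> 'b::comm_ring_1) \<Rightarrow> ('n \<Rightarrow> 'b) \<Rightarrow> 'n \<Rightarrow> 'b" where
  "mvf A v i = (\<Sum>l\<in>UNIV. A i l * v l)"

definition pencil :: "'b::comm_ring_1 \<Rightarrow> ('n \<Rightarrow> 'n \<Rightarrow> 'b) \<Rightarrow> ('n \<Rightarrow> 'n \<Rightarrow> 'b) \<Rightarrow> 'n \<Rightarrow> 'n \<Rightarrow> 'b" where
  "pencil c A B i j = A i j + c * B i j"

text \<open>Cofactors along row 0 of the minor with rows 0..r-1 and columns \<open>y\<close>, 1..r-1
  of the numbering. Rows 1..r-1 of \<open>A\<close> annihilate this vector identically, and its
  support lies in those columns.\<close>

definition kv :: "nat \<Rightarrow> 'n \<Rightarrow> ('n::finite \<Rightarrow> 'n \<Rightarrow> 'b::comm_ring_1) \<Rightarrow> 'n \<Rightarrow> 'b" where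
  "kv r y A = cofv r enum_type (enum_type(0 := y)) 0 A"

lemma mvf_hom:
  assumes "comm_ring_hom h"
  shows "h (mvf A v i) = mvf (\<lambda>a b. h (A a b)) (\<lambda>l. h (v l)) i"
proof -
  interpret comm_ring_hom h by fact
  show ?thesis by (simp add: mvf_def hom_distribs)
qed

lemma pencil_hom:
  assumes "comm_ring_hom h"
  shows "h (pencil c A B i j) = pencil (h c) (\<lambda>a b. h (A a b)) (\<lambda>a b. h (B a b)) i j"
proof -
  interpret comm_ring_hom h by fact
  show ?thesis by (simp add: pencil_def hom_distribs)
qed

lemma kv_hom: "comm_ring_hom h \<Longrightarrow> 0 < r \<Longrightarrow> h (kv r y A l) = kv r y (\<lambda>a b. h (A a b)) l"
  by (simp add: kv_def cofv_hom)

lemma mvf_kv: "0 < r \<Longrightarrow> mvf A (kv r y A) k = dt r (\<lambda>a b. A ((enum_type(0 := k)) a) ((enum_type(0 := y)) b))"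
  unfolding mvf_def kv_def by (rule row_cofv)

lemma mvf_kv_zero:
  assumes "1 \<le> i" "i < r"
  shows "mvf A (kv r y A) (enum_type i) = 0"
proof -
  have "dt r (\<lambda>a b. A ((enum_type(0 := enum_type i)) a) ((enum_type(0 := y)) b)) = 0"
    by (rule dt_identical_rows[of 0 r i]) (use assms in auto)
  then show ?thesis using assms by (simp add: mvf_kv)
qed

lemma kv_support:
  assumes "l \<noteq> y" "l \<notin> enum_type ` {1..<r}"
  shows "kv r y A l = 0"
  unfolding kv_def cofv_def
proof (rule sum.neutral, rule ballI)
  fix j assume "j \<in> {..<r}"
  then have "(enum_type(0 := y)) j \<noteq> l" using assms by (cases "j = 0") auto
  then show "(if (enum_type(0 := y)) j = l then cf r (\<lambda>i j. A (enum_type i) ((enum_type(0 := y)) j)) 0 j else 0) = 0" by simp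
qed

lemma kv_self:
  assumes "0 < r" "y \<notin> enum_type ` {1..<r}"
  shows "kv r y A y = dt (r - 1) (\<lambda>i j. A (enum_type (Suc i)) (enum_type (Suc j)))"
proof -
  obtain m where m: "r = Suc m" using assms(1) by (cases r) auto
  have "(enum_type(0 := y)) j = y \<longleftrightarrow> j = 0" if "j < r" for j
    using assms(2) that by (cases "j = 0") auto
  then have "kv r y A y = (\<Sum>j<r. if j = 0 then cf r (\<lambda>i j. A (enum_type i) ((enum_type(0 := y)) j)) 0 j else 0)"
    unfolding kv_def cofv_def by (intro sum.cong) auto
  also have "\<dots> = cf r (\<lambda>i j. A (enum_type i) ((enum_type(0 := y)) j)) 0 0" using assms(1) by simp
  finally show ?thesis unfolding m by (simp add: cf_0_0)
qed

text \<open>The (s+1) by s bidiagonal block of a Kronecker pencil, with diagonal \<open>l\<close>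
  and subdiagonal \<open>c\<close>.\<close>

definition sp_up :: "nat \<Rightarrow> (nat \<Rightarrow> 'k) \<Rightarrow> 'k \<Rightarrow> nat \<Rightarrow> nat \<Rightarrow> 'k::comm_ring_1" where
  "sp_up s l c i j = (if i \<le> s \<and> s < j \<and> j \<le> 2 * s then (if j = s + 1 + i then l i else if j = s + i then c else 0) else 0)"

definition sp :: "nat \<Rightarrow> nat \<Rightarrow> (nat \<Rightarrow> 'k) \<Rightarrow> 'k \<Rightarrow> (nat \<Rightarrow> 'k) \<Rightarrow> nat \<Rightarrow> nat \<Rightarrow> 'k::comm_ring_1" where
  "sp s r l c b i j = sp_up s l c i j + sp_up s l c j i + (if i = j \<and> 2 * s < i \<and> i < r then b i else 0)"

text \<open>The indices \<open>0..s\<close> and those from \<open>r\<close> on span \<open>U\<close>, the indices \<open>s+1..2s\<close> a complement of \<open>W\<close>, and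
  \<open>2s+1..r-1\<close> a complement of \<open>U\<close> in \<open>W\<close>. The block pairing \<open>0..s\<close> with \<open>s+1..2s\<close> is the
  pencil with kernel \<open>(1, t, t^2, ...)\<close>.\<close>

definition spm :: "nat \<Rightarrow> nat \<Rightarrow> (nat \<Rightarrow> 'k) \<Rightarrow> 'k \<Rightarrow> (nat \<Rightarrow> 'k) \<Rightarrow> 'n::finite \<Rightarrow> 'n \<Rightarrow> 'k::comm_ring_1" where
  "spm s r l c b x y = sp s r l c b (type_index x) (type_index y)"

lemma sp_sym: "sp s r l c b i j = sp s r l c b j i"
  by (simp add: sp_def add.commute)

lemma spm_sym: "spm s r l c b i j = spm s r l c b j i"
  unfolding spm_def by (rule sp_sym)

lemma pencil_spm:
  "pencil t (spm s r l c b) (spm s r l' c' b') =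
    (spm s r (\<lambda>i. l i + t * l' i) (c + t * c') (\<lambda>i. b i + t * b' i) :: 'n::finite \<Rightarrow> 'n \<Rightarrow> 'b::comm_ring_1)"
proof (intro ext)
  have up: "sp_up s l c i j + t * sp_up s l' c' i j = sp_up s (\<lambda>i. l i + t * l' i) (c + t * c') i j" for i j
    by (simp add: sp_up_def)
  fix x y :: 'n
  let ?i = "type_index x" and ?j = "type_index y"
  let ?d = "\<lambda>b. if ?i = ?j \<and> 2 * s < ?i \<and> ?i < r then b ?i else 0"
  have "pencil t (spm s r l c b) (spm s r l' c' b') x y =
      (sp_up s l c ?i ?j + t * sp_up s l' c' ?i ?j) + (sp_up s l c ?j ?i + t * sp_up s l' c' ?j ?i) + (?d b + t * ?d b')"
    by (simp only: pencil_def spm_def sp_def distrib_left add_ac)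
  also have "?d b + t * ?d b' = ?d (\<lambda>i. b i + t * b' i)" by simp
  also have "(sp_up s l c ?i ?j + t * sp_up s l' c' ?i ?j) + (sp_up s l c ?j ?i + t * sp_up s l' c' ?j ?i) +
      ?d (\<lambda>i. b i + t * b' i) = spm s r (\<lambda>i. l i + t * l' i) (c + t * c') (\<lambda>i. b i + t * b' i) x y"
    unfolding up by (simp only: spm_def sp_def)
  finally show "pencil t (spm s r l c b) (spm s r l' c' b') x y =
      spm s r (\<lambda>i. l i + t * l' i) (c + t * c') (\<lambda>i. b i + t * b' i) x y" .
qed

lemma sp_row_U:
  assumes "i \<le> s" "2 * s < n"
  shows "(\<Sum>j<n. sp s r l c b i j * v j) =
    (if i < s then l i * v (s + 1 + i) else 0) + (if 1 \<le> i then c * v (s + i) else 0)"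
proof -
  have "sp s r l c b i j * v j = (if j = s + 1 + i then (if i < s then l i * v (s + 1 + i) else 0) else 0) +
      (if j = s + i then (if 1 \<le> i then c * v (s + i) else 0) else 0)" for j
    using assms by (auto simp: sp_def sp_up_def)
  then show ?thesis using assms by (simp add: sum.distrib)
qed

lemma sp_row_V:
  assumes "a < s" "2 * s < n"
  shows "(\<Sum>j<n. sp s r l c b (s + 1 + a) j * v j) = l a * v a + c * v (a + 1)"
proof -
  have "sp s r l c b (s + 1 + a) j * v j = (if j = a then l a * v a else 0) + (if j = a + 1 then c * v (a + 1) else 0)" for j
    using assms by (auto simp: sp_def sp_up_def)
  then show ?thesis using assms by (simp add: sum.distrib)
qed

lemma sp_row_B:
  assumes "2 * s < i" "i < r" "r \<le> n"
  shows "(\<Sum>j<n. sp s r l c b i j * v j) = b i * v i"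
proof -
  have "sp s r l c b i j * v j = (if j = i then b i * v i else 0)" for j
    using assms by (auto simp: sp_def sp_up_def)
  then show ?thesis using assms by simp
qed

text \<open>With c = -1, rows s+1..2s express each of the coordinates 1..s by its predecessor; rows
  s, s-1, ..., 1 kill the coordinates s+1..2s from the top down, and the diagonal rows kill the
  rest. Row 0 is left out because \<open>kv\<close> solves the rows 1..r-1 for formal
  reasons.\<close>

lemma sp_kernel:
  fixes l b :: "nat \<Rightarrow> 'k::field"
  assumes r: "2 * s < r" "r \<le> n" and b: "\<And>i. 2 * s < i \<Longrightarrow> i < r \<Longrightarrow> b i \<noteq> 0"
    and v: "\<And>i. 1 \<le> i \<Longrightarrow> i < r \<Longrightarrow> (\<Sum>j<n. sp s r l (-1) b i j * v j) = 0"
  shows "\<And>a. a < s \<Longrightarrow> v (Suc a) = l a * v a" "\<And>a. a < s \<Longrightarrow> v (s + 1 + a) = 0"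
    "\<And>i. 2 * s < i \<Longrightarrow> i < r \<Longrightarrow> v i = 0"
proof -
  show "v (Suc a) = l a * v a" if "a < s" for a
    using v[of "s + 1 + a"] sp_row_V[of a s n r l "-1" b v] that r by simp
  have step: "v (s + 1 + a) = (if Suc a < s then l (Suc a) * v (s + 1 + Suc a) else 0)" if "a < s" for a
    using v[of "Suc a"] sp_row_U[of "Suc a" s n r l "-1" b v] that r by simp
  show "v (s + 1 + a) = 0" if "a < s" for a
    using that
  proof (induction "s - a" arbitrary: a)
    case 0
    then show ?case by simp
  next
    case (Suc k)
    have "v (s + 1 + Suc a) = 0" if "Suc a < s" using Suc that by (intro Suc.hyps(1)) auto
    then show ?case using step[OF Suc.prems] by simp
  qed
  show "v i = 0" if "2 * s < i" "i < r" for i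
    using v[of i] sp_row_B[of s i r n l "-1" b v] b[OF that] that r by simp
qed

lemma sum_enum_nat: "(\<Sum>x\<in>UNIV. F x) = (\<Sum>j<CARD('n). F (enum_type j :: 'n::finite))"
  by (rule sum_enum_type[symmetric])

lemma mvf_spm:
  assumes "i < CARD('n::finite)"
  shows "mvf (spm s r l c b) v (enum_type i :: 'n) = (\<Sum>j<CARD('n). sp s r l c b i j * v (enum_type j))"
  unfolding mvf_def sum_enum_nat spm_def by (rule sum.cong) (auto simp: type_index_enum assms)

text \<open>Extended by zero, a kernel vector of the minor satisfies the recursion of
  \<open>sp_kernel\<close> with value 0 at index 0, so it vanishes.\<close>

lemma spm_minor_nonzero:
  fixes l b :: "nat \<Rightarrow> 'k::field"
  assumes r: "2 * s < r" "r \<le> CARD('n::finite)" and b: "\<And>i. 2 * s < i \<Longrightarrow> i < r \<Longrightarrow> b i \<noteq> 0"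
  shows "dt (r - 1) (\<lambda>i j. spm s r l (-1) b (enum_type (Suc i) :: 'n) (enum_type (Suc j))) \<noteq> 0"
proof
  assume "dt (r - 1) (\<lambda>i j. spm s r l (-1) b (enum_type (Suc i) :: 'n) (enum_type (Suc j))) = 0"
  then obtain v where v: "\<exists>j<r - 1. v j \<noteq> 0"
    "\<forall>i<r - 1. (\<Sum>j<r - 1. spm s r l (-1) b (enum_type (Suc i) :: 'n) (enum_type (Suc j)) * v j) = 0"
    unfolding dt_zero_iff by (elim exE conjE) (rule that, auto)
  define w where "w j = (if 1 \<le> j \<and> j < r then v (j - 1) else 0)" for j
  have "(\<Sum>j<CARD('n). sp s r l (-1) b i j * w j) = 0" if i: "1 \<le> i" "i < r" for i
  proof -
    have "(\<Sum>j<CARD('n). sp s r l (-1) b i j * w j) = (\<Sum>j\<in>Suc ` {..<r - 1}. sp s r l (-1) b i j * w j)"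
      by (rule sum.mono_neutral_right) (use r in \<open>auto simp: w_def image_iff Suc_le_eq gr0_conv_Suc\<close>)
    also have "\<dots> = (\<Sum>j<r - 1. sp s r l (-1) b i (Suc j) * v j)"
      by (simp add: sum.reindex w_def) (rule sum.cong, auto)
    also have "\<dots> = (\<Sum>j<r - 1. spm s r l (-1) b (enum_type (Suc (i - 1)) :: 'n) (enum_type (Suc j)) * v j)"
      by (rule sum.cong) (use i r in \<open>auto simp: spm_def type_index_enum\<close>)
    also have "\<dots> = 0"
    proof -
      have "i - 1 < r - 1" using i by linarith
      then show ?thesis by (rule v(2)[rule_format])
    qed
    finally show ?thesis .
  qed
  note k = sp_kernel[OF r b this]
  have w0: "w a = 0" if "a \<le> s" for a
    using that by (induction a) (simp_all add: w_def[of 0] k(1))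
  have wz: "w i = 0" if "i < r" for i
  proof -
    consider "i \<le> s" | "s < i" "i \<le> 2 * s" | "2 * s < i" by linarith
    then show ?thesis
    proof cases
      case 2
      then have "w (s + 1 + (i - s - 1)) = 0" by (intro k(2)) auto
      then show ?thesis using 2 by simp
    qed (use w0 k(3) that in auto)
  qed
  have "v j = 0" if "j < r - 1" for j
  proof -
    have j: "Suc j < r" using that by linarith
    then show ?thesis using wz[OF j] by (simp add: w_def)
  qed
  then show False using v(1) by blast
qed

lemma enum_type_inj: "i < CARD('n) \<Longrightarrow> j < CARD('n) \<Longrightarrow> (enum_type i :: 'n::finite) = enum_type j \<longleftrightarrow> i = j"
  by (metis type_index_enum)

text \<open>The value at its own pivot is the nonzero minor \<open>\<delta>\<close> on the indices
  1..r-1. The recursion then gives a multiple of (1, l 0, l 0 * l 1, ...) for pivot 0 and multiples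
  of unit vectors for the pivots from r on.\<close>

lemma kv_spm:
  fixes l b :: "nat \<Rightarrow> 'k::field"
  assumes r: "2 * s < r" "r \<le> CARD('n::finite)" and b: "\<And>i. 2 * s < i \<Longrightarrow> i < r \<Longrightarrow> b i \<noteq> 0"
  defines "A \<equiv> spm s r l (-1) b :: 'n \<Rightarrow> 'n \<Rightarrow> 'k"
  shows "\<exists>\<delta>. \<delta> \<noteq> 0 \<and> (\<forall>i<CARD('n). kv r (enum_type 0) A (enum_type i) = (if i \<le> s then \<delta> * (\<Prod>a<i. l a) else 0)) \<and>
     (\<forall>m. r \<le> m \<and> m < CARD('n) \<longrightarrow> (\<forall>i<CARD('n). kv r (enum_type m) A (enum_type i) = (if i = m then \<delta> else 0)))"
proof -
  let ?n = "CARD('n)"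
  let ?e = "enum_type :: nat \<Rightarrow> 'n"
  define \<delta> where "\<delta> = dt (r - 1) (\<lambda>i j. A (?e (Suc i)) (?e (Suc j)))"
  have \<delta>: "\<delta> \<noteq> 0" unfolding \<delta>_def A_def by (rule spm_minor_nonzero[OF r b])
  have notin: "?e m \<notin> ?e ` {1..<r}" if "m = 0 \<or> r \<le> m" "m < ?n" for m
    using that r by (auto simp: enum_type_inj)
  have self: "kv r (?e m) A (?e m) = \<delta>" if "m = 0 \<or> r \<le> m" "m < ?n" for m
    unfolding \<delta>_def by (rule kv_self) (use r notin[OF that] in auto)
  have supp: "kv r (?e m) A (?e i) = 0" if "m < ?n" "i < ?n" "i \<noteq> m" "i = 0 \<or> r \<le> i" for m i
    by (rule kv_support) (use that notin[of i] in \<open>auto simp: enum_type_inj\<close>)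
  have rows: "(\<Sum>j<?n. sp s r l (-1) b i j * kv r (?e m) A (?e j)) = 0" if "1 \<le> i" "i < r" for i m
    using mvf_kv_zero[OF that, of A "?e m"] mvf_spm[of i s r l "-1" b "kv r (?e m) A"] that r by (simp add: A_def)
  note k = sp_kernel[OF r b rows]
  have Vz: "kv r (?e m) A (?e i) = 0" if "s < i" "i < r" for m i
  proof (cases "i \<le> 2 * s")
    case True
    then have "kv r (?e m) A (?e (s + 1 + (i - s - 1))) = 0" using that by (intro k(2)) auto
    then show ?thesis using that by simp
  next
    case False
    then show ?thesis using that by (intro k(3)) auto
  qed
  have Us: "kv r (?e m) A (?e i) = kv r (?e m) A (?e 0) * (\<Prod>a<i. l a)" if "i \<le> s" for m i
    using that by (induction i) (simp_all add: k(1) mult_ac)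
  have n0: "0 < ?n" using r by simp
  show ?thesis
  proof (intro exI[of _ \<delta>] conjI allI impI)
    show "\<delta> \<noteq> 0" by (rule \<delta>)
    show "kv r (?e 0) A (?e i) = (if i \<le> s then \<delta> * (\<Prod>a<i. l a) else 0)" if i: "i < ?n" for i
    proof -
      consider "i \<le> s" | "s < i" "i < r" | "r \<le> i" by linarith
      then show ?thesis
      proof cases
        case 1
        then show ?thesis using Us[of i 0] self[of 0] n0 by simp
      next
        case 2
        then show ?thesis using Vz by simp
      next
        case 3
        then show ?thesis using supp[of 0 i] i r n0 by simp
      qed
    qed
    show "kv r (?e m) A (?e i) = (if i = m then \<delta> else 0)" if m: "r \<le> m \<and> m < ?n" and i: "i < ?n" for m i
    proof -
      have m0: "kv r (?e m) A (?e 0) = 0" using supp[of m 0] m r n0 by simp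
      consider "i = m" | "i \<noteq> m" "i \<le> s" | "i \<noteq> m" "s < i" "i < r" | "i \<noteq> m" "r \<le> i" by linarith
      then show ?thesis
      proof cases
        case 1
        then show ?thesis using self[of m] m by simp
      next
        case 2
        then show ?thesis using Us[of i m] m0 by simp
      next
        case 3
        then show ?thesis using Vz by simp
      next
        case 4
        then show ?thesis using supp[of m i] i m by simp
      qed
    qed
  qed
qed

lemma spm_coord_compression:
  assumes r: "2 * s < r" "r \<le> CARD('n)"
  defines "I \<equiv> (enum_type :: nat \<Rightarrow> 'n::finite) ` ({..s} \<union> {r..<CARD('n)})"
    and "J \<equiv> (enum_type :: nat \<Rightarrow> 'n) ` ({..s} \<union> {2 * s<..<CARD('n)})"
  shows "I \<subseteq> J" "card I = s + 1 + CARD('n) - r" "card J = CARD('n) - s"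
    "symvec (spm s r l c b) \<in> (coord_compression I J :: ('k::field ^ 'n uprod) set)"
proof -
  have inj: "inj_on (enum_type :: nat \<Rightarrow> 'n) S" if "S \<subseteq> {..<CARD('n)}" for S
    using bij_enum_type[where 'c='n] that by (auto simp: bij_betw_def intro: inj_on_subset)
  have sub: "{..s} \<union> {r..<CARD('n)} \<subseteq> {..<CARD('n)}" "{..s} \<union> {2 * s<..<CARD('n)} \<subseteq> {..<CARD('n)}"
    using r by auto
  show "I \<subseteq> J" unfolding I_def J_def using r by (intro image_mono) auto
  have "card I = card ({..s} \<union> {r..<CARD('n)})" unfolding I_def by (rule card_image[OF inj[OF sub(1)]])
  also have "\<dots> = card {..s} + card {r..<CARD('n)}" by (rule card_Un_disjoint) (use r in auto)
  finally show "card I = s + 1 + CARD('n) - r" using r by simp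
  have "card J = card ({..s} \<union> {2 * s<..<CARD('n)})" unfolding J_def by (rule card_image[OF inj[OF sub(2)]])
  also have "\<dots> = card {..s} + card {2 * s<..<CARD('n)}" by (rule card_Un_disjoint) auto
  finally show "card J = CARD('n) - s" using r by simp
  have "spm s r l c b (enum_type i :: 'n) (enum_type j) = 0"
    if "i \<in> {..s} \<union> {r..<CARD('n)}" "j \<in> {..s} \<union> {2 * s<..<CARD('n)}" for i j
  proof -
    have ij: "i < CARD('n)" "j < CARD('n)" using that r by auto
    have "sp_up s l c i j = 0" "sp_up s l c j i = 0" "\<not> (i = j \<and> 2 * s < i \<and> i < r)"
      using that r by (auto simp: sp_up_def)
    then have "sp s r l c b i j = 0" unfolding sp_def by (simp only: if_False add_0_right)
    then show ?thesis by (simp only: spm_def type_index_enum[OF ij(1)] type_index_enum[OF ij(2)])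
  qed
  then have "symvec (spm s r l c b) $ Upair x y = 0" if "x \<in> I" "y \<in> J" for x y
    using that unfolding I_def J_def symvec_nth[of "spm s r l c b", OF spm_sym] by (elim imageE) simp
  then show "symvec (spm s r l c b) \<in> (coord_compression I J :: ('k ^ 'n uprod) set)"
    unfolding coord_compression_def by simp
qed

text \<open>A kernel vector would be the coefficient vector of a nonzero polynomial of degree below
  \<open>m\<close> with \<open>m\<close> roots.\<close>

lemma vandermonde_nonzero:
  fixes \<xi> \<delta> :: "nat \<Rightarrow> 'k::field"
  assumes inj: "inj_on \<xi> {..<m}" and \<delta>: "\<And>i. i < m \<Longrightarrow> \<delta> i \<noteq> 0"
  shows "dt m (\<lambda>i j. \<delta> i * \<xi> i ^ j) \<noteq> 0"
proof
  assume "dt m (\<lambda>i j. \<delta> i * \<xi> i ^ j) = 0"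
  then obtain v where v: "\<exists>j<m. v j \<noteq> 0" "\<forall>i<m. (\<Sum>j<m. \<delta> i * \<xi> i ^ j * v j) = 0"
    unfolding dt_zero_iff by (elim exE conjE) (rule that, auto)
  define p where "p = (\<Sum>j<m. monom (v j) j)"
  have cp: "coeff p j = (if j < m then v j else 0)" for j
    by (simp add: p_def coeff_sum if_distrib[of "\<lambda>x. x = _"] cong: if_cong)
  have "poly p (\<xi> i) = 0" if "i < m" for i
  proof -
    have "\<delta> i * poly p (\<xi> i) = (\<Sum>j<m. \<delta> i * \<xi> i ^ j * v j)"
      by (simp add: p_def poly_sum poly_monom sum_distrib_left mult_ac)
    then show ?thesis using v(2) \<delta> that by simp
  qed
  then have sub: "\<xi> ` {..<m} \<subseteq> {x. poly p x = 0}" by auto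
  have p0: "p \<noteq> 0" using v(1) cp by (metis coeff_0)
  then have "m > 0" using v(1) by auto
  have "degree p \<le> m - 1" by (rule degree_le) (use cp in auto)
  moreover have "card (\<xi> ` {..<m}) \<le> degree p"
    using card_mono[OF poly_roots_finite[OF p0] sub] card_poly_roots_bound[OF p0] by linarith
  ultimately show False using card_image[OF inj] \<open>m > 0\<close> by simp
qed

section \<open>First-order deformations and non-reducedness\<close>

definition kvp :: "nat \<Rightarrow> (nat \<Rightarrow> 'b) \<Rightarrow> ('n::finite \<Rightarrow> 'n \<Rightarrow> 'b::comm_ring_1) \<Rightarrow> ('n \<Rightarrow> 'n \<Rightarrow> 'b) \<Rightarrow> nat \<Rightarrow> 'n \<Rightarrow> 'b" where
  "kvp r \<xi> A B i = kv r (enum_type 0) (pencil (\<xi> i) A B)"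

text \<open>The rows are the images under \<open>B\<close> of the kernel vectors at
  \<open>\<xi> 0\<close>, ..., \<open>\<xi> s\<close>. One column is free, so that leaving the
  annihilator of \<open>W\<close> is detected in whatever coordinate it happens; the others are
  s+1..2s, where the images are independent for the special pencil.\<close>

definition image_minor :: "nat \<Rightarrow> nat \<Rightarrow> (nat \<Rightarrow> 'b) \<Rightarrow> ('n::finite \<Rightarrow> 'n \<Rightarrow> 'b::comm_ring_1) \<Rightarrow> ('n \<Rightarrow> 'n \<Rightarrow> 'b) \<Rightarrow> 'n \<Rightarrow> 'b" where
  "image_minor s r \<xi> A B l =
    dt (Suc s) (\<lambda>i j. mvf B (kvp r \<xi> A B i) (if j = 0 then l else enum_type (s + j)))"

text \<open>A nonzero value certifies that \<open>A\<close> and \<open>B\<close> are linearly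
  independent.\<close>

definition entry_minor :: "'n \<Rightarrow> 'n \<Rightarrow> 'n \<Rightarrow> 'n \<Rightarrow> ('n \<Rightarrow> 'n \<Rightarrow> 'b) \<Rightarrow> ('n \<Rightarrow> 'n \<Rightarrow> 'b) \<Rightarrow> 'b::comm_ring_1" where
  "entry_minor p q p' q' A B = A p q * B p' q' - A p' q' * B p q"

text \<open>The first factor makes the kernel vectors 0..s independent, the second the images of the
  kernel vectors 1..s, and the third gives \<open>B\<close> rank above 2 s, so that \<open>W\<close>
  cannot be isotropic for it. The third minor omits index s, whose row is zero in the special
  \<open>B\<close>.\<close>

definition nondeg_minors :: "nat \<Rightarrow> nat \<Rightarrow> (nat \<Rightarrow> 'b) \<Rightarrow> ('n::finite \<Rightarrow> 'n \<Rightarrow> 'b::comm_ring_1) \<Rightarrow> ('n \<Rightarrow> 'n \<Rightarrow> 'b) \<Rightarrow> 'b" where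
  "nondeg_minors s r \<xi> A B =
    dt (Suc s) (\<lambda>i j. kvp r \<xi> A B i (enum_type j)) *
    dt s (\<lambda>i j. mvf B (kvp r \<xi> A B (Suc i)) (enum_type (s + Suc j))) *
    dt (2 * s + 1) (\<lambda>i j. B (enum_type (if i < s then i else Suc i)) (enum_type (if j < s then j else Suc j)))"

lemma kvp_hom:
  assumes "comm_ring_hom h" "0 < r"
  shows "h (kvp r \<xi> A B i l) = kvp r (\<lambda>i. h (\<xi> i)) (\<lambda>a b. h (A a b)) (\<lambda>a b. h (B a b)) i l"
proof -
  have "(\<lambda>a b. h (pencil (\<xi> i) A B a b)) = pencil (h (\<xi> i)) (\<lambda>a b. h (A a b)) (\<lambda>a b. h (B a b))"
    by (intro ext pencil_hom assms(1))
  then show ?thesis unfolding kvp_def by (simp only: kv_hom[OF assms])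
qed

lemma image_minor_hom:
  assumes h: "comm_ring_hom h" "0 < r"
  shows "h (image_minor s r \<xi> A B l) = image_minor s r (\<lambda>i. h (\<xi> i)) (\<lambda>a b. h (A a b)) (\<lambda>a b. h (B a b)) l"
  unfolding image_minor_def by (simp only: dt_hom[OF h(1)] mvf_hom[OF h(1)] kvp_hom[OF h])

lemma entry_minor_hom:
  assumes "comm_ring_hom h"
  shows "h (entry_minor p q p' q' A B) = entry_minor p q p' q' (\<lambda>a b. h (A a b)) (\<lambda>a b. h (B a b))"
proof -
  interpret comm_ring_hom h by fact
  show ?thesis by (simp add: entry_minor_def hom_distribs)
qed

lemma nondeg_minors_hom:
  assumes h: "comm_ring_hom h" "0 < r"
  shows "h (nondeg_minors s r \<xi> A B) = nondeg_minors s r (\<lambda>i. h (\<xi> i)) (\<lambda>a b. h (A a b)) (\<lambda>a b. h (B a b))"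
proof -
  interpret comm_ring_hom h by fact
  show ?thesis unfolding nondeg_minors_def by (simp only: hom_mult dt_hom[OF h(1)] mvf_hom[OF h(1)] kvp_hom[OF h])
qed

section \<open>Tangent vectors to the Fano scheme\<close>

lemma comm_ring_hom_pCons: "comm_ring_hom (\<lambda>c :: 'k::comm_ring_1. [:c:])"
  by unfold_locales (auto simp: one_pCons)

text \<open>A tangent vector of rank one at \<open>x\<close>: every member of the plane is moved by
  a multiple of one fixed matrix \<open>m\<close>, the multiple being given by the functional
  \<open>\<phi>\<close>. Only the coefficients 0 and 1 of the values matter.\<close>

definition tangent_hom :: "'c set \<Rightarrow> ('c \<times> 'c \<Rightarrow> 'k) \<Rightarrow> ('c \<Rightarrow> 'k) \<Rightarrow> ('k::comm_ring_1) ^ 'c::finite \<Rightarrow> ('c \<times> 'c, 'k) mpoly \<Rightarrow> 'k poly" where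
  "tangent_hom I x \<phi> m =
    eval_poly (\<lambda>c. [:c:]) (\<lambda>v. if v \<in> I \<times> - I then [:x v, \<phi> (fst v) * m $ snd v:] else [:x v:])"

lemma tangent_hom_hom: "comm_ring_hom (tangent_hom I x \<phi> m)"
  unfolding tangent_hom_def by (rule comm_ring_hom.comm_ring_hom_eval_poly[OF comm_ring_hom_pCons])

lemma tangent_hom_const: "tangent_hom I x \<phi> m (poly_const c) = [:c:]"
  unfolding tangent_hom_def by (rule comm_ring_hom.eval_poly_const[OF comm_ring_hom_pCons])

lemma tangent_hom_var:
  "tangent_hom I x \<phi> m (poly_var v) = (if v \<in> I \<times> - I then [:x v, \<phi> (fst v) * m $ snd v:] else [:x v:])"
  unfolding tangent_hom_def by (rule comm_ring_hom.eval_poly_var[OF comm_ring_hom_pCons])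

lemma tangent_hom_coeff_0: "coeff (tangent_hom I x \<phi> m f) 0 = evl x f"
proof (rule mpoly_hom_cong[of "\<lambda>f. coeff (tangent_hom I x \<phi> m f) 0"])
  show "comm_ring_hom (\<lambda>f. coeff (tangent_hom I x \<phi> m f) 0)"
    by (rule comm_ring_hom_comp[OF comm_ring_hom_coeff_0 tangent_hom_hom])
  show "comm_ring_hom (evl x)" by (rule evl.comm_ring_hom_axioms)
  show "coeff (tangent_hom I x \<phi> m (poly_const c)) 0 = evl x (poly_const c)" for c
    by (simp only: tangent_hom_const evl_const coeff_pCons_0)
  show "coeff (tangent_hom I x \<phi> m (poly_var v)) 0 = evl x (poly_var v)" for v
    by (simp only: tangent_hom_var evl_var) (simp split: if_split)
qed

lemma tangent_hom_ret:
  assumes "chart_mask I x = x"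
  shows "tangent_hom I x \<phi> m (ret I f) = tangent_hom I x \<phi> m f"
proof (rule mpoly_hom_cong[of "\<lambda>f. tangent_hom I x \<phi> m (ret I f)"])
  show "comm_ring_hom (\<lambda>f. tangent_hom I x \<phi> m (ret I f))"
    by (rule comm_ring_hom_comp[OF tangent_hom_hom ret.comm_ring_hom_axioms])
  interpret comm_ring_hom "tangent_hom I x \<phi> m" by (rule tangent_hom_hom)
  show "tangent_hom I x \<phi> m (ret I (poly_var v)) = tangent_hom I x \<phi> m (poly_var v)" for v
    using fun_cong[OF assms, of v] by (auto simp: ret_var chart_mask_def tangent_hom_var split: if_splits)
qed (simp_all add: tangent_hom_hom)

lemma sum_pCons2: "(\<Sum>a\<in>S. [:f a, g a:]) = [:\<Sum>a\<in>S. f a, \<Sum>a\<in>S. g a:]"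
  by (induction S rule: infinite_finite_induct) auto

lemma tangent_hom_pmat:
  fixes m :: "'k::comm_ring_1 ^ 'n::finite uprod"
  assumes "\<And>p. p \<in> I \<Longrightarrow> m $ p = 0"
  shows "pmat I (\<lambda>v. tangent_hom I x \<phi> m (poly_var v)) (\<lambda>a. [:t a:]) i j =
    [:pmat I x t i j, (\<Sum>a\<in>I. t a * \<phi> a) * m $ Upair i j:]"
proof -
  let ?p = "Upair i j"
  have "[:t a:] * chart_entry I (\<lambda>v. tangent_hom I x \<phi> m (poly_var v)) a ?p =
      [:t a * chart_entry I x a ?p, t a * \<phi> a * m $ ?p:]" if "a \<in> I" for a
    using that assms[of ?p] by (simp add: chart_entry_def tangent_hom_var mult.assoc)
  then show ?thesis unfolding pmat_def by (simp add: sum_pCons2 sum_distrib_right)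
qed

text \<open>Polynomials vanishing to first order along the tangent vector form an ideal. It contains
  the generators: their values vanish by compression, their derivatives by
  \<open>minor_deriv_zero\<close>, as the perturbation is zero on
  \<open>U \<times> U\<close>.\<close>

lemma tangent_hom_fano:
  fixes x :: "'n::finite uprod \<times> 'n uprod \<Rightarrow> 'k::field"
  assumes inf: "infinite (UNIV :: 'k set)" and x: "chart_mask I x = x"
    and U: "vec.subspace U" and W: "vec.subspace W"
    and m: "Suc ((CARD('n) - vec.dim U) + (CARD('n) - vec.dim W)) = r"
    and z: "\<And>t u w. u \<in> U \<Longrightarrow> w \<in> W \<Longrightarrow> bf (pmat I x t) u w = 0"
    and M0: "\<And>p. p \<in> I \<Longrightarrow> v $ p = 0"
    and M: "\<And>u w. u \<in> U \<Longrightarrow> w \<in> U \<Longrightarrow> bf (\<lambda>i j. v $ Upair i j) u w = 0"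
    and f: "f \<in> fano_pull r I"
  shows "coeff (tangent_hom I x \<phi> v f) 0 = 0" "coeff (tangent_hom I x \<phi> v f) 1 = 0"
proof -
  let ?H = "tangent_hom I x \<phi> v"
  interpret H: comm_ring_hom ?H by (rule tangent_hom_hom)
  let ?J = "{f. coeff (?H f) 0 = 0 \<and> coeff (?H f) 1 = 0}"
  have J: "is_ideal ?J" by (auto simp: is_ideal_def H.hom_add H.hom_mult coeff_mult)
  have van: "dt r (\<lambda>i j. pmat I x t (\<rho> i) (\<sigma> j)) = 0" for t \<rho> \<sigma>
    by (rule compression_minors_zero[OF U W z]) (use m in auto)
  have c0: "coeff (dt r (\<lambda>i j. pmat I (\<lambda>v. ?H (poly_var v)) (\<lambda>a. [:t a:]) (\<rho> i) (\<sigma> j))) 0 = 0" for t \<rho> \<sigma>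
    by (subst dt_hom[OF comm_ring_hom_coeff_0]) (simp add: tangent_hom_pmat[OF M0] van)
  have c1: "coeff (dt r (\<lambda>i j. pmat I (\<lambda>v. ?H (poly_var v)) (\<lambda>a. [:t a:]) (\<rho> i) (\<sigma> j))) 1 = 0" for t \<rho> \<sigma>
  proof -
    let ?c = "\<Sum>a\<in>I. t a * \<phi> a"
    have "bf (\<lambda>i j. ?c * v $ Upair i j) u w = 0" if "u \<in> U" "w \<in> U" for u w
    proof -
      have "bf (\<lambda>i j. ?c * v $ Upair i j) u w = ?c * bf (\<lambda>i j. v $ Upair i j) u w"
        unfolding bf_def by (simp add: sum_distrib_left mult_ac)
      then show ?thesis using M that by simp
    qed
    from minor_deriv_zero[OF U W pmat_sym z m this]
    show ?thesis by (simp only: tangent_hom_pmat[OF M0])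
  qed
  have "fano_gens r I \<subseteq> ?J"
    using fano_gens_coeff_zero[OF inf tangent_hom_hom c0] fano_gens_coeff_zero[OF inf tangent_hom_hom c1]
    by (intro subsetI CollectI conjI) assumption+
  then have "sd_fano r I \<subseteq> ?J" by (rule sd_fano_subset[OF J])
  moreover have "ret I f \<in> sd_fano r I" using f by (simp add: pull_def)
  ultimately have "ret I f \<in> ?J" by (rule subsetD)
  then show "coeff (?H f) 0 = 0" "coeff (?H f) 1 = 0" by (simp_all add: tangent_hom_ret[OF x])
qed

lemma dt_deriv_truncated:
  fixes F :: "nat \<Rightarrow> nat \<Rightarrow> 'k::comm_ring_1 poly"
  shows "coeff (dt r F) 1 = (\<Sum>i<r. \<Sum>j<r. coeff (F i j) 1 * cf r (\<lambda>i j. coeff (F i j) 0) i j)"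
proof -
  let ?J = "{f :: 'k poly. coeff f 0 = 0 \<and> coeff f 1 = 0}"
  have J: "is_ideal ?J" by (auto simp: is_ideal_def coeff_mult)
  have "dt r F - dt r (\<lambda>i j. [:coeff (F i j) 0, coeff (F i j) 1:]) \<in> ?J"
    by (rule dt_ideal_cong[OF J]) simp
  then have "coeff (dt r F) 1 = coeff (dt r (\<lambda>i j. [:coeff (F i j) 0, coeff (F i j) 1:])) 1" by simp
  then show ?thesis by (simp only: dt_deriv)
qed

text \<open>The product of the perturbed matrix with its cofactor vector consists of
  \<open>r\<close>-minors, which vanish to first order; the linear coefficient of this identity is
  the equation for the derivative of the kernel vector.\<close>

lemma kv_deriv:
  fixes B M :: "'n::finite \<Rightarrow> 'n \<Rightarrow> 'k::field"
  assumes r: "0 < r" and z: "\<And>\<rho> \<sigma>. coeff (dt r (\<lambda>i j. [:B (\<rho> i) (\<sigma> j), M (\<rho> i) (\<sigma> j):])) 1 = 0"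
  shows "coeff (kv r y (\<lambda>i j. [:B i j, M i j:]) l) 0 = kv r y B l"
    "mv B (\<chi> l. coeff (kv r y (\<lambda>i j. [:B i j, M i j:]) l) 1) + mv M (\<chi> l. kv r y B l) = 0"
proof -
  let ?k = "kv r y (\<lambda>i j. [:B i j, M i j:])"
  have c0: "coeff (?k l) 0 = kv r y B l" for l
    by (subst kv_hom[OF comm_ring_hom_coeff_0 r]) simp
  then show "coeff (?k l) 0 = kv r y B l" .
  have prod: "coeff ([:a, b:] * p) 1 = a * coeff p 1 + b * coeff p 0" for a b and p :: "'k poly"
    by (simp add: coeff_pCons)
  have "(\<Sum>l\<in>UNIV. B i l * coeff (?k l) 1) + (\<Sum>l\<in>UNIV. M i l * kv r y B l) = 0" for i
  proof -
    have "(\<Sum>l\<in>UNIV. B i l * coeff (?k l) 1) + (\<Sum>l\<in>UNIV. M i l * kv r y B l) =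
        (\<Sum>l\<in>UNIV. coeff ([:B i l, M i l:] * ?k l) 1)"
      by (simp only: prod c0 sum.distrib)
    also have "\<dots> = coeff (mvf (\<lambda>i j. [:B i j, M i j:]) ?k i) 1"
      unfolding mvf_def by (simp only: coeff_sum)
    also have "\<dots> = 0" unfolding mvf_kv[OF r] by (rule z)
    finally show ?thesis .
  qed
  then show "mv B (\<chi> l. coeff (?k l) 1) + mv M (\<chi> l. kv r y B l) = 0"
    by (simp add: mv_def Finite_Cartesian_Product.vec_eq_iff)
qed

text \<open>The derivative of the minor is a sum over rows replaced by their derivatives. Replacing
  a row of positive index leaves s + 1 vectors in \<open>Y\<close>, so only row 0 contributes. Were
  that determinant zero for every \<open>l\<close>, expansion along the free column would express
  \<open>R' 0\<close> by the vectors \<open>R 1\<close>, ..., \<open>R s\<close> of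
  \<open>Y\<close>.\<close>

lemma deriv_minor_nonzero:
  fixes R R' :: "nat \<Rightarrow> 'k::field ^ 'n::finite" and c :: "nat \<Rightarrow> 'n"
  assumes Y: "vec.subspace Y" "vec.dim Y \<le> s" and R: "\<And>i. i \<le> s \<Longrightarrow> R i \<in> Y"
    and R': "\<And>i. 1 \<le> i \<Longrightarrow> i \<le> s \<Longrightarrow> R' i \<in> Y" "R' 0 \<notin> Y"
    and nz: "dt s (\<lambda>i j. R (Suc i) $ c (Suc j)) \<noteq> 0"
  shows "\<exists>l. (\<Sum>i<Suc s. \<Sum>j<Suc s. R' i $ (if j = 0 then l else c j) *
    cf (Suc s) (\<lambda>i j. R i $ (if j = 0 then l else c j)) i j) \<noteq> 0"
proof (rule ccontr)
  let ?col = "\<lambda>l j. if j = 0 then l else c j"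
  define Q where "Q = R(0 := R' 0)"
  \<comment> \<open>Cofactors of the free column; they involve only the columns \<open>c 1\<close>,
    ..., \<open>c s\<close>, so they do not depend on \<open>l\<close>.\<close>
  define C where "C i = (-1) ^ i * dt s (\<lambda>a b. Q (if a < i then a else Suc a) $ c (Suc b))" for i
  assume asm: "\<nexists>l. (\<Sum>i<Suc s. \<Sum>j<Suc s. R' i $ ?col l j * cf (Suc s) (\<lambda>i j. R i $ ?col l j) i j) \<noteq> 0"
  define S where "S l = (\<Sum>i<Suc s. \<Sum>j<Suc s. R' i $ ?col l j * cf (Suc s) (\<lambda>i j. R i $ ?col l j) i j)" for l
  have S0: "S l = 0" for l
    using asm unfolding S_def[symmetric] by blast
  have total: "(\<Sum>i<Suc s. C i * Q i $ l) = 0" for l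
  proof -
    let ?f = "\<lambda>i j. R i $ ?col l j"
    have upd: "(\<Sum>j<Suc s. R' i $ ?col l j * cf (Suc s) ?f i j) = dt (Suc s) (\<lambda>a j. (R(i := R' i)) a $ ?col l j)"
      if "i < Suc s" for i
    proof -
      have "(\<lambda>a j. (R(i := R' i)) a $ ?col l j) = ?f(i := \<lambda>j. R' i $ ?col l j)" by (intro ext) simp
      then show ?thesis by (simp only: dt_row_update[OF that])
    qed
    have zero: "dt (Suc s) (\<lambda>a j. (R(i := R' i)) a $ ?col l j) = 0" if "1 \<le> i" "i \<le> s" for i
      by (subst dt_transpose[symmetric], rule dt_family_zero[of _ _ Y])
        (use R R'(1)[OF that] Y(2) in auto)
    have "S l = (\<Sum>i<Suc s. dt (Suc s) (\<lambda>a j. (R(i := R' i)) a $ ?col l j))"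
      unfolding S_def by (rule sum.cong[OF refl], rule upd) simp
    then have "0 = (\<Sum>i<Suc s. dt (Suc s) (\<lambda>a j. (R(i := R' i)) a $ ?col l j))" by (simp only: S0)
    also have "\<dots> = dt (Suc s) (\<lambda>a j. Q a $ ?col l j)"
    proof -
      have "(\<Sum>i<s. dt (Suc s) (\<lambda>a j. (R(Suc i := R' (Suc i))) a $ ?col l j)) = 0"
        by (rule sum.neutral, rule ballI, rule zero) auto
      then show ?thesis unfolding Q_def by (simp only: sum.lessThan_Suc_shift add_0_right)
    qed
    also have "\<dots> = (\<Sum>i<Suc s. Q i $ ?col l 0 * cf (Suc s) (\<lambda>a j. Q a $ ?col l j) i 0)"
      by (subst adj_col) simp_all
    also have "\<dots> = (\<Sum>i<Suc s. C i * Q i $ l)"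
      by (rule sum.cong) (simp_all add: cf_minor C_def mult_ac)
    finally show ?thesis by simp
  qed
  have "C 0 * Q 0 $ l + (\<Sum>i<s. C (Suc i) * Q (Suc i) $ l) = 0" for l
    using total[of l] by (simp only: sum.lessThan_Suc_shift)
  then have eq: "C 0 * Q 0 $ l = - (\<Sum>i<s. C (Suc i) * Q (Suc i) $ l)" for l
    by (simp add: eq_neg_iff_add_eq_0)
  have C0: "C 0 \<noteq> 0" using nz by (simp add: C_def Q_def)
  have "Q 0 = (- inverse (C 0)) *s (\<Sum>i<s. C (Suc i) *s Q (Suc i))"
  proof (rule Finite_Cartesian_Product.vec_eq_iff[THEN iffD2], rule allI)
    fix l
    have "Q 0 $ l = inverse (C 0) * (C 0 * Q 0 $ l)" using C0 by simp
    then show "Q 0 $ l = ((- inverse (C 0)) *s (\<Sum>i<s. C (Suc i) *s Q (Suc i))) $ l"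
      unfolding eq by (simp add: sum_component)
  qed
  moreover have "Q (Suc i) \<in> Y" if "i < s" for i using R[of "Suc i"] that by (simp add: Q_def)
  ultimately have "Q 0 \<in> Y"
    by (simp only:) (intro vec.subspace_scale[OF Y(1)] vec.subspace_sum[OF Y(1)], simp)
  then show False using R'(2) by (simp add: Q_def)
qed

text \<open>The first column of the inverse matrix, placed at the coordinates
  \<open>c j\<close>.\<close>

lemma exists_dual_vector:
  fixes k :: "nat \<Rightarrow> 'n::finite \<Rightarrow> 'k::field"
  assumes nz: "dt m (\<lambda>i j. k i (c j)) \<noteq> 0" and m: "0 < m"
  shows "\<exists>\<psi>. \<forall>i<m. scalar_product \<psi> (\<chi> l. k i l) = (if i = 0 then 1 else 0)"
proof -
  let ?d = "dt m (\<lambda>i j. k i (c j))"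
  define \<psi> :: "'k ^ 'n" where "\<psi> = (\<Sum>j<m. axis (c j) (cf m (\<lambda>i j. k i (c j)) 0 j / ?d))"
  have "scalar_product \<psi> (\<chi> l. k i l) = (if i = 0 then 1 else 0)" if i: "i < m" for i
  proof -
    have "scalar_product \<psi> (\<chi> l. k i l) = (\<Sum>l\<in>UNIV. \<Sum>j<m. (if l = c j then cf m (\<lambda>i j. k i (c j)) 0 j / ?d * k i l else 0))"
      unfolding scalar_product_def \<psi>_def sum_component sum_distrib_right
      by (intro sum.cong refl) (simp add: axis_def)
    also have "\<dots> = (\<Sum>j<m. cf m (\<lambda>i j. k i (c j)) 0 j / ?d * k i (c j))"
      by (subst sum.swap) simp
    also have "\<dots> = (\<Sum>j<m. k i (c j) * cf m (\<lambda>i j. k i (c j)) 0 j) / ?d"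
      by (simp add: sum_divide_distrib mult.commute)
    also have "\<dots> = (if i = 0 then 1 else 0)"
      using adj_row[OF m i, of "\<lambda>i j. k i (c j)"] nz by simp
    finally show ?thesis .
  qed
  then show ?thesis by blast
qed

text \<open>An isotropic \<open>W\<close> would bound the rank of \<open>B\<close> by twice its
  codimension.\<close>

lemma exists_image_outside:
  fixes B :: "'n::finite \<Rightarrow> 'n \<Rightarrow> 'k::field"
  assumes W: "vec.subspace W" and s: "CARD('n) - vec.dim W = s" 
    and nz: "dt (2 * s + 1) (\<lambda>i j. B (\<rho> i) (\<sigma> j)) \<noteq> 0"
  shows "\<exists>z\<in>W. mv B z \<notin> ann W"
proof (rule ccontr)
  assume "\<not> (\<exists>z\<in>W. mv B z \<notin> ann W)"
  then have "bf B u w = 0" if "u \<in> W" "w \<in> W" for u w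
    using that by (auto simp: bf_mv ann_def)
  from dim_range_le[OF W W this] have "vec.dim (range (mv B)) < 2 * s + 1" using s by linarith
  then show False using minors_zero[of B "2 * s + 1" \<rho> \<sigma>] nz by simp
qed

text \<open>Cramer's rule: the entry minor of the member \<open>t\<close> with the member
  \<open>\<tau>1\<close> is linear in \<open>t\<close> and vanishes at \<open>\<tau>1\<close>;
  dividing by its value at \<open>\<tau>0\<close> gives the functional.\<close>

lemma pmat_functional:
  fixes x :: "'n::finite uprod \<times> 'n uprod \<Rightarrow> 'k::field"
  assumes "entry_minor p q p' q' (pmat I x \<tau>0) (pmat I x \<tau>1) \<noteq> 0"
  shows "\<exists>\<phi>. (\<Sum>a\<in>I. \<tau>0 a * \<phi> a) = 1 \<and> (\<Sum>a\<in>I. \<tau>1 a * \<phi> a) = 0"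
proof -
  let ?A = "pmat I x \<tau>0" and ?B = "pmat I x \<tau>1"
  let ?d = "entry_minor p q p' q' ?A ?B"
  define \<phi> where "\<phi> a = (chart_entry I x a (Upair p q) * ?B p' q' - chart_entry I x a (Upair p' q') * ?B p q) / ?d" for a
  have "(\<Sum>a\<in>I. t a * \<phi> a) = entry_minor p q p' q' (pmat I x t) ?B / ?d" for t
    unfolding \<phi>_def entry_minor_def pmat_def[of I x t] sum_distrib_right sum_subtractf[symmetric] sum_divide_distrib
    by (rule sum.cong) (simp_all add: algebra_simps)
  from this[of \<tau>0] this[of \<tau>1] show ?thesis using assms by (intro exI[of _ \<phi>]) (simp add: entry_minor_def)
qed

lemma kv_minor_nonzero:
  assumes "kv r y A l \<noteq> 0"
  shows "\<exists>\<rho> \<sigma>. dt (r - 1) (\<lambda>i j. A (\<rho> i) (\<sigma> j)) \<noteq> 0"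
proof (rule ccontr)
  assume "\<nexists>\<rho> \<sigma>. dt (r - 1) (\<lambda>i j. A (\<rho> i) (\<sigma> j)) \<noteq> 0"
  then have z: "dt (r - 1) (\<lambda>i j. A (\<rho> i) (\<sigma> j)) = 0" for \<rho> \<sigma> by blast
  have "cf r (\<lambda>i j. A (enum_type i) ((enum_type(0 := y)) j)) 0 j = 0" for j
    by (simp only: cf_minor z mult_zero_right)
  then have "kv r y A l = 0" unfolding kv_def cofv_def by (simp cong: if_cong)
  then show False using assms by simp
qed

text \<open>Only the first member is perturbed, since \<open>\<phi>\<close> is 1 on
  \<open>\<tau>0\<close> and 0 on \<open>\<tau>1\<close>. All members \<open>P i\<close> of the
  pencil thus receive the same perturbation \<open>N\<close>, and the images under the second member
  vary only through the kernel vectors. \<open>N\<close> is built to move the kernel vector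
  \<open>k 0\<close> by \<open>z0\<close> modulo \<open>U\<close>, which takes its image out of the
  annihilator of \<open>W\<close>, while \<open>k 1\<close>, ..., \<open>k s\<close> move within
  \<open>U\<close>.\<close>

lemma deformation_exists:
  fixes x :: "'n::finite uprod \<times> 'n uprod \<Rightarrow> 'k::field" and \<xi> :: "nat \<Rightarrow> 'k"
  assumes U: "vec.subspace U" and W: "vec.subspace W" and UW: "U \<subseteq> W"
    and m: "Suc ((CARD('n) - vec.dim U) + s) = r" and s: "CARD('n) - vec.dim W = s"
    and z: "\<And>t u w. u \<in> U \<Longrightarrow> w \<in> W \<Longrightarrow> bf (pmat I x t) u w = 0"
    and nd: "nondeg_minors s r \<xi> (pmat I x \<tau>0) (pmat I x \<tau>1) \<noteq> 0"
    and em: "entry_minor p q p' q' (pmat I x \<tau>0) (pmat I x \<tau>1) \<noteq> 0"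
  shows "\<exists>\<phi> v. (\<forall>p\<in>I. v $ p = 0) \<and> (\<forall>u\<in>U. \<forall>w\<in>U. bf (\<lambda>i j. v $ Upair i j) u w = 0) \<and>
    (\<exists>l. coeff (tangent_hom I x \<phi> v (image_minor s r (\<lambda>i. poly_const (\<xi> i))
      (pmat I poly_var (\<lambda>a. poly_const (\<tau>0 a))) (pmat I poly_var (\<lambda>a. poly_const (\<tau>1 a))) l)) 1 \<noteq> 0)"
proof -
  have r: "0 < r" using m by simp
  have mm: "Suc ((CARD('n) - vec.dim U) + (CARD('n) - vec.dim W)) = r" using m s by simp
  let ?A = "pmat I x \<tau>0" and ?B = "pmat I x \<tau>1" and ?e = "enum_type :: nat \<Rightarrow> 'n"
  define P where "P i = pencil (\<xi> i) ?A ?B" for i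
  define k where "k i = (\<chi> l. kvp r \<xi> ?A ?B i l)" for i
  have P: "P i = pmat I x (\<lambda>a. \<tau>0 a + \<xi> i * \<tau>1 a)" for i
    unfolding P_def pencil_def by (intro ext) (simp only: pmat_add)
  have Psym: "P i a b = P i b a" for i a b unfolding P by (rule pmat_sym)
  have Pz: "bf (P i) u w = 0" if "u \<in> U" "w \<in> W" for i u w unfolding P by (rule z[OF that])
  have annW: "mv (pmat I x t) u \<in> ann W" if "u \<in> U" for t u
    unfolding ann_def
  proof (intro CollectI ballI)
    fix w assume "w \<in> W"
    then have "bf (pmat I x t) u w = 0" by (rule z[OF that])
    then show "scalar_product w (mv (pmat I x t) u) = 0"
      by (simp only: bf_mv[symmetric] bf_commute[of "pmat I x t" w u, OF pmat_sym])
  qed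
  have k_kv: "k i = (\<chi> l. kv r (?e 0) (P i) l)" for i by (simp add: k_def kvp_def P_def)
  have kU: "k i \<in> U" for i
    unfolding k_kv kv_def by (rule cofv_in[OF U W Psym Pz mm r])
  have O1: "dt (Suc s) (\<lambda>i j. kvp r \<xi> ?A ?B i (?e j)) \<noteq> 0"
    and O2: "dt s (\<lambda>i j. mvf ?B (kvp r \<xi> ?A ?B (Suc i)) (?e (s + Suc j))) \<noteq> 0"
    and O3: "dt (2 * s + 1) (\<lambda>i j. ?B (?e (if i < s then i else Suc i)) (?e (if j < s then j else Suc j))) \<noteq> 0"
    using nd by (auto simp: nondeg_minors_def)
  obtain \<psi> where \<psi>: "\<And>i. i < Suc s \<Longrightarrow> scalar_product \<psi> (k i) = (if i = 0 then 1 else 0)"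
    unfolding k_def using exists_dual_vector[OF O1] by blast
  obtain z0 where z0: "z0 \<in> W" "mv ?B z0 \<notin> ann W"
    using exists_image_outside[OF W s O3] by (elim bexE)
  obtain \<phi> where \<phi>: "(\<Sum>a\<in>I. \<tau>0 a * \<phi> a) = 1" "(\<Sum>a\<in>I. \<tau>1 a * \<phi> a) = 0"
    using pmat_functional[OF em] by (elim exE conjE)
  \<comment> \<open>With this choice \<open>z0\<close> solves, modulo \<open>U\<close>, the
    first-order equation for the kernel vector \<open>k 0\<close>; and \<open>y\<close> is
    orthogonal to \<open>U\<close> because \<open>z0\<close> lies in \<open>W\<close>.\<close>
  define y where "y = (- 1) *s mv (P 0) z0"
  have yU: "scalar_product u y = 0" if "u \<in> U" for u
    using Pz[OF that z0(1), of 0] by (simp only: y_def bf_mv scalar_product_scale_right mult_zero_right)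
  \<comment> \<open>The symmetrised product of \<open>\<psi>\<close> and \<open>y\<close>. As
    \<open>y\<close> is orthogonal to \<open>U\<close>, it maps u in \<open>U\<close> to \<psi>(u)
    times y, that is \<open>k 0\<close> to \<open>y\<close> and \<open>k 1\<close>, ...,
    \<open>k s\<close> to 0.\<close>
  define M where "M i j = \<psi> $ i * y $ j + y $ i * \<psi> $ j" for i j
  have Msym: "M i j = M j i" for i j by (simp add: M_def)
  \<comment> \<open>Subtracting a member of the plane clears the coordinates in \<open>I\<close>, as
    the chart requires; the values on \<open>U \<times> W\<close> stay the same because members of
    the plane vanish there.\<close>
  define v where "v = symvec M - (\<Sum>a\<in>I. symvec M $ a *s rowv I x a)"
  define N where "N i j = v $ Upair i j" for i j
  define \<mu> where "\<mu> a = symvec M $ a" for a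
  have vI: "v $ p = 0" if "p \<in> I" for p
    unfolding v_def vector_minus_component rowv_comb_nth[OF that] by simp
  have N: "N i j = M i j - pmat I x \<mu> i j" for i j
    unfolding N_def v_def pmat_comb \<mu>_def by (simp add: symvec_nth[OF Msym])
  have mvN: "mv N u = mv M u - mv (pmat I x \<mu>) u" for u
    by (simp add: mv_def N Finite_Cartesian_Product.vec_eq_iff left_diff_distrib sum_subtractf)
  have mvM: "mv M u = scalar_product \<psi> u *s y" if "u \<in> U" for u
  proof -
    have "mv M u = scalar_product y u *s \<psi> + scalar_product \<psi> u *s y"
      by (simp add: mv_def M_def scalar_product_def Finite_Cartesian_Product.vec_eq_iff
          distrib_left distrib_right sum.distrib sum_distrib_left sum_distrib_right mult_ac)
    then show ?thesis using yU[OF that] by (simp add: scalar_product_commute)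
  qed
  have bfN: "scalar_product w (mv N u) = scalar_product \<psi> u * scalar_product w y" if "w \<in> W" "u \<in> U" for u w
    using annW[OF that(2), of \<mu>] that(1) unfolding mvN mvM[OF that(2)]
    by (simp add: scalar_product_diff_right scalar_product_scale_right ann_def)
  have NU: "bf N u w = 0" if "u \<in> U" "w \<in> U" for u w
    unfolding bf_mv using bfN[OF subsetD[OF UW that(1)] that(2)] yU[OF that(1)] by simp
  have Nz: "coeff (dt r (\<lambda>a b. [:P i (\<rho> a) (\<sigma> b), N (\<rho> a) (\<sigma> b):])) 1 = 0" for i \<rho> \<sigma>
    by (rule minor_deriv_zero[OF U W Psym Pz mm NU])
  define k' where "k' i = (\<chi> l. coeff (kv r (?e 0) (\<lambda>a b. [:P i a b, N a b:]) l) 1)" for i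
  have d0: "coeff (kv r (?e 0) (\<lambda>a b. [:P i a b, N a b:]) l) 0 = k i $ l" for i l
    by (simp add: kv_deriv(1)[OF r Nz] k_kv)
  have d1: "mv (P i) (k' i) + mv N (k i) = 0" for i
    unfolding k'_def k_kv by (rule kv_deriv(2)[OF r Nz])
  \<comment> \<open>The rank of \<open>P i\<close> is maximal, so a vector that it maps into the
    annihilator of \<open>W\<close> lies in \<open>U\<close>.\<close>
  have k'U: "k' i - (if i = 0 then z0 else 0) \<in> U" if i: "i \<le> s" for i
  proof -
    have "\<exists>l. kvp r \<xi> ?A ?B i l \<noteq> 0"
    proof (rule ccontr)
      assume "\<nexists>l. kvp r \<xi> ?A ?B i l \<noteq> 0"
      then have "kvp r \<xi> ?A ?B i l = 0" for l by blast
      then have "dt (Suc s) (\<lambda>i j. kvp r \<xi> ?A ?B i (?e j)) = 0"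
        using i by (subst dt_row[of i]) simp_all
      then show False using O1 by simp
    qed
    then obtain l where "kv r (?e 0) (P i) l \<noteq> 0" by (auto simp: kvp_def P_def)
    then obtain \<rho> \<sigma> where nz: "dt (r - 1) (\<lambda>a b. P i (\<rho> a) (\<sigma> b)) \<noteq> 0"
      by (drule_tac kv_minor_nonzero) (elim exE)
    have mr: "(CARD('n) - vec.dim U) + (CARD('n) - vec.dim W) = r - 1" using mm by simp
    show ?thesis
    proof (rule preimage_ann[OF U W Psym Pz mr nz])
      fix w assume w: "w \<in> W"
      have "mv (P i) (k' i) = - mv N (k i)" using d1[of i] by (simp only: eq_neg_iff_add_eq_0)
      then have "scalar_product w (mv (P i) (k' i)) = - (scalar_product \<psi> (k i) * scalar_product w y)"
        using bfN[OF w kU[of i]] scalar_product_diff_right[of w 0 "mv N (k i)"] by simp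
      also have "\<dots> = scalar_product w (mv (P i) (if i = 0 then z0 else 0))"
        using \<psi>[of i] i unfolding y_def scalar_product_scale_right by simp
      finally show "bf (P i) w (k' i - (if i = 0 then z0 else 0)) = 0"
        by (simp add: bf_mv mv_diff scalar_product_diff_right)
    qed
  qed
  have dimY: "vec.dim (ann W) \<le> s" using dim_ann[OF W] s by simp
  have R0: "mv ?B (k' 0) \<notin> ann W"
  proof
    assume asm: "mv ?B (k' 0) \<in> ann W"
    have "mv ?B z0 = mv ?B (k' 0) - mv ?B (k' 0 - z0)" by (simp add: mv_diff)
    moreover have "mv ?B (k' 0 - z0) \<in> ann W" using annW k'U[of 0] by simp
    ultimately show False using z0(2) vec.subspace_diff[OF subspace_ann asm] by simp
  qed
  have R1: "mv ?B (k' i) \<in> ann W" if "1 \<le> i" "i \<le> s" for i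
    using annW[of "k' i"] k'U[of i] that by simp
  have nz: "dt s (\<lambda>i j. mv ?B (k (Suc i)) $ ?e (s + Suc j)) \<noteq> 0"
    using O2 by (simp add: mv_def mvf_def k_def)
  have "\<exists>l. (\<Sum>i<Suc s. \<Sum>j<Suc s. mv ?B (k' i) $ (if j = 0 then l else ?e (s + j)) *
    cf (Suc s) (\<lambda>i j. mv ?B (k i) $ (if j = 0 then l else ?e (s + j))) i j) \<noteq> 0"
    by (rule deriv_minor_nonzero[OF subspace_ann dimY annW[OF kU]], erule (1) R1, rule R0, rule nz)
  then obtain l where l: "(\<Sum>i<Suc s. \<Sum>j<Suc s. mv ?B (k' i) $ (if j = 0 then l else ?e (s + j)) *
    cf (Suc s) (\<lambda>i j. mv ?B (k i) $ (if j = 0 then l else ?e (s + j))) i j) \<noteq> 0"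
    by (elim exE)
  let ?H = "tangent_hom I x \<phi> v"
  have H: "comm_ring_hom ?H" by (rule tangent_hom_hom)
  have HA: "?H (pmat I poly_var (\<lambda>a. poly_const (t a)) i j) = [:pmat I x t i j, (\<Sum>a\<in>I. t a * \<phi> a) * N i j:]" for t i j
    unfolding N_def by (simp only: pmat_hom[OF H] tangent_hom_const tangent_hom_pmat[OF vI])
  have pen: "pencil [:\<xi> i:] (\<lambda>a b. [:?A a b, N a b:]) (\<lambda>a b. [:?B a b, 0:]) = (\<lambda>a b. [:P i a b, N a b:])" for i
    by (intro ext) (simp add: pencil_def P_def)
  have c1: "coeff (mvf (\<lambda>a b. [:?B a b, 0:]) (kv r (?e 0) (\<lambda>a b. [:P i a b, N a b:])) l) 1 = mv ?B (k' i) $ l"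
    and c0: "coeff (mvf (\<lambda>a b. [:?B a b, 0:]) (kv r (?e 0) (\<lambda>a b. [:P i a b, N a b:])) l) 0 = mv ?B (k i) $ l" for i l
    by (simp_all add: mvf_def mv_def coeff_sum k'_def d0)
  have "coeff (?H (image_minor s r (\<lambda>i. poly_const (\<xi> i)) (pmat I poly_var (\<lambda>a. poly_const (\<tau>0 a)))
      (pmat I poly_var (\<lambda>a. poly_const (\<tau>1 a))) l)) 1 \<noteq> 0"
    unfolding image_minor_hom[OF H r] tangent_hom_const HA \<phi>
    unfolding image_minor_def kvp_def mult_1 mult_zero_left pen dt_deriv_truncated c0 c1 by (rule l)
  moreover have "\<forall>u\<in>U. \<forall>w\<in>U. bf (\<lambda>i j. v $ Upair i j) u w = 0"
    using NU unfolding N_def by blast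
  ultimately show ?thesis using vI by (intro exI[of _ \<phi>] exI[of _ v] conjI ballI exI[of _ l]) auto
qed

text \<open>In the test pencil the diagonal entry at 2 s + 1 belongs to \<open>B\<close> and the
  remaining ones to \<open>A\<close>. This raises the rank of \<open>B\<close> to 2 s + 1 and keeps
  the two matrices independent also for s = 0.\<close>

definition tail_ind :: "nat \<Rightarrow> nat \<Rightarrow> 'k::comm_ring_1" where
  "tail_ind s i = (if i = 2 * s + 1 then 0 else 1)"

lemma kvp_spm:
  fixes \<xi> :: "nat \<Rightarrow> 'k::field"
  assumes r: "2 * s < r" "r \<le> CARD('n)" and \<xi>: "\<xi> i \<noteq> 0"
  shows "\<exists>\<delta>. \<delta> \<noteq> 0 \<and> (\<forall>j<CARD('n). kvp r \<xi> (spm s r (\<lambda>_. 0) (-1) (tail_ind s)) (spm s r (\<lambda>_. 1) 0 (\<lambda>i. 1 - tail_ind s i)) i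
    (enum_type j :: 'n::finite) = (if j \<le> s then \<delta> * \<xi> i ^ j else 0))"
proof -
  have "tail_ind s j + \<xi> i * (1 - tail_ind s j) \<noteq> 0" for j using \<xi> by (simp add: tail_ind_def)
  from kv_spm[where l = "\<lambda>_. \<xi> i" and b = "\<lambda>j. tail_ind s j + \<xi> i * (1 - tail_ind s j)", OF r this] obtain \<delta> where \<delta>: "\<delta> \<noteq> 0"
    and k: "\<forall>j<CARD('n). kv r (enum_type 0) (spm s r (\<lambda>_. \<xi> i) (-1) (\<lambda>j. tail_ind s j + \<xi> i * (1 - tail_ind s j))) (enum_type j :: 'n) =
      (if j \<le> s then \<delta> * (\<Prod>a<j. \<xi> i) else 0)"
    by (elim exE conjE)
  show ?thesis
  proof (intro exI[of _ \<delta>] conjI)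
    show "\<delta> \<noteq> 0" by (rule \<delta>)
    show "\<forall>j<CARD('n). kvp r \<xi> (spm s r (\<lambda>_. 0) (-1) (tail_ind s)) (spm s r (\<lambda>_. 1) 0 (\<lambda>i. 1 - tail_ind s i)) i
        (enum_type j :: 'n) = (if j \<le> s then \<delta> * \<xi> i ^ j else 0)"
      using k unfolding kvp_def pencil_spm by (simp only: prod_constant card_lessThan mult_1_right mult_zero_right add_0 add_0_right)
  qed
qed

lemma nondeg_minors_spm:
  fixes \<xi> :: "nat \<Rightarrow> 'k::field"
  assumes r: "2 * s + 1 < r" "r \<le> CARD('n)" and \<xi>: "inj \<xi>" "\<And>i. \<xi> i \<noteq> 0"
  shows "nondeg_minors s r \<xi> (spm s r (\<lambda>_. 0) (-1) (tail_ind s)) (spm s r (\<lambda>_. 1) 0 (\<lambda>i. 1 - tail_ind s i) :: 'n::finite \<Rightarrow> 'n \<Rightarrow> 'k) \<noteq> 0"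
proof -
  let ?A = "spm s r (\<lambda>_. 0) (-1) (tail_ind s) :: 'n \<Rightarrow> 'n \<Rightarrow> 'k"
  let ?B = "spm s r (\<lambda>_. 1) 0 (\<lambda>i. 1 - tail_ind s i) :: 'n \<Rightarrow> 'n \<Rightarrow> 'k"
  let ?e = "enum_type :: nat \<Rightarrow> 'n"
  have r': "2 * s < r" using r by simp
  have "\<forall>i. \<exists>\<delta>. \<delta> \<noteq> 0 \<and> (\<forall>j<CARD('n). kvp r \<xi> ?A ?B i (?e j) = (if j \<le> s then \<delta> * \<xi> i ^ j else 0))"
    by (rule allI, rule kvp_spm[OF r' r(2) \<xi>(2)])
  from choice[OF this] obtain \<delta> where \<delta>k: "\<forall>i. \<delta> i \<noteq> 0 \<and> (\<forall>j<CARD('n). kvp r \<xi> ?A ?B i (?e j) = (if j \<le> s then \<delta> i * \<xi> i ^ j else 0))"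
    by (elim exE)
  have \<delta>: "\<delta> i \<noteq> 0" for i by (rule \<delta>k[rule_format, THEN conjunct1])
  have k: "kvp r \<xi> ?A ?B i (?e j) = (if j \<le> s then \<delta> i * \<xi> i ^ j else 0)" if "j < CARD('n)" for i j
    by (rule \<delta>k[rule_format, THEN conjunct2, rule_format, OF that])
  have "dt (Suc s) (\<lambda>i j. kvp r \<xi> ?A ?B i (?e j)) = dt (Suc s) (\<lambda>i j. \<delta> i * \<xi> i ^ j)"
    by (rule dt_cong) (use r in \<open>simp add: k\<close>)
  moreover have "dt (Suc s) (\<lambda>i j. \<delta> i * \<xi> i ^ j) \<noteq> 0"
    by (rule vandermonde_nonzero) (use \<xi>(1) \<delta> in \<open>auto intro: inj_on_subset\<close>)
  ultimately have O1: "dt (Suc s) (\<lambda>i j. kvp r \<xi> ?A ?B i (?e j)) \<noteq> 0" by simp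
  have "dt s (\<lambda>i j. mvf ?B (kvp r \<xi> ?A ?B (Suc i)) (?e (s + Suc j))) = dt s (\<lambda>i j. \<delta> (Suc i) * \<xi> (Suc i) ^ j)"
  proof (rule dt_cong)
    fix i j assume "i < s" "j < s"
    then have "mvf ?B (kvp r \<xi> ?A ?B (Suc i)) (?e (s + 1 + j)) = kvp r \<xi> ?A ?B (Suc i) (?e j)"
    proof -
      have s: "s + 1 + j < CARD('n)" "2 * s < CARD('n)" using \<open>j < s\<close> r by linarith+
      show ?thesis unfolding mvf_spm[OF s(1)] sp_row_V[OF \<open>j < s\<close> s(2)] by simp
    qed
    then show "mvf ?B (kvp r \<xi> ?A ?B (Suc i)) (?e (s + Suc j)) = \<delta> (Suc i) * \<xi> (Suc i) ^ j"
      using \<open>j < s\<close> r by (simp add: k)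
  qed
  moreover have "dt s (\<lambda>i j. \<delta> (Suc i) * \<xi> (Suc i) ^ j) \<noteq> 0"
  proof (rule vandermonde_nonzero)
    show "inj_on (\<lambda>i. \<xi> (Suc i)) {..<s}"
      by (rule inj_onI, drule injD[OF \<xi>(1)]) (erule Suc_inject)
  qed (use \<delta> in simp)
  ultimately have O2: "dt s (\<lambda>i j. mvf ?B (kvp r \<xi> ?A ?B (Suc i)) (?e (s + Suc j))) \<noteq> 0" by simp
  let ?g = "\<lambda>i. if i < s then i else Suc i"
  \<comment> \<open>On the chosen indices \<open>B\<close> is the permutation matrix of this
    involution.\<close>
  define \<sigma> where "\<sigma> i = (if i < s then s + i else if i < 2 * s then i - s else i)" for i
  have O3: "dt (2 * s + 1) (\<lambda>i j. ?B (?e (?g i)) (?e (?g j))) \<noteq> 0"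
  proof
    assume "dt (2 * s + 1) (\<lambda>i j. ?B (?e (?g i)) (?e (?g j))) = 0"
    then obtain v where v: "\<exists>j<2 * s + 1. v j \<noteq> 0"
      "\<forall>i<2 * s + 1. (\<Sum>j<2 * s + 1. ?B (?e (?g i)) (?e (?g j)) * v j) = 0"
      unfolding dt_zero_iff by (elim exE conjE) (rule that, auto)
    have "v (\<sigma> i) = 0" if i: "i < 2 * s + 1" for i
    proof -
      have "?B (?e (?g i)) (?e (?g j)) = (if j = \<sigma> i then 1 else 0)" if "j < 2 * s + 1" for j
      proof -
        have "?g i < CARD('n)" "?g j < CARD('n)" using i that r by auto
        then have "?B (?e (?g i)) (?e (?g j)) = sp s r (\<lambda>_. 1) 0 (\<lambda>i. 1 - tail_ind s i) (?g i) (?g j)"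
          by (simp only: spm_def type_index_enum)
        also have "\<dots> = (if j = \<sigma> i then 1 else 0)"
        proof -
          consider (U) "i < s" | (V) "s \<le> i" "i < 2 * s" | (B) "i = 2 * s" using i by linarith
          then show ?thesis
          proof cases
            case U
            then have "sp_up s (\<lambda>_. 1) 0 (?g j) i = (0 :: 'k)" by (simp add: sp_up_def)
            then show ?thesis using U that by (simp add: sp_def \<sigma>_def) (simp add: sp_up_def)
          next
            case V
            then have "sp_up s (\<lambda>_. 1) 0 (Suc i) (?g j) = (0 :: 'k)" by (simp add: sp_up_def)
            then show ?thesis using V that by (simp add: sp_def \<sigma>_def) (auto simp: sp_up_def)
          next
            case B
            then have "sp_up s (\<lambda>_. 1) 0 (Suc i) (?g j) = (0 :: 'k)" "sp_up s (\<lambda>_. 1) 0 (?g j) (Suc i) = (0 :: 'k)"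
              by (simp_all add: sp_up_def)
            then show ?thesis using B that r by (simp add: sp_def \<sigma>_def tail_ind_def)
          qed
        qed
        finally show ?thesis .
      qed
      then have "(\<Sum>j<2 * s + 1. ?B (?e (?g i)) (?e (?g j)) * v j) = (\<Sum>j<2 * s + 1. if j = \<sigma> i then v j else 0)"
        by (intro sum.cong) auto
      also have "\<dots> = v (\<sigma> i)"
      proof -
        have "(\<Sum>j<N. if j = \<sigma> i then v j else 0) = v (\<sigma> i)" if "\<sigma> i < N" for N using that by simp
        moreover have "\<sigma> i < 2 * s + 1" using i by (auto simp: \<sigma>_def)
        ultimately show ?thesis by blast
      qed
      finally show ?thesis using v(2)[rule_format, OF i] by (simp only:)
    qed
    moreover have "\<sigma> j < 2 * s + 1" if "j < 2 * s + 1" for j using that by (auto simp: \<sigma>_def)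
    moreover have "\<sigma> (\<sigma> j) = j" if "j < 2 * s + 1" for j using that by (auto simp: \<sigma>_def)
    ultimately have "v j = 0" if "j < 2 * s + 1" for j using that by metis
    then show False using v(1) by blast
  qed
  show ?thesis unfolding nondeg_minors_def using O1 O2 O3 by simp
qed

section \<open>Points of the compression locus in a chart\<close>

lemma compression_locus_chart:
  fixes x :: "'n::finite uprod \<times> 'n uprod \<Rightarrow> 'k::field"
  assumes "chart_plane I x \<in> compression_locus r k s" and r: "s + 1 \<le> r" "r \<le> CARD('n)"
  shows "\<exists>U W :: ('k ^ 'n) set. vec.subspace U \<and> vec.subspace W \<and> U \<subseteq> W \<and>
    vec.dim U = s + 1 + CARD('n) - r \<and> CARD('n) - vec.dim W = s \<and> Suc ((CARD('n) - vec.dim U) + s) = r \<and>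
    (\<forall>t. \<forall>u\<in>U. \<forall>w\<in>W. bf (pmat I x t) u w = 0)"
proof -
  have "nested_compression_space r s (chart_plane I x)" using assms(1) by (simp add: compression_locus_def)
  then obtain U W :: "('k ^ 'n) set" where UW: "vec.subspace U" "vec.subspace W" "U \<subseteq> W"
    "vec.dim U = s + 1 + CARD('n) - r" "vec.dim W = CARD('n) - s"
    and z: "\<forall>u\<in>U. \<forall>w\<in>W. \<forall>z\<in>chart_plane I x. scalar_product u (sym_matrix z *v w) = 0"
    unfolding nested_compression_space_def by (elim conjE exE)
  have "bf (pmat I x t) u w = 0" if "u \<in> U" "w \<in> W" for t u w
  proof -
    have "scalar_product u (sym_matrix (\<Sum>a\<in>I. t a *s rowv I x a) *v w) = 0"
      using z that comb_in_chart_plane by blast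
    then show ?thesis unfolding scalar_product_sym_matrix pmat_comb[symmetric] by simp
  qed
  then show ?thesis using UW r by (intro exI[of _ U] exI[of _ W]) auto
qed

text \<open>The images lie in the annihilator of \<open>W\<close>, whose dimension \<open>s\<close>
  is one less than the size of the minor.\<close>

lemma image_minor_zero:
  fixes x :: "'n::finite uprod \<times> 'n uprod \<Rightarrow> 'k::field"
  assumes x: "chart_plane I x \<in> compression_locus r k s" and r: "s + 1 \<le> r" "r \<le> CARD('n)"
  shows "image_minor s r \<xi> (pmat I x \<tau>0) (pmat I x \<tau>1) l = 0"
proof -
  obtain U W :: "('k ^ 'n) set" where U: "vec.subspace U" and W: "vec.subspace W" 
    and d: "CARD('n) - vec.dim W = s" "Suc ((CARD('n) - vec.dim U) + s) = r"
    and z: "\<forall>t. \<forall>u\<in>U. \<forall>w\<in>W. bf (pmat I x t) u w = 0"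
    using compression_locus_chart[OF x r] by (elim exE conjE)
  have z': "bf (pmat I x t) u w = 0" if "u \<in> U" "w \<in> W" for t u w using z that by blast
  have r0: "0 < r" and m: "Suc ((CARD('n) - vec.dim U) + (CARD('n) - vec.dim W)) = r" using d by simp_all
  have pen: "pencil c (pmat I x \<tau>0) (pmat I x \<tau>1) = pmat I x (\<lambda>a. \<tau>0 a + c * \<tau>1 a)" for c
    unfolding pencil_def by (intro ext) (simp only: pmat_add)
  define k where "k i = (\<chi> l. kvp r \<xi> (pmat I x \<tau>0) (pmat I x \<tau>1) i l)" for i
  have kU: "k i \<in> U" for i
    unfolding k_def kvp_def pen kv_def by (rule cofv_in[OF U W pmat_sym z' m r0])
  have "mv (pmat I x \<tau>1) (k i) \<in> ann W" for i
    unfolding ann_def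
  proof (intro CollectI ballI)
    fix w assume "w \<in> W"
    then show "scalar_product w (mv (pmat I x \<tau>1) (k i)) = 0"
      by (simp only: bf_mv[symmetric] bf_commute[of "pmat I x \<tau>1" w, OF pmat_sym] z'[OF kU])
  qed
  then have "dt (Suc s) (\<lambda>j i. mv (pmat I x \<tau>1) (k i) $ (if j = 0 then l else enum_type (s + j))) = 0"
    by (intro dt_family_zero[of _ _ "ann W"]) (use dim_ann[OF W] d in auto)
  moreover have "mvf (pmat I x \<tau>1) (kvp r \<xi> (pmat I x \<tau>0) (pmat I x \<tau>1) i) q = mv (pmat I x \<tau>1) (k i) $ q" for i q
    by (simp add: mvf_def mv_def k_def)
  ultimately show ?thesis unfolding image_minor_def by (subst dt_transpose[symmetric]) simp
qed

section \<open>Generic reducedness along a component of the Fano scheme\<close>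

lemma fano_component_facts:
  fixes Z :: "('k::alg_closed_field ^ 'n::finite uprod) set set"
  assumes "irreducible_component d (sd_fano r) Z"
  shows "irreducible_locus d Z" "Z \<subseteq> grassmannian d" "\<exists>I x. card I = d \<and> chart_plane I x \<in> Z"
    "\<And>I f x. f \<in> sd_fano r I \<Longrightarrow> chart_plane I x \<in> Z \<Longrightarrow> evl x f = 0"
proof -
  have sub: "Z \<subseteq> scheme_points d (sd_fano r)" and irr: "irreducible_locus d Z"
    using assms by (auto simp: irreducible_component_def)
  show "irreducible_locus d Z" by (rule irr)
  show gr: "Z \<subseteq> grassmannian d" using sub by (auto simp: scheme_points_def)
  obtain Q where Q: "Q \<in> Z" using irr by (auto simp: irreducible_locus_def)
  then have "vec.subspace Q" "vec.dim Q = d" using gr by (auto simp: grassmannian_def)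
  then show "\<exists>I x. card I = d \<and> chart_plane I x \<in> Z" using exists_chart[of Q] Q by metis
  show "evl x f = 0" if "f \<in> sd_fano r I" "chart_plane I x \<in> Z" for I f x
  proof -
    have "minors_vanish r (chart_plane I x)"
      using that(2) sub unfolding scheme_points_sd_fano[OF alg_closed_infinite] by blast
    then show ?thesis using that(1) fano_zero_iff[OF alg_closed_infinite] by blast
  qed
qed

lemma fano_component_nilpotent:
  fixes Z :: "('k::alg_closed_field ^ 'n::finite uprod) set set"
  assumes "irreducible_component d (sd_fano r) Z" "card I = d" "chart_plane I x0 \<in> Z" "f \<in> van Z I"
  shows "\<exists>h m. h \<notin> van Z I \<and> h * f ^ m \<in> fano_pull r I"
proof (rule component_nilpotent[OF assms(1-3) ideal_sd_fano _ assms(4)])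
  fix x :: "'n uprod \<times> 'n uprod \<Rightarrow> 'k"
  assume "\<And>f. f \<in> sd_fano r I \<Longrightarrow> evl x f = 0"
  then have "minors_vanish r (chart_plane I x)" using fano_zero_iff[OF alg_closed_infinite] by blast
  then show "chart_plane I x \<in> scheme_points d (sd_fano r)"
    unfolding scheme_points_sd_fano[OF alg_closed_infinite] using chart_plane_in_grassmannian[OF assms(2)] by blast
qed

lemma compression_locus_nonempty:
  fixes Z C :: "('k::alg_closed_field ^ 'c::finite) set set"
  assumes "is_prime (van Z I)" "van C I = van Z I"
  shows "C \<noteq> {}"
proof
  assume "C = {}"
  then have "1 \<in> van C I" by (simp add: van_def)
  then show False using prime_one[OF assms(1)] assms(2) by simp
qed

lemma exists_nonzero_sequence:
  assumes "infinite (UNIV :: 'k::field set)"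
  shows "\<exists>\<xi> :: nat \<Rightarrow> 'k. inj \<xi> \<and> (\<forall>i. \<xi> i \<noteq> 0)"
proof -
  have "infinite (UNIV - {0 :: 'k})" using assms by simp
  then obtain \<xi> :: "nat \<Rightarrow> 'k" where "inj \<xi>" "range \<xi> \<subseteq> UNIV - {0}"
    using infinite_countable_subset by blast
  then show ?thesis by (intro exI[of _ \<xi>]) auto
qed

text \<open>Along a component every element of the prime is nilpotent in the local ring, so
  reducedness says exactly that the whole prime becomes zero there. The converse direction uses that
  the Fano ideal lies in the prime.\<close>

lemma fano_generic_reduced_iff:
  fixes Z :: "('k::alg_closed_field ^ 'n::finite uprod) set set"
  assumes comp: "irreducible_component d (sd_fano r) Z" and I: "card I = d" "chart_plane I x0 \<in> Z"
  shows "reduced_ring (generic_local_ring (sd_fano r) Z I) \<longleftrightarrow>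
    (\<forall>f\<in>van Z I. \<exists>h. h \<notin> van Z I \<and> h * f \<in> fano_pull r I)"
proof -
  note facts = fano_component_facts[OF comp]
  have prime: "is_prime (van Z I)" by (rule prime_van[OF facts(1,2) I])
  have pull: "f \<in> van Z I" if "f \<in> fano_pull r I" for f
    using that facts(4) by (auto simp: van_def pull_def)
  have iff: "reduced_ring (generic_local_ring (sd_fano r) Z I) \<longleftrightarrow>
    (\<forall>f h m. h \<notin> van Z I \<and> h * f ^ m \<in> fano_pull r I \<longrightarrow> (\<exists>h'. h' \<notin> van Z I \<and> h' * f \<in> fano_pull r I))"
  proof (rule generic_reduced_iff[where X = "sd_fano r" and I = I, OF prime])
    show "ideal (sd_fano r I :: ('n uprod \<times> 'n uprod, 'k) mpoly set) (chart_ring I)" by (rule ideal_sd_fano)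
    show "evl x f = 0" if "f \<in> sd_fano r I" "chart_plane I x \<in> Z" for f x
      by (rule facts(4)[OF that])
  qed
  show ?thesis
  proof
    assume red: "reduced_ring (generic_local_ring (sd_fano r) Z I)"
    show "\<forall>f\<in>van Z I. \<exists>h. h \<notin> van Z I \<and> h * f \<in> fano_pull r I"
    proof
      fix f assume "f \<in> van Z I"
      from fano_component_nilpotent[OF comp I this] obtain h m
        where "h \<notin> van Z I" "h * f ^ m \<in> fano_pull r I" by (elim exE conjE)
      then show "\<exists>h. h \<notin> van Z I \<and> h * f \<in> fano_pull r I" using red unfolding iff by blast
    qed
  next
    assume b: "\<forall>f\<in>van Z I. \<exists>h. h \<notin> van Z I \<and> h * f \<in> fano_pull r I"
    show "reduced_ring (generic_local_ring (sd_fano r) Z I)"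
      unfolding iff
    proof (intro allI impI, elim conjE)
      fix f h m assume "h \<notin> van Z I" "h * f ^ m \<in> fano_pull r I"
      then have "f ^ m \<in> van Z I" using pull prime_mult_iff[OF prime] by blast
      then have "f \<in> van Z I" by (rule prime_power[OF prime])
      then show "\<exists>h'. h' \<notin> van Z I \<and> h' * f \<in> fano_pull r I" using b by blast
    qed
  qed
qed

theorem not_generically_reduced:
  fixes Z :: "('k::alg_closed_field ^ 'n::finite uprod) set set"
  assumes r: "2 * s + 1 < r" "3 \<le> r" "r \<le> CARD('n)" and k: "1 \<le> k"
    and comp: "irreducible_component (k + 1) (sd_fano r) Z"
    and red: "reduced_structure (compression_locus r k s) = reduced_structure Z"
  shows "\<not> generically_reduced_on (sd_fano r) Z"
proof
  assume gr: "generically_reduced_on (sd_fano r) Z"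
  let ?C = "compression_locus r k s :: ('k ^ 'n uprod) set set"
  note facts = fano_component_facts[OF comp]
  obtain I :: "'n uprod set" and x0 where I: "card I = k + 1" "chart_plane I x0 \<in> Z"
    using facts(3) by (elim exE conjE)
  have prime: "is_prime (van Z I)" by (rule prime_van[OF facts(1,2) I])
  have vanC: "van ?C I = van Z I" by (rule van_cong[OF red])
  have ne: "?C \<noteq> {}" by (rule compression_locus_nonempty[OF prime vanC])
  have inf: "infinite (UNIV :: 'k set)" by (rule alg_closed_infinite)
  have reduced: "reduced_ring (generic_local_ring (sd_fano r) Z I)"
    using gr I(2) by (auto simp: generically_reduced_on_def)
  have van_b: "\<exists>h. h \<notin> van Z I \<and> h * f \<in> fano_pull r I" if "f \<in> van Z I" for f
    using reduced that unfolding fano_generic_reduced_iff[OF comp I] by blast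
  obtain \<xi> :: "nat \<Rightarrow> 'k" where \<xi>: "inj \<xi>" "\<And>i. \<xi> i \<noteq> 0"
    using exists_nonzero_sequence[OF inf] by blast
  let ?e = "enum_type :: nat \<Rightarrow> 'n"
  \<comment> \<open>Entries showing that the special \<open>A\<close> and \<open>B\<close> are
    independent. For s = 0 there is no bidiagonal block and two diagonal entries are taken, which is
    possible because r >= 3.\<close>
  define p q p' q' where "p = ?e 1" and "q = ?e (s + 1)" and "p' = (if s = 0 then ?e 2 else ?e 0)"
    and "q' = (if s = 0 then ?e 2 else ?e (s + 1))"
  define A where "A = (spm s r (\<lambda>_. 0) (-1) (tail_ind s) :: 'n \<Rightarrow> 'n \<Rightarrow> 'k)"
  define B where "B = (spm s r (\<lambda>_. 1) 0 (\<lambda>i. 1 - tail_ind s i) :: 'n \<Rightarrow> 'n \<Rightarrow> 'k)"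
  have r2: "2 * s < r" using r by simp
  have em: "entry_minor p q p' q' A B \<noteq> 0"
  proof (cases "s = 0")
    case True
    have lt: "1 < CARD('n)" "2 < CARD('n)" using r by simp_all
    show ?thesis using True r
      by (simp add: entry_minor_def p_def q_def p'_def q'_def A_def B_def spm_def type_index_enum[OF lt(1)] type_index_enum[OF lt(2)]
        type_index_enum[OF lt(1), simplified] sp_def sp_up_def tail_ind_def)
  next
    case False
    then have lt: "0 < CARD('n)" "1 < CARD('n)" "s + 1 < CARD('n)" using r by linarith+
    show ?thesis using False
      by (simp only: entry_minor_def p_def q_def p'_def q'_def A_def B_def spm_def type_index_enum[OF lt(1)] type_index_enum[OF lt(2)]
        type_index_enum[OF lt(3)] if_False) (simp add: sp_def sp_up_def)
  qed
  define \<gamma> where "\<gamma> M = nondeg_minors s r \<xi> (M 0) (M 1) * entry_minor p q p' q' (M 0) (M 1)"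
    for M :: "nat \<Rightarrow> 'n \<Rightarrow> 'n \<Rightarrow> 'k"
  define G where "G I \<tau> = nondeg_minors s r (\<lambda>i. poly_const (\<xi> i)) (pmat I poly_var (\<lambda>a. poly_const (\<tau> 0 a))) (pmat I poly_var (\<lambda>a. poly_const (\<tau> 1 a)))
    * entry_minor p q p' q' (pmat I poly_var (\<lambda>a. poly_const (\<tau> 0 a))) (pmat I poly_var (\<lambda>a. poly_const (\<tau> 1 a)))"
    for I :: "'n uprod set" and \<tau> :: "nat \<Rightarrow> 'n uprod \<Rightarrow> 'k"
  have r0: "0 < r" using r by simp
  have evp: "evl x (pmat J poly_var (\<lambda>a. poly_const (t a)) i j) = pmat J x t i j"
    for x and t :: "'n uprod \<Rightarrow> 'k" and J i j
    by (simp only: pmat_hom[OF evl.comm_ring_hom_axioms] evl_const evl_var)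
  have evG: "evl x (G J \<tau>) = \<gamma> (\<lambda>m. pmat J x (\<tau> m))" for x J \<tau>
    unfolding G_def \<gamma>_def
    by (simp only: evl.hom_mult nondeg_minors_hom[OF evl.comm_ring_hom_axioms r0] entry_minor_hom[OF evl.comm_ring_hom_axioms] evl_const evp)
  define S where "S = {symvec A, symvec B}"
  note cc = spm_coord_compression[OF r2 r(3)]
  have AB: "A i j = A j i" "B i j = B j i" for i j unfolding A_def B_def by (rule spm_sym)+
  have Ssub: "S \<subseteq> coord_compression (?e ` ({..s} \<union> {r..<CARD('n)})) (?e ` ({..s} \<union> {2 * s<..<CARD('n)}))"
    unfolding S_def A_def B_def using cc(4) by blast
  have "vec.dim S \<le> card S" by (rule vec.dim_le_card[OF vec.span_superset]) (simp add: S_def)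
  also have "\<dots> \<le> 2" unfolding S_def by (simp add: card_insert_if)
  finally have dimS: "vec.dim S \<le> k + 1" using k by linarith
  obtain Q where Q: "Q \<in> ?C" "Q \<in> grassmannian (k + 1)" "S \<subseteq> Q"
    using exists_special_plane[OF inf _ r(3) ne cc(1-3) Ssub dimS] r2 by auto
  define z where "z m = symvec (if m = 0 then A else B)" for m :: nat
  have zQ: "z m \<in> Q" for m using Q(3) by (simp add: z_def S_def)
  have z: "z 0 $ Upair i j = A i j" "z 1 $ Upair i j = B i j" for i j
    using AB by (simp_all add: z_def symvec_nth)
  have nz: "\<gamma> (\<lambda>m i j. z m $ Upair i j) \<noteq> 0"
    unfolding \<gamma>_def z using em nondeg_minors_spm[OF r(1,3) \<xi>] by (simp add: A_def B_def)
  have poly: "\<exists>G. \<forall>x. evl x G = \<gamma> (\<lambda>m. pmat I x (\<tau> m))" for I \<tau>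
    using evG by blast
  obtain \<tau> where \<tau>: "\<forall>G. (\<forall>x. evl x G = \<gamma> (\<lambda>m. pmat I x (\<tau> m))) \<longrightarrow> G \<notin> van Z I"
    using generic_condition[where \<gamma> = \<gamma>, OF facts(1,2) red poly Q(1,2) zQ nz I] by (elim exE)
  have G: "G I \<tau> \<notin> van Z I" using \<tau> evG by blast
  define F where "F = image_minor s r (\<lambda>i. poly_const (\<xi> i)) (pmat I poly_var (\<lambda>a. poly_const (\<tau> 0 a))) (pmat I poly_var (\<lambda>a. poly_const (\<tau> 1 a)))"
  have sr: "s + 1 \<le> r" using r2 r by linarith
  have evF: "evl x (F l) = image_minor s r \<xi> (pmat I x (\<tau> 0)) (pmat I x (\<tau> 1)) l" for x l
    unfolding F_def by (simp only: image_minor_hom[OF evl.comm_ring_hom_axioms r0] evl_const evp)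
  have Fz: "evl x (F l) = 0" if "chart_plane I x \<in> ?C" for x l
    unfolding evF by (rule image_minor_zero[OF that sr r(3)])
  have "F l \<in> van Z I" for l
    unfolding vanC[symmetric] van_iff by (intro allI impI Fz) simp
  then have "\<forall>l. \<exists>h. h \<notin> van Z I \<and> h * F l \<in> fano_pull r I" using van_b by blast
  \<comment> \<open>One multiplier for each \<open>l\<close>: the coordinate at which the
    deformation is detected is known only after the point has been chosen, and the point must avoid
    the zeros of all multipliers.\<close>
  from choice[OF this] obtain h where h: "\<forall>l. h l \<notin> van Z I \<and> h l * F l \<in> fano_pull r I" by (elim exE)
  have "(\<Prod>l\<in>UNIV. h l) \<notin> van Z I" using h unfolding prime_prod_iff[OF prime finite] by blast
  then have "G I \<tau> * (\<Prod>l\<in>UNIV. h l) \<notin> van ?C I"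
    using G unfolding vanC prime_mult_iff[OF prime] by blast
  then obtain x1 where x1: "chart_plane I x1 \<in> ?C" "evl (chart_mask I x1) (G I \<tau> * (\<Prod>l\<in>UNIV. h l)) \<noteq> 0"
    unfolding van_iff by (simp only: not_all not_imp) (elim exE conjE)
  define x where "x = chart_mask I x1"
  have x: "chart_plane I x \<in> ?C" "chart_mask I x = x" using x1(1) by (simp_all add: x_def)
  have gx: "\<gamma> (\<lambda>m. pmat I x (\<tau> m)) \<noteq> 0" and hx: "evl x (h l) \<noteq> 0" for l
    using x1(2) unfolding x_def[symmetric] evl.hom_mult evl.hom_prod evG by auto
  obtain U W :: "('k ^ 'n) set" where U: "vec.subspace U" and W: "vec.subspace W" and UW: "U \<subseteq> W"
    and d: "CARD('n) - vec.dim W = s" "Suc ((CARD('n) - vec.dim U) + s) = r"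
    and zz: "\<forall>t. \<forall>u\<in>U. \<forall>w\<in>W. bf (pmat I x t) u w = 0"
    using compression_locus_chart[OF x(1) sr r(3)] by (elim exE conjE)
  have z': "bf (pmat I x t) u w = 0" if "u \<in> U" "w \<in> W" for t u w using zz that by blast
  have nd': "nondeg_minors s r \<xi> (pmat I x (\<tau> 0)) (pmat I x (\<tau> 1)) \<noteq> 0"
    and em': "entry_minor p q p' q' (pmat I x (\<tau> 0)) (pmat I x (\<tau> 1)) \<noteq> 0"
    using gx unfolding \<gamma>_def by auto
  from deformation_exists[where x = x and I = I and U = U and W = W and s = s and r = r, OF U W UW d(2,1) z' nd' em']
  obtain \<phi> v l where v: "\<forall>p\<in>I. v $ p = 0" "\<forall>u\<in>U. \<forall>w\<in>U. bf (\<lambda>i j. v $ Upair i j) u w = 0"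
    and l: "coeff (tangent_hom I x \<phi> v (F l)) 1 \<noteq> 0"
    unfolding F_def by auto
  have v': "v $ p = 0" if "p \<in> I" for p using v(1) that by blast
  have v2: "bf (\<lambda>i j. v $ Upair i j) u w = 0" if "u \<in> U" "w \<in> U" for u w using v(2) that by blast
  have m: "Suc ((CARD('n) - vec.dim U) + (CARD('n) - vec.dim W)) = r" using d by simp
  let ?H = "tangent_hom I x \<phi> v"
  interpret H: comm_ring_hom ?H by (rule tangent_hom_hom)
  have "h l * F l \<in> fano_pull r I" using h by blast
  then have "coeff (?H (h l * F l)) 1 = 0"
    by (rule tangent_hom_fano(2)[OF inf x(2) U W m z' v' v2, rotated -1])
  then have "coeff (?H (h l) * ?H (F l)) 1 = 0" by (simp only: H.hom_mult)
  then have "coeff (?H (h l)) 0 * coeff (?H (F l)) 1 + coeff (?H (h l)) 1 * coeff (?H (F l)) 0 = 0"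
    by (simp add: coeff_mult)
  \<comment> \<open>\<open>F l\<close> vanishes at the point, so the derivative of the product is
    \<open>h l\<close> times the derivative of \<open>F l\<close>.\<close>
  then have "evl x (h l) * coeff (?H (F l)) 1 = 0"
    unfolding tangent_hom_coeff_0 Fz[OF x(1)] by simp
  then show False using hx l by simp
qed

section \<open>Bilinear forms over a commutative ring, modulo an ideal\<close>

definition bff :: "('n::finite \<Rightarrow> 'n \<Rightarrow> 'b::comm_ring_1) \<Rightarrow> ('n \<Rightarrow> 'b) \<Rightarrow> ('n \<Rightarrow> 'b) \<Rightarrow> 'b" where
  "bff A u w = (\<Sum>i\<in>UNIV. \<Sum>j\<in>UNIV. u i * A i j * w j)"

lemma bff_mvf: "bff A u w = (\<Sum>i\<in>UNIV. u i * mvf A w i)"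
  by (simp add: bff_def mvf_def sum_distrib_left mult.assoc)

lemma bff_commute:
  assumes "\<And>i j. A i j = A j i"
  shows "bff A u w = bff A w u"
proof -
  have "bff A u w = (\<Sum>j\<in>UNIV. \<Sum>i\<in>UNIV. u i * A i j * w j)" unfolding bff_def by (rule sum.swap)
  also have "\<dots> = bff A w u"
    unfolding bff_def
  proof (intro sum.cong refl)
    fix i j
    show "u i * A i j * w j = w j * A j i * u i" unfolding assms[of i j] by (simp only: mult_ac)
  qed
  finally show ?thesis .
qed

lemma bff_add_left: "bff A (\<lambda>l. u l + v l) w = bff A u w + bff A v w"
  by (simp add: bff_def distrib_right sum.distrib)

lemma bff_add_right: "bff A u (\<lambda>l. v l + w l) = bff A u v + bff A u w"
  by (simp add: bff_def distrib_left sum.distrib)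

lemma bff_diff_left: "bff A (\<lambda>l. u l - v l) w = bff A u w - bff A v w"
  by (simp add: bff_def left_diff_distrib sum_subtractf)

lemma bff_diff_right: "bff A u (\<lambda>l. v l - w l) = bff A u v - bff A u w"
  by (simp add: bff_def right_diff_distrib sum_subtractf)

lemma bff_scale_left: "bff A (\<lambda>l. c * u l) w = c * bff A u w"
  by (simp add: bff_def sum_distrib_left mult_ac)

lemma bff_scale_right: "bff A u (\<lambda>l. c * w l) = c * bff A u w"
  by (simp add: bff_def sum_distrib_left mult_ac)

lemma bff_sum_left: "bff A (\<lambda>l. \<Sum>m\<in>S. c m * u m l) w = (\<Sum>m\<in>S. c m * bff A (u m) w)"
  by (induction S rule: infinite_finite_induct) (simp_all add: bff_add_left bff_scale_left, simp_all add: bff_def)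

lemma bff_sum_right: "bff A u (\<lambda>l. \<Sum>m\<in>S. c m * w m l) = (\<Sum>m\<in>S. c m * bff A u (w m))"
  by (induction S rule: infinite_finite_induct) (simp_all add: bff_add_right bff_scale_right, simp_all add: bff_def)

lemma bff_matrix_add: "bff (\<lambda>i j. A i j + c * B i j) u w = bff A u w + c * bff B u w"
  by (simp add: bff_def distrib_left distrib_right sum.distrib sum_distrib_left mult_ac)

lemma bff_matrix_sum: "bff (\<lambda>i j. \<Sum>a\<in>S. t a * A a i j) u w = (\<Sum>a\<in>S. t a * bff (A a) u w)"
proof (induction S rule: infinite_finite_induct)
  case (insert x F)
  then show ?case using bff_matrix_add[of "\<lambda>i j. \<Sum>a\<in>F. t a * A a i j" "t x" "A x" u w]
    by (simp add: add.commute)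
qed (simp_all add: bff_def)

lemma bff_hom:
  assumes "comm_ring_hom h"
  shows "h (bff A u w) = bff (\<lambda>i j. h (A i j)) (\<lambda>l. h (u l)) (\<lambda>l. h (w l))"
proof -
  interpret comm_ring_hom h by fact
  show ?thesis by (simp add: bff_def hom_distribs)
qed

lemma bff_ideal:
  assumes J: "is_ideal J" and w: "\<And>i. mvf A w i \<in> J"
  shows "bff A u w \<in> J"
  unfolding bff_mvf by (intro ideal_sum[OF J] ideal_mult[OF J] w)

section \<open>Interpolation and isotropy of kernel vectors of a pencil\<close>

text \<open>Infinitely many nodes remain outside \<open>F\<close>, and a Vandermonde system with an
  invertible constant determinant recovers the coefficients from sufficiently many values.\<close>

lemma interpolation_ideal:
  fixes p :: "('v, 'k::field) mpoly poly"
  assumes inf: "infinite (UNIV :: 'k set)" and J: "is_ideal J" and F: "finite F"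
    and p: "\<And>c. c \<notin> F \<Longrightarrow> poly p (poly_const c) \<in> J"
  shows "coeff p i \<in> J"
proof (cases "i \<le> degree p")
  case True
  have "infinite (UNIV - F)" using inf F by (rule Diff_infinite_finite[rotated])
  then obtain c :: "nat \<Rightarrow> 'k" where c: "inj c" "range c \<subseteq> UNIV - F"
    using infinite_countable_subset by blast
  define m where "m = Suc (degree p)"
  define d where "d = dt m (\<lambda>i j. c i ^ j)"
  have "dt m (\<lambda>i j. 1 * c i ^ j) \<noteq> 0"
    by (rule vandermonde_nonzero) (use c(1) in \<open>auto intro: inj_on_subset\<close>)
  then have d: "d \<noteq> 0" by (simp add: d_def)
  have dd: "dt m (\<lambda>i j. poly_const (c i) ^ j) = (poly_const d :: ('v, 'k) mpoly)"
    unfolding d_def dt_hom[OF comm_ring_hom_poly_const] by (simp add: poly_const.hom_power)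
  have "(\<Sum>j<m. poly_const (c i) ^ j * coeff p j) \<in> J" if "i < m" for i
  proof -
    have "(\<Sum>j<m. poly_const (c i) ^ j * coeff p j) = poly p (poly_const (c i))"
      unfolding poly_altdef m_def by (simp add: lessThan_Suc_atMost mult.commute)
    also have "\<dots> \<in> J" using c(2) by (intro p) blast
    finally show ?thesis .
  qed
  then have "dt m (\<lambda>i j. poly_const (c i) ^ j) * coeff p i \<in> J"
    by (rule cramer_ideal[OF J]) (use True in \<open>simp_all add: m_def\<close>)
  then have "poly_const (inverse d) * (poly_const d * coeff p i) \<in> J"
    unfolding dd by (rule ideal_mult[OF J])
  moreover have "poly_const (inverse d) * (poly_const d * coeff p i) = coeff p i"
    using d by (simp add: mult.assoc[symmetric] poly_const.hom_mult[symmetric])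
  ultimately show ?thesis by simp
qed (use J in \<open>simp add: coeff_eq_0 ideal_zero\<close>)

text \<open>For two parameters c and c', subtracting the two kernel equations and using symmetry
  leaves (c - c') times the pairing under \<open>B\<close>. The case c = c' is out of reach of this
  argument and follows by interpolation in c.\<close>

lemma pencil_isotropic:
  fixes A B :: "'n::finite \<Rightarrow> 'n \<Rightarrow> ('v, 'k::field) mpoly"
  assumes inf: "infinite (UNIV :: 'k set)" and J: "is_ideal J" and r: "0 < r"
    and sym: "\<And>i j. A i j = A j i" "\<And>i j. B i j = B j i"
    and minors: "\<And>c \<rho> \<sigma>. dt r (\<lambda>i j. pencil (poly_const c) A B (\<rho> i) (\<sigma> j)) \<in> J"
  defines "k \<equiv> \<lambda>y c. kv r y (pencil (poly_const c) A B)"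
  shows "bff B (k y c) (k y' c') \<in> J" "bff A (k y c) (k y' c') \<in> J"
proof -
  have ker: "bff (pencil (poly_const c) A B) u (k y c) \<in> J" for u y c
    unfolding k_def by (rule bff_ideal[OF J]) (simp only: mvf_kv[OF r] minors)
  have pen: "bff (pencil (poly_const c) A B) u w = bff A u w + poly_const c * bff B u w" for u w c
    using bff_matrix_add[of A "poly_const c" B u w] by (simp add: pencil_def[abs_def])
  have comm: "bff A u w = bff A w u" "bff B u w = bff B w u" for u w
    by (rule bff_commute, rule sym)+
  have e1: "bff A u (k y c) + poly_const c * bff B u (k y c) \<in> J" for u y c
    using ker[of c u y] unfolding pen .
  have distinct: "bff B (k y c) (k y' c') \<in> J" if ne: "c \<noteq> c'" for y y' c c'
  proof -
    have "(bff A (k y' c') (k y c) + poly_const c * bff B (k y' c') (k y c)) -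
        (bff A (k y c) (k y' c') + poly_const c' * bff B (k y c) (k y' c')) \<in> J"
      by (rule ideal_diff[OF J e1 e1])
    also have "(bff A (k y' c') (k y c) + poly_const c * bff B (k y' c') (k y c)) -
        (bff A (k y c) (k y' c') + poly_const c' * bff B (k y c) (k y' c')) =
        poly_const (c - c') * bff B (k y c) (k y' c')"
      unfolding comm[of "k y' c'" "k y c"] by (simp add: poly_const.hom_minus left_diff_distrib)
    finally have "poly_const (inverse (c - c')) * (poly_const (c - c') * bff B (k y c) (k y' c')) \<in> J"
      by (rule ideal_mult[OF J])
    then show ?thesis using ne by (simp add: mult.assoc[symmetric] poly_const.hom_mult[symmetric])
  qed
  show B: "bff B (k y c) (k y' c') \<in> J"
  proof -
    \<comment> \<open>The pairing as a polynomial in the first parameter; its values at constants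
      other than \<open>c'\<close> are already known to lie in \<open>J\<close>.\<close>
    define p where "p = (\<Sum>l\<in>UNIV. kv r y (\<lambda>i j. [:A i j, B i j:]) l * [:mvf B (k y' c') l:])"
    have pp: "poly p (poly_const d) = bff B (k y d) (k y' c')" for d
    proof -
      have "(\<lambda>i j. poly [:A i j, B i j:] (poly_const d)) = pencil (poly_const d) A B"
        by (intro ext) (simp add: pencil_def)
      then have "poly (kv r y (\<lambda>i j. [:A i j, B i j:]) l) (poly_const d) = k y d l" for l
        unfolding k_def by (simp only: kv_hom[OF comm_ring_hom_poly r])
      then show ?thesis unfolding p_def bff_mvf by (simp add: poly_sum mult.commute)
    qed
    have "coeff p i \<in> J" for i
      by (rule interpolation_ideal[OF inf J, of "{c'}"]) (simp_all add: pp distinct)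
    then have "poly p (poly_const c) \<in> J" by (rule poly_in_ideal[OF J])
    then show ?thesis by (simp only: pp)
  qed
  show "bff A (k y c) (k y' c') \<in> J"
    using ideal_diff[OF J e1[of "k y c" y' c'] ideal_mult[OF J B, of "poly_const c'"]] by simp
qed

section \<open>Normalised frames\<close>

text \<open>For r = 2 s + 1 these are the coordinates of \<open>U\<close> in the special plane, in
  increasing order; \<open>vp\<close> numbers the s complementary ones.\<close>

definition nu :: "nat \<Rightarrow> nat \<Rightarrow> 'n::finite" where
  "nu s m = enum_type (if m \<le> s then m else m + s)"

text \<open>The first s + 1 frame vectors share the pivot 0 and differ by the parameter of the
  pencil; each later one has a pivot of its own.\<close>

definition pivot :: "nat \<Rightarrow> nat \<Rightarrow> 'n::finite" where
  "pivot s m = enum_type (if m \<le> s then 0 else m + s)"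

definition vp :: "nat \<Rightarrow> nat \<Rightarrow> 'n::finite" where
  "vp s a = enum_type (s + 1 + a)"

lemma nu_inj: "2 * s < CARD('n) \<Longrightarrow> m < CARD('n) - s \<Longrightarrow> l < CARD('n) - s \<Longrightarrow> (nu s m :: 'n::finite) = nu s l \<longleftrightarrow> m = l"
  unfolding nu_def by (subst enum_type_inj) auto

lemma vp_inj: "2 * s < CARD('n) \<Longrightarrow> a < s \<Longrightarrow> b < s \<Longrightarrow> (vp s a :: 'n::finite) = vp s b \<longleftrightarrow> a = b"
  unfolding vp_def by (subst enum_type_inj) auto

lemma nu_vp: "2 * s < CARD('n) \<Longrightarrow> m < CARD('n) - s \<Longrightarrow> a < s \<Longrightarrow> (nu s m :: 'n::finite) \<noteq> vp s a"
  unfolding nu_def vp_def by (subst enum_type_inj) auto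

lemma nu_vp_cases:
  assumes "2 * s < CARD('n)"
  obtains m where "m < CARD('n) - s" "(l :: 'n::finite) = nu s m" | a where "a < s" "l = vp s a"
proof -
  define i where "i = type_index l"
  have i: "i < CARD('n)" "l = enum_type i" by (simp_all add: i_def type_index_less enum_type_index)
  consider "i \<le> s" | "s < i" "i \<le> 2 * s" | "2 * s < i" by linarith
  then show ?thesis
  proof cases
    case 1
    then show ?thesis using that(1)[of i] i assms by (simp add: nu_def)
  next
    case 2
    then show ?thesis using that(2)[of "i - s - 1"] i by (simp add: vp_def)
  next
    case 3
    then have "\<not> i - s \<le> s" "i - s + s = i" "i - s < CARD('n) - s" using i(1) by linarith+
    then show ?thesis using that(1)[of "i - s"] i(2) by (simp add: nu_def)
  qed
qed

text \<open>What is left of \<open>d * w\<close> after its expansion in a frame normalised at the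
  positions \<open>nu\<close>; only the coordinates \<open>vp\<close> survive.\<close>

definition frame_rest :: "nat \<Rightarrow> 'b \<Rightarrow> (nat \<Rightarrow> 'n::finite \<Rightarrow> 'b) \<Rightarrow> ('n \<Rightarrow> 'b) \<Rightarrow> nat \<Rightarrow> 'b::comm_ring_1" where
  "frame_rest s d u w a = d * w (vp s a) - (\<Sum>m<CARD('n) - s. w (nu s m) * u m (vp s a))"

lemma frame_decomp:
  fixes u :: "nat \<Rightarrow> 'n::finite \<Rightarrow> 'b::comm_ring_1"
  assumes s: "2 * s < CARD('n)"
    and u: "\<And>m l. m < CARD('n) - s \<Longrightarrow> l < CARD('n) - s \<Longrightarrow> u m (nu s l) = (if l = m then d else 0)"
  shows "d * w l = (\<Sum>m<CARD('n) - s. w (nu s m) * u m l) + (\<Sum>a<s. frame_rest s d u w a * (if l = vp s a then 1 else 0))"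
proof (rule nu_vp_cases[OF s, of l])
  fix m assume m: "m < CARD('n) - s" "l = nu s m"
  have "(\<Sum>i<CARD('n) - s. w (nu s i) * u i (nu s m)) = (\<Sum>i<CARD('n) - s. if i = m then w (nu s m) * d else 0)"
    by (rule sum.cong) (use u m in auto)
  also have "\<dots> = w (nu s m) * d" using m by simp
  moreover have "(\<Sum>a<s. frame_rest s d u w a * (if nu s m = (vp s a :: 'n) then 1 else 0)) = 0"
    by (rule sum.neutral) (use nu_vp[OF s m(1)] in auto)
  ultimately show ?thesis using m by (simp add: mult.commute)
next
  fix a assume a: "a < s" "l = vp s a"
  have "(\<Sum>b<s. frame_rest s d u w b * (if vp s a = (vp s b :: 'n) then 1 else 0)) = (\<Sum>b<s. if b = a then frame_rest s d u w a else 0)"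
    by (rule sum.cong) (use vp_inj[OF s a(1)] in auto)
  also have "\<dots> = frame_rest s d u w a" using a by simp
  finally show ?thesis using a by (simp add: frame_rest_def)
qed

text \<open>Split d times a kernel vector into frame part and remainder; everything paired with a
  kernel vector lies in \<open>J\<close>. The second relation trades the form on two frame parts for
  the form on the two remainders, so it is of second order in the remainders. This gain is what
  makes Nakayama's lemma applicable.\<close>

lemma frame_relations:
  fixes u :: "nat \<Rightarrow> 'n::finite \<Rightarrow> 'b::comm_ring_1"
  assumes s: "2 * s < CARD('n)" and J: "is_ideal J" and sym: "\<And>i j. A i j = A j i"
    and u: "\<And>m l. m < CARD('n) - s \<Longrightarrow> l < CARD('n) - s \<Longrightarrow> u m (nu s l) = (if l = m then d else 0)"
    and w: "\<And>i. mvf A w i \<in> J" and w': "\<And>i. mvf A w' i \<in> J"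
  defines "N \<equiv> CARD('n) - s" and "e \<equiv> \<lambda>a (l :: 'n). if l = vp s a then 1 else (0 :: 'b)"
  shows "(\<Sum>m'<N. w (nu s m') * bff A (u m) (u m')) + (\<Sum>a<s. frame_rest s d u w a * bff A (u m) (e a)) \<in> J"
    "(\<Sum>m<N. \<Sum>m'<N. w' (nu s m) * w (nu s m') * bff A (u m) (u m')) -
      (\<Sum>a<s. \<Sum>c<s. frame_rest s d u w' a * frame_rest s d u w c * bff A (e a) (e c)) \<in> J"
proof -
  define wh where "wh w l = (\<Sum>m<N. w (nu s m) * u m l)" for w :: "'n \<Rightarrow> 'b" and l :: 'n
  define re where "re w l = (\<Sum>a<s. frame_rest s d u w a * e a l)" for w :: "'n \<Rightarrow> 'b" and l :: 'n
  have dec: "d * w l = wh w l + re w l" for w :: "'n \<Rightarrow> 'b" and l :: 'n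
    unfolding wh_def re_def N_def e_def by (rule frame_decomp[OF s u])
  have comm: "bff A x y = bff A y x" for x y by (rule bff_commute[OF sym])
  have wJ: "bff A x w \<in> J" "bff A x w' \<in> J" for x by (rule bff_ideal[OF J], rule w w')+
  have "(\<lambda>l. d * w l) = (\<lambda>l. wh w l + re w l)" by (intro ext dec)
  then have "bff A (u m) (wh w) + bff A (u m) (re w) = d * bff A (u m) w"
    by (metis bff_scale_right bff_add_right)
  then have "bff A (u m) (wh w) + bff A (u m) (re w) \<in> J" using ideal_mult[OF J wJ(1)] by simp
  then show "(\<Sum>m'<N. w (nu s m') * bff A (u m) (u m')) + (\<Sum>a<s. frame_rest s d u w a * bff A (u m) (e a)) \<in> J"
    by (simp only: wh_def[abs_def] re_def[abs_def] bff_sum_right)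
  have whe: "wh w = (\<lambda>l. d * w l - re w l)" for w using dec[of w] by (intro ext) (simp add: algebra_simps)
  have "bff A (wh w') (wh w) - bff A (re w') (re w) =
      d * (d * bff A w' w) - d * bff A (re w') w - d * bff A (re w) w'"
    unfolding whe bff_diff_left bff_diff_right bff_scale_left bff_scale_right comm[of w' "re w"] by simp
  also have "\<dots> \<in> J" by (intro ideal_diff[OF J] ideal_mult[OF J] wJ)
  finally have "bff A (wh w') (wh w) - bff A (re w') (re w) \<in> J" .
  then show "(\<Sum>m<N. \<Sum>m'<N. w' (nu s m) * w (nu s m') * bff A (u m) (u m')) -
      (\<Sum>a<s. \<Sum>c<s. frame_rest s d u w' a * frame_rest s d u w c * bff A (e a) (e c)) \<in> J"
    by (simp only: wh_def[abs_def] re_def[abs_def] bff_sum_left bff_sum_right sum_distrib_left mult.assoc)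
qed

section \<open>Saturation and Nakayama's lemma\<close>

text \<open>The contraction to the ring of \<open>J\<close> localised at \<open>P\<close>.\<close>

definition sat :: "'b set \<Rightarrow> 'b set \<Rightarrow> 'b::comm_ring_1 set" where
  "sat P J = {f. \<exists>h. h \<notin> P \<and> h * f \<in> J}"

lemma ideal_sat:
  assumes P: "is_prime P" and J: "is_ideal J"
  shows "is_ideal (sat P J)"
  unfolding is_ideal_def
proof (intro conjI ballI allI)
  show "0 \<in> sat P J" unfolding sat_def using prime_one[OF P] ideal_zero[OF J] by (intro CollectI exI[of _ 1]) simp
next
  fix a b assume "a \<in> sat P J" "b \<in> sat P J"
  then obtain h h' where h: "h \<notin> P" "h * a \<in> J" "h' \<notin> P" "h' * b \<in> J" by (auto simp: sat_def)
  have "h' * (h * a) + h * (h' * b) \<in> J" by (intro ideal_add[OF J] ideal_mult[OF J] h)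
  moreover have "h' * (h * a) + h * (h' * b) = (h * h') * (a + b)" by (simp add: algebra_simps)
  ultimately show "a + b \<in> sat P J" unfolding sat_def using prime_mult_iff[OF P] h by (intro CollectI exI[of _ "h * h'"]) simp
next
  fix a c assume "a \<in> sat P J"
  then obtain h where "h \<notin> P" "h * a \<in> J" by (auto simp: sat_def)
  then show "c * a \<in> sat P J" unfolding sat_def using ideal_mult[OF J, of "h * a" c] by (intro CollectI exI[of _ h]) (simp add: mult_ac)
qed

lemma sat_saturated: "is_prime P \<Longrightarrow> h \<notin> P \<Longrightarrow> h * f \<in> sat P J \<Longrightarrow> f \<in> sat P J"
  unfolding sat_def using prime_mult_iff by (auto simp: mult.assoc[symmetric])

lemma sat_superset: "is_prime P \<Longrightarrow> f \<in> J \<Longrightarrow> f \<in> sat P J"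
  unfolding sat_def using prime_one by (intro CollectI exI[of _ 1]) auto

lemma sat_subset: "is_prime P \<Longrightarrow> J \<subseteq> P \<Longrightarrow> sat P J \<subseteq> P"
  unfolding sat_def using prime_mult_iff by blast

lemma sat_mult: "f \<in> sat P J \<Longrightarrow> (\<And>g. g \<in> J \<Longrightarrow> c * g \<in> J') \<Longrightarrow> c * f \<in> sat P J'"
  unfolding sat_def
proof (elim CollectE exE conjE, intro CollectI exI conjI)
  fix h assume "\<And>g. g \<in> J \<Longrightarrow> c * g \<in> J'" "h * f \<in> J"
  then have "c * (h * f) \<in> J'" by blast
  then show "h * (c * f) \<in> J'" by (simp only: mult.left_commute)
qed

text \<open>The ideal S D + J: \<open>S = UNIV\<close> gives the ideal generated by \<open>J\<close>
  and the \<open>D i\<close>, and \<open>S = P\<close> the smaller one in the hypothesis of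
  Nakayama's lemma.\<close>

definition gen :: "'b set \<Rightarrow> 'i set \<Rightarrow> ('i \<Rightarrow> 'b) \<Rightarrow> 'b set \<Rightarrow> 'b::comm_ring_1 set" where
  "gen S T D J = {f. \<exists>p. (\<forall>i. p i \<in> S) \<and> f - (\<Sum>i\<in>T. p i * D i) \<in> J}"

lemma ideal_gen:
  assumes S: "is_ideal S" and J: "is_ideal J"
  shows "is_ideal (gen S T D J)"
  unfolding is_ideal_def
proof (intro conjI ballI allI)
  show "0 \<in> gen S T D J" unfolding gen_def using ideal_zero[OF S] ideal_zero[OF J] by (intro CollectI exI[of _ "\<lambda>_. 0"]) simp
next
  fix a b assume "a \<in> gen S T D J" "b \<in> gen S T D J"
  then obtain p q where p: "\<forall>i. p i \<in> S" "a - (\<Sum>i\<in>T. p i * D i) \<in> J" and q: "\<forall>i. q i \<in> S" "b - (\<Sum>i\<in>T. q i * D i) \<in> J"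
    unfolding gen_def by (elim CollectE exE conjE)
  have "(a - (\<Sum>i\<in>T. p i * D i)) + (b - (\<Sum>i\<in>T. q i * D i)) = a + b - (\<Sum>i\<in>T. (p i + q i) * D i)"
    by (simp add: distrib_right sum.distrib)
  with ideal_add[OF J p(2) q(2)] have "a + b - (\<Sum>i\<in>T. (p i + q i) * D i) \<in> J" by (simp only:)
  then show "a + b \<in> gen S T D J" unfolding gen_def
    using p q ideal_add[OF S] by (intro CollectI exI[of _ "\<lambda>i. p i + q i"]) simp
next
  fix a c assume "a \<in> gen S T D J"
  then obtain p where p: "\<forall>i. p i \<in> S" "a - (\<Sum>i\<in>T. p i * D i) \<in> J" unfolding gen_def by (elim CollectE exE conjE)
  have "c * (a - (\<Sum>i\<in>T. p i * D i)) = c * a - (\<Sum>i\<in>T. (c * p i) * D i)"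
    by (simp add: right_diff_distrib sum_distrib_left mult.assoc)
  with ideal_mult[OF J p(2), of c] have "c * a - (\<Sum>i\<in>T. (c * p i) * D i) \<in> J" by (simp only:)
  then show "c * a \<in> gen S T D J" unfolding gen_def
    using p ideal_mult[OF S] by (intro CollectI exI[of _ "\<lambda>i. c * p i"]) simp
qed

lemma gen_base: "is_ideal S \<Longrightarrow> J \<subseteq> gen S T D J"
  unfolding gen_def using ideal_zero by (intro subsetI CollectI exI[of _ "\<lambda>_. 0"]) simp

lemma gen_generator:
  assumes "finite T" "i \<in> T" "is_ideal J"
  shows "D i \<in> gen UNIV T D J"
proof -
  have "(\<Sum>j\<in>T. (if j = i then 1 else 0) * D j) = (\<Sum>j\<in>T. if j = i then D i else 0)" by (rule sum.cong) auto
  also have "\<dots> = D i" using assms by simp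
  finally show ?thesis unfolding gen_def using ideal_zero[OF assms(3)]
    by (intro CollectI exI[of _ "\<lambda>j. if j = i then 1 else 0"]) simp
qed

lemma gen_mult:
  assumes P: "is_ideal P" and J: "is_ideal J" and c: "c \<in> P" and f: "f \<in> gen UNIV T D J"
  shows "c * f \<in> gen P T D J"
proof -
  obtain p where p: "f - (\<Sum>i\<in>T. p i * D i) \<in> J" using f unfolding gen_def by (elim CollectE exE conjE)
  have "c * (f - (\<Sum>i\<in>T. p i * D i)) = c * f - (\<Sum>i\<in>T. (c * p i) * D i)"
    by (simp add: right_diff_distrib sum_distrib_left mult.assoc)
  with ideal_mult[OF J p, of c] have "c * f - (\<Sum>i\<in>T. (c * p i) * D i) \<in> J" by (simp only:)
  then show ?thesis unfolding gen_def using ideal_mult_right[OF P c]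
    by (intro CollectI exI[of _ "\<lambda>i. c * p i"]) simp
qed

lemma gen_subset:
  assumes "is_ideal P" "J \<subseteq> P" "\<And>i. i \<in> T \<Longrightarrow> D i \<in> P"
  shows "gen UNIV T D J \<subseteq> P"
proof
  fix f assume "f \<in> gen UNIV T D J"
  then obtain p where "f - (\<Sum>i\<in>T. p i * D i) \<in> P" using assms(2) unfolding gen_def by blast
  moreover have "(\<Sum>i\<in>T. p i * D i) \<in> P" by (intro ideal_sum[OF assms(1)] ideal_mult[OF assms(1)] assms(3))
  ultimately show "f \<in> P" using ideal_diff_iff[OF assms(1)] by blast
qed

lemma dt_scalar: "dt m (\<lambda>i j. if i = j then h else 0) = h ^ m"
proof -
  have "Matrix.mat m m (\<lambda>(i, j). if i = j then h else 0) = h \<cdot>\<^sub>m 1\<^sub>m m" by (intro eq_matI) auto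
  then show ?thesis unfolding dt_def by (simp add: det_smult)
qed

text \<open>The determinant trick: after multiplication by a common \<open>H\<close> outside
  \<open>P\<close>, the \<open>D i\<close> satisfy a linear system modulo \<open>J\<close> whose
  matrix is \<open>H\<close> times the identity modulo \<open>P\<close>. Its determinant is
  \<open>H ^ card T\<close> modulo \<open>P\<close>, hence outside \<open>P\<close>, and can be
  cancelled.\<close>

lemma nakayama:
  assumes P: "is_prime P" and J: "is_ideal J" and sat: "\<And>h f. h \<notin> P \<Longrightarrow> h * f \<in> J \<Longrightarrow> f \<in> J"
    and T: "finite T" and D: "\<And>i. i \<in> T \<Longrightarrow> D i \<in> sat P (gen P T D J)" and i: "i \<in> T"
  shows "D i \<in> J"
proof -
  have PI: "is_ideal P" by (rule prime_ideal[OF P])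
  have "\<forall>i\<in>T. \<exists>h. h \<notin> P \<and> h * D i \<in> gen P T D J" using D by (simp add: sat_def)
  from bchoice[OF this] obtain h where h: "\<forall>i\<in>T. h i \<notin> P \<and> h i * D i \<in> gen P T D J" by (elim exE)
  define H where "H = (\<Prod>i\<in>T. h i)"
  have H: "H \<notin> P" unfolding H_def prime_prod_iff[OF P T] using h by blast
  have "\<exists>p. (\<forall>j. p j \<in> P) \<and> H * D i - (\<Sum>j\<in>T. p j * D j) \<in> J" if "i \<in> T" for i
  proof -
    have "H * D i = (\<Prod>j\<in>T - {i}. h j) * (h i * D i)" unfolding H_def using T that by (simp add: prod.remove mult_ac)
    also have "\<dots> \<in> gen P T D J"
      by (rule ideal_mult[OF ideal_gen[OF PI J]]) (use h that in blast)
    finally show ?thesis by (simp add: gen_def)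
  qed
  then have "\<forall>i\<in>T. \<exists>p. (\<forall>j. p j \<in> P) \<and> H * D i - (\<Sum>j\<in>T. p j * D j) \<in> J" by (intro ballI)
  from bchoice[OF this] obtain p where p: "\<forall>i\<in>T. (\<forall>j. p i j \<in> P) \<and> H * D i - (\<Sum>j\<in>T. p i j * D j) \<in> J" by (elim exE)
  obtain e where e: "bij_betw e {..<card T} T"
    using ex_bij_betw_nat_finite[OF T] by (auto simp: lessThan_atLeast0)
  let ?m = "card T"
  define f where "f a b = (if a = b then H else 0) - p (e a) (e b)" for a b
  have eT: "e a \<in> T" if "a < ?m" for a using e that by (auto simp: bij_betw_def)
  have "(\<Sum>b<?m. f a b * D (e b)) \<in> J" if a: "a < ?m" for a
  proof -
    have "(\<Sum>b<?m. f a b * D (e b)) = (\<Sum>b<?m. if b = a then H * D (e b) else 0) - (\<Sum>b<?m. p (e a) (e b) * D (e b))"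
      unfolding f_def left_diff_distrib sum_subtractf by (intro arg_cong2[of _ _ _ _ "(-)"] sum.cong) auto
    also have "(\<Sum>b<?m. p (e a) (e b) * D (e b)) = (\<Sum>j\<in>T. p (e a) j * D j)"
      by (rule sum.reindex_bij_betw[OF e])
    also have "(\<Sum>b<?m. if b = a then H * D (e b) else 0) = H * D (e a)" using a by simp
    finally show ?thesis using p eT[OF a] by simp
  qed
  note rows = this
  have c: "dt ?m f * D (e b) \<in> J" if "b < ?m" for b
    by (rule cramer_ideal[where v = "\<lambda>b. D (e b)", OF J rows that])
  have "dt ?m f - dt ?m (\<lambda>a b. if a = b then H else 0) \<in> P"
  proof (rule dt_ideal_cong[OF PI])
    fix a b assume "a < ?m" "b < ?m"
    then have "- p (e a) (e b) \<in> P" using p eT by (intro ideal_uminus[OF PI]) blast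
    then show "f a b - (if a = b then H else 0) \<in> P" by (simp add: f_def)
  qed
  then have "dt ?m f \<in> P \<longleftrightarrow> H ^ ?m \<in> P" unfolding dt_scalar by (rule ideal_diff_iff[OF PI])
  then have nP: "dt ?m f \<notin> P" using H prime_power[OF P, of H ?m] by argo
  obtain b where b: "b < ?m" "i = e b" using i e by (auto simp: bij_betw_def)
  show ?thesis unfolding b(2) by (rule sat[OF nP c[OF b(1)]])
qed

section \<open>Isotropic frames parametrise the compression locus\<close>

definition upfun :: "('n \<Rightarrow> 'n \<Rightarrow> 'b) \<Rightarrow> 'n uprod \<Rightarrow> 'b" where
  "upfun A q = A (fst_up q) (snd_up q)"

lemma upfun_Upair:
  assumes "\<And>i j. A i j = A j i"
  shows "upfun A (Upair i j) = A i j"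
proof -
  have "Upair (fst_up (Upair i j)) (snd_up (Upair i j)) = Upair i j" by (rule Upair_fst_snd)
  then show ?thesis using assms by (auto simp: upfun_def)
qed

text \<open>The normalisation makes the frame independent, so it spans a space of dimension n - s.
  This serves both as \<open>U\<close> and as \<open>W\<close>, since s + 1 + n - r = n - s.\<close>

lemma isotropic_plane_in_locus:
  fixes u :: "nat \<Rightarrow> 'n::finite \<Rightarrow> 'k::field" and M :: "'n uprod \<Rightarrow> 'n uprod \<Rightarrow> 'k"
  assumes inf: "infinite (UNIV :: 'k set)" and r: "r = 2 * s + 1" "r \<le> CARD('n)" and I: "card I = k + 1"
    and u: "\<And>m l. m < CARD('n) - s \<Longrightarrow> l < CARD('n) - s \<Longrightarrow> u m (nu s l) = (if l = m then d else 0)" and d: "d \<noteq> 0"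
    and iso: "\<And>a m l. a \<in> I \<Longrightarrow> m < CARD('n) - s \<Longrightarrow> l < CARD('n) - s \<Longrightarrow> bff (\<lambda>i j. M a (Upair i j)) (u m) (u l) = 0"
    and span: "vec.span ((\<lambda>a. \<chi> p. M a p) ` I) = chart_plane I y"
  shows "chart_plane I y \<in> compression_locus r k s"
proof -
  let ?N = "CARD('n) - s"
  define v where "v m = (\<chi> l. u m l)" for m
  define U where "U = vec.span (v ` {..<?N})"
  have U: "vec.subspace U" unfolding U_def by (rule vec.subspace_span)
  have vU: "v m \<in> U" if "m < ?N" for m unfolding U_def using that by (intro vec.span_base) simp
  have "vec.dim U \<le> card (v ` {..<?N})" unfolding U_def by (rule vec.dim_le_card) simp_all
  also have "\<dots> \<le> ?N" using card_image_le[of "{..<?N}" v] by simp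
  finally have le: "vec.dim U \<le> ?N" .
  have "\<not> vec.dim U < ?N"
  proof
    assume "vec.dim U < ?N"
    with vU have "\<exists>c. (\<exists>j<?N. c j \<noteq> 0) \<and> (\<Sum>j<?N. c j *s v j) = 0" by (rule dependent_family)
    then obtain c where c: "\<exists>j<?N. c j \<noteq> 0" "(\<Sum>j<?N. c j *s v j) = 0"
      by - (erule exE, erule conjE, rule that)
    have "c m = 0" if m: "m < ?N" for m
    proof -
      have "0 = (\<Sum>j<?N. c j *s v j) $ nu s m" by (simp only: c(2) zero_index)
      also have "\<dots> = (\<Sum>j<?N. if j = m then c m * d else 0)"
        unfolding sum_component by (rule sum.cong) (use u m in \<open>auto simp: v_def\<close>)
      also have "\<dots> = c m * d" using m by simp
      finally show ?thesis using d by simp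
    qed
    then show False using c(1) by blast
  qed
  then have dim: "vec.dim U = ?N" using le by linarith
  let ?Z = "{z :: 'k ^ 'n uprod. \<forall>x\<in>U. \<forall>w\<in>U. bf (\<lambda>i j. z $ Upair i j) x w = 0}"
  have "vec.subspace ?Z"
    by (rule vec.subspaceI) (auto simp: bf_def distrib_left distrib_right sum.distrib mult.left_commute[of _ "_ :: 'k"]
        mult.assoc sum_distrib_left[symmetric])
  moreover have "(\<chi> p. M a p) \<in> ?Z" if a: "a \<in> I" for a
  proof (intro CollectI ballI)
    fix x w assume xw: "x \<in> U" "w \<in> U"
    show "bf (\<lambda>i j. (\<chi> p. M a p) $ Upair i j) x w = 0"
    proof (rule bf_span_zero[of "v ` {..<?N}"])
      fix x w assume "x \<in> v ` {..<?N}" "w \<in> v ` {..<?N}"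
      then obtain m l where ml: "m < ?N" "l < ?N" "x = v m" "w = v l" by auto
      show "bf (\<lambda>i j. (\<chi> p. M a p) $ Upair i j) x w = 0"
        using iso[OF a ml(1,2)] by (simp add: ml(3,4) v_def bf_def bff_def)
    qed (use xw in \<open>simp_all add: U_def\<close>)
  qed
  ultimately have sub: "chart_plane I y \<subseteq> ?Z"
    unfolding span[symmetric] by (intro vec.span_minimal) auto
  have codim: "(CARD('n) - vec.dim U) + (CARD('n) - vec.dim U) < r" using dim r by simp
  have "minors_vanish r (chart_plane I y)"
    unfolding minors_vanish_def
  proof (intro ballI allI)
    fix z and \<rho> \<sigma> :: "nat \<Rightarrow> 'n" assume "z \<in> chart_plane I y"
    then have zz: "bf (\<lambda>i j. z $ Upair i j) x w = 0" if "x \<in> U" "w \<in> U" for x w using sub that by blast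
    show "dt r (\<lambda>i j. z $ Upair (\<rho> i) (\<sigma> j)) = 0"
      by (rule compression_minors_zero[of U U "\<lambda>i j. z $ Upair i j", OF U U zz codim])
  qed
  then have "chart_plane I y \<in> scheme_points (k + 1) (sd_fano r)"
    unfolding scheme_points_sd_fano[OF inf] using chart_plane_in_grassmannian[OF I] by blast
  moreover have "nested_compression_space r s (chart_plane I y)"
    unfolding nested_compression_space_def
  proof (intro conjI exI[of _ U])
    show "vec.dim U = s + 1 + CARD('n) - r" using dim r by simp
    show "\<forall>x\<in>U. \<forall>w\<in>U. \<forall>z\<in>chart_plane I y. scalar_product x (sym_matrix z *v w) = 0"
      unfolding scalar_product_sym_matrix using sub by blast
  qed (use U dim subspace_chart_plane in auto)
  ultimately show ?thesis by (simp add: compression_locus_def)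
qed

text \<open>The universal rows, scaled by the square of \<open>\<omega>\<close>, are corrected by
  elements of \<open>J\<close> to rows \<open>M\<close> that are exactly isotropic on the frame.
  Wherever these span a plane of the chart it belongs to the locus, so a function vanishing on the
  locus pulls back to the zero polynomial. Modulo \<open>J\<close> the correction disappears and a
  multiple of the function remains.\<close>

lemma isotropic_frame_van:
  fixes u :: "nat \<Rightarrow> 'n::finite \<Rightarrow> ('n uprod \<times> 'n uprod, 'k::field) mpoly"
  assumes inf: "infinite (UNIV :: 'k set)" and r: "r = 2 * s + 1" "r \<le> CARD('n)" and I: "card I = k + 1"
    and u: "\<And>m l. m < CARD('n) - s \<Longrightarrow> l < CARD('n) - s \<Longrightarrow> u m (nu s l) = (if l = m then \<omega> else 0)"
    and J: "is_ideal J"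
    and iso: "\<And>a m l. a \<in> I \<Longrightarrow> m < CARD('n) - s \<Longrightarrow> l < CARD('n) - s \<Longrightarrow>
      bff (\<lambda>i j. chart_entry I poly_var a (Upair i j)) (u m) (u l) \<in> J"
    and f: "f \<in> van (compression_locus r k s) I"
  shows "\<exists>j. \<omega> * tdet (complete_rows I (\<lambda>a p. \<omega>\<^sup>2 * chart_entry I poly_var a p)) ^ j * ret I f \<in> J"
proof -
  let ?N = "CARD('n) - s" and ?C = "compression_locus r k s :: ('k ^ 'n uprod) set set"
  have s2: "2 * s < CARD('n)" using r by simp
  have idl: "(\<lambda>c :: 'k. c) = id" by (simp add: fun_eq_iff)
  define A where "A a i j = (chart_entry I poly_var a (Upair i j) :: ('n uprod \<times> 'n uprod, 'k) mpoly)" for a i j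
  define D where "D a m l = bff (A a) (u m) (u l)" for a m l
  \<comment> \<open>A form supported on the coordinates \<open>nu\<close>, with the frame values as
    entries. On the frame it takes \<open>\<omega>\<^sup>2\<close> times these values, which is why
    the rows are scaled.\<close>
  define B where "B a i j = (\<Sum>m<?N. \<Sum>l<?N. (if i = nu s m then 1 else 0) * (if j = nu s l then 1 else 0) * D a m l)" for a and i j :: 'n
  define R where "R a p = \<omega>\<^sup>2 * (chart_entry I poly_var a p :: ('n uprod \<times> 'n uprod, 'k) mpoly)" for a p
  define M where "M a p = R a p - upfun (B a) p" for a p
  have Asym: "A a i j = A a j i" for a i j unfolding A_def by (rule arg_cong[of _ _ "chart_entry I poly_var a"]) simp
  have Dsym: "D a m l = D a l m" for a m l unfolding D_def by (rule bff_commute[OF Asym])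
  have Bsym: "B a i j = B a j i" for a i j
    unfolding B_def by (subst sum.swap) (simp only: Dsym[of a] mult_ac)
  have MU: "M a (Upair i j) = \<omega>\<^sup>2 * A a i j - B a i j" for a i j
    unfolding M_def R_def A_def upfun_Upair[of "B a", OF Bsym] ..
  have Bnu: "B a (nu s m) (nu s l) = D a m l" if "m < ?N" "l < ?N" for a m l
  proof -
    have "B a (nu s m) (nu s l) = (\<Sum>m'<?N. \<Sum>l'<?N. if l' = l then (if m' = m then D a m l else 0) else 0)"
    proof -
      have "(if nu s m = (nu s m' :: 'n) then 1 else 0) * (if nu s l = (nu s l' :: 'n) then 1 else 0) * D a m' l' =
          (if l' = l then (if m' = m then D a m l else 0) else 0)" if "m' < ?N" "l' < ?N" for m' l'
        using nu_inj[OF s2 \<open>m < ?N\<close> \<open>m' < ?N\<close>] nu_inj[OF s2 \<open>l < ?N\<close> \<open>l' < ?N\<close>] by simp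
      then show ?thesis unfolding B_def by (intro sum.cong refl) simp
    qed
    then show ?thesis using that by simp
  qed
  have BJ: "B a i j \<in> J" if "a \<in> I" for a i j
    unfolding B_def D_def A_def by (intro ideal_sum[OF J] ideal_mult[OF J] iso[OF that]) auto
  have e: "(\<Sum>i\<in>UNIV. u m i * (if i = nu s m' then 1 else 0)) = (if m' = m then \<omega> else 0)" if "m < ?N" "m' < ?N" for m m'
    using u[OF that] by (simp add: if_distrib[of "\<lambda>x. _ * x"] cong: if_cong)
  have uBu: "bff (B a) (u m) (u l) = \<omega>\<^sup>2 * D a m l" if ml: "m < ?N" "l < ?N" for a m l
  proof -
    have "bff (B a) (u m) (u l) = (\<Sum>m'<?N. \<Sum>l'<?N. (\<Sum>i\<in>UNIV. u m i * (if i = nu s m' then 1 else 0)) *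
        (\<Sum>j\<in>UNIV. u l j * (if j = nu s l' then 1 else 0)) * D a m' l')"
    proof -
      have "bff (B a) (u m) (u l) = (\<Sum>i\<in>UNIV. \<Sum>j\<in>UNIV. \<Sum>m'<?N. \<Sum>l'<?N. (u m i * (if i = nu s m' then 1 else 0)) *
        (u l j * (if j = nu s l' then 1 else 0)) * D a m' l')"
        unfolding bff_def B_def sum_distrib_left sum_distrib_right by (simp only: mult_ac)
      also have "\<dots> = (\<Sum>m'<?N. \<Sum>l'<?N. \<Sum>i\<in>UNIV. \<Sum>j\<in>UNIV. (u m i * (if i = nu s m' then 1 else 0)) *
        (u l j * (if j = nu s l' then 1 else 0)) * D a m' l')"
        by (simp only: sum.swap[where A = UNIV and B = "{..<?N}"])
      moreover have "(\<Sum>i\<in>S. f i) * (\<Sum>j\<in>S. g j) * c = (\<Sum>i\<in>S. \<Sum>j\<in>S. f i * g j * c)"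
        for f g :: "'n \<Rightarrow> ('n uprod \<times> 'n uprod, 'k) mpoly" and S c
        unfolding sum_product by (simp only: sum_distrib_right)
      ultimately show ?thesis by (simp only:)
    qed
    also have "\<dots> = (\<Sum>m'<?N. \<Sum>l'<?N. if l' = l then (if m' = m then \<omega> * \<omega> * D a m l else 0) else 0)"
      by (intro sum.cong refl) (use e ml in auto)
    finally show ?thesis using ml by (simp add: power2_eq_square)
  qed
  have Miso: "bff (\<lambda>i j. M a (Upair i j)) (u m) (u l) = 0" if ml: "m < ?N" "l < ?N" for a m l
  proof -
    have "bff (\<lambda>i j. M a (Upair i j)) (u m) (u l) = \<omega>\<^sup>2 * bff (A a) (u m) (u l) - bff (B a) (u m) (u l)"
      unfolding MU by (simp add: bff_def left_diff_distrib right_diff_distrib sum_subtractf sum_distrib_left mult_ac)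
    then show ?thesis unfolding uBu[OF ml] D_def by simp
  qed
  define g where "g = ret I f"
  have g0: "evl y g = 0" if "chart_plane I y \<in> ?C" for y
    using f that unfolding van_def g_def by blast
  \<comment> \<open>The factor \<open>\<omega>\<close> covers the points where the frame
    degenerates, the extra factor inside \<open>chart_hom\<close> those where the corrected rows
    leave the chart.\<close>
  have "evl x (\<omega> * chart_hom I poly_const g M) = 0" for x
  proof (cases "evl x \<omega> = 0")
    case False
    define Mx where "Mx a p = evl x (M a p)" for a p
    have ch: "evl x (chart_hom I poly_const g M) = chart_hom I id g Mx"
      by (simp only: chart_hom_hom[OF evl.comm_ring_hom_axioms] evl_const Mx_def[abs_def] idl)
    have "chart_hom I id g Mx = 0"
    proof (cases "tdet (complete_rows I Mx) = 0")
      case True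
      then show ?thesis unfolding chart_hom_def by simp
    next
      case nz: False
      have "chart_plane I (\<lambda>(a, p). - tcof (complete_rows I Mx) p a / tdet (complete_rows I Mx)) \<in> ?C"
      proof (rule isotropic_plane_in_locus[OF inf r I _ False _ span_rows_chart[OF nz], where u = "\<lambda>m l. evl x (u m l)"])
        show "evl x (u m (nu s l)) = (if l = m then evl x \<omega> else 0)" if "m < ?N" "l < ?N" for m l
          using u[OF that] by simp
        show "bff (\<lambda>i j. Mx a (Upair i j)) (\<lambda>l. evl x (u m l)) (\<lambda>i. evl x (u l i)) = 0" if "m < ?N" "l < ?N" for a m l
          unfolding Mx_def bff_hom[OF evl.comm_ring_hom_axioms, symmetric] Miso[OF that] by simp
      qed
      from g0[OF this] show ?thesis unfolding chart_hom_field[OF nz] by simp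
    qed
    then show ?thesis by (simp add: evl.hom_mult ch)
  qed (simp add: evl.hom_mult)
  then have zero: "\<omega> * chart_hom I poly_const g M = 0" by (rule mpoly_all_zero[OF inf])
  let ?\<delta> = "tdet (complete_rows I R)" and ?K = "Suc (total_deg g)"
  have "chart_hom I poly_const g R - chart_hom I poly_const g M \<in> J"
  proof (rule chart_hom_ideal_cong[OF J])
    fix a p assume "a \<in> I"
    then show "R a p - M a p \<in> J" using BJ by (simp add: M_def upfun_def)
  qed
  then have "\<omega> * (chart_hom I poly_const g R - chart_hom I poly_const g M) \<in> J" by (rule ideal_mult[OF J])
  then have inJ: "\<omega> * chart_hom I poly_const g R \<in> J" by (simp only: right_diff_distrib zero diff_zero)
  \<comment> \<open>The rows \<open>R\<close> span the original plane, so \<open>chart_hom\<close>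
    returns \<open>g\<close> up to the cleared denominators. It is enough to compare values, as the
    field is infinite.\<close>
  have "\<omega> * chart_hom I poly_const g R = \<omega> * ?\<delta> ^ ?K * g"
  proof (rule mpoly_eqI[OF inf])
    fix x
    define Rx where "Rx a p = evl x (R a p)" for a p
    have ch: "evl x (chart_hom I poly_const g R) = chart_hom I id g Rx"
      by (simp only: chart_hom_hom[OF evl.comm_ring_hom_axioms] evl_const Rx_def[abs_def] idl)
    have de: "evl x ?\<delta> = tdet (complete_rows I Rx)"
      unfolding tdet_hom[OF evl.comm_ring_hom_axioms] complete_rows_def Rx_def by (simp add: if_distrib[of "evl x"] cong: if_cong)
    have "evl x \<omega> * chart_hom I id g Rx = evl x \<omega> * tdet (complete_rows I Rx) ^ ?K * evl x g"
    proof (cases "evl x \<omega> = 0 \<or> tdet (complete_rows I Rx) = 0")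
      case True
      then show ?thesis unfolding chart_hom_def by auto
    next
      case False
      then have nz: "tdet (complete_rows I Rx) \<noteq> 0" and w: "evl x \<omega> \<noteq> 0" by auto
      let ?y = "\<lambda>(a, p). - tcof (complete_rows I Rx) p a / tdet (complete_rows I Rx)"
      have Rx: "(\<chi> p. Rx a p) = (evl x \<omega>)\<^sup>2 *s rowv I x a" for a
      proof -
        have "evl x (chart_entry I poly_var a p) = chart_entry I x a p" for p by (simp add: chart_entry_def)
        then show ?thesis unfolding Finite_Cartesian_Product.vec_eq_iff
          by (simp add: Rx_def R_def rowv_nth evl.hom_mult evl.hom_power)
      qed
      have "rowv I ?y a \<in> chart_plane I x" if "a \<in> I" for a
      proof -
        have "vec.span ((\<lambda>a. \<chi> p. Rx a p) ` I) \<subseteq> chart_plane I x"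
          unfolding Rx by (rule vec.span_minimal) (auto intro!: vec.subspace_scale[OF subspace_chart_plane] rowv_in_chart_plane simp: subspace_chart_plane)
        then show ?thesis using rowv_in_chart_plane[OF that, of ?y] unfolding span_rows_chart[OF nz] by blast
      qed
      moreover have "rowv I x a \<in> chart_plane I ?y" if "a \<in> I" for a
      proof -
        have "(evl x \<omega>)\<^sup>2 *s rowv I x a \<in> chart_plane I ?y"
          unfolding span_rows_chart[OF nz, symmetric] Rx[symmetric] using that by (intro vec.span_base) simp
        then have "inverse ((evl x \<omega>)\<^sup>2) *s ((evl x \<omega>)\<^sup>2 *s rowv I x a) \<in> chart_plane I ?y"
          by (rule vec.subspace_scale[OF subspace_chart_plane])
        then show ?thesis using w by simp
      qed
      ultimately have "chart_plane I ?y = chart_plane I x"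
        unfolding chart_plane_rowv by (intro equalityI vec.span_minimal vec.subspace_span image_subsetI)
      then have "?y (a, p) = x (a, p)" if "a \<in> I" "p \<notin> I" for a p using that by (rule chart_plane_inj)
      then have "evl ?y g = evl x g"
        unfolding g_def by (intro evl_cong[OF vars_in_ret]) auto
      then show ?thesis unfolding chart_hom_field[OF nz] by simp
    qed
    then show "evl x (\<omega> * chart_hom I poly_const g R) = evl x (\<omega> * ?\<delta> ^ ?K * g)"
      by (simp only: evl.hom_mult evl.hom_power ch de)
  qed
  then show ?thesis using inJ unfolding g_def R_def[abs_def] by (intro exI[of _ ?K]) (simp only: g_def R_def[abs_def])
qed

section \<open>The frame and its nondegeneracy conditions\<close>

definition frame :: "nat \<Rightarrow> nat \<Rightarrow> (nat \<Rightarrow> 'b) \<Rightarrow> ('n::finite \<Rightarrow> 'n \<Rightarrow> 'b::comm_ring_1) \<Rightarrow> ('n \<Rightarrow> 'n \<Rightarrow> 'b) \<Rightarrow> nat \<Rightarrow> 'n \<Rightarrow> 'b" where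
  "frame s r \<xi> A B m = kv r (pivot s m) (pencil (\<xi> m) A B)"

definition frame_det :: "nat \<Rightarrow> nat \<Rightarrow> (nat \<Rightarrow> 'b) \<Rightarrow> ('n::finite \<Rightarrow> 'n \<Rightarrow> 'b::comm_ring_1) \<Rightarrow> ('n \<Rightarrow> 'n \<Rightarrow> 'b) \<Rightarrow> 'b" where
  "frame_det s r \<xi> A B = dt (CARD('n) - s) (\<lambda>i j. frame s r \<xi> A B i (nu s j))"

text \<open>The adjugate of the \<open>nu\<close>-block of the frame applied to the frame: the block
  becomes the determinant times the identity, without any division.\<close>

definition nframe :: "nat \<Rightarrow> nat \<Rightarrow> (nat \<Rightarrow> 'b) \<Rightarrow> ('n::finite \<Rightarrow> 'n \<Rightarrow> 'b::comm_ring_1) \<Rightarrow> ('n \<Rightarrow> 'n \<Rightarrow> 'b) \<Rightarrow> nat \<Rightarrow> 'n \<Rightarrow> 'b" where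
  "nframe s r \<xi> A B m l = (\<Sum>i<CARD('n) - s. cf (CARD('n) - s) (\<lambda>i j. frame s r \<xi> A B i (nu s j)) i m * frame s r \<xi> A B i l)"

definition kv3 :: "nat \<Rightarrow> nat \<Rightarrow> 'b \<Rightarrow> 'b \<Rightarrow> ('n::finite \<Rightarrow> 'n \<Rightarrow> 'b::comm_ring_1) \<Rightarrow> ('n \<Rightarrow> 'n \<Rightarrow> 'b) \<Rightarrow> ('n \<Rightarrow> 'n \<Rightarrow> 'b) \<Rightarrow> nat \<Rightarrow> 'n \<Rightarrow> 'b" where
  "kv3 s r c y A B C m = kv r (pivot s m) (pencil y (pencil c A B) C)"

text \<open>Where this is nonzero, the remainder of a kernel vector can be solved for from its
  pairings with the frame vectors 1..s. Starting at index 1 makes the matrix of the special members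
  triangular, with diagonal entries that are nonzero for all \<open>c\<close> and
  \<open>y\<close>.\<close>

definition pairing_det :: "nat \<Rightarrow> nat \<Rightarrow> (nat \<Rightarrow> 'b) \<Rightarrow> 'b \<Rightarrow> 'b \<Rightarrow> ('n::finite \<Rightarrow> 'n \<Rightarrow> 'b::comm_ring_1) \<Rightarrow> ('n \<Rightarrow> 'n \<Rightarrow> 'b) \<Rightarrow> ('n \<Rightarrow> 'n \<Rightarrow> 'b) \<Rightarrow> 'b" where
  "pairing_det s r \<xi> c y A B C =
    dt s (\<lambda>i a. bff (pencil y (pencil c A B) C) (nframe s r \<xi> A B (Suc i)) (\<lambda>l. if l = vp s a then 1 else 0))"

text \<open>With the flag set, the functional is the difference of the entries \<open>(a, b)\<close> and \<open>(b, a)\<close>;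
  it allows symmetric forms to be treated as arbitrary families indexed by pairs.\<close>

definition form_coeff :: "('k \<Rightarrow> 'b) \<Rightarrow> nat \<Rightarrow> nat \<Rightarrow> bool \<times> 'k \<times> 'k \<times> nat \<times> nat \<Rightarrow> ('n::finite \<Rightarrow> 'n \<Rightarrow> 'b::comm_ring_1) \<Rightarrow> ('n \<Rightarrow> 'n \<Rightarrow> 'b) \<Rightarrow> ('n \<Rightarrow> 'n \<Rightarrow> 'b) \<Rightarrow> nat \<times> nat \<Rightarrow> 'b" where
  "form_coeff h s r q A B C p = (case q of (flag, c, y, a, b) \<Rightarrow>
     if flag then (if p = (a, b) then 1 else 0) - (if p = (b, a) then 1 else 0)
     else kv3 s r (h c) (h y) A B C a (nu s (fst p)) * kv3 s r (h c) (h y) A B C b (nu s (snd p)))"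

definition form_guard :: "('k \<Rightarrow> 'b) \<Rightarrow> nat \<Rightarrow> nat \<Rightarrow> (nat \<Rightarrow> 'k) \<Rightarrow> bool \<times> 'k \<times> 'k \<times> nat \<times> nat \<Rightarrow> ('n::finite \<Rightarrow> 'n \<Rightarrow> 'b::comm_ring_1) \<Rightarrow> ('n \<Rightarrow> 'n \<Rightarrow> 'b) \<Rightarrow> ('n \<Rightarrow> 'n \<Rightarrow> 'b) \<Rightarrow> 'b" where
  "form_guard h s r \<xi> q A B C = (case q of (flag, c, y, a, b) \<Rightarrow> pairing_det s r (\<lambda>i. h (\<xi> i)) (h c) (h y) A B C)"

text \<open>All open conditions of the odd case in one polynomial, as
  \<open>generic_condition\<close> expects. The map \<open>h\<close> embeds the constants, so that
  the same expression applies to actual matrices, to the universal plane and to a line of members in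
  it.\<close>

definition form_test :: "('k \<Rightarrow> 'b) \<Rightarrow> nat \<Rightarrow> nat \<Rightarrow> (nat \<Rightarrow> 'k) \<Rightarrow> nat \<Rightarrow> (nat \<Rightarrow> bool \<times> 'k \<times> 'k \<times> nat \<times> nat) \<Rightarrow> (nat \<Rightarrow> nat \<times> nat) \<Rightarrow> ('n::finite \<Rightarrow> 'n \<Rightarrow> 'b::comm_ring_1) \<Rightarrow> ('n \<Rightarrow> 'n \<Rightarrow> 'b) \<Rightarrow> ('n \<Rightarrow> 'n \<Rightarrow> 'b) \<Rightarrow> 'b" where
  "form_test h s r \<xi> L q pr A B C = frame_det s r (\<lambda>i. h (\<xi> i)) A B *
     dt L (\<lambda>i j. form_coeff h s r (q i) A B C (pr j)) * (\<Prod>i<L. form_guard h s r \<xi> (q i) A B C)"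

lemma pencil_hom_fun:
  assumes "comm_ring_hom h"
  shows "(\<lambda>a b. h (pencil c A B a b)) = pencil (h c) (\<lambda>a b. h (A a b)) (\<lambda>a b. h (B a b))"
  by (intro ext pencil_hom assms)

lemma frame_hom:
  assumes h: "comm_ring_hom h" "0 < r"
  shows "h (frame s r \<xi> A B m l) = frame s r (\<lambda>i. h (\<xi> i)) (\<lambda>a b. h (A a b)) (\<lambda>a b. h (B a b)) m l"
  unfolding frame_def by (simp only: kv_hom[OF h] pencil_hom_fun[OF h(1)])

lemma frame_det_hom:
  assumes h: "comm_ring_hom h" "0 < r"
  shows "h (frame_det s r \<xi> A B) = frame_det s r (\<lambda>i. h (\<xi> i)) (\<lambda>a b. h (A a b)) (\<lambda>a b. h (B a b))"
  unfolding frame_det_def by (simp only: dt_hom[OF h(1)] frame_hom[OF h])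

lemma nframe_hom:
  assumes h: "comm_ring_hom h" "0 < r" and m: "m < CARD('n) - s"
  shows "h (nframe s r \<xi> A B m (l :: 'n::finite)) = nframe s r (\<lambda>i. h (\<xi> i)) (\<lambda>a b. h (A a b)) (\<lambda>a b. h (B a b)) m l"
proof -
  interpret comm_ring_hom h by fact
  have "h (cf (CARD('n) - s) f i m) = cf (CARD('n) - s) (\<lambda>i j. h (f i j)) i m" if "i < CARD('n) - s" for f i
    by (rule cf_hom[OF h(1) that m])
  then have "h (cf (CARD('n) - s) (\<lambda>i j. frame s r \<xi> A B i (nu s j)) i m * frame s r \<xi> A B i l) =
      cf (CARD('n) - s) (\<lambda>i j. frame s r (\<lambda>i. h (\<xi> i)) (\<lambda>a b. h (A a b)) (\<lambda>a b. h (B a b)) i (nu s j)) i m *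
      frame s r (\<lambda>i. h (\<xi> i)) (\<lambda>a b. h (A a b)) (\<lambda>a b. h (B a b)) i l" if "i < CARD('n) - s" for i
    using that by (simp only: hom_mult frame_hom[OF h])
  then show ?thesis unfolding nframe_def hom_sum by (intro sum.cong refl) (simp only: lessThan_iff)
qed

lemma kv3_hom:
  assumes h: "comm_ring_hom h" "0 < r"
  shows "h (kv3 s r c y A B C m l) = kv3 s r (h c) (h y) (\<lambda>a b. h (A a b)) (\<lambda>a b. h (B a b)) (\<lambda>a b. h (C a b)) m l"
  unfolding kv3_def by (simp only: kv_hom[OF h] pencil_hom_fun[OF h(1)])

lemma pairing_det_hom:
  assumes h: "comm_ring_hom h" "0 < r" and s: "2 * s < CARD('n)"
  shows "h (pairing_det s r \<xi> c y A B C) = pairing_det s r (\<lambda>i. h (\<xi> i)) (h c) (h y) (\<lambda>a b. h (A a b)) (\<lambda>a b. h (B a b)) (\<lambda>a b. h ((C :: 'n::finite \<Rightarrow> 'n \<Rightarrow> 'b::comm_ring_1) a b))"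
proof -
  interpret comm_ring_hom h by fact
  have ind: "(\<lambda>l. h (if l = vp s a then 1 else 0)) = (\<lambda>l :: 'n. if l = vp s a then 1 else 0)" for a by auto
  have nf: "(\<lambda>l. h (nframe s r \<xi> A B (Suc i) l)) = nframe s r (\<lambda>i. h (\<xi> i)) (\<lambda>a b. h (A a b)) (\<lambda>a b. h (B a b)) (Suc i)" if "i < s" for i
    by (intro ext nframe_hom[OF h]) (use that s in linarith)
  have ent: "h (bff (pencil y (pencil c A B) C) (nframe s r \<xi> A B (Suc i)) (\<lambda>l. if l = vp s a then 1 else 0)) =
      bff (pencil (h y) (pencil (h c) (\<lambda>a b. h (A a b)) (\<lambda>a b. h (B a b))) (\<lambda>a b. h (C a b)))
        (nframe s r (\<lambda>i. h (\<xi> i)) (\<lambda>a b. h (A a b)) (\<lambda>a b. h (B a b)) (Suc i)) (\<lambda>l. if l = vp s a then 1 else 0)" if "i < s" for i a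
    by (subst bff_hom[OF h(1)], subst pencil_hom_fun[OF h(1)], subst pencil_hom_fun[OF h(1)], subst nf[OF that], subst ind) (rule refl)
  show ?thesis unfolding pairing_det_def
    by (subst dt_hom[OF h(1)], rule dt_cong, erule ent)
qed

lemma form_test_hom:
  fixes A B C :: "'n::finite \<Rightarrow> 'n \<Rightarrow> 'b::comm_ring_1"
  assumes h: "comm_ring_hom h" "0 < r" and s: "2 * s < CARD('n)"
  shows "h (form_test g s r \<xi> L q pr A B C) = form_test (\<lambda>c. h (g c)) s r \<xi> L q pr (\<lambda>a b. h (A a b)) (\<lambda>a b. h (B a b)) (\<lambda>a b. h (C a b))"
proof -
  interpret comm_ring_hom h by fact
  have c: "h (form_coeff g s r q A B C p) = form_coeff (\<lambda>c. h (g c)) s r q (\<lambda>a b. h (A a b)) (\<lambda>a b. h (B a b)) (\<lambda>a b. h (C a b)) p" for q p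
  proof (cases q)
    case (fields flag c y a b)
    show ?thesis
    proof (cases flag)
      case True
      have "h (if P then 1 else 0) = (if P then 1 else 0)" for P by simp
      then show ?thesis by (simp only: form_coeff_def fields prod.case True if_True hom_minus)
    next
      case False
      then show ?thesis by (simp only: form_coeff_def fields prod.case if_False hom_mult kv3_hom[OF h])
    qed
  qed
  have u: "h (form_guard g s r \<xi> q A B C) = form_guard (\<lambda>c. h (g c)) s r \<xi> q (\<lambda>a b. h (A a b)) (\<lambda>a b. h (B a b)) (\<lambda>a b. h (C a b))" for q
    by (cases q) (simp only: form_guard_def prod.case pairing_det_hom[OF h s])
  show ?thesis unfolding form_test_def hom_mult hom_prod dt_hom[OF h(1)] frame_det_hom[OF h] c u ..
qed

lemma nframe_nu:
  assumes "m < CARD('n) - s" "l < CARD('n) - s"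
  shows "nframe s r \<xi> A B m (nu s l :: 'n::finite) = (if l = m then frame_det s r \<xi> A B else 0)"
  using adj_col[OF assms, of "\<lambda>i j. frame s r \<xi> A B i (nu s j)"]
  by (simp add: nframe_def frame_det_def mult.commute)

section \<open>The special matrices\<close>

lemma kv_special:
  fixes l :: "nat \<Rightarrow> 'k::field"
  assumes r: "r = 2 * s + 1" "r \<le> CARD('n)"
  shows "\<exists>\<delta>. \<delta> \<noteq> 0 \<and> (\<forall>m j. m < CARD('n) - s \<longrightarrow> j < CARD('n) - s \<longrightarrow>
      kv r (pivot s m) (spm s r l (-1) (\<lambda>_. 0) :: 'n::finite \<Rightarrow> 'n \<Rightarrow> 'k) (nu s j) =
        (if m \<le> s then (if j \<le> s then \<delta> * (\<Prod>a<j. l a) else 0) else (if j = m then \<delta> else 0))) \<and>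
    (\<forall>m a. m < CARD('n) - s \<longrightarrow> a < s \<longrightarrow> kv r (pivot s m) (spm s r l (-1) (\<lambda>_. 0) :: 'n \<Rightarrow> 'n \<Rightarrow> 'k) (vp s a) = 0)"
proof -
  let ?A = "spm s r l (-1) (\<lambda>_. 0) :: 'n \<Rightarrow> 'n \<Rightarrow> 'k"
  have r2: "2 * s < r" using r by simp
  have "\<exists>\<delta>. \<delta> \<noteq> 0 \<and> (\<forall>i<CARD('n). kv r (enum_type 0) ?A (enum_type i) = (if i \<le> s then \<delta> * (\<Prod>a<i. l a) else 0)) \<and>
      (\<forall>m. r \<le> m \<and> m < CARD('n) \<longrightarrow> (\<forall>i<CARD('n). kv r (enum_type m) ?A (enum_type i) = (if i = m then \<delta> else 0)))"
    by (rule kv_spm[OF r2 r(2)]) (use r in linarith)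
  then obtain \<delta> where \<delta>: "\<delta> \<noteq> 0"
    and k0: "\<forall>i<CARD('n). kv r (enum_type 0) ?A (enum_type i) = (if i \<le> s then \<delta> * (\<Prod>a<i. l a) else 0)"
    and k1: "\<forall>m. r \<le> m \<and> m < CARD('n) \<longrightarrow> (\<forall>i<CARD('n). kv r (enum_type m) ?A (enum_type i) = (if i = m then \<delta> else 0))"
    by - (erule exE, elim conjE, rule that)
  have n: "2 * s < CARD('n)" using r by simp
  show ?thesis
  proof (intro exI[of _ \<delta>] conjI allI impI)
    show "\<delta> \<noteq> 0" by (rule \<delta>)
    fix m assume m: "m < CARD('n) - s"
    show "kv r (pivot s m) ?A (nu s j) = (if m \<le> s then (if j \<le> s then \<delta> * (\<Prod>a<j. l a) else 0) else (if j = m then \<delta> else 0))"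
      if j: "j < CARD('n) - s" for j
    proof -
      define i where "i = (if j \<le> s then j else j + s)"
      have i: "i < CARD('n)" "i \<le> s \<longleftrightarrow> j \<le> s" "j \<le> s \<Longrightarrow> i = j" using j n by (auto simp: i_def less_diff_conv)
      show ?thesis
      proof (cases "m \<le> s")
        case True
        then show ?thesis using k0[rule_format, OF i(1)] i by (simp add: pivot_def nu_def i_def[symmetric])
      next
        case False
        then have "r \<le> m + s \<and> m + s < CARD('n)" "i = m + s \<longleftrightarrow> j = m" using m r by (auto simp: i_def)
        then show ?thesis using k1[rule_format, OF _ i(1), of "m + s"] False by (simp add: pivot_def nu_def i_def[symmetric])
      qed
    qed
    show "kv r (pivot s m) ?A (vp s a) = 0" if a: "a < s" for a
    proof -
      have i: "s + 1 + a < CARD('n)" using a n by linarith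
      show ?thesis
      proof (cases "m \<le> s")
        case True
        then show ?thesis using k0[rule_format, OF i] by (simp add: pivot_def vp_def)
      next
        case False
        then have "r \<le> m + s \<and> m + s < CARD('n)" "s + 1 + a \<noteq> m + s" using m r a by auto
        then show ?thesis using k1[rule_format, OF _ i, of "m + s"] False by (simp add: pivot_def vp_def)
      qed
    qed
  qed
qed

text \<open>The first s + 1 frame vectors form a Vandermonde block at the nodes
  \<open>\<xi>\<close>, the others are multiples of unit vectors. No kernel vector here has a
  \<open>vp\<close> coordinate, so normalisation turns the whole frame into multiples of unit
  vectors.\<close>

lemma frame_det_special:
  fixes \<xi> :: "nat \<Rightarrow> 'k::field"
  assumes r: "r = 2 * s + 1" "r \<le> CARD('n)" and \<xi>: "inj \<xi>"
  defines "A \<equiv> spm s r (\<lambda>_. 0) (-1) (\<lambda>_. 0) :: 'n::finite \<Rightarrow> 'n \<Rightarrow> 'k" and "B \<equiv> spm s r (\<lambda>_. 1) 0 (\<lambda>_. 0) :: 'n \<Rightarrow> 'n \<Rightarrow> 'k"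
  shows "frame_det s r \<xi> A B \<noteq> 0"
    "m < CARD('n) - s \<Longrightarrow> nframe s r \<xi> A B m = (\<lambda>l. if l = nu s m then frame_det s r \<xi> A B else 0)"
proof -
  let ?N = "CARD('n) - s"
  have n: "2 * s < CARD('n)" using r by simp
  have pen: "pencil t A B = spm s r (\<lambda>_. t) (-1) (\<lambda>_. 0)" for t
    unfolding A_def B_def pencil_spm by simp
  have "\<forall>i. \<exists>\<delta>. \<delta> \<noteq> 0 \<and> (\<forall>m j. m < ?N \<longrightarrow> j < ?N \<longrightarrow>
      kv r (pivot s m) (pencil (\<xi> i) A B) (nu s j) = (if m \<le> s then (if j \<le> s then \<delta> * (\<Prod>a<j. \<xi> i) else 0) else (if j = m then \<delta> else 0))) \<and>
    (\<forall>m a. m < ?N \<longrightarrow> a < s \<longrightarrow> kv r (pivot s m) (pencil (\<xi> i) A B) (vp s a) = 0)"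
    unfolding pen by (rule allI, rule kv_special[OF r])
  from choice[OF this] obtain \<delta> where "\<forall>i. \<delta> i \<noteq> 0 \<and> (\<forall>m j. m < ?N \<longrightarrow> j < ?N \<longrightarrow>
      kv r (pivot s m) (pencil (\<xi> i) A B) (nu s j) = (if m \<le> s then (if j \<le> s then \<delta> i * (\<Prod>a<j. \<xi> i) else 0) else (if j = m then \<delta> i else 0))) \<and>
    (\<forall>m a. m < ?N \<longrightarrow> a < s \<longrightarrow> kv r (pivot s m) (pencil (\<xi> i) A B) (vp s a) = 0)" by (elim exE)
  note \<delta>k = this[rule_format]
  have \<delta>: "\<delta> i \<noteq> 0" for i by (rule \<delta>k[THEN conjunct1])
  have k: "frame s r \<xi> A B i (nu s j) = (if i \<le> s then (if j \<le> s then \<delta> i * \<xi> i ^ j else 0) else (if j = i then \<delta> i else 0))"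
    if "i < ?N" "j < ?N" for i j
    using \<delta>k[THEN conjunct2, THEN conjunct1, rule_format, OF that, of i] unfolding frame_def by simp
  have kvp: "frame s r \<xi> A B i (vp s a) = 0" if "i < ?N" "a < s" for i a
    using \<delta>k[THEN conjunct2, THEN conjunct2, rule_format, OF that, of i] unfolding frame_def .
  have sN: "s < ?N" using n by linarith
  show "frame_det s r \<xi> A B \<noteq> 0"
  proof
    assume "frame_det s r \<xi> A B = 0"
    then obtain v where v: "\<exists>j<?N. v j \<noteq> 0" "\<forall>i<?N. (\<Sum>j<?N. frame s r \<xi> A B i (nu s j) * v j) = 0"
      unfolding frame_det_def dt_zero_iff by - (erule exE, erule conjE, rule that)
    have hi: "v i = 0" if "s < i" "i < ?N" for i
    proof -
      have "(\<Sum>j<?N. frame s r \<xi> A B i (nu s j) * v j) = (\<Sum>j<?N. if j = i then \<delta> i * v i else 0)"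
        by (rule sum.cong) (use k that in auto)
      then show ?thesis using v(2)[rule_format, OF that(2)] \<delta>[of i] that by simp
    qed
    have "(\<Sum>j<Suc s. \<delta> i * \<xi> i ^ j * v j) = 0" if "i < Suc s" for i
    proof -
      have i: "i < ?N" using that sN by linarith
      have "(\<Sum>j<?N. frame s r \<xi> A B i (nu s j) * v j) = (\<Sum>j<Suc s. frame s r \<xi> A B i (nu s j) * v j)"
        by (rule sum.mono_neutral_right) (use sN hi in auto)
      also have "\<dots> = (\<Sum>j<Suc s. \<delta> i * \<xi> i ^ j * v j)"
        by (rule sum.cong) (use k[OF i] that sN in auto)
      finally show ?thesis using v(2)[rule_format, OF i] by simp
    qed
    moreover have "dt (Suc s) (\<lambda>i j. \<delta> i * \<xi> i ^ j) \<noteq> 0"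
      by (rule vandermonde_nonzero) (use \<xi> \<delta> in \<open>auto intro: inj_on_subset\<close>)
    ultimately have "v j = 0" if "j < Suc s" for j using that unfolding dt_zero_iff by blast
    then have "v j = 0" if "j < ?N" for j using hi[of j] that by (cases "j < Suc s") auto
    then show False using v(1) by blast
  qed
  show "nframe s r \<xi> A B m = (\<lambda>l. if l = nu s m then frame_det s r \<xi> A B else 0)" if m: "m < ?N"
  proof
    fix l :: 'n
    show "nframe s r \<xi> A B m l = (if l = nu s m then frame_det s r \<xi> A B else 0)"
    proof (rule nu_vp_cases[OF n, of l])
      fix j assume j: "j < ?N" "l = nu s j"
      show ?thesis unfolding j(2) nframe_nu[OF m j(1)] nu_inj[OF n j(1) m] ..
    next
      fix a assume a: "a < s" "l = vp s a"
      show ?thesis using nu_vp[OF n m a(1)] by (simp add: a(2) nframe_def kvp[OF _ a(1)])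
    qed
  qed
qed

lemma pairing_det_special:
  fixes \<xi> \<theta> :: "nat \<Rightarrow> 'k::field"
  assumes r: "r = 2 * s + 1" "r \<le> CARD('n)" and \<xi>: "inj \<xi>"
  shows "pairing_det s r \<xi> c y (spm s r (\<lambda>_. 0) (-1) (\<lambda>_. 0) :: 'n::finite \<Rightarrow> 'n \<Rightarrow> 'k) (spm s r (\<lambda>_. 1) 0 (\<lambda>_. 0)) (spm s r \<theta> 0 (\<lambda>_. 0)) \<noteq> 0"
proof
  let ?A = "spm s r (\<lambda>_. 0) (-1) (\<lambda>_. 0) :: 'n::finite \<Rightarrow> 'n \<Rightarrow> 'k" and ?B = "spm s r (\<lambda>_. 1) 0 (\<lambda>_. 0) :: 'n \<Rightarrow> 'n \<Rightarrow> 'k"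
  let ?C = "spm s r \<theta> 0 (\<lambda>_. 0) :: 'n \<Rightarrow> 'n \<Rightarrow> 'k" and ?\<omega> = "frame_det s r \<xi> ?A (?B :: 'n \<Rightarrow> 'n \<Rightarrow> 'k)"
  define l where "l a = c + y * \<theta> a" for a
  have n: "2 * s < CARD('n)" using r by simp
  have pen: "pencil y (pencil c ?A ?B) ?C = spm s r l (-1) (\<lambda>_. 0)" unfolding pencil_spm l_def by simp
  have ent: "bff (pencil y (pencil c ?A ?B) ?C) (nframe s r \<xi> ?A ?B (Suc i)) (\<lambda>l. if l = vp s a then 1 else 0) =
      ?\<omega> * (if a = Suc i then l (Suc i) else if a = i then -1 else 0)" if ia: "i < s" "a < s" for i a
  proof -
    have N: "Suc i < CARD('n) - s" using ia n by linarith
    have lt: "Suc i < CARD('n)" "s + 1 + a < CARD('n)" using ia n by linarith+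
    have "bff M (\<lambda>l. if l = p then d else 0) (\<lambda>l. if l = q then 1 else 0) = d * M p q" for M :: "'n \<Rightarrow> 'n \<Rightarrow> 'k" and p q d
    proof -
      have "bff M (\<lambda>l. if l = p then d else 0) (\<lambda>l. if l = q then 1 else 0) = (\<Sum>i\<in>UNIV. \<Sum>j\<in>UNIV. if j = q then (if i = p then d * M p q else 0) else 0)"
        unfolding bff_def by (intro sum.cong refl) auto
      then show ?thesis by simp
    qed
    then have "bff (pencil y (pencil c ?A ?B) ?C) (nframe s r \<xi> ?A ?B (Suc i)) (\<lambda>l. if l = vp s a then 1 else 0) =
        ?\<omega> * spm s r l (-1) (\<lambda>_. 0) (nu s (Suc i)) (vp s a :: 'n)"
      unfolding frame_det_special(2)[OF r \<xi> N] pen by simp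
    also have "spm s r l (-1) (\<lambda>_. 0) (nu s (Suc i)) (vp s a :: 'n) = sp s r l (-1) (\<lambda>_. 0) (Suc i) (s + 1 + a)"
      unfolding spm_def nu_def vp_def using ia lt by (simp add: type_index_enum)
    also have "\<dots> = (if a = Suc i then l (Suc i) else if a = i then -1 else 0)"
      using ia by (simp add: sp_def sp_up_def)
    finally show ?thesis .
  qed
  assume "pairing_det s r \<xi> c y ?A ?B ?C = 0"
  then obtain v where v: "\<exists>a<s. v a \<noteq> 0" "\<forall>i<s. (\<Sum>a<s. bff (pencil y (pencil c ?A ?B) ?C) (nframe s r \<xi> ?A ?B (Suc i)) (\<lambda>l. if l = vp s a then 1 else 0) * v a) = 0"
    unfolding pairing_det_def dt_zero_iff by - (erule exE, erule conjE, rule that)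
  \<comment> \<open>Up to the common factor the matrix is bidiagonal with -1 on the diagonal, so a
    solution vanishes from the top index down.\<close>
  have step: "v i = (if Suc i < s then l (Suc i) * v (Suc i) else 0)" if i: "i < s" for i
  proof -
    have "0 = (\<Sum>a<s. ?\<omega> * (if a = Suc i then l (Suc i) else if a = i then -1 else 0) * v a)"
      using v(2)[rule_format, OF i] ent[OF i] by simp
    also have "\<dots> = (\<Sum>a<s. (if a = Suc i then ?\<omega> * l (Suc i) * v (Suc i) else 0) - (if a = i then ?\<omega> * v i else 0))"
      by (rule sum.cong) auto
    also have "\<dots> = (if Suc i < s then ?\<omega> * l (Suc i) * v (Suc i) else 0) - ?\<omega> * v i"
      using i by (simp add: sum_subtractf)
    finally have e: "0 = (if Suc i < s then ?\<omega> * l (Suc i) * v (Suc i) else 0) - ?\<omega> * v i" .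
    show ?thesis
    proof (cases "Suc i < s")
      case True
      then have "0 = ?\<omega> * l (Suc i) * v (Suc i) - ?\<omega> * v i" using e by (simp only: if_True)
      then have "?\<omega> * l (Suc i) * v (Suc i) = ?\<omega> * v i" by (rule right_minus_eq[THEN iffD1, OF sym])
      then have "?\<omega> * (l (Suc i) * v (Suc i)) = ?\<omega> * v i" by (simp only: mult.assoc)
      then have "l (Suc i) * v (Suc i) = v i" by (rule mult_left_cancel[OF frame_det_special(1)[OF r \<xi>], THEN iffD1])
      then show ?thesis using True by simp
    next
      case False
      then have "?\<omega> * v i = 0" using e by simp
      then show ?thesis using frame_det_special(1)[OF r \<xi>] False by simp
    qed
  qed
  have "v i = 0" if "i < s" for i
    using that
  proof (induction "s - i" arbitrary: i)
    case (Suc k)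
    have "v (Suc i) = 0" if "Suc i < s" using Suc that by (intro Suc.hyps(1)) auto
    then show ?case using step[OF Suc.prems] by simp
  qed simp
  then show False using v(1) by blast
qed

section \<open>No quadric contains the kernel vectors\<close>

text \<open>The coefficients \<open>d m j\<close> with m + j = e are eliminated by increasing m.
  Once the smaller indices are gone, all terms share a common factor; what is left of the term (m,
  j) and of its mirror image does not vanish at x = -\<theta> m, whereas every term in between keeps
  a factor x + \<theta> m. Evaluation there gives 2 * d m j times a nonzero number. For m = j there
  is a single term.\<close>

lemma quadric_degree_part:
  fixes d :: "nat \<Rightarrow> nat \<Rightarrow> 'k::field" and \<theta> :: "nat \<Rightarrow> 'k"
  assumes inf: "infinite (UNIV :: 'k set)" and two: "(2 :: 'k) \<noteq> 0" and \<theta>: "inj \<theta>" and sym: "\<And>i j. d i j = d j i"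
    and z: "\<And>x. (\<Sum>i\<le>e. d i (e - i) * ((\<Prod>a<i. x + \<theta> a) * (\<Prod>a<e - i. x + \<theta> a))) = 0"
  shows "m \<le> j \<Longrightarrow> m + j = e \<Longrightarrow> d m j = 0"
proof (induction m arbitrary: j rule: less_induct)
  case (less m)
  have je: "j = e - m" "m \<le> e" using less.prems by auto
  define S where "S = {m<..<j}"
  define g where "g i = (\<Prod>a\<in>{m<..<i}. [:\<theta> a, 1:])" for i
  \<comment> \<open>The sum divided by (x + \<theta> a)^2 for all a < m and, unless m = j, by one
    more factor x + \<theta> m. The division is legitimate off finitely many x, which suffices for p
    = 0.\<close>
  define p where "p = (if m = j then [:d m j:] else smult (2 * d m j) (g j) + [:\<theta> m, 1:] * (\<Sum>i\<in>S. smult (d i (e - i)) (g i * g (e - i))))"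
  have low: "d i (e - i) = 0" if "i \<le> e" "i < m \<or> j < i" for i
  proof (cases "i < m")
    case True
    then show ?thesis using less.IH[of i "e - i"] less.prems that by simp
  next
    case False
    then have "d (e - i) i = 0" using less.IH[of "e - i" i] less.prems that by simp
    then show ?thesis by (simp only: sym[of i])
  qed
  have split: "(\<Prod>a<i. x + \<theta> a) = (\<Prod>a<m. x + \<theta> a) * ((x + \<theta> m) * poly (g i) x)" if "m < i" for i x
  proof -
    have "{..<i} = insert m ({..<m} \<union> {m<..<i})" using that by auto
    moreover have "prod f (insert m ({..<m} \<union> {m<..<i})) = prod f {..<m} * (f m * prod f {m<..<i})" for f :: "nat \<Rightarrow> 'k"
    proof -
      have "prod f ({..<m} \<union> {m<..<i}) = prod f {..<m} * prod f {m<..<i}" by (rule prod.union_disjoint) auto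
      then show ?thesis by (simp add: mult_ac)
    qed
    ultimately show ?thesis by (simp add: g_def poly_prod add.commute)
  qed
  have zero: "poly p x = 0" if x: "x \<notin> (\<lambda>a. - \<theta> a) ` {..m}" for x
  proof -
    let ?k = "\<Prod>a<m. x + \<theta> a" and ?F = "\<lambda>i. d i (e - i) * ((\<Prod>a<i. x + \<theta> a) * (\<Prod>a<e - i. x + \<theta> a))"
    have ne: "x + \<theta> a \<noteq> 0" if a: "a \<le> m" for a
    proof
      assume "x + \<theta> a = 0"
      then have "x = - \<theta> a" by (simp add: eq_neg_iff_add_eq_0)
      then show False using x a by blast
    qed
    have nz: "?k \<noteq> 0" "x + \<theta> m \<noteq> 0" using ne by simp_all
    have "0 = (\<Sum>i\<le>e. ?F i)" by (simp only: z)
    also have "\<dots> = (\<Sum>i\<in>{m..j}. ?F i)"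
      by (rule sum.mono_neutral_right) (use less.prems low in auto)
    finally have sum0: "(\<Sum>i\<in>{m..j}. ?F i) = 0" by simp
    show ?thesis
    proof (cases "m = j")
      case True
      then have "d m j * (?k * ?k) = 0" using sum0 je by simp
      then show ?thesis using True nz by (simp add: p_def)
    next
      case False
      then have mj: "m < j" using less.prems by simp
      have "{m..j} = insert m (insert j S)" using mj by (auto simp: S_def)
      then have "?F m + (?F j + (\<Sum>i\<in>S. ?F i)) = 0" using sum0 mj by (simp add: S_def)
      moreover have "?F m = ?k * ?k * (x + \<theta> m) * (d m j * poly (g j) x)"
        unfolding je(1)[symmetric] split[OF mj] by (simp only: mult_ac)
      moreover have "?F j = ?k * ?k * (x + \<theta> m) * (d m j * poly (g j) x)"
      proof -
        have "e - j = m" using less.prems by simp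
        then show ?thesis unfolding split[OF mj] sym[of j] by (simp only: mult_ac)
      qed
      moreover have "(\<Sum>i\<in>S. ?F i) = ?k * ?k * (x + \<theta> m) * ((x + \<theta> m) * (\<Sum>i\<in>S. d i (e - i) * (poly (g i) x * poly (g (e - i)) x)))"
        unfolding sum_distrib_left
      proof (rule sum.cong[OF refl])
        fix i assume "i \<in> S"
        then have "m < i" "m < e - i" using less.prems by (auto simp: S_def)
        then show "?F i = ?k * ?k * (x + \<theta> m) * ((x + \<theta> m) * (d i (e - i) * (poly (g i) x * poly (g (e - i)) x)))"
          using split by (simp only: mult_ac)
      qed
      ultimately have "?k * ?k * (x + \<theta> m) * (d m j * poly (g j) x + d m j * poly (g j) x + (x + \<theta> m) * (\<Sum>i\<in>S. d i (e - i) * (poly (g i) x * poly (g (e - i)) x))) = 0"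
        by (simp only: distrib_left add.assoc)
      moreover have "poly p x = d m j * poly (g j) x + d m j * poly (g j) x + (x + \<theta> m) * (\<Sum>i\<in>S. d i (e - i) * (poly (g i) x * poly (g (e - i)) x))"
        using mj by (simp add: p_def poly_sum algebra_simps)
      ultimately show ?thesis using nz by simp
    qed
  qed
  have p0: "p = 0"
  proof (rule ccontr)
    assume "p \<noteq> 0"
    then have "finite ({x. poly p x = 0} \<union> (\<lambda>a. - \<theta> a) ` {..m})" by (simp add: poly_roots_finite)
    moreover have "UNIV \<subseteq> {x. poly p x = 0} \<union> (\<lambda>a. - \<theta> a) ` {..m}" using zero by blast
    ultimately have "finite (UNIV :: 'k set)" by (rule rev_finite_subset)
    then show False using inf by blast
  qed
  show ?case
  proof (cases "m = j")
    case True
    then show ?thesis using p0 by (simp add: p_def)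
  next
    case False
    then have "poly p (- \<theta> m) = 2 * d m j * poly (g j) (- \<theta> m)" by (simp add: p_def)
    moreover have "poly (g j) (- \<theta> m) \<noteq> 0" using \<theta> by (auto simp: g_def poly_prod inj_eq)
    ultimately show ?thesis using p0 two by simp
  qed
qed

text \<open>The condition is imposed only for nonzero t, because t will be the coefficient y of the
  third member, which has to stay nonzero.\<close>

lemma power_coefficients:
  fixes x :: "'i \<Rightarrow> 'k::field"
  assumes inf: "infinite (UNIV :: 'k set)" and S: "finite S" and z: "\<And>t. t \<noteq> 0 \<Longrightarrow> (\<Sum>i\<in>S. t ^ g i * x i) = 0"
  shows "(\<Sum>i\<in>{i \<in> S. g i = e}. x i) = 0"
proof -
  define p where "p = (\<Sum>i\<in>S. monom (x i) (g i))"
  have "poly p t = 0" if "t \<noteq> 0" for t using z[OF that] by (simp add: p_def poly_sum poly_monom mult.commute)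
  then have sub: "UNIV - {0} \<subseteq> {t. poly p t = 0}" by blast
  have "p = 0"
  proof (rule ccontr)
    assume "p \<noteq> 0"
    from finite_subset[OF sub poly_roots_finite[OF this]] show False using inf by simp
  qed
  have "(\<Sum>i\<in>S. if g i = e then x i else 0) = coeff p e" unfolding p_def coeff_sum by (simp only: coeff_monom)
  also have "\<dots> = 0" unfolding \<open>p = 0\<close> by simp
  finally show ?thesis unfolding sum.inter_filter[OF S] .
qed

text \<open>Read \<open>d\<close> as a bilinear form: the flagged functionals make it symmetric, the
  others say that it vanishes on all pairs of kernel vectors of a common member. With c = t * x and
  y = t, the coordinate i <= s of the kernel vector is t^i times a product in x. Comparing powers of
  t splits the condition by degree and reduces it to \<open>quadric_degree_part\<close>.\<close>

lemma form_coeff_separates: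
  fixes d :: "nat \<times> nat \<Rightarrow> 'k::field" and \<theta> :: "nat \<Rightarrow> 'k"
  assumes inf: "infinite (UNIV :: 'k set)" and two: "(2 :: 'k) \<noteq> 0" and \<theta>: "inj \<theta>"
    and r: "r = 2 * s + 1" "r \<le> CARD('n)"
    and z: "\<And>flag c y a b. y \<noteq> 0 \<Longrightarrow> (\<Sum>p\<in>{..<CARD('n) - s} \<times> {..<CARD('n) - s}. d p *
      form_coeff (\<lambda>c. c) s r (flag, c, y, a, b) (spm s r (\<lambda>_. 0) (-1) (\<lambda>_. 0) :: 'n::finite \<Rightarrow> 'n \<Rightarrow> 'k)
        (spm s r (\<lambda>_. 1) 0 (\<lambda>_. 0)) (spm s r \<theta> 0 (\<lambda>_. 0)) p) = 0"
    and mj: "m < CARD('n) - s" "j < CARD('n) - s"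
  shows "d (m, j) = 0"
proof -
  let ?N = "CARD('n) - s"
  let ?T = "{..<?N} \<times> {..<?N}"
  let ?A = "spm s r (\<lambda>_. 0) (-1) (\<lambda>_. 0) :: 'n \<Rightarrow> 'n \<Rightarrow> 'k" and ?B = "spm s r (\<lambda>_. 1) 0 (\<lambda>_. 0) :: 'n \<Rightarrow> 'n \<Rightarrow> 'k"
    and ?C = "spm s r \<theta> 0 (\<lambda>_. 0) :: 'n \<Rightarrow> 'n \<Rightarrow> 'k"
  have sN: "s < ?N" using r by simp
  have dsym: "d (a, b) = d (b, a)" if "a < ?N" "b < ?N" for a b
  proof -
    have delta: "(\<Sum>p\<in>?T. d p * (if p = (x, y) then 1 else 0)) = d (x, y)" if "x < ?N" "y < ?N" for x y
    proof -
      have "(\<Sum>p\<in>?T. d p * (if p = (x, y) then 1 else 0)) = (\<Sum>p\<in>?T. if p = (x, y) then d (x, y) else 0)"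
        by (rule sum.cong) auto
      then show ?thesis using that by simp
    qed
    have "0 = (\<Sum>p\<in>?T. d p * ((if p = (a, b) then 1 else 0) - (if p = (b, a) then 1 else 0)))"
      using z[OF one_neq_zero, of True 0 a b] unfolding form_coeff_def prod.case if_True by (rule sym)
    also have "\<dots> = d (a, b) - d (b, a)"
      unfolding right_diff_distrib sum_subtractf delta[OF that] delta[OF that(2,1)] ..
    finally show ?thesis by simp
  qed
  define w where "w c y a m = (if a \<le> s then (if m \<le> s then (\<Prod>t<m. c + y * \<theta> t) else 0) else if m = a then 1 else 0)"
    for c y :: 'k and a m :: nat
  have quad: "(\<Sum>p\<in>?T. d p * (w c y a (fst p) * w c y b (snd p))) = 0" if y: "y \<noteq> 0" and ab: "a < ?N" "b < ?N" for c y a b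
  proof -
    have pen: "pencil y (pencil c ?A ?B) ?C = spm s r (\<lambda>t. c + y * \<theta> t) (-1) (\<lambda>_. 0)" unfolding pencil_spm by simp
    obtain \<delta> where \<delta>: "\<delta> \<noteq> 0" and k: "\<forall>m j. m < ?N \<longrightarrow> j < ?N \<longrightarrow>
      kv r (pivot s m) (pencil y (pencil c ?A ?B) ?C) (nu s j) =
        (if m \<le> s then (if j \<le> s then \<delta> * (\<Prod>t<j. c + y * \<theta> t) else 0) else (if j = m then \<delta> else 0))"
      using kv_special[OF r, of "\<lambda>t. c + y * \<theta> t"] unfolding pen by (elim exE conjE)
    have kw: "kv3 s r c y ?A ?B ?C a (nu s j) = \<delta> * w c y a j" if "a < ?N" "j < ?N" for a j
      using k[rule_format, OF that] unfolding kv3_def w_def by simp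
    have "0 = (\<Sum>p\<in>?T. d p * (kv3 s r c y ?A ?B ?C a (nu s (fst p)) * kv3 s r c y ?A ?B ?C b (nu s (snd p))))"
      using z[OF y, of False c a b] unfolding form_coeff_def prod.case if_False by (rule sym)
    also have "\<dots> = (\<Sum>p\<in>?T. \<delta> * \<delta> * (d p * (w c y a (fst p) * w c y b (snd p))))"
    proof (rule sum.cong[OF refl])
      fix p assume "p \<in> ?T"
      then have p: "fst p < ?N" "snd p < ?N" by auto
      show "d p * (kv3 s r c y ?A ?B ?C a (nu s (fst p)) * kv3 s r c y ?A ?B ?C b (nu s (snd p))) =
          \<delta> * \<delta> * (d p * (w c y a (fst p) * w c y b (snd p)))"
        unfolding kw[OF ab(1) p(1)] kw[OF ab(2) p(2)] by (simp only: mult_ac)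
    qed
    also have "\<dots> = \<delta> * \<delta> * (\<Sum>p\<in>?T. d p * (w c y a (fst p) * w c y b (snd p)))" by (simp only: sum_distrib_left)
    finally show ?thesis using \<delta> by simp
  qed
  have quad2: "(\<Sum>i<?N. w c y a i * (\<Sum>l<?N. w c y b l * d (i, l))) = 0" if "y \<noteq> 0" "a < ?N" "b < ?N" for c y a b
  proof -
    have "(\<Sum>i<?N. w c y a i * (\<Sum>l<?N. w c y b l * d (i, l))) = (\<Sum>i<?N. \<Sum>l<?N. d (i, l) * (w c y a i * w c y b l))"
      by (simp only: sum_distrib_left mult_ac)
    also have "\<dots> = (\<Sum>p\<in>?T. d p * (w c y a (fst p) * w c y b (snd p)))"
      unfolding sum.cartesian_product by (rule sum.cong) auto
    finally show ?thesis using quad[OF that] by simp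
  qed
  have big: "(\<Sum>l<?N. w c y b l * F l) = F b" if "s < b" "b < ?N" for c y b F
  proof -
    have "(\<Sum>l<?N. w c y b l * F l) = (\<Sum>l<?N. if l = b then F l else 0)" by (rule sum.cong) (use that in \<open>auto simp: w_def\<close>)
    then show ?thesis using that by simp
  qed
  have small: "(\<Sum>l<?N. w (t * x) t 0 l * F l) = (\<Sum>l\<le>s. t ^ l * ((\<Prod>a<l. x + \<theta> a) * F l))" for t x F
  proof -
    have "(\<Sum>l<?N. w (t * x) t 0 l * F l) = (\<Sum>l\<le>s. w (t * x) t 0 l * F l)"
      by (rule sum.mono_neutral_right) (use sN in \<open>auto simp: w_def\<close>)
    also have "\<dots> = (\<Sum>l\<le>s. t ^ l * ((\<Prod>a<l. x + \<theta> a) * F l))"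
      by (rule sum.cong) (simp_all add: w_def distrib_left[symmetric] prod.distrib mult_ac)
    finally show ?thesis .
  qed
  have N0: "0 < ?N" using sN by simp
  \<comment> \<open>Pairing with a kernel vector that is a multiple of a unit vector leaves a linear
    condition, whose terms are separated by the powers of t.\<close>
  have mixed: "d (i, b) = 0" if i: "i \<le> s" and b: "s < b" "b < ?N" for i b
  proof -
    have "\<exists>x. x \<notin> (\<lambda>a. - \<theta> a) ` {..<i}" by (rule ex_new_if_finite[OF inf]) simp
    then obtain x where x: "x \<notin> (\<lambda>a. - \<theta> a) ` {..<i}" by (elim exE)
    have ne: "x + \<theta> a \<noteq> 0" if a: "a < i" for a
    proof
      assume "x + \<theta> a = 0"
      then have "x = - \<theta> a" by (simp add: eq_neg_iff_add_eq_0)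
      then show False using x a by blast
    qed
    have "(\<Sum>l\<le>s. t ^ l * ((\<Prod>a<l. x + \<theta> a) * d (l, b))) = 0" if "t \<noteq> 0" for t
      using quad2[OF that N0 b(2), of "t * x"] unfolding big[OF b] small .
    from power_coefficients[OF inf finite_atMost this, of i] have "(\<Sum>l\<in>{l \<in> {..s}. l = i}. (\<Prod>a<l. x + \<theta> a) * d (l, b)) = 0" .
    moreover have "{l \<in> {..s}. l = i} = {i}" using i by auto
    ultimately have "(\<Prod>a<i. x + \<theta> a) * d (i, b) = 0" by simp
    then show ?thesis using ne by simp
  qed
  define d' where "d' i l = (if i \<le> s \<and> l \<le> s then d (i, l) else 0)" for i l
  have d'sym: "d' i l = d' l i" for i l using dsym[of i l] sN by (simp add: d'_def)
  have deg: "(\<Sum>i\<le>e. d' i (e - i) * ((\<Prod>a<i. x + \<theta> a) * (\<Prod>a<e - i. x + \<theta> a))) = 0" for e x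
  proof -
    let ?F = "\<lambda>p. (\<Prod>a<fst p. x + \<theta> a) * ((\<Prod>a<snd p. x + \<theta> a) * d p)"
    have "(\<Sum>p\<in>{..s} \<times> {..s}. t ^ (fst p + snd p) * ?F p) = 0" if "t \<noteq> 0" for t
    proof -
      have "(\<Sum>p\<in>{..s} \<times> {..s}. t ^ (fst p + snd p) * ?F p) =
          (\<Sum>i\<le>s. \<Sum>l\<le>s. t ^ i * ((\<Prod>a<i. x + \<theta> a) * (t ^ l * ((\<Prod>a<l. x + \<theta> a) * d (i, l)))))"
        unfolding sum.cartesian_product by (rule sum.cong) (auto simp: power_add mult_ac)
      also have "\<dots> = 0" using quad2[OF that N0 N0, of "t * x"] unfolding small by (simp only: sum_distrib_left)
      finally show ?thesis .
    qed
    from power_coefficients[where g = "\<lambda>p. fst p + snd p" and x = ?F and e = e, OF inf _ this]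
    have "(\<Sum>p\<in>{p \<in> {..s} \<times> {..s}. fst p + snd p = e}. ?F p) = 0" by simp
    also have "(\<Sum>p\<in>{p \<in> {..s} \<times> {..s}. fst p + snd p = e}. ?F p) = (\<Sum>i\<in>{i \<in> {..e}. i \<le> s \<and> e - i \<le> s}. ?F (i, e - i))"
      by (rule sum.reindex_bij_witness[where i = "\<lambda>i. (i, e - i)" and j = fst]) auto
    also have "\<dots> = (\<Sum>i\<le>e. if i \<le> s \<and> e - i \<le> s then ?F (i, e - i) else 0)" by (rule sum.inter_filter) simp
    also have "\<dots> = (\<Sum>i\<le>e. d' i (e - i) * ((\<Prod>a<i. x + \<theta> a) * (\<Prod>a<e - i. x + \<theta> a)))"
    proof (rule sum.cong[OF refl])
      fix i
      show "(if i \<le> s \<and> e - i \<le> s then ?F (i, e - i) else 0) = d' i (e - i) * ((\<Prod>a<i. x + \<theta> a) * (\<Prod>a<e - i. x + \<theta> a))"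
        unfolding d'_def by (cases "i \<le> s \<and> e - i \<le> s") (simp_all only: if_True if_False simp_thms fst_conv snd_conv mult_zero_left mult_ac)
    qed
    finally show ?thesis .
  qed
  have le: "d' i l = 0" if "i \<le> l" for i l
    by (rule quadric_degree_part[OF inf two \<theta> d'sym deg that refl])
  have d'0: "d' i l = 0" for i l using le[of i l] le[of l i] d'sym[of i l] by (cases "i \<le> l") auto
  consider "m \<le> s" "j \<le> s" | "m \<le> s" "s < j" | "s < m" "j \<le> s" | "s < m" "s < j" by linarith
  then show ?thesis
  proof cases
    case 1
    then show ?thesis using d'0[of m j] by (simp add: d'_def)
  next
    case 2
    then show ?thesis using mixed mj by blast
  next
    case 3
    then show ?thesis using mixed[OF 3(2,1) mj(1)] dsym[OF mj] by simp
  next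
    case 4
    then show ?thesis using quad2[OF one_neq_zero mj, of 0] unfolding big[OF 4(2) mj(2)] big[OF 4(1) mj(1)] by blast
  qed
qed

section \<open>Reducedness when r = 2s + 1\<close>

text \<open>Pairing a kernel vector with the frame shows that its remainder lies, up to a multiplier
  outside \<open>P\<close>, in the ideal of \<open>J\<close> and the \<open>D i\<close>. By
  \<open>frame_relations\<close> the form on frame parts is a combination of products of two
  remainders: one factor counts as an element of \<open>P\<close>, the other supplies the
  \<open>D i\<close>, so the value lands in P D + J.\<close>

lemma gen_family_in_sat:
  fixes D :: "'n::finite uprod \<times> nat \<times> nat \<Rightarrow> ('v, 'k::field) mpoly"
    and A B C :: "'n \<Rightarrow> 'n \<Rightarrow> ('v, 'k) mpoly"
  assumes s: "2 * s < CARD('n)" and r: "0 < r" and P: "is_prime P" and J: "is_ideal J" and JP: "J \<subseteq> P"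
    and T: "finite T" and DP: "\<And>i. i \<in> T \<Longrightarrow> D i \<in> P"
    and symA: "\<And>i j. A i j = A j i" and symB: "\<And>i j. B i j = B j i" and symC: "\<And>i j. C i j = C j i"
    and u: "\<And>m l. m < CARD('n) - s \<Longrightarrow> l < CARD('n) - s \<Longrightarrow> u m (nu s l) = (if l = m then \<omega> else 0)"
    and ker: "\<And>c y \<rho> \<sigma>. dt r (\<lambda>i j. pencil (poly_const y) (pencil (poly_const c) A B) C (\<rho> i) (\<sigma> j)) \<in> J"
    and isoA: "\<And>m l. m < CARD('n) - s \<Longrightarrow> l < CARD('n) - s \<Longrightarrow> bff A (u m) (u l) \<in> J"
    and isoB: "\<And>m l. m < CARD('n) - s \<Longrightarrow> l < CARD('n) - s \<Longrightarrow> bff B (u m) (u l) \<in> J"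
    and isoC: "\<And>m l. m < CARD('n) - s \<Longrightarrow> l < CARD('n) - s \<Longrightarrow> bff C (u m) (u l) \<in> gen UNIV T D J"
    and y: "y \<noteq> 0"
    and guard: "dt s (\<lambda>i a. bff (pencil (poly_const y) (pencil (poly_const c) A B) C) (u (Suc i)) (\<lambda>l. if l = vp s a then 1 else 0)) \<notin> P"
  shows "(\<Sum>m<CARD('n) - s. \<Sum>l<CARD('n) - s. kv3 s r (poly_const c) (poly_const y) A B C a (nu s m) *
    kv3 s r (poly_const c) (poly_const y) A B C b (nu s l) * bff C (u m) (u l)) \<in> sat P (gen P T D J)"
proof -
  let ?N = "CARD('n) - s"
  let ?M = "pencil (poly_const y) (pencil (poly_const c) A B) C"
  let ?w = "kv3 s r (poly_const c) (poly_const y) A B C"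
  let ?e = "\<lambda>a (l :: 'n). if l = vp s a then 1 else (0 :: ('v, 'k) mpoly)"
  let ?S = "sat P (gen P T D J)" and ?G = "gen UNIV T D J"
  have PI: "is_ideal P" by (rule prime_ideal[OF P])
  have UI: "is_ideal (UNIV :: ('v, 'k) mpoly set)" by (simp add: is_ideal_def)
  have GI: "is_ideal ?G" by (rule ideal_gen[OF UI J])
  have SI: "is_ideal ?S" by (rule ideal_sat[OF P ideal_gen[OF PI J]])
  have JG: "J \<subseteq> ?G" by (rule gen_base[OF UI])
  have GP: "?G \<subseteq> P" by (rule gen_subset[OF PI JP DP])
  have JS: "f \<in> ?S" if "f \<in> J" for f
    by (rule sat_superset[OF P]) (use gen_base[OF PI] that in blast)
  have symM: "?M i j = ?M j i" for i j unfolding pencil_def by (simp only: symA[of i j] symB[of i j] symC[of i j])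
  have Mw: "mvf ?M (?w a) i \<in> J" for a i unfolding kv3_def mvf_kv[OF r] by (rule ker)
  have pen: "bff ?M x z = (bff A x z + poly_const c * bff B x z) + poly_const y * bff C x z" for x z
  proof -
    have "pencil d X Y = (\<lambda>i j. X i j + d * Y i j)" for d and X Y :: "'n \<Rightarrow> 'n \<Rightarrow> ('v, 'k) mpoly" by (intro ext) (simp add: pencil_def)
    then show ?thesis by (simp only: bff_matrix_add)
  qed
  have AB: "bff A (u m) (u l) + poly_const c * bff B (u m) (u l) \<in> J" if "m < ?N" "l < ?N" for m l
    by (intro ideal_add[OF J] ideal_mult[OF J] isoA[OF that] isoB[OF that])
  have MG: "bff ?M (u m) (u l) \<in> ?G" if "m < ?N" "l < ?N" for m l
    unfolding pen by (intro ideal_add[OF GI] ideal_mult[OF GI] isoC[OF that] subsetD[OF JG AB[OF that]])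
  have rest: "frame_rest s \<omega> u (?w a) k \<in> sat P ?G" if k: "k < s" for a k
  proof -
    let ?E = "\<lambda>i k. bff ?M (u (Suc i)) (?e k)"
    have "(\<Sum>k<s. ?E i k * frame_rest s \<omega> u (?w a) k) \<in> ?G" if i: "i < s" for i
    proof -
      have N: "Suc i < ?N" using i s by linarith
      have "(\<Sum>m'<?N. ?w a (nu s m') * bff ?M (u (Suc i)) (u m')) + (\<Sum>k<s. frame_rest s \<omega> u (?w a) k * bff ?M (u (Suc i)) (?e k)) \<in> J"
        by (rule frame_relations(1)[OF s J symM u Mw Mw])
      then have "((\<Sum>m'<?N. ?w a (nu s m') * bff ?M (u (Suc i)) (u m')) + (\<Sum>k<s. frame_rest s \<omega> u (?w a) k * bff ?M (u (Suc i)) (?e k))) -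
          (\<Sum>m'<?N. ?w a (nu s m') * bff ?M (u (Suc i)) (u m')) \<in> ?G"
        by (intro ideal_diff[OF GI] ideal_sum[OF GI] ideal_mult[OF GI] MG[OF N]) (use JG in auto)
      then show ?thesis by (simp only: add_diff_cancel_left' mult.commute)
    qed
    from cramer_ideal[where f = ?E and v = "frame_rest s \<omega> u (?w a)", OF GI this k]
    have "dt s ?E * frame_rest s \<omega> u (?w a) k \<in> ?G" by simp
    then show ?thesis unfolding sat_def using guard by blast
  qed
  have "(\<Sum>a'<s. \<Sum>k<s. frame_rest s \<omega> u (?w a) a' * frame_rest s \<omega> u (?w b) k * bff ?M (?e a') (?e k)) \<in> ?S"
  proof (intro ideal_sum[OF SI])
    fix a' k assume "a' \<in> {..<s}" "k \<in> {..<s}"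
    then have a': "frame_rest s \<omega> u (?w a) a' \<in> P" and k: "frame_rest s \<omega> u (?w b) k \<in> sat P ?G"
      using rest sat_subset[OF P GP] by auto
    have "frame_rest s \<omega> u (?w a) a' * frame_rest s \<omega> u (?w b) k \<in> ?S"
      by (rule sat_mult[OF k]) (rule gen_mult[OF PI J a'])
    then show "frame_rest s \<omega> u (?w a) a' * frame_rest s \<omega> u (?w b) k * bff ?M (?e a') (?e k) \<in> ?S"
      by (rule ideal_mult_right[OF SI])
  qed
  moreover have "(\<Sum>m<?N. \<Sum>l<?N. ?w a (nu s m) * ?w b (nu s l) * bff ?M (u m) (u l)) -
      (\<Sum>a'<s. \<Sum>k<s. frame_rest s \<omega> u (?w a) a' * frame_rest s \<omega> u (?w b) k * bff ?M (?e a') (?e k)) \<in> ?S"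
    by (rule JS, rule frame_relations(2)[OF s J symM u Mw Mw])
  ultimately have full: "(\<Sum>m<?N. \<Sum>l<?N. ?w a (nu s m) * ?w b (nu s l) * bff ?M (u m) (u l)) \<in> ?S"
    using ideal_diff_iff[OF SI] by blast
  \<comment> \<open>\<open>A\<close> and \<open>B\<close> are isotropic on the frame, so of the form
    of \<open>?M\<close> only \<open>y\<close> times the form of \<open>C\<close> remains.\<close>
  have low: "(\<Sum>m<?N. \<Sum>l<?N. ?w a (nu s m) * ?w b (nu s l) * (bff A (u m) (u l) + poly_const c * bff B (u m) (u l))) \<in> ?S"
    by (intro ideal_sum[OF SI] ideal_mult[OF SI] JS AB) auto
  let ?C = "\<Sum>m<?N. \<Sum>l<?N. ?w a (nu s m) * ?w b (nu s l) * bff C (u m) (u l)"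
  have "poly_const y * ?C = (\<Sum>m<?N. \<Sum>l<?N. ?w a (nu s m) * ?w b (nu s l) * bff ?M (u m) (u l)) -
      (\<Sum>m<?N. \<Sum>l<?N. ?w a (nu s m) * ?w b (nu s l) * (bff A (u m) (u l) + poly_const c * bff B (u m) (u l)))"
    unfolding sum_distrib_left sum_subtractf[symmetric] right_diff_distrib[symmetric] pen add_diff_cancel_left'
    by (simp only: mult_ac)
  then have "poly_const y * ?C \<in> ?S" using ideal_diff[OF SI full low] by (simp only:)
  then have "poly_const (inverse y) * (poly_const y * ?C) \<in> ?S" by (rule ideal_mult[OF SI])
  moreover have "poly_const (inverse y) * (poly_const y * ?C) = ?C"
    using y by (simp add: mult.assoc[symmetric] poly_const.hom_mult[symmetric])
  ultimately show ?thesis by simp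
qed

text \<open>The flagged functionals give zero on the values of a symmetric form, so they can be used
  alongside the quadratic ones.\<close>

lemma form_coeff_relation:
  fixes A B C :: "'n::finite \<Rightarrow> 'n \<Rightarrow> ('v, 'k::field) mpoly"
  assumes S: "is_ideal S" and symC: "\<And>i j. C i j = C j i"
    and quad: "(\<Sum>m<CARD('n) - s. \<Sum>l<CARD('n) - s. kv3 s r (poly_const c) (poly_const y) A B C a (nu s m) *
      kv3 s r (poly_const c) (poly_const y) A B C b (nu s l) * bff C (u m) (u l)) \<in> S"
  shows "(\<Sum>p\<in>{..<CARD('n) - s} \<times> {..<CARD('n) - s}. form_coeff poly_const s r (flag, c, y, a, b) A B C p *
    bff C (u (fst p)) (u (snd p))) \<in> S"
proof (cases flag)
  case True
  let ?T = "{..<CARD('n) - s} \<times> {..<CARD('n) - s}" and ?D = "\<lambda>p. bff C (u (fst p)) (u (snd p))"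
  have delta: "(\<Sum>p\<in>?T. (if p = q then 1 else 0) * ?D p) = (if q \<in> ?T then ?D q else 0)" for q
  proof -
    have "(\<Sum>p\<in>?T. (if p = q then 1 else 0) * ?D p) = (\<Sum>p\<in>?T. if p = q then ?D q else 0)" by (rule sum.cong) auto
    then show ?thesis by simp
  qed
  have "(\<Sum>p\<in>?T. form_coeff poly_const s r (flag, c, y, a, b) A B C p * ?D p) =
      (if (a, b) \<in> ?T then ?D (a, b) else 0) - (if (b, a) \<in> ?T then ?D (b, a) else 0)"
  proof -
    have "form_coeff poly_const s r (flag, c, y, a, b) A B C p = (if p = (a, b) then 1 else 0) - (if p = (b, a) then 1 else 0)" for p
      using True by (simp add: form_coeff_def)
    then show ?thesis by (simp only: left_diff_distrib sum_subtractf delta)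
  qed
  also have "\<dots> = 0" using bff_commute[where A = C and u = "u a" and w = "u b", OF symC] by auto
  finally show ?thesis using ideal_zero[OF S] by simp
next
  case False
  have "(\<Sum>p\<in>{..<CARD('n) - s} \<times> {..<CARD('n) - s}. form_coeff poly_const s r (flag, c, y, a, b) A B C p * bff C (u (fst p)) (u (snd p))) =
      (\<Sum>m<CARD('n) - s. \<Sum>l<CARD('n) - s. kv3 s r (poly_const c) (poly_const y) A B C a (nu s m) *
      kv3 s r (poly_const c) (poly_const y) A B C b (nu s l) * bff C (u m) (u l))"
    unfolding sum.cartesian_product by (rule sum.cong) (simp_all only: form_coeff_def prod.case_eq_if fst_conv snd_conv if_False False)
  then show ?thesis using quad by simp
qed

lemma exists_form_selection:
  fixes \<xi> :: "nat \<Rightarrow> 'k::field"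
  assumes inf: "infinite (UNIV :: 'k set)" and two: "(2 :: 'k) \<noteq> 0" and \<xi>: "inj \<xi>" and r: "r = 2 * s + 1" "r \<le> CARD('n)"
    and pr: "bij_betw pr {..<L} ({..<CARD('n) - s} \<times> {..<CARD('n) - s})"
  defines "A \<equiv> spm s r (\<lambda>_. 0) (-1) (\<lambda>_. 0) :: 'n::finite \<Rightarrow> 'n \<Rightarrow> 'k"
    and "B \<equiv> spm s r (\<lambda>_. 1) 0 (\<lambda>_. 0) :: 'n \<Rightarrow> 'n \<Rightarrow> 'k" and "C \<equiv> spm s r \<xi> 0 (\<lambda>_. 0) :: 'n \<Rightarrow> 'n \<Rightarrow> 'k"
  shows "\<exists>q. (\<forall>i<L. fst (snd (snd (q i))) \<noteq> 0) \<and> form_test (\<lambda>c. c) s r \<xi> L q pr A B C \<noteq> 0"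
proof -
  let ?T = "{..<CARD('n) - s} \<times> {..<CARD('n) - s}" and ?Q = "{q :: bool \<times> 'k \<times> 'k \<times> nat \<times> nat. fst (snd (snd q)) \<noteq> 0}"
  have "\<exists>q. (\<forall>i<L. q i \<in> ?Q) \<and> dt L (\<lambda>i j. form_coeff (\<lambda>c. c) s r (q i) A B C (pr j)) \<noteq> 0"
  proof (rule exists_nonsingular_selection)
    fix D :: "nat \<Rightarrow> 'k"
    assume D: "\<And>q. q \<in> ?Q \<Longrightarrow> (\<Sum>j<L. D j * form_coeff (\<lambda>c. c) s r q A B C (pr j)) = 0"
    define d where "d p = D (the_inv_into {..<L} pr p)" for p
    have dp: "d (pr j) = D j" if "j < L" for j
      using pr that by (simp add: d_def bij_betw_def the_inv_into_f_f)
    have sum0: "(\<Sum>p\<in>?T. d p * form_coeff (\<lambda>c. c) s r (flag, c, y, a, b) A B C p) = 0" if y: "y \<noteq> 0" for flag c y a b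
    proof -
      have "(\<Sum>p\<in>?T. d p * form_coeff (\<lambda>c. c) s r (flag, c, y, a, b) A B C p) =
          (\<Sum>j<L. d (pr j) * form_coeff (\<lambda>c. c) s r (flag, c, y, a, b) A B C (pr j))"
        by (rule sum.reindex_bij_betw[OF pr, symmetric])
      also have "\<dots> = (\<Sum>j<L. D j * form_coeff (\<lambda>c. c) s r (flag, c, y, a, b) A B C (pr j))"
        by (rule sum.cong) (simp_all add: dp)
      also have "\<dots> = 0" by (rule D) (simp add: y)
      finally show ?thesis .
    qed
    show "\<forall>j<L. D j = 0"
    proof (intro allI impI)
      fix j assume j: "j < L"
      obtain m l where ml: "pr j = (m, l)" by (cases "pr j")
      have "(m, l) \<in> ?T" using bij_betwE[OF pr] j ml by (metis lessThan_iff)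
      then have "d (m, l) = 0"
        by (intro form_coeff_separates[OF inf two \<xi> r sum0[unfolded A_def B_def C_def]]) auto
      then show "D j = 0" using dp[OF j] ml by simp
    qed
  qed
  then obtain q where q: "\<forall>i<L. q i \<in> ?Q" "dt L (\<lambda>i j. form_coeff (\<lambda>c. c) s r (q i) A B C (pr j)) \<noteq> 0"
    by - (erule exE, erule conjE, rule that)
  have "form_guard (\<lambda>c. c) s r \<xi> p A B C \<noteq> 0" for p
    unfolding form_guard_def A_def B_def C_def by (cases p) (simp only: prod.case pairing_det_special[OF r \<xi>] not_False_eq_True)
  then have "form_test (\<lambda>c. c) s r \<xi> L q pr A B C \<noteq> 0"
    using q(2) frame_det_special(1)[OF r \<xi>] unfolding form_test_def A_def B_def by simp
  then show ?thesis using q(1) by (intro exI[of _ q]) simp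
qed

theorem odd_case_saturated:
  fixes Z :: "('k::alg_closed_field ^ 'n::finite uprod) set set"
  assumes two: "(2 :: 'k) \<noteq> 0" and r: "r = 2 * s + 1" "r \<le> CARD('n)" and s1: "1 \<le> s" and k: "1 \<le> k"
    and comp: "irreducible_component (k + 1) (sd_fano r) Z"
    and red: "reduced_structure (compression_locus r k s) = reduced_structure Z"
    and I: "card I = k + 1" "chart_plane I x0 \<in> Z" and f: "f \<in> van Z I"
  shows "\<exists>h. h \<notin> van Z I \<and> h * f \<in> fano_pull r I"
proof -
  let ?C = "compression_locus r k s :: ('k ^ 'n uprod) set set" and ?N = "CARD('n) - s"
  note facts = fano_component_facts[OF comp]
  define P where "P = van Z I"
  have PP: "is_prime P" unfolding P_def by (rule prime_van[OF facts(1,2) I])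
  have PI: "is_ideal P" by (rule prime_ideal[OF PP])
  have vanC: "van ?C I = P" unfolding P_def by (rule van_cong[OF red])
  have ne: "?C \<noteq> {}" by (rule compression_locus_nonempty[OF PP[unfolded P_def] van_cong[OF red]])
  have inf: "infinite (UNIV :: 'k set)" by (rule alg_closed_infinite)
  have r0: "0 < r" and r2: "2 * s < r" and n2: "2 * s < CARD('n)" and sr: "s + 1 \<le> r" using r s1 by simp_all
  \<comment> \<open>The ideal \<open>b\<close>, contracted from the local ring to the
    polynomials.\<close>
  define J where "J = sat P (fano_pull r I)"
  have FP: "fano_pull r I \<subseteq> P" unfolding P_def using facts(4) by (auto simp: van_def pull_def)
  have J: "is_ideal J" unfolding J_def by (rule ideal_sat[OF PP ideal_fano_pull])
  have JP: "J \<subseteq> P" unfolding J_def by (rule sat_subset[OF PP FP])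
  have Jsat: "g \<in> J" if "h \<notin> P" "h * g \<in> J" for h g using that unfolding J_def by (rule sat_saturated[OF PP])
  define M where "M t = pmat I poly_var (\<lambda>a. poly_const (t a))" for t :: "'n uprod \<Rightarrow> 'k"
  define E where "E a = (\<lambda>i j. chart_entry I poly_var a (Upair i j) :: ('n uprod \<times> 'n uprod, 'k) mpoly)" for a :: "'n uprod"
  define \<delta> where "\<delta> a b = (if b = a then 1 else 0 :: 'k)" for a b :: "'n uprod"
  have Msym: "M t i j = M t j i" for t i j unfolding M_def by (rule pmat_sym)
  have evp: "evl x (pmat I' poly_var (\<lambda>a. poly_const (t a)) i j) = pmat I' x t i j" for x t I' and i j :: 'n
    by (simp only: pmat_hom[OF evl.comm_ring_hom_axioms] evl_const evl_var)
  have MS: "M t = (\<lambda>i j. \<Sum>a\<in>I. poly_const (t a) * E a i j)" for t unfolding M_def E_def by (intro ext) (simp only: pmat_def)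
  have ME: "M (\<delta> a) = E a" if "a \<in> I" for a
  proof (intro ext)
    fix i j
    have "M (\<delta> a) i j = (\<Sum>b\<in>I. if b = a then E a i j else 0)" unfolding MS \<delta>_def by (rule sum.cong) auto
    then show "M (\<delta> a) i j = E a i j" using that by simp
  qed
  have lin: "bff (M t) x z = (\<Sum>a\<in>I. poly_const (t a) * bff (M (\<delta> a)) x z)" for t x z
    unfolding MS[of t] bff_matrix_sum by (rule sum.cong) (simp_all only: ME)
  have Mpen: "pencil (poly_const c) (M t) (M t') = M (\<lambda>a. t a + c * t' a)" for c t t'
    by (intro ext) (simp only: pencil_def M_def poly_const.hom_add poly_const.hom_mult pmat_add)
  have minorsJ: "dt r (\<lambda>i j. M t (\<rho> i) (\<sigma> j)) \<in> J" for t \<rho> \<sigma>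
    unfolding J_def M_def by (rule sat_superset[OF PP minor_in_fano_pull])
  obtain \<xi> :: "nat \<Rightarrow> 'k" where \<xi>: "inj \<xi>" using exists_nonzero_sequence[OF inf] by (elim exE conjE)
  let ?\<Xi> = "\<lambda>i. poly_const (\<xi> i) :: ('n uprod \<times> 'n uprod, 'k) mpoly"
  define u where "u \<tau>0 \<tau>1 = nframe s r ?\<Xi> (M \<tau>0) (M \<tau>1)" for \<tau>0 \<tau>1
  define \<omega> where "\<omega> \<tau>0 \<tau>1 = frame_det s r ?\<Xi> (M \<tau>0) (M \<tau>1)" for \<tau>0 \<tau>1
  have unu: "u \<tau>0 \<tau>1 m (nu s l) = (if l = m then \<omega> \<tau>0 \<tau>1 else 0)" if "m < ?N" "l < ?N" for \<tau>0 \<tau>1 m l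
    unfolding u_def \<omega>_def by (rule nframe_nu[OF that])
  \<comment> \<open>Only the isotropy of the frame modulo \<open>J\<close> remains to be shown: the
    determinant in \<open>isotropic_frame_van\<close> lies outside \<open>P\<close>, being nonzero
    at every point of the locus where the frame is nondegenerate.\<close>
  have core: "f \<in> J" if w: "\<omega> \<tau>0 \<tau>1 \<notin> P"
    and D: "\<And>a m l. a \<in> I \<Longrightarrow> m < ?N \<Longrightarrow> l < ?N \<Longrightarrow> bff (M (\<delta> a)) (u \<tau>0 \<tau>1 m) (u \<tau>0 \<tau>1 l) \<in> J" for \<tau>0 \<tau>1
  proof -
    let ?w = "\<omega> \<tau>0 \<tau>1"
    let ?d = "tdet (complete_rows I (\<lambda>a p. ?w\<^sup>2 * chart_entry I poly_var a p))"
    have iso: "bff (\<lambda>i j. chart_entry I poly_var a (Upair i j)) (u \<tau>0 \<tau>1 m) (u \<tau>0 \<tau>1 l) \<in> J"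
      if "a \<in> I" "m < ?N" "l < ?N" for a m l
      using D[OF that] unfolding ME[OF that(1)] E_def .
    obtain j where j: "?w * ?d ^ j * ret I f \<in> J"
      using isotropic_frame_van[where u = "u \<tau>0 \<tau>1" and \<omega> = ?w and J = J and f = f, OF inf r I(1) unu J iso]
        f[folded P_def, folded vanC] by blast
    obtain x1 where x1: "chart_plane I x1 \<in> ?C" "evl (chart_mask I x1) ?w \<noteq> 0"
      using w unfolding vanC[symmetric] van_iff by (simp only: not_all not_imp) (elim exE conjE)
    let ?x = "chart_mask I x1"
    have "evl ?x ?d = tdet (complete_rows I (\<lambda>a p. (evl ?x ?w)\<^sup>2 * chart_entry I ?x a p))"
    proof -
      have ce: "evl ?x (chart_entry I poly_var a p) = chart_entry I ?x a p" for a p by (simp add: chart_entry_def)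
      have "evl ?x (complete_rows I (\<lambda>a p. ?w\<^sup>2 * chart_entry I poly_var a p) p q) = complete_rows I (\<lambda>a p. (evl ?x ?w)\<^sup>2 * chart_entry I ?x a p) p q" for p q
        unfolding complete_rows_def by (simp add: if_distrib[of "evl ?x"] evl.hom_mult evl.hom_power ce cong: if_cong)
      then show ?thesis unfolding tdet_hom[OF evl.comm_ring_hom_axioms] by simp
    qed
    moreover have "tdet (complete_rows I (\<lambda>a p. (evl ?x ?w)\<^sup>2 * chart_entry I ?x a p)) \<noteq> 0"
    proof (rule span_rows_tdet)
      have row: "(\<chi> p. (evl ?x ?w)\<^sup>2 * chart_entry I ?x a p) = (evl ?x ?w)\<^sup>2 *s rowv I ?x a" for a
        by (simp add: Finite_Cartesian_Product.vec_eq_iff rowv_nth)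
      show "vec.span ((\<lambda>a. \<chi> p. (evl ?x ?w)\<^sup>2 * chart_entry I ?x a p) ` I) = chart_plane I ?x"
        unfolding row
      proof (rule equalityI)
        show "vec.span ((\<lambda>a. (evl ?x ?w)\<^sup>2 *s rowv I ?x a) ` I) \<subseteq> chart_plane I ?x"
          by (rule vec.span_minimal) (auto intro!: vec.subspace_scale[OF subspace_chart_plane] rowv_in_chart_plane simp: subspace_chart_plane simp del: chart_plane_mask)
        have "rowv I ?x a \<in> vec.span ((\<lambda>a. (evl ?x ?w)\<^sup>2 *s rowv I ?x a) ` I)" if "a \<in> I" for a
        proof -
          have "inverse ((evl ?x ?w)\<^sup>2) *s ((evl ?x ?w)\<^sup>2 *s rowv I ?x a) \<in> vec.span ((\<lambda>a. (evl ?x ?w)\<^sup>2 *s rowv I ?x a) ` I)"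
            by (rule vec.span_scale, rule vec.span_base, rule imageI, rule that)
          then show ?thesis using x1(2) by simp
        qed
        then show "chart_plane I ?x \<subseteq> vec.span ((\<lambda>a. (evl ?x ?w)\<^sup>2 *s rowv I ?x a) ` I)"
          unfolding chart_plane_rowv by (intro vec.span_minimal vec.subspace_span image_subsetI)
      qed
    qed
    ultimately have dx: "evl ?x ?d \<noteq> 0" by simp
    have "?d \<notin> P"
    proof
      assume "?d \<in> P"
      then have "evl ?x ?d = 0" using x1(1) unfolding vanC[symmetric] van_iff by blast
      then show False using dx by contradiction
    qed
    then have "?w * ?d ^ j \<notin> P" using w prime_power[OF PP] unfolding prime_mult_iff[OF PP] by blast
    then have "ret I f \<in> J" using j by (rule Jsat)
    then obtain h where "h \<notin> P" "h * ret I f \<in> fano_pull r I" unfolding J_def sat_def by blast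
    then show ?thesis unfolding J_def sat_def by (intro CollectI exI[of _ h]) (simp add: pull_def ret.hom_mult)
  qed
  have mins: "dt r (\<lambda>i j. pencil (poly_const c) (M \<tau>0) (M \<tau>1) (\<rho> i) (\<sigma> j)) \<in> J" for c \<tau>0 \<tau>1 \<rho> \<sigma>
    unfolding Mpen by (rule minorsJ)
  have iso0: "bff (M \<tau>0) (u \<tau>0 \<tau>1 m) (u \<tau>0 \<tau>1 l) \<in> J" for \<tau>0 \<tau>1 m l
    unfolding u_def nframe_def[abs_def] bff_sum_left bff_sum_right frame_def
    by (intro ideal_sum[OF J] ideal_mult[OF J], rule pencil_isotropic(2)[OF inf J r0 Msym Msym mins])
  have iso1: "bff (M \<tau>1) (u \<tau>0 \<tau>1 m) (u \<tau>0 \<tau>1 l) \<in> J" for \<tau>0 \<tau>1 m l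
    unfolding u_def nframe_def[abs_def] bff_sum_left bff_sum_right frame_def
    by (intro ideal_sum[OF J] ideal_mult[OF J], rule pencil_isotropic(1)[OF inf J r0 Msym Msym mins])
  \<comment> \<open>At points of the locus the normalised frame consists of vectors of
    \<open>U\<close>, which is contained in \<open>W\<close>; hence every member vanishes on pairs
    of them.\<close>
  have DP: "bff (M t) (u \<tau>0 \<tau>1 m) (u \<tau>0 \<tau>1 l) \<in> P" if ml: "m < ?N" "l < ?N" for t \<tau>0 \<tau>1 m l
    unfolding vanC[symmetric] van_iff
  proof (intro allI impI)
    fix x1 assume "chart_plane I x1 \<in> ?C"
    then have x: "chart_plane I (chart_mask I x1) \<in> ?C" by simp
    define x where "x = chart_mask I x1"
    obtain U W :: "('k ^ 'n) set" where U: "vec.subspace U" and W: "vec.subspace W" and UW: "U \<subseteq> W"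
      and d: "vec.dim U = s + 1 + CARD('n) - r" "CARD('n) - vec.dim W = s" "Suc ((CARD('n) - vec.dim U) + s) = r"
      and zz: "\<forall>t. \<forall>u\<in>U. \<forall>w\<in>W. bf (pmat I x t) u w = 0"
      using compression_locus_chart[OF x sr r(2)] unfolding x_def by (elim exE conjE)
    have z: "bf (pmat I x t) u w = 0" if "u \<in> U" "w \<in> W" for t u w using zz that by blast
    have mm: "Suc ((CARD('n) - vec.dim U) + (CARD('n) - vec.dim W)) = r" using d by simp
    let ?A = "pmat I x \<tau>0" and ?B = "pmat I x \<tau>1"
    have pen: "pencil c ?A ?B = pmat I x (\<lambda>a. \<tau>0 a + c * \<tau>1 a)" for c
      unfolding pencil_def by (intro ext) (simp only: pmat_add)
    have fU: "(\<chi> l. frame s r \<xi> ?A ?B i l) \<in> U" for i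
      unfolding frame_def pen kv_def by (rule cofv_in[OF U W pmat_sym z mm r0])
    have nU: "(\<chi> l. nframe s r \<xi> ?A ?B i l) \<in> U" for i
    proof -
      have "(\<chi> l. nframe s r \<xi> ?A ?B i l) = (\<Sum>j<?N. cf ?N (\<lambda>i j. frame s r \<xi> ?A ?B i (nu s j)) j i *s (\<chi> l. frame s r \<xi> ?A ?B j l))"
        by (simp add: Finite_Cartesian_Product.vec_eq_iff nframe_def sum_component)
      then show ?thesis by (simp only:) (intro vec.subspace_sum[OF U] vec.subspace_scale[OF U] fU)
    qed
    have "evl x (bff (M t) (u \<tau>0 \<tau>1 m) (u \<tau>0 \<tau>1 l)) = bff (pmat I x t) (nframe s r \<xi> ?A ?B m) (nframe s r \<xi> ?A ?B l)"
      unfolding bff_hom[OF evl.comm_ring_hom_axioms] u_def nframe_hom[OF evl.comm_ring_hom_axioms r0 ml(1)]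
        nframe_hom[OF evl.comm_ring_hom_axioms r0 ml(2)] M_def evp evl_const ..
    also have "\<dots> = bf (pmat I x t) (\<chi> i. nframe s r \<xi> ?A ?B m i) (\<chi> i. nframe s r \<xi> ?A ?B l i)"
      by (simp add: bff_def bf_def)
    also have "\<dots> = 0" by (rule z[OF nU subsetD[OF UW nU]])
    finally show "evl (chart_mask I x1) (bff (M t) (u \<tau>0 \<tau>1 m) (u \<tau>0 \<tau>1 l)) = 0" unfolding x_def .
  qed
  let ?e = "enum_type :: nat \<Rightarrow> 'n"
  define A where "A = (spm s r (\<lambda>_. 0) (-1) (\<lambda>_. 0) :: 'n \<Rightarrow> 'n \<Rightarrow> 'k)"
  define B where "B = (spm s r (\<lambda>_. 1) 0 (\<lambda>_. 0) :: 'n \<Rightarrow> 'n \<Rightarrow> 'k)"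
  define C where "C = (spm s r \<xi> 0 (\<lambda>_. 0) :: 'n \<Rightarrow> 'n \<Rightarrow> 'k)"
  \<comment> \<open>For k = 1 the plane has no room for \<open>C\<close>, so \<open>A\<close> is
    repeated in its position.\<close>
  define z where "z m = symvec (if m = 0 then A else if m = 1 then B else if k = 1 then A else C)" for m :: nat
  note cc = spm_coord_compression[OF r2 r(2)]
  have ABC: "A i j = A j i" "B i j = B j i" "C i j = C j i" for i j unfolding A_def B_def C_def by (rule spm_sym)+
  define S where "S = (if k = 1 then {symvec A, symvec B} else {symvec A, symvec B, symvec C})"
  have Ssub: "S \<subseteq> coord_compression (?e ` ({..s} \<union> {r..<CARD('n)})) (?e ` ({..s} \<union> {2 * s<..<CARD('n)}))"
    unfolding S_def A_def B_def C_def using cc(4) by auto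
  have "vec.dim S \<le> card S" by (rule vec.dim_le_card[OF vec.span_superset]) (simp add: S_def)
  also have "\<dots> \<le> k + 1" unfolding S_def using k by (auto simp: card_insert_if)
  finally have dimS: "vec.dim S \<le> k + 1" .
  obtain Q where Q: "Q \<in> ?C" "Q \<in> grassmannian (k + 1)" "S \<subseteq> Q"
    using exists_special_plane[OF inf _ r(2) ne cc(1-3) Ssub dimS] r by auto
  have zQ: "z m \<in> Q" for m using Q(3) by (auto simp: z_def S_def split: if_splits)
  have z0: "z 0 $ Upair i j = A i j" "z 1 $ Upair i j = B i j" for i j using ABC by (simp_all add: z_def symvec_nth)
  have z2: "z 2 $ Upair i j = C i j" if "k \<noteq> 1" for i j using ABC that by (simp add: z_def symvec_nth)
  have "f \<in> J"
  proof (cases "k = 1")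
    case True
    \<comment> \<open>For k = 1 two members span the plane once they are independent, which the
      entry minor secures; isotropy then passes from the pencil to the rows of the chart by Cramer's
      rule.\<close>
    define p q p' where "p = ?e 1" and "q = ?e (s + 1)" and "p' = ?e 0"
    define \<gamma> where "\<gamma> M = frame_det s r \<xi> (M 0) (M 1) * entry_minor p q p' q (M 0) (M 1)" for M :: "nat \<Rightarrow> 'n \<Rightarrow> 'n \<Rightarrow> 'k"
    have lt: "0 < CARD('n)" "1 < CARD('n)" "s + 1 < CARD('n)" using r s1 by linarith+
    have "entry_minor p q p' q A B \<noteq> 0" using s1
      by (simp only: entry_minor_def p_def q_def p'_def A_def B_def spm_def type_index_enum[OF lt(1)] type_index_enum[OF lt(2)]
        type_index_enum[OF lt(3)]) (simp add: sp_def sp_up_def)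
    then have nz: "\<gamma> (\<lambda>m i j. z m $ Upair i j) \<noteq> 0"
      unfolding \<gamma>_def z0 using frame_det_special(1)[OF r \<xi>] by (simp add: A_def B_def)
    have evG: "evl x (frame_det s r ?\<Xi> (pmat I' poly_var (\<lambda>a. poly_const (\<tau> 0 a))) (pmat I' poly_var (\<lambda>a. poly_const (\<tau> 1 a))) *
        entry_minor p q p' q (pmat I' poly_var (\<lambda>a. poly_const (\<tau> 0 a))) (pmat I' poly_var (\<lambda>a. poly_const (\<tau> 1 a)))) =
        \<gamma> (\<lambda>m. pmat I' x (\<tau> m))" for x I' and \<tau> :: "nat \<Rightarrow> 'n uprod \<Rightarrow> 'k"
      unfolding \<gamma>_def evl.hom_mult frame_det_hom[OF evl.comm_ring_hom_axioms r0] entry_minor_hom[OF evl.comm_ring_hom_axioms] evl_const evp ..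
    have poly: "\<exists>G. \<forall>x. evl x G = \<gamma> (\<lambda>m. pmat I' x (\<tau> m))" for I' \<tau> by (intro exI allI, rule evG)
    obtain \<tau> where \<tau>: "\<forall>G. (\<forall>x. evl x G = \<gamma> (\<lambda>m. pmat I x (\<tau> m))) \<longrightarrow> G \<notin> van Z I"
      using generic_condition[where \<gamma> = \<gamma>, OF facts(1,2) red poly Q(1,2) zQ nz I] by (elim exE)
    have "\<omega> (\<tau> 0) (\<tau> 1) * entry_minor p q p' q (M (\<tau> 0)) (M (\<tau> 1)) \<notin> P"
      unfolding P_def \<omega>_def M_def by (rule \<tau>[rule_format], rule evG)
    then have w: "\<omega> (\<tau> 0) (\<tau> 1) \<notin> P" and em: "entry_minor p q p' q (M (\<tau> 0)) (M (\<tau> 1)) \<notin> P"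
      unfolding prime_mult_iff[OF PP] by auto
    have "card I = 2" using I(1) True by simp
    then obtain a b where ab: "I = {a, b}" "a \<noteq> b" unfolding card_2_iff by (elim exE conjE)
    let ?t = "\<tau> 0" and ?t' = "\<tau> 1"
    define d where "d = ?t a * ?t' b - ?t b * ?t' a"
    have M2: "M t i j = poly_const (t a) * E a i j + poly_const (t b) * E b i j" for t i j unfolding MS ab using ab(2) by simp
    have d: "d \<noteq> 0"
    proof
      assume "d = 0"
      have "entry_minor p q p' q (M ?t) (M ?t') = poly_const d * (E a p q * E b p' q - E a p' q * E b p q)"
        unfolding entry_minor_def M2 d_def poly_const.hom_minus poly_const.hom_mult by (simp add: algebra_simps)
      then show False using em ideal_zero[OF PI] \<open>d = 0\<close> by simp
    qed
    have D: "bff (M (\<delta> c)) (u ?t ?t' m) (u ?t ?t' l) \<in> J" if c: "c \<in> I" for c m l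
    proof -
      let ?F = "\<lambda>c. bff (M (\<delta> c)) (u ?t ?t' m) (u ?t ?t' l)"
      have l2: "bff (M t) (u ?t ?t' m) (u ?t ?t' l) = poly_const (t a) * ?F a + poly_const (t b) * ?F b" for t
        unfolding lin[of t] ab using ab(2) by simp
      have i0: "poly_const (?t a) * ?F a + poly_const (?t b) * ?F b \<in> J" unfolding l2[symmetric] by (rule iso0)
      have i1: "poly_const (?t' a) * ?F a + poly_const (?t' b) * ?F b \<in> J" unfolding l2[symmetric] by (rule iso1)
      have "poly_const d * ?F a = poly_const (?t' b) * (poly_const (?t a) * ?F a + poly_const (?t b) * ?F b) -
          poly_const (?t b) * (poly_const (?t' a) * ?F a + poly_const (?t' b) * ?F b)"
        unfolding d_def poly_const.hom_minus poly_const.hom_mult by (simp add: algebra_simps)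
      also have "\<dots> \<in> J" by (intro ideal_diff[OF J] ideal_mult[OF J] i0 i1)
      finally have a: "poly_const d * ?F a \<in> J" .
      have "poly_const d * ?F b = poly_const (?t a) * (poly_const (?t' a) * ?F a + poly_const (?t' b) * ?F b) -
          poly_const (?t' a) * (poly_const (?t a) * ?F a + poly_const (?t b) * ?F b)"
        unfolding d_def poly_const.hom_minus poly_const.hom_mult by (simp add: algebra_simps)
      also have "\<dots> \<in> J" by (intro ideal_diff[OF J] ideal_mult[OF J] i0 i1)
      finally have b: "poly_const d * ?F b \<in> J" .
      have "poly_const d * ?F c \<in> J" using a b c ab(1) by auto
      then have "poly_const (inverse d) * (poly_const d * ?F c) \<in> J" by (rule ideal_mult[OF J])
      then show ?thesis using d by (simp add: mult.assoc[symmetric] poly_const.hom_mult[symmetric])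
    qed
    show ?thesis by (rule core[OF w D])
  next
    case False
    let ?NN = "{..<?N} \<times> {..<?N}"
    define L where "L = card ?NN"
    obtain pr where pr: "bij_betw pr {..<L} ?NN"
      using ex_bij_betw_nat_finite[of ?NN] unfolding L_def by (auto simp: lessThan_atLeast0)
    obtain q where q: "\<forall>i<L. fst (snd (snd (q i))) \<noteq> 0" and qnz: "form_test (\<lambda>c. c) s r \<xi> L q pr A B C \<noteq> 0"
      using exists_form_selection[OF inf two \<xi> r pr] unfolding A_def B_def C_def by (elim exE conjE)
    define \<gamma> where "\<gamma> M = form_test (\<lambda>c. c) s r \<xi> L q pr (M 0) (M 1) (M 2)" for M :: "nat \<Rightarrow> 'n \<Rightarrow> 'n \<Rightarrow> 'k"
    have nz: "\<gamma> (\<lambda>m i j. z m $ Upair i j) \<noteq> 0" unfolding \<gamma>_def z0 z2[OF False] by (rule qnz)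
    have evG: "evl x (form_test poly_const s r \<xi> L q pr (pmat I' poly_var (\<lambda>a. poly_const (\<tau> 0 a)))
        (pmat I' poly_var (\<lambda>a. poly_const (\<tau> 1 a))) (pmat I' poly_var (\<lambda>a. poly_const (\<tau> 2 a)))) =
        \<gamma> (\<lambda>m. pmat I' x (\<tau> m))" for x I' and \<tau> :: "nat \<Rightarrow> 'n uprod \<Rightarrow> 'k"
      unfolding \<gamma>_def form_test_hom[OF evl.comm_ring_hom_axioms r0 n2] evl_const evp ..
    have poly: "\<exists>G. \<forall>x. evl x G = \<gamma> (\<lambda>m. pmat I' x (\<tau> m))" for I' \<tau> by (intro exI allI, rule evG)
    obtain \<tau> where \<tau>: "\<forall>G. (\<forall>x. evl x G = \<gamma> (\<lambda>m. pmat I x (\<tau> m))) \<longrightarrow> G \<notin> van Z I"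
      using generic_condition[where \<gamma> = \<gamma>, OF facts(1,2) red poly Q(1,2) zQ nz I] by (elim exE)
    define F where "F t = form_test poly_const s r \<xi> L q pr (M (\<tau> 0)) (M (\<tau> 1)) (M t)" for t
    have F2: "F (\<tau> 2) \<notin> P" unfolding P_def F_def M_def by (rule \<tau>[rule_format], rule evG)
    have w: "\<omega> (\<tau> 0) (\<tau> 1) \<notin> P"
      using F2 unfolding F_def form_test_def \<omega>_def[symmetric] prime_mult_iff[OF PP] by auto
    let ?u = "u (\<tau> 0) (\<tau> 1)" and ?T = "I \<times> ({..<?N} \<times> {..<?N})"
    define Dg where "Dg = (\<lambda>(a, m, l). bff (M (\<delta> a)) (?u m) (?u l))"
    have fT: "finite ?T" by simp
    have DgP: "Dg i \<in> P" if "i \<in> ?T" for i using that DP by (auto simp: Dg_def)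
    let ?S = "sat P (gen P ?T Dg J)"
    have SI: "is_ideal ?S" by (rule ideal_sat[OF PP ideal_gen[OF PI J]])
    have UI: "is_ideal (UNIV :: ('n uprod \<times> 'n uprod, 'k) mpoly set)" by (simp add: is_ideal_def)
    have DG: "bff (M t) (?u m) (?u l) \<in> gen UNIV ?T Dg J" if "m < ?N" "l < ?N" for t m l
      unfolding lin[of t]
    proof (intro ideal_sum[OF ideal_gen[OF UI J]] ideal_mult[OF ideal_gen[OF UI J]])
      fix a assume "a \<in> I"
      then have "Dg (a, m, l) \<in> gen UNIV ?T Dg J" using that by (intro gen_generator[OF fT _ J]) simp
      then show "bff (M (\<delta> a)) (?u m) (?u l) \<in> gen UNIV ?T Dg J" by (simp add: Dg_def)
    qed
    \<comment> \<open>The selected functionals give a square linear system for the values of one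
      member on the frame, with right-hand sides in the saturation of P D + J and determinant
      outside \<open>P\<close>.\<close>
    have good: "bff (M t) (?u m) (?u l) \<in> ?S" if t: "F t \<notin> P" and ml: "m < ?N" "l < ?N" for t m l
    proof -
      let ?c = "\<lambda>i j. form_coeff poly_const s r (q i) (M (\<tau> 0)) (M (\<tau> 1)) (M t) (pr j)"
      let ?D = "\<lambda>p. bff (M t) (?u (fst p)) (?u (snd p))"
      have dL: "dt L ?c \<notin> P"
        using t unfolding F_def form_test_def prime_mult_iff[OF PP] by blast
      have gd: "form_guard poly_const s r \<xi> (q i) (M (\<tau> 0)) (M (\<tau> 1)) (M t) \<notin> P" if "i < L" for i
        using t that unfolding F_def form_test_def prime_mult_iff[OF PP] prime_prod_iff[OF PP finite_lessThan] by blast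
      have row: "(\<Sum>j<L. ?c i j * ?D (pr j)) \<in> ?S" if i: "i < L" for i
      proof -
        obtain flag c y a b where qi: "q i = (flag, c, y, a, b)" by (rule prod_cases5)
        have "fst (snd (snd (q i))) \<noteq> 0" using q i by blast
        then have y: "y \<noteq> 0" unfolding qi by simp
        have guard: "dt s (\<lambda>i a. bff (pencil (poly_const y) (pencil (poly_const c) (M (\<tau> 0)) (M (\<tau> 1))) (M t)) (?u (Suc i)) (\<lambda>l. if l = vp s a then 1 else 0)) \<notin> P"
          using gd[OF i] unfolding qi form_guard_def prod.case pairing_det_def u_def .
        have ker: "dt r (\<lambda>i j. pencil (poly_const y) (pencil (poly_const c) (M (\<tau> 0)) (M (\<tau> 1))) (M t) (\<rho> i) (\<sigma> j)) \<in> J" for c y \<rho> \<sigma>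
          unfolding Mpen by (rule minorsJ)
        have "(\<Sum>p\<in>?NN. form_coeff poly_const s r (flag, c, y, a, b) (M (\<tau> 0)) (M (\<tau> 1)) (M t) p * ?D p) \<in> ?S"
          by (rule form_coeff_relation[where u = ?u and C = "M t", OF SI Msym],
              rule gen_family_in_sat[where \<omega> = "\<omega> (\<tau> 0) (\<tau> 1)" and A = "M (\<tau> 0)" and B = "M (\<tau> 1)" and C = "M t" and u = ?u,
                OF n2 r0 PP J JP fT],
              erule DgP, rule Msym, rule Msym, rule Msym, erule (1) unu, rule ker, rule iso0, rule iso1, erule (1) DG, rule y, rule guard)
        then have "(\<Sum>p\<in>?NN. form_coeff poly_const s r (q i) (M (\<tau> 0)) (M (\<tau> 1)) (M t) p * ?D p) \<in> ?S" by (simp only: qi)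
        then show ?thesis by (subst sum.reindex_bij_betw[OF pr])
      qed
      have "(m, l) \<in> pr ` {..<L}" using ml bij_betw_imp_surj_on[OF pr] by simp
      then obtain j where j: "j < L" "pr j = (m, l)" by (elim imageE) simp
      have "dt L ?c * ?D (pr j) \<in> ?S" by (rule cramer_ideal[where v = "\<lambda>j. ?D (pr j)", OF SI row j(1)])
      then have "?D (pr j) \<in> ?S" by (rule sat_saturated[OF PP dL])
      then show ?thesis by (simp add: j(2))
    qed
    \<comment> \<open>The rows of the chart need not pass the test themselves. A suitable
      perturbation of the third member in the direction of a row does, since otherwise interpolation
      would make the unperturbed member fail. The row is then a multiple of the difference of two
      members that pass.\<close>
    have move: "\<exists>c. c \<noteq> 0 \<and> F (\<lambda>b. \<tau> 2 b + c * \<delta> a b) \<notin> P" for a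
    proof (rule ccontr)
      assume asm: "\<nexists>c. c \<noteq> 0 \<and> F (\<lambda>b. \<tau> 2 b + c * \<delta> a b) \<notin> P"
      define p where "p = form_test (\<lambda>c. [:poly_const c:]) s r \<xi> L q pr (\<lambda>i j. [:M (\<tau> 0) i j:]) (\<lambda>i j. [:M (\<tau> 1) i j:])
        (\<lambda>i j. [:M (\<tau> 2) i j, M (\<delta> a) i j:])"
      have pp: "poly p (poly_const c) = F (\<lambda>b. \<tau> 2 b + c * \<delta> a b)" for c
      proof -
        have m0: "(\<lambda>i j. poly [:M t i j:] (poly_const c)) = M t" for t by (intro ext) simp
        have m1: "(\<lambda>i j. poly [:M t i j, M t' i j:] (poly_const c)) = M (\<lambda>b. t b + c * t' b)" for t t'
          unfolding Mpen[symmetric] by (intro ext) (simp add: pencil_def)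
        have m2: "(\<lambda>d. poly [:poly_const d:] (poly_const c)) = poly_const" by (intro ext) simp
        show ?thesis unfolding p_def form_test_hom[OF comm_ring_hom_poly r0 n2] m0 m1 m2 F_def ..
      qed
      have "coeff p i \<in> P" for i
      proof (rule interpolation_ideal[OF inf PI, of "{0}"])
        fix c :: 'k assume "c \<notin> {0}"
        then have "c \<noteq> 0" by simp
        then show "poly p (poly_const c) \<in> P" using asm unfolding pp by blast
      qed simp
      then have "poly p (poly_const 0) \<in> P" by (rule poly_in_ideal[OF PI])
      then show False using F2 unfolding pp by simp
    qed
    have DgS: "Dg i \<in> ?S" if iT: "i \<in> ?T" for i
    proof -
      obtain a m l where i: "i = (a, m, l)" "a \<in> I" "m < ?N" "l < ?N" using iT by auto
      obtain c where c: "c \<noteq> 0" "F (\<lambda>b. \<tau> 2 b + c * \<delta> a b) \<notin> P" using move by blast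
      have pn: "pencil d X Y = (\<lambda>i j. X i j + d * Y i j)" for d and X Y :: "'n \<Rightarrow> 'n \<Rightarrow> ('n uprod \<times> 'n uprod, 'k) mpoly"
        by (intro ext) (simp add: pencil_def)
      have "bff (M (\<lambda>b. \<tau> 2 b + c * \<delta> a b)) (?u m) (?u l) - bff (M (\<tau> 2)) (?u m) (?u l) \<in> ?S"
        by (rule ideal_diff[OF SI good[OF c(2) i(3,4)] good[OF F2 i(3,4)]])
      then have "poly_const c * Dg i \<in> ?S"
        unfolding Mpen[symmetric] pn bff_matrix_add add_diff_cancel_left' by (simp add: Dg_def i(1))
      then have "poly_const (inverse c) * (poly_const c * Dg i) \<in> ?S" by (rule ideal_mult[OF SI])
      then show ?thesis using c(1) by (simp add: mult.assoc[symmetric] poly_const.hom_mult[symmetric])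
    qed
    have DgJ: "Dg i \<in> J" if "i \<in> ?T" for i by (rule nakayama[where D = Dg and T = ?T, OF PP J _ fT _ that], erule (1) Jsat, erule DgS)
    have "bff (M (\<delta> a)) (?u m) (?u l) \<in> J" if "a \<in> I" "m < ?N" "l < ?N" for a m l
      using DgJ[of "(a, m, l)"] that by (simp add: Dg_def)
    then show ?thesis by (rule core[OF w])
  qed
  then show ?thesis unfolding J_def sat_def P_def by blast
qed

theorem proposition1p12:
  fixes n r k s :: nat
    and Z :: "('k::alg_closed_field ^ 'n::finite uprod) set set"
  assumes "(2::'k) \<noteq> 0"
    and "n = CARD('n)"
    and "3 \<le> r" and "r \<le> n"
    and "s \<le> (r - 1) div 2"
    and "1 \<le> k"
    and "irreducible_component (k + 1) (sd_fano r) Z"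
    and "reduced_structure (compression_locus r k s) = reduced_structure Z"
  shows "generically_reduced_on (sd_fano r) Z \<longleftrightarrow> odd r \<and> s = (r - 1) div 2"
proof (cases "2 * s + 1 < r")
  case True
  have "\<not> (odd r \<and> s = (r - 1) div 2)" using True by (auto elim!: oddE)
  moreover have "\<not> generically_reduced_on (sd_fano r) Z"
    using True assms by (intro not_generically_reduced) auto
  ultimately show ?thesis by blast
next
  case False
  then have r: "r = 2 * s + 1" and s: "1 \<le> s" using assms(3,5) by linarith+
  then have rhs: "odd r \<and> s = (r - 1) div 2" by simp
  have "reduced_ring (generic_local_ring (sd_fano r) Z I)" if x: "chart_plane I x \<in> Z" for I x
  proof -
    have "chart_plane I x \<in> grassmannian (k + 1)" using x fano_component_facts(2)[OF assms(7)] by blast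
    then have I: "card I = k + 1" by (simp add: grassmannian_def dim_chart_plane)
    show ?thesis unfolding fano_generic_reduced_iff[OF assms(7) I x]
      by (intro ballI odd_case_saturated[OF assms(1) r _ s assms(6,7,8) I x]) (use assms(2,4) in simp)
  qed
  then show ?thesis using rhs unfolding generically_reduced_on_def by blast
qed

end
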